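(* Let $\gamma\geq 1$ be an integer and let $n$ be sufficiently large (in terms of $\gamma$). Let $H^*$ be a graph obtained from a spanning path $u_1u_2\ldots u_{n-2}$ by adding $3\gamma$ edges, such that $K_2\nabla H^*\in SPEX(n,\gamma)$. Then: (i) $H^*$ contains neither contractible 2-vertices nor separate forks; (ii) there exists a graph $H_0$ of order $n_0\leq 9\gamma$ such that $H^*\in \mathbb{H}_0\big(\lfloor\frac{n-2-n_0}{2}\rfloor,\lceil\frac{n-2-n_0}{2}\rceil\big)$.
   Context: All graphs are finite and simple. The Euler genus of a closed surface is the number of its cross-caps plus twice the number of its handles. $\mathbb{G}(n,\gamma)$ is the family of simple graphs on $n$ vertices that can be embedded on a closed surface of Euler genus $\gamma$ (orientable or not); $SPEX(n,\gamma)$ is the set of graphs in $\mathbb{G}(n,\gamma)$ whose spectral radius (largest adjacency eigenvalue) is maximum over $\mathbb{G}(n,\gamma)$. $A\nabla B$ is the join of $A$ and $B$ (disjoint union plus all edges between $V(A)$ and $V(B)$). Let $H$ be a graph obtained from a spanning path $u_1u_2\ldots u_{n-2}$ by adding $3\gamma$ edges. A $k$-vertex of $H$ is a vertex of degree $k$ in $H$. A fork is a $k$-vertex with $k\geq 3$. A 2-vertex $u_i$ is contractible if $u_{i-1}u_{i+1}\notin E(H)$ and there exist two forks $u_{i_1},u_{i_2}$ with $i_1<i<i_2$. A fork $u_i$ is separate if neither $u_{i-1}$ nor $u_{i+1}$ is a fork. For a graph $H_0$, $\mathbb{H}_0(a,b)$ is the family of graphs obtained from $H_0$ by attaching two pendant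 paths of lengths $a$ and $b$ to two distinct vertices of $H_0$ (attaching a pendant path of length $a$ at $v$ adds $a$ new vertices forming, together with $v$, a path of length $a$ starting at $v$); so graphs in $\mathbb{H}_0(a,b)$ have order $|V(H_0)|+a+b$. *)

theory Defs
  imports "HOL-Analysis.Analysis"
begin

section \<open>Simple graphs\<close>

record 'a sgraph =
  verts :: "'a set"
  edges :: "'a set set"

definition simple_graph :: "'a sgraph \<Rightarrow> bool" where
  "simple_graph G \<longleftrightarrow> finite (verts G) \<and> edges G \<subseteq> {e. e \<subseteq> verts G \<and> card e = 2}"

definition degree :: "'a sgraph \<Rightarrow> 'a \<Rightarrow> nat" where
  "degree G v = card {e \<in> edges G. v \<in> e}"

definition complete_sgraph :: "'a set \<Rightarrow> 'a sgraph" where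
  "complete_sgraph V = \<lparr>verts = V, edges = {e. e \<subseteq> V \<and> card e = 2}\<rparr>"

abbreviation K2 :: "bool sgraph" where
  "K2 \<equiv> complete_sgraph UNIV"

definition join :: "'a sgraph \<Rightarrow> 'b sgraph \<Rightarrow> ('a + 'b) sgraph"  (infixr "\<nabla>" 65) where
  "A \<nabla> B = \<lparr>verts = verts A <+> verts B,
            edges = (image Inl) ` edges A \<union> (image Inr) ` edges B
                     \<union> {{Inl a, Inr b} | a b. a \<in> verts A \<and> b \<in> verts B}\<rparr>"


section \<open>Spectral radius\<close>

text \<open>The adjacency matrix, with rows and columns indexed by the vertices themselves.\<close>

definition adj :: "'a sgraph \<Rightarrow> 'a \<Rightarrow> 'a \<Rightarrow> real" where
  "adj G v w = (if {v, w} \<in> edges G then 1 else 0)"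

definition adj_eigenvalue :: "'a sgraph \<Rightarrow> real \<Rightarrow> bool" where
  "adj_eigenvalue G \<mu> \<longleftrightarrow>
     (\<exists>x :: 'a \<Rightarrow> real. (\<exists>v \<in> verts G. x v \<noteq> 0) \<and>
        (\<forall>v \<in> verts G. (\<Sum>w \<in> verts G. adj G v w * x w) = \<mu> * x v))"

definition spectral_radius :: "'a sgraph \<Rightarrow> real" where
  "spectral_radius G = (GREATEST \<mu>. adj_eigenvalue G \<mu>)"


section \<open>Closed surfaces\<close>

definition quotient_topology :: "'a topology \<Rightarrow> ('a \<times> 'a) set \<Rightarrow> 'a set topology" where
  "quotient_topology X R = topology (\<lambda>U. U \<subseteq> topspace X // R \<and> openin X (\<Union>U))"

text \<open>Inverse stereographic projection from the north pole, onto the unit sphere of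
  \<open>\<complex> \<times> \<real>\<close>; discs and circles on the sphere are described by their planar images.\<close>

definition stereo :: "complex \<Rightarrow> complex \<times> real" where
  "stereo z = ((2 / ((cmod z)\<^sup>2 + 1)) *\<^sub>R z, ((cmod z)\<^sup>2 - 1) / ((cmod z)\<^sup>2 + 1))"

definition centre :: "nat \<Rightarrow> complex" where
  "centre k = of_nat (3 * k)"

text \<open>The sphere with \<open>m\<close> open discs, whose closures are disjoint, removed.\<close>

definition holed_sphere :: "nat \<Rightarrow> (complex \<times> real) topology" where
  "holed_sphere m = top_of_set (sphere 0 1 - stereo ` (\<Union>k<m. ball (centre k) 1))"

text \<open>Discs \<open>2 * j\<close> and \<open>2 * j + 1\<close> for \<open>j < h\<close> carry the handles: their boundaries are
  identified by an orientation-reversing map (a map preserving the orientation inherited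
  from the plane would give a Klein bottle instead of a handle). Each of the \<open>c\<close> remaining
  discs becomes a cross-cap by identifying antipodal points of its boundary.\<close>

definition sewn :: "nat \<Rightarrow> nat \<Rightarrow> complex \<Rightarrow> complex \<Rightarrow> bool" where
  "sewn h c w w' \<longleftrightarrow>
     (\<exists>j<h. \<exists>z. cmod z = 1 \<and>
         (w = centre (2 * j) + z \<and> w' = centre (2 * j + 1) + cnj z \<or>
          w = centre (2 * j + 1) + cnj z \<and> w' = centre (2 * j) + z)) \<or>
     (\<exists>k\<in>{2 * h..<2 * h + c}. \<exists>z. cmod z = 1 \<and> w = centre k + z \<and> w' = centre k - z)"

definition sewing :: "nat \<Rightarrow> nat \<Rightarrow> ((complex \<times> real) \<times> (complex \<times> real)) set" where
  "sewing h c = Id_on (topspace (holed_sphere (2 * h + c)))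
                 \<union> {(stereo w, stereo w') | w w'. sewn h c w w'}"

text \<open>The sphere with \<open>h\<close> handles and \<open>c\<close> cross-caps. By the classification theorem every
  closed surface is homeomorphic to one of these.\<close>

definition closed_surface :: "nat \<Rightarrow> nat \<Rightarrow> (complex \<times> real) set topology" where
  "closed_surface h c = quotient_topology (holed_sphere (2 * h + c)) (sewing h c)"


section \<open>Embedded graphs\<close>

text \<open>Vertices become distinct points, edges become simple arcs joining their ends, which meet
  no further vertices and meet one another only in common ends.\<close>

definition embeddable :: "'a sgraph \<Rightarrow> 's topology \<Rightarrow> bool" where
  "embeddable G S \<longleftrightarrow>
     (\<exists>(\<phi> :: 'a \<Rightarrow> 's) (\<alpha> :: 'a set \<Rightarrow> real \<Rightarrow> 's).
        inj_on \<phi> (verts G) \<and> \<phi> ` verts G \<subseteq> topspace S \<and>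
        (\<forall>e \<in> edges G. pathin S (\<alpha> e) \<and> inj_on (\<alpha> e) {0..1} \<and>
            {\<alpha> e 0, \<alpha> e 1} = \<phi> ` e \<and> \<alpha> e ` {0<..<1} \<inter> \<phi> ` verts G = {}) \<and>
        (\<forall>e \<in> edges G. \<forall>f \<in> edges G. e \<noteq> f \<longrightarrow> \<alpha> e ` {0<..<1} \<inter> \<alpha> f ` {0<..<1} = {}))"

definition genus_graphs :: "nat \<Rightarrow> nat \<Rightarrow> 'a sgraph set" where
  "genus_graphs n \<gamma> = {G. simple_graph G \<and> card (verts G) = n \<and>
      (\<exists>h c. 2 * h + c = \<gamma> \<and> embeddable G (closed_surface h c))}"

definition SPEX :: "nat \<Rightarrow> nat \<Rightarrow> 'a sgraph set" where
  "SPEX n \<gamma> = {G \<in> genus_graphs n \<gamma>.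
      \<forall>G' \<in> (genus_graphs n \<gamma> :: 'a sgraph set). spectral_radius G' \<le> spectral_radius G}"


section \<open>Paths with additional edges\<close>

definition path_plus :: "'a sgraph \<Rightarrow> (nat \<Rightarrow> 'a) \<Rightarrow> nat \<Rightarrow> nat \<Rightarrow> bool" where
  "path_plus H u m k \<longleftrightarrow> simple_graph H \<and> bij_betw u {1..m} (verts H) \<and>
     (\<exists>F. card F = k \<and> finite F \<and> F \<inter> {{u i, u (i + 1)} | i. i \<in> {1..<m}} = {} \<and>
        edges H = {{u i, u (i + 1)} | i. i \<in> {1..<m}} \<union> F)"

definition fork :: "'a sgraph \<Rightarrow> 'a \<Rightarrow> bool" where
  "fork H v \<longleftrightarrow> v \<in> verts H \<and> degree H v \<ge> 3"

text \<open>The bounds on \<open>i1\<close> and \<open>i2\<close> force \<open>1 < i < m\<close>, so \<open>u (i - 1)\<close> and \<open>u (i + 1)\<close> exist.\<close>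

definition contractible_at :: "'a sgraph \<Rightarrow> (nat \<Rightarrow> 'a) \<Rightarrow> nat \<Rightarrow> nat \<Rightarrow> bool" where
  "contractible_at H u m i \<longleftrightarrow> i \<in> {1..m} \<and> degree H (u i) = 2 \<and>
     {u (i - 1), u (i + 1)} \<notin> edges H \<and>
     (\<exists>i1 \<in> {1..m}. \<exists>i2 \<in> {1..m}. i1 < i \<and> i < i2 \<and> fork H (u i1) \<and> fork H (u i2))"

text \<open>An end of the path has a single neighbour on the path, which alone must not be a fork.\<close>

definition separate_at :: "'a sgraph \<Rightarrow> (nat \<Rightarrow> 'a) \<Rightarrow> nat \<Rightarrow> nat \<Rightarrow> bool" where
  "separate_at H u m i \<longleftrightarrow> i \<in> {1..m} \<and> fork H (u i) \<and>
     (\<forall>j \<in> {1..m}. (j + 1 = i \<or> j = i + 1) \<longrightarrow> \<not> fork H (u j))"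

text \<open>The family \<open>\<H>\<^sub>0(a, b)\<close>: the new vertices of the two pendant paths
  are \<open>p 1, \<dots>, p a\<close> and \<open>q 1, \<dots>, q b\<close>, attached at \<open>p 0\<close> and \<open>q 0\<close>.\<close>

definition pendant_paths :: "'a sgraph \<Rightarrow> nat \<Rightarrow> nat \<Rightarrow> 'a sgraph set" where
  "pendant_paths H0 a b = {G. \<exists>p q :: nat \<Rightarrow> 'a.
      p 0 \<in> verts H0 \<and> q 0 \<in> verts H0 \<and> p 0 \<noteq> q 0 \<and>
      inj_on p {1..a} \<and> inj_on q {1..b} \<and> p ` {1..a} \<inter> q ` {1..b} = {} \<and>
      (p ` {1..a} \<union> q ` {1..b}) \<inter> verts H0 = {} \<and>
      G = \<lparr>verts = verts H0 \<union> p ` {1..a} \<union> q ` {1..b},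
           edges = edges H0 \<union> {{p i, p (i + 1)} | i. i < a} \<union> {{q i, q (i + 1)} | i. i < b}\<rparr>}"


section \<open>The surfaces are genuine quotient spaces\<close>

lemma openin_quotient_topology:
  assumes R: "equiv (topspace X) R"
  shows "openin (quotient_topology X R) U \<longleftrightarrow> U \<subseteq> topspace X // R \<and> openin X (\<Union>U)"
proof -
  have int: "\<Union>(S \<inter> T) = \<Union>S \<inter> \<Union>T"
    if S: "S \<subseteq> topspace X // R" and T: "T \<subseteq> topspace X // R" for S T
  proof
    show "\<Union>S \<inter> \<Union>T \<subseteq> \<Union>(S \<inter> T)"
    proof
      fix x assume "x \<in> \<Union>S \<inter> \<Union>T"
      then obtain A B where AB: "A \<in> S" "x \<in> A" "B \<in> T" "x \<in> B" by blast
      then have "A = B" using quotient_disj[OF R, of A B] S T by blast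
      then show "x \<in> \<Union>(S \<inter> T)" using AB by blast
    qed
  qed blast
  have "istopology (\<lambda>U. U \<subseteq> topspace X // R \<and> openin X (\<Union>U))"
    unfolding istopology_def
  proof (intro conjI allI impI)
    fix S T assume "S \<subseteq> topspace X // R \<and> openin X (\<Union>S)" "T \<subseteq> topspace X // R \<and> openin X (\<Union>T)"
    then show "S \<inter> T \<subseteq> topspace X // R" "openin X (\<Union>(S \<inter> T))"
      by (auto simp only: int openin_Int)
  next
    fix \<K> assume K: "\<forall>K\<in>\<K>. K \<subseteq> topspace X // R \<and> openin X (\<Union>K)"
    then show "\<Union>\<K> \<subseteq> topspace X // R" by blast
    have "openin X (\<Union>(Union ` \<K>))" using K by (intro openin_Union) blast
    moreover have "\<Union>(Union ` \<K>) = \<Union>(\<Union>\<K>)" by blast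
    ultimately show "openin X (\<Union>(\<Union>\<K>))" by simp
  qed
  then show ?thesis
    unfolding quotient_topology_def by (simp add: topology_inverse')
qed

lemma topspace_quotient_topology:
  assumes R: "equiv (topspace X) R"
  shows "topspace (quotient_topology X R) = topspace X // R"
proof -
  have "openin (quotient_topology X R) (topspace X // R)"
    unfolding openin_quotient_topology[OF R] Union_quotient[OF R] by simp
  then show ?thesis
    using openin_quotient_topology[OF R] by (meson openin_subset openin_topspace subset_antisym)
qed

lemma quotient_map_quotient_topology:
  assumes R: "equiv (topspace X) R"
  shows "quotient_map X (quotient_topology X R) (\<lambda>x. R `` {x})"
  unfolding quotient_map_def topspace_quotient_topology[OF R] openin_quotient_topology[OF R]
proof (intro conjI allI impI)
  show "(\<lambda>x. R `` {x}) ` topspace X = topspace X // R"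
    by (auto simp: quotient_def)
  fix U assume U: "U \<subseteq> topspace X // R"
  have "{x \<in> topspace X. R `` {x} \<in> U} = \<Union>U"
  proof safe
    fix x assume "x \<in> topspace X" "R `` {x} \<in> U"
    then show "x \<in> \<Union>U" using equiv_class_self[OF R] by blast
  next
    fix x A assume x: "x \<in> A" "A \<in> U"
    then have A: "A \<in> topspace X // R" using U by blast
    then show "x \<in> topspace X" using x in_quotient_imp_subset[OF R] by blast
    then have "R `` {x} = A" using x A
      by (metis R equiv_class_self quotientI quotient_disj disjoint_iff)
    then show "R `` {x} \<in> U" using x by simp
  qed
  then show "openin X {x \<in> topspace X. R `` {x} \<in> U} \<longleftrightarrow> U \<subseteq> topspace X // R \<and> openin X (\<Union>U)"
    using U by simp
qed

lemma stereo_in_sphere: "stereo z \<in> sphere 0 1"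
proof -
  let ?r = "(cmod z)\<^sup>2"
  have pos: "?r + 1 > 0" by (simp add: add_nonneg_pos)
  have "((2 / (?r + 1)) * cmod z)\<^sup>2 + ((?r - 1) / (?r + 1))\<^sup>2 = (4 * ?r + (?r - 1)\<^sup>2) / (?r + 1)\<^sup>2"
    by (simp add: power_mult_distrib power_divide add_divide_distrib)
  also have "4 * ?r + (?r - 1)\<^sup>2 = (?r + 1)\<^sup>2" by (simp add: power2_eq_square algebra_simps)
  finally have "((2 / (?r + 1)) * cmod z)\<^sup>2 + ((?r - 1) / (?r + 1))\<^sup>2 = 1"
    using pos by simp
  then show ?thesis using pos by (simp add: stereo_def norm_Pair power_divide)
qed

lemma inj_stereo: "inj stereo"
proof
  fix x y assume eq: "stereo x = stereo y"
  have pos: "(cmod z)\<^sup>2 + 1 > 0" for z by (simp add: add_nonneg_pos)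
  have s: "((cmod z)\<^sup>2 - 1) / ((cmod z)\<^sup>2 + 1) = 1 - 2 / ((cmod z)\<^sup>2 + 1)" for z
    using pos[of z] by (simp add: field_simps)
  have "2 / ((cmod x)\<^sup>2 + 1) = 2 / ((cmod y)\<^sup>2 + 1)"
    using eq by (simp add: stereo_def s)
  moreover have "2 / ((cmod x)\<^sup>2 + 1) \<noteq> 0" using pos[of x] by simp
  moreover have "(2 / ((cmod x)\<^sup>2 + 1)) *\<^sub>R x = (2 / ((cmod y)\<^sup>2 + 1)) *\<^sub>R y"
    using eq by (simp add: stereo_def)
  ultimately show "x = y" by (metis scaleR_left_imp_eq)
qed

lemma dist_centre: "i \<noteq> j \<Longrightarrow> dist (centre i) (centre j) \<ge> 3"
proof -
  assume "i \<noteq> j"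
  have "centre i - centre j = of_int (3 * (int i - int j))"
    by (simp add: centre_def)
  then have "dist (centre i) (centre j) = \<bar>of_int (3 * (int i - int j))\<bar>"
    by (simp only: dist_norm norm_of_int)
  moreover have "\<bar>3 * (int i - int j)\<bar> \<ge> 3" using \<open>i \<noteq> j\<close> by (cases i j rule: linorder_cases) auto
  ultimately show ?thesis by linarith
qed

lemma centre_circle_eqD:
  assumes "centre i + y = centre j + z" "cmod y = 1" "cmod z = 1"
  shows "i = j \<and> y = z"
proof -
  have "i = j"
  proof (rule ccontr)
    assume "i \<noteq> j"
    then have "3 \<le> dist (centre i) (centre j)" by (rule dist_centre)
    also have "centre i - centre j = z - y" using assms(1) by (simp add: algebra_simps)
    then have "dist (centre i) (centre j) \<le> 2"
      unfolding dist_norm using norm_triangle_ineq4[of z y] assms by simp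
    finally show False by simp
  qed
  then show ?thesis using assms by simp
qed

lemma sewn_on_circle:
  assumes "sewn h c w w'"
  shows "\<exists>k < 2 * h + c. \<exists>z. cmod z = 1 \<and> w = centre k + z"
proof -
  consider j z where "j < h" "cmod z = 1" "w = centre (2 * j) + z"
    | j z where "j < h" "cmod z = 1" "w = centre (2 * j + 1) + cnj z"
    | k z where "k < 2 * h + c" "cmod z = 1" "w = centre k + z"
    using assms unfolding sewn_def by (metis atLeastLessThan_iff)
  then show ?thesis
  proof cases
    case 1 then show ?thesis by (intro exI[of _ "2 * j"]) auto
  next
    case 2 then show ?thesis
      by (intro exI[of _ "2 * j + 1"] conjI exI[of _ "cnj z"]) auto
  qed blast
qed

lemma sewn_sym: "sewn h c w w' \<Longrightarrow> sewn h c w' w"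
proof -
  assume "sewn h c w w'"
  then consider "\<exists>j<h. \<exists>z. cmod z = 1 \<and>
         (w = centre (2 * j) + z \<and> w' = centre (2 * j + 1) + cnj z \<or>
          w = centre (2 * j + 1) + cnj z \<and> w' = centre (2 * j) + z)"
    | k z where "k \<in> {2 * h..<2 * h + c}" "cmod z = 1" "w = centre k + z" "w' = centre k - z"
    unfolding sewn_def by blast
  then show ?thesis
  proof cases
    case 1 then show ?thesis unfolding sewn_def by blast
  next
    case 2
    then have "cmod (- z) = 1 \<and> w' = centre k + (- z) \<and> w = centre k - (- z)" by simp
    then show ?thesis using 2(1) unfolding sewn_def by blast
  qed
qed

lemma sewn_unique:
  assumes "sewn h c w w'" "sewn h c w w''"
  shows "w' = w''"
proof -
  define P where "P k z = (if k < 2 * h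
      then centre (if even k then k + 1 else k - 1) + cnj z else centre k - z)" for k z
  have P: "\<exists>k z. cmod z = 1 \<and> w = centre k + z \<and> v = P k z" if sv: "sewn h c w v" for v
  proof -
    consider j z where "j < h" "cmod z = 1" "w = centre (2 * j) + z" "v = centre (2 * j + 1) + cnj z"
      | j z where "j < h" "cmod z = 1" "w = centre (2 * j + 1) + cnj z" "v = centre (2 * j) + z"
      | k z where "2 * h \<le> k" "cmod z = 1" "w = centre k + z" "v = centre k - z"
      using sv unfolding sewn_def by (metis atLeastLessThan_iff)
    then show ?thesis
    proof cases
      case 1 then show ?thesis
        by (intro exI[of _ "2 * j"] exI[of _ z]) (simp add: P_def)
    next
      case 2 then show ?thesis
        by (intro exI[of _ "2 * j + 1"] exI[of _ "cnj z"]) (simp add: P_def)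
    next
      case 3 then show ?thesis
        by (intro exI[of _ k] exI[of _ z]) (simp add: P_def)
    qed
  qed
  obtain k y where y: "cmod y = 1" "w = centre k + y" "w' = P k y" using P[OF assms(1)] by blast
  obtain l z where z: "cmod z = 1" "w = centre l + z" "w'' = P l z" using P[OF assms(2)] by blast
  have "k = l \<and> y = z" using centre_circle_eqD[of k y l z] y z by simp
  then show ?thesis using y z by simp
qed

lemma sewn_in_holed_sphere:
  assumes "sewn h c w w'"
  shows "stereo w \<in> topspace (holed_sphere (2 * h + c))"
proof -
  obtain k z where k: "cmod z = 1" "w = centre k + z" using sewn_on_circle[OF assms] by blast
  have "w \<notin> ball (centre i) 1" for i
  proof
    assume i: "w \<in> ball (centre i) 1"
    have d: "dist w (centre k) = 1" using k by (simp add: dist_norm)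
    with i have "i \<noteq> k" by (auto simp: dist_commute)
    then have "3 \<le> dist (centre i) (centre k)" by (rule dist_centre)
    also have "\<dots> \<le> dist (centre i) w + dist w (centre k)" by (rule dist_triangle)
    finally show False using d i by simp
  qed
  then show ?thesis
    using stereo_in_sphere[of w] inj_stereo by (auto simp: holed_sphere_def dest: injD)
qed

lemma equiv_sewing: "equiv (topspace (holed_sphere (2 * h + c))) (sewing h c)"
proof (rule equivI)
  show "sewing h c \<subseteq> topspace (holed_sphere (2 * h + c)) \<times> topspace (holed_sphere (2 * h + c))"
    unfolding sewing_def using sewn_in_holed_sphere sewn_sym by fastforce
  show "refl_on (topspace (holed_sphere (2 * h + c))) (sewing h c)"
    by (auto simp: refl_on_def sewing_def)
  show "sym (sewing h c)"
    using sewn_sym unfolding sym_def sewing_def by fastforce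
  have un: "w' = w''" if "sewn h c w' w" "sewn h c w w''" for w w' w''
    using that sewn_unique sewn_sym by blast
  show "trans (sewing h c)"
  proof (rule transI)
    fix p q r assume pq: "(p, q) \<in> sewing h c" and qr: "(q, r) \<in> sewing h c"
    show "(p, r) \<in> sewing h c"
    proof (cases "p = q \<or> q = r")
      case True then show ?thesis using pq qr by auto
    next
      case False
      then obtain w w' v v' where w: "p = stereo w" "q = stereo w'" "sewn h c w w'"
        and v: "q = stereo v" "r = stereo v'" "sewn h c v v'"
        using pq qr unfolding sewing_def by blast
      then have "w' = v" using inj_stereo by (auto dest: injD)
      then have "w = v'" using un w(3) v(3) by blast
      then show ?thesis
        using w(1) v(2) sewn_in_holed_sphere[OF w(3)] by (auto simp: sewing_def)
    qed
  qed
qed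

lemma quotient_map_closed_surface:
  "quotient_map (holed_sphere (2 * h + c)) (closed_surface h c) (\<lambda>p. sewing h c `` {p})"
  unfolding closed_surface_def by (rule quotient_map_quotient_topology[OF equiv_sewing])

end

theory Submission
  imports Defs
begin

text \<open>
  Two topological operations suffice: contracting an edge of a drawing, and placing a new vertex in
  the corner between two consecutive edges at a vertex, joined to the three vertices of that corner.
  They only need that the surface is Hausdorff and covered by open charts of the plane.
  Adding an edge raises the spectral radius, so contracting the new vertex of a corner shows that in
  an extremal graph consecutive neighbours around any vertex are adjacent.

  Normalise the Perron vector to be \<open>1\<close> on \<open>K\<^sub>2\<close> and let \<open>f\<close> be its restriction to \<open>H\<close>. Maximising over
  the values on \<open>K\<^sub>2\<close>, a graph \<open>H'\<close> beats \<open>H\<close> as soon as the quadratic function \<open>energy\<close> takes a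
  value larger than \<open>(\<rho> - 1) / 2\<close>. Suppressing a vertex of degree two and inserting it elsewhere
  changes the energy by an explicit amount, governed by the deviation \<open>g = f - 1 / (\<rho> - 2)\<close>, which
  satisfies \<open>\<rho> x\<^sub>i = x\<^sub>i\<^sub>-\<^sub>1 + x\<^sub>i\<^sub>+\<^sub>1\<close> along untouched stretches of the path.

  If a vertex \<open>v\<close> of \<open>H\<close> shares a face with both vertices of \<open>K\<^sub>2\<close>, a leaf can be moved to \<open>v\<close>; this
  pays off unless \<open>v\<close> is an end of the path. So the two ends are the neighbours of one vertex of \<open>K\<^sub>2\<close>
  around the other, and a vertex can be inserted anywhere in the two pendant paths. On such a path
  \<open>g\<close> changes its sign, and inserting there gains at least \<open>invariant / \<rho>\<close>, where the conserved
  quantity \<open>x\<^sub>i\<^sup>2 + x\<^sub>i\<^sub>+\<^sub>1\<^sup>2 - \<rho> x\<^sub>i x\<^sub>i\<^sub>+\<^sub>1\<close> decays geometrically with the length of the path. Hence removing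
  a contractible vertex with the least deviation would pay off, and so would shortening a pendant path
  that is longer than the other one by at least two. A separate fork is impossible because the
  rotation around it would consist of only four vertices. Counting the forks that follow each
  untouched vertex between the first and the last fork bounds the order of \<open>H\<^sub>0\<close>.
\<close>

section \<open>Charts and self-maps of surfaces\<close>

text \<open>Drawings are purely topological, so arcs may be wild. Every appeal to a face becomes the
  embeddability of a graph with one more vertex. Arcs are tamed by redrawing them as radii inside
  small discs; an edge is then contracted by dragging a chart along it until two straight segments,
  each in a chart, lead from one end to the other. All spectral comparisons have one form: the
  Perron vector \<open>f\<close> of \<open>H\<close>, altered at a single vertex, is a test vector
  for the competitor \<open>H'\<close>. With \<open>k = 3 * \<gamma>\<close> extra edges the degrees
  in \<open>H\<close> are at most \<open>d = k + 2\<close>, and deviations are at most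
  \<open>2 * d * c / \<rho>\<close>. The requirement \<open>\<rho> \<ge> 200 * d\<^sup>2\<close>
  makes \<open>\<rho>\<close> times a product of two deviations at most \<open>c * c / 50\<close>,
  so that suppressing a vertex costs less than a leaf at an inner vertex gains. It holds for large
  \<open>n\<close> because \<open>\<rho>\<^sup>2 \<ge> 2 * (n - 2)\<close>. Finally
  \<open>9 * \<gamma>\<close> is \<open>3 * k\<close>: at most \<open>2 * k\<close> vertices are
  ends of extra edges, and at most \<open>k\<close> others lie between the first and the last of
  them.\<close>

definition chart :: "'s topology \<Rightarrow> (complex \<Rightarrow> 's) \<Rightarrow> bool" where
  "chart S \<psi> \<longleftrightarrow> continuous_map euclidean S \<psi> \<and> open_map euclidean S \<psi> \<and> inj \<psi>"

definition surface :: "'s topology \<Rightarrow> bool" where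
  "surface S \<longleftrightarrow> Hausdorff_space S \<and> (\<forall>p\<in>topspace S. \<exists>\<psi>. chart S \<psi> \<and> \<psi> 0 = p)"

lemma chartD:
  assumes "chart S \<psi>"
  shows "continuous_map euclidean S \<psi>" "inj \<psi>" "\<psi> z \<in> topspace S"
    "open U \<Longrightarrow> openin S (\<psi> ` U)" "openin S (range \<psi>)"
  using assms unfolding chart_def open_map_def continuous_map_def
  by (auto simp: Pi_iff)

lemma chart_open_vimage:
  assumes "chart S \<psi>" "openin S W"
  shows "open (\<psi> -` W)"
  using chartD(1)[OF assms(1)] assms(2)
  by (auto simp: continuous_map_def vimage_def)

lemma chart_closedin_image:
  assumes "chart S \<psi>" "Hausdorff_space S" "compact K"
  shows "closedin S (\<psi> ` K)"
  using assms chartD(1)[OF assms(1)]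
  by (meson compactin_imp_closedin image_compactin compactin_euclidean_iff)

lemma chart_closed_vimage:
  assumes "chart S \<psi>" "closedin S W"
  shows "closed (\<psi> -` W)"
proof -
  have "\<psi> -` W = - (\<psi> -` (topspace S - W))"
    using chartD(3)[OF assms(1)] by auto
  then show ?thesis
    using chart_open_vimage[OF assms(1)] assms(2) by (auto simp: closed_def closedin_def)
qed

lemma chart_scale:
  assumes "chart S \<psi>" "a \<noteq> 0"
  shows "chart S (\<lambda>z. \<psi> (a * z))"
  unfolding chart_def
proof (intro conjI)
  have "continuous_map euclidean euclidean (\<lambda>z. a * z)"
    by (auto intro!: continuous_intros)
  from continuous_map_compose[OF this chartD(1)[OF assms(1)]]
  show "continuous_map euclidean S (\<lambda>z. \<psi> (a * z))" by (simp add: o_def)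
  show "inj (\<lambda>z. \<psi> (a * z))"
    using chartD(2)[OF assms(1)] assms(2) by (auto simp: inj_def) (metis mult_left_cancel)
  have "openin S ((\<lambda>z. \<psi> (a * z)) ` U)" if "open U" for U
  proof -
    have "(\<lambda>z. a * z) ` U = (\<lambda>z. z / a) -` U"
      using assms(2) by (auto simp: image_iff intro!: bexI[of _ "_ / a"])
    moreover have "open ((\<lambda>z. z / a) -` U)"
      using that assms(2) by (intro open_vimage continuous_intros) auto
    ultimately have "open ((\<lambda>z. a * z) ` U)" by simp
    then have "openin S (\<psi> ` ((\<lambda>z. a * z) ` U))" by (rule chartD(4)[OF assms(1)])
    then show ?thesis by (simp add: image_image)
  qed
  then show "open_map euclidean S (\<lambda>z. \<psi> (a * z))" by (simp add: open_map_def)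
qed

lemma chart_homeomorphic:
  assumes "chart S \<psi>" "homeomorphic_maps S S h h'"
  shows "chart S (h \<circ> \<psi>)"
proof -
  have h: "homeomorphic_map S S h" using assms(2) homeomorphic_map_maps by blast
  have "open_map S S h" "continuous_map S S h" "inj_on h (topspace S)"
    using h homeomorphic_imp_open_map homeomorphic_imp_continuous_map homeomorphic_imp_injective_map
    by blast+
  moreover have "inj (h \<circ> \<psi>)"
    using \<open>inj_on h (topspace S)\<close> chartD(2,3)[OF assms(1)] by (auto simp: inj_def inj_on_def)
  ultimately show ?thesis
    using assms(1) unfolding chart_def by (blast intro: continuous_map_compose open_map_compose)
qed

text \<open>Carries a self-map of the plane to the surface; it is applied to maps that are the
  identity far out, so that the two branches fit together.\<close>

definition chart_extend :: "(complex \<Rightarrow> 's) \<Rightarrow> (complex \<Rightarrow> complex) \<Rightarrow> 's \<Rightarrow> 's" where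
  "chart_extend \<psi> k p = (if p \<in> range \<psi> then \<psi> (k (inv \<psi> p)) else p)"

lemma chart_extend_apply [simp]: "inj \<psi> \<Longrightarrow> chart_extend \<psi> k (\<psi> z) = \<psi> (k z)"
  by (simp add: chart_extend_def)

lemma chart_extend_outside: "p \<notin> range \<psi> \<Longrightarrow> chart_extend \<psi> k p = p"
  by (simp add: chart_extend_def)

text \<open>The chart domain and the complement of the image of a closed disc form an open cover,
  because the compact image is closed in a Hausdorff space. On the overlap both descriptions are the
  identity, so the pieces can be pasted.\<close>

lemma continuous_map_chart_extend:
  assumes \<psi>: "chart S \<psi>" and S: "Hausdorff_space S"
    and k: "continuous_on UNIV k" and id: "\<And>z. cmod z > r \<Longrightarrow> k z = z"
  shows "continuous_map S S (chart_extend \<psi> k)"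
proof -
  have inj: "inj \<psi>" by (rule chartD(2)[OF \<psi>])
  define T where "T b = (if b then range \<psi> else topspace S - \<psi> ` cball 0 r)" for b
  define f where "f b = (if b then \<psi> \<circ> k \<circ> inv \<psi> else id)" for b
  have cinv: "continuous_map (subtopology S (range \<psi>)) euclidean (inv \<psi>)"
  proof (clarsimp simp: continuous_map_def)
    fix U :: "complex set" assume "open U"
    have "{x \<in> topspace S. x \<in> range \<psi> \<and> inv \<psi> x \<in> U} = \<psi> ` U"
      using chartD(3)[OF \<psi>] inj by auto
    moreover have "openin (subtopology S (range \<psi>)) (\<psi> ` U)"
      using chartD(4,5)[OF \<psi>] \<open>open U\<close> by (auto simp: openin_open_subtopology)
    ultimately show "openin (subtopology S (range \<psi>)) {x \<in> topspace S. x \<in> range \<psi> \<and> inv \<psi> x \<in> U}"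
      by simp
  qed
  show ?thesis
  proof (rule pasting_lemma[of UNIV S T S f])
    fix i show "openin S (T i)"
      using chartD(5)[OF \<psi>] chart_closedin_image[OF \<psi> S compact_cball] by (auto simp: T_def)
    show "continuous_map (subtopology S (T i)) S (f i)"
    proof (cases i)
      case True
      have "continuous_map euclidean euclidean k" using k by simp
      then have "continuous_map (subtopology S (range \<psi>)) S (\<psi> \<circ> (k \<circ> inv \<psi>))"
        by (intro continuous_map_compose[OF _ chartD(1)[OF \<psi>]] continuous_map_compose[OF cinv])
      then show ?thesis using True by (simp add: T_def f_def o_assoc)
    qed (simp add: f_def)
  next
    fix i j x assume x: "x \<in> topspace S \<inter> T i \<inter> T j"
    have *: "\<psi> (k (inv \<psi> y)) = y" if y: "y \<in> range \<psi>" "y \<notin> \<psi> ` cball 0 r" for y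
    proof -
      obtain z where z: "y = \<psi> z" using y(1) by blast
      then have "cmod z > r" using y(2) by (metis image_eqI mem_cball_0 not_le)
      then show ?thesis using z id inj by simp
    qed
    show "f i x = f j x" using x *[of x] by (cases i; cases j) (auto simp: f_def T_def)
  next
    fix x assume x: "x \<in> topspace S"
    show "\<exists>j. j \<in> UNIV \<and> x \<in> T j \<and> chart_extend \<psi> k x = f j x"
    proof (cases "x \<in> range \<psi>")
      case True then show ?thesis
        by (intro exI[of _ True]) (auto simp: T_def f_def chart_extend_def)
    next
      case False then show ?thesis using x
        by (intro exI[of _ False]) (auto simp: T_def f_def chart_extend_def)
    qed
  qed
qed

lemma homeomorphic_maps_chart_extend:
  assumes \<psi>: "chart S \<psi>" and S: "Hausdorff_space S"
    and k: "homeomorphism UNIV UNIV k k'" and id: "\<And>z. cmod z > r \<Longrightarrow> k z = z"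
  shows "homeomorphic_maps S S (chart_extend \<psi> k) (chart_extend \<psi> k')"
proof -
  have kk: "k (k' z) = z" "k' (k z) = z" for z using k by (auto simp: homeomorphism_def)
  have id': "k' z = z" if "cmod z > r" for z using id[OF that] kk(2)[of z] by simp
  have inj: "inj \<psi>" by (rule chartD(2)[OF \<psi>])
  have "chart_extend \<psi> k (chart_extend \<psi> k' x) = x" "chart_extend \<psi> k' (chart_extend \<psi> k x) = x" for x
    by (cases "x \<in> range \<psi>"; auto simp: inj kk chart_extend_outside)+
  moreover have "continuous_on UNIV k" "continuous_on UNIV k'"
    using k by (auto simp: homeomorphism_def)
  ultimately show ?thesis
    unfolding homeomorphic_maps_def
    using continuous_map_chart_extend[OF \<psi> S _ id] continuous_map_chart_extend[OF \<psi> S _ id'] by blast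
qed

section \<open>Homogeneity: moving points by homeomorphisms of the surface\<close>

lemma surface_move_local:
  assumes S: "surface S" and W: "openin S W" and p: "p \<in> W"
  obtains V where "openin S V" "p \<in> V" "V \<subseteq> W"
    "\<And>q. q \<in> V \<Longrightarrow> \<exists>h h'. homeomorphic_maps S S h h' \<and> (\<forall>x. x \<notin> W \<longrightarrow> h x = x) \<and> h p = q"
proof -
  have HS: "Hausdorff_space S" using S unfolding surface_def by blast
  have "p \<in> topspace S" using W p openin_subset by blast
  then obtain \<psi> where \<psi>: "chart S \<psi>" and \<psi>0: "\<psi> 0 = p" using S unfolding surface_def by blast
  have inj: "inj \<psi>" by (rule chartD(2)[OF \<psi>])
  have "open (\<psi> -` W)" "0 \<in> \<psi> -` W" using chart_open_vimage[OF \<psi> W] p \<psi>0 by auto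
  then obtain r where r: "r > 0" "ball 0 r \<subseteq> \<psi> -` W" using openE by blast
  show ?thesis
  proof (rule that[of "\<psi> ` ball 0 r"])
    show "openin S (\<psi> ` ball 0 r)" by (rule chartD(4)[OF \<psi>]) auto
    show "p \<in> \<psi> ` ball 0 r" using r \<psi>0 by force
    show "\<psi> ` ball 0 r \<subseteq> W" using r by auto
    fix q assume "q \<in> \<psi> ` ball 0 r"
    then obtain u where u: "u \<in> ball 0 r" "q = \<psi> u" by auto
    obtain f g :: "complex \<Rightarrow> complex" where fg: "homeomorphism UNIV UNIV f g"
      "f 0 = u" "{x. \<not> (f x = x \<and> g x = x)} \<subseteq> ball 0 r"
    proof (rule homeomorphism_moving_points_exists[of "ball 0 r" UNIV "{()}" "\<lambda>_. 0" "\<lambda>_. u"])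
      show "2 \<le> DIM(complex)" by simp
    qed (use r u affine_hull_open[of "ball (0::complex) r"] in \<open>auto simp: pairwise_def\<close>)
    have id: "f z = z" if "z \<notin> ball 0 r" for z using that fg(3) by auto
    have hm: "homeomorphic_maps S S (chart_extend \<psi> f) (chart_extend \<psi> g)"
      by (rule homeomorphic_maps_chart_extend[OF \<psi> HS fg(1), of r]) (use id in auto)
    moreover have "chart_extend \<psi> f x = x" if "x \<notin> W" for x
    proof (cases "x \<in> range \<psi>")
      case True
      then obtain z where "x = \<psi> z" by auto
      moreover have "z \<notin> ball 0 r" using \<open>x = \<psi> z\<close> r that by auto
      ultimately show ?thesis using id inj by simp
    qed (simp add: chart_extend_outside)
    moreover have "chart_extend \<psi> f p = q" using inj fg(2) u \<psi>0 chart_extend_apply[of \<psi> f 0] by simp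
    ultimately show "\<exists>h h'. homeomorphic_maps S S h h' \<and> (\<forall>x. x \<notin> W \<longrightarrow> h x = x) \<and> h p = q" by blast
  qed
qed

text \<open>The points of \<open>W\<close> reachable from \<open>p\<close> form an open set, and so
  do the unreachable ones, by composing with local moves and their inverses; a connected subset of
  \<open>W\<close> cannot meet both. In \<open>drawn_contract\<close> the set \<open>C\<close> is
  the interior of an edge and \<open>W\<close> the complement of the remaining drawing, which
  therefore stays fixed.\<close>

lemma surface_homogeneous:
  assumes S: "surface S" and W: "openin S W" and C: "connectedin S C" "C \<subseteq> W"
    and p: "p \<in> C" and q: "q \<in> C"
  obtains h h' where "homeomorphic_maps S S h h'" "\<And>x. x \<notin> W \<Longrightarrow> h x = x" "h p = q"
proof -
  define R where "R a b \<longleftrightarrow> (\<exists>h h'. homeomorphic_maps S S h h' \<and> (\<forall>x. x \<notin> W \<longrightarrow> h x = x) \<and> h a = b)" for a b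
  have trans: "R a c" if ab: "R a b" and bc: "R b c" for a b c
  proof -
    obtain h h' where 1: "homeomorphic_maps S S h h'" "\<forall>x. x \<notin> W \<longrightarrow> h x = x" "h a = b"
      using ab unfolding R_def by blast
    obtain g g' where 2: "homeomorphic_maps S S g g'" "\<forall>x. x \<notin> W \<longrightarrow> g x = x" "g b = c"
      using bc unfolding R_def by blast
    show ?thesis unfolding R_def
      using homeomorphic_maps_compose[OF conjI[OF 1(1) 2(1)]] 1 2
      by (intro exI[of _ "g \<circ> h"] exI[of _ "h' \<circ> g'"]) auto
  qed
  have sym: "R b a" if ab: "R a b" and aW: "a \<in> W" for a b
  proof -
    obtain h h' where 1: "homeomorphic_maps S S h h'" "\<forall>x. x \<notin> W \<longrightarrow> h x = x" "h a = b"
      using ab unfolding R_def by blast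
    have WS: "W \<subseteq> topspace S" using W openin_subset by blast
    \<comment> \<open>\<open>homeomorphic_maps\<close> does not control \<open>h'\<close> outside
      \<open>topspace S\<close>, whereas \<open>R\<close> asks for fixed points everywhere outside
      \<open>W\<close>; hence the correction.\<close>
    define g where "g x = (if x \<in> topspace S then h' x else x)" for x
    have "continuous_map S S g"
      by (rule continuous_map_eq[of S S h']) (use 1 in \<open>auto simp: homeomorphic_maps_def g_def\<close>)
    then have "homeomorphic_maps S S g h"
      using 1(1) unfolding homeomorphic_maps_def by (simp add: g_def continuous_map_def Pi_iff)
    moreover have "g x = x" if "x \<notin> W" for x
      using 1 that unfolding g_def homeomorphic_maps_def by metis
    moreover have "g b = a"
      using 1 aW WS unfolding g_def homeomorphic_maps_def continuous_map_def Pi_iff by auto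
    ultimately show ?thesis unfolding R_def by blast
  qed
  define A where "A = {b \<in> W. R p b}"
  define B where "B = {b \<in> W. \<not> R p b}"
  have "openin S A"
  proof (subst openin_subopen, intro ballI)
    fix b assume b: "b \<in> A"
    then obtain V where V: "openin S V" "b \<in> V" "V \<subseteq> W" "\<And>q. q \<in> V \<Longrightarrow> R b q"
      using surface_move_local[OF S W, of b] unfolding A_def R_def by blast
    then have "V \<subseteq> A" using b trans[of p b] by (auto simp: A_def)
    then show "\<exists>T. openin S T \<and> b \<in> T \<and> T \<subseteq> A" using V by blast
  qed
  moreover have "openin S B"
  proof (subst openin_subopen, intro ballI)
    fix b assume b: "b \<in> B"
    then obtain V where V: "openin S V" "b \<in> V" "V \<subseteq> W" "\<And>q. q \<in> V \<Longrightarrow> R b q"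
      using surface_move_local[OF S W, of b] unfolding B_def R_def by blast
    have "x \<in> B" if x: "x \<in> V" for x
    proof -
      have "R x b" using sym[OF V(4)[OF x]] b by (simp add: B_def)
      then have "\<not> R p x" using trans[of p x b] b by (auto simp: B_def)
      then show ?thesis using x V(3) by (auto simp: B_def)
    qed
    then show "\<exists>T. openin S T \<and> b \<in> T \<and> T \<subseteq> B" using V by blast
  qed
  moreover have "p \<in> A"
  proof -
    have "R p p" unfolding R_def by (intro exI[of _ id]) (auto simp: homeomorphic_maps_id)
    then show ?thesis using p C unfolding A_def by blast
  qed
  moreover have "C \<subseteq> A \<union> B" "A \<inter> B \<inter> C = {}" using C by (auto simp: A_def B_def)
  ultimately have "B \<inter> C = {}"
    using C(1) p unfolding connectedin by (metis (no_types, lifting) IntI empty_iff)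
  then have "R p q" using q C unfolding B_def by blast
  then show ?thesis using that unfolding R_def by blast
qed

text \<open>Pushes points to the right along horizontal lines, inside the diamond
  \<open>|Re z| + |Im z| < 1\<close>. On the real axis it is \<open>x + max 0 (1 - |x|)\<close>,
  which is constantly 1 between 0 and 1; the factor \<open>1 - |Im z|\<close> makes it strictly
  increasing on every other line.\<close>

definition radial_collapse :: "complex \<Rightarrow> complex" where
  "radial_collapse z = z + of_real ((1 - \<bar>Im z\<bar>) * max 0 (1 - \<bar>Im z\<bar> - \<bar>Re z\<bar>))"

lemma radial_collapse_continuous: "continuous_on UNIV radial_collapse"
  unfolding radial_collapse_def by (intro continuous_intros)

lemma radial_collapse_outside:
  assumes "cmod z \<ge> 1" shows "radial_collapse z = z"
proof -
  have "cmod z \<le> \<bar>Re z\<bar> + \<bar>Im z\<bar>" by (rule cmod_le)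
  then show ?thesis using assms by (simp add: radial_collapse_def)
qed

lemma radial_collapse_segment: "0 \<le> x \<Longrightarrow> x \<le> 1 \<Longrightarrow> radial_collapse (of_real x) = 1"
  by (simp add: radial_collapse_def flip: of_real_add)

text \<open>Horizontal lines are preserved, so only the monotonicity of \<open>F\<close> on one line
  matters. For \<open>t < 1\<close> the second summand of \<open>F\<close> has Lipschitz constant
  \<open>1 - t\<close>, less than 1 off the real axis; on the axis the slope of \<open>F\<close>
  vanishes only between 0 and 1.\<close>

lemma radial_collapse_eqD:
  assumes eq: "radial_collapse z = radial_collapse w" and z: "z \<notin> complex_of_real ` {0..1}"
  shows "z = w"
proof -
  define t where "t = \<bar>Im z\<bar>"
  define F where "F x = x + (1 - t) * max 0 (1 - t - \<bar>x\<bar>)" for x :: real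
  have im: "Im z = Im w" using arg_cong[OF eq, of Im] by (simp add: radial_collapse_def)
  have Fzw: "F (Re z) = F (Re w)"
    using arg_cong[OF eq, of Re] im by (simp add: radial_collapse_def F_def t_def)
  have t0: "t \<ge> 0" by (simp add: t_def)
  \<comment> \<open>The side condition says that the interval from \<open>x\<close> to
    \<open>y\<close> is not part of the collapsed segment.\<close>
  have strict: "F x < F y" if "x < y" and c: "t > 0 \<or> x < 0 \<or> y > 1" for x y
  proof (cases "t \<ge> 1")
    case True then show ?thesis using that by (simp add: F_def)
  next
    case False
    define M where "M x = max 0 (1 - t - \<bar>x\<bar>)" for x :: real
    have "(1 - t) * (M x - M y) < y - x"
    proof (cases "M x \<le> M y")
      case True
      then have "(1 - t) * (M x - M y) \<le> 0" using False by (intro mult_nonneg_nonpos) auto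
      then show ?thesis using that by simp
    next
      case mm: False
      have b: "M x - M y \<le> y - x" using that by (auto simp: M_def)
      show ?thesis
      proof (cases "t > 0")
        case True
        have "(1 - t) * (M x - M y) < 1 * (M x - M y)"
          using mm True by (intro mult_strict_right_mono) auto
        then show ?thesis using b by simp
      next
        case f: False
        then have "t = 0" using t0 by simp
        then have "M x - M y < y - x" using c that mm by (auto simp: M_def max_def split: if_splits)
        then show ?thesis using \<open>t = 0\<close> by simp
      qed
    qed
    then show ?thesis by (simp add: F_def M_def algebra_simps)
  qed
  have out: "t > 0 \<or> Re z < 0 \<or> Re z > 1"
  proof (rule ccontr)
    assume "\<not> ?thesis"
    then have "z = of_real (Re z)" "Re z \<in> {0..1}" by (auto simp: t_def complex_eq_iff)
    then show False using z by (metis image_eqI)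
  qed
  have "Re z = Re w"
  proof (cases "Re z" "Re w" rule: linorder_cases)
    case less
    have "F (Re z) < F (Re w)"
    proof (cases "t > 0 \<or> Re z < 0 \<or> Re w > 1")
      case True then show ?thesis using strict less by blast
    next
      case False then show ?thesis using out less by auto
    qed
    then show ?thesis using Fzw by simp
  next
    case greater
    have "F (Re w) < F (Re z)"
    proof (cases "t > 0 \<or> Re w < 0 \<or> Re z > 1")
      case True then show ?thesis using strict greater by blast
    next
      case False then show ?thesis using out greater by auto
    qed
    then show ?thesis using Fzw by simp
  qed
  then show ?thesis using im by (simp add: complex_eq_iff)
qed

text \<open>Transport of \<open>radial_collapse\<close> along the chart
  \<open>z \<mapsto> \<psi> (a * z)\<close>. The segment shrinks to its far end
  \<open>\<psi> a\<close>, not to the centre, so that the two collapses in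
  \<open>drawn_contract\<close> end in a common point.\<close>

lemma chart_collapse:
  assumes \<psi>: "chart S \<psi>" and S: "Hausdorff_space S" and a: "a \<noteq> 0"
  obtains c where "continuous_map S S c"
    "\<And>x. 0 \<le> x \<Longrightarrow> x \<le> 1 \<Longrightarrow> c (\<psi> (of_real x * a)) = \<psi> a"
    "\<And>p q. c p = c q \<Longrightarrow> p \<notin> \<psi> ` closed_segment 0 a \<Longrightarrow> p = q"
    "\<And>p. p \<notin> \<psi> ` ball 0 (cmod a) \<Longrightarrow> c p = p"
proof -
  define \<psi>' where "\<psi>' z = \<psi> (a * z)" for z
  have \<psi>': "chart S \<psi>'" unfolding \<psi>'_def by (rule chart_scale[OF \<psi> a])
  have inj: "inj \<psi>'" by (rule chartD(2)[OF \<psi>'])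
  define c where "c = chart_extend \<psi>' radial_collapse"
  have ap: "c (\<psi>' z) = \<psi>' (radial_collapse z)" for z unfolding c_def using inj by simp
  show ?thesis
  proof (rule that[of c])
    show "continuous_map S S c" unfolding c_def
      by (rule continuous_map_chart_extend[OF \<psi>' S radial_collapse_continuous, of 1])
         (simp add: radial_collapse_outside)
    show "c (\<psi> (of_real x * a)) = \<psi> a" if "0 \<le> x" "x \<le> 1" for x
      using ap[of "of_real x"] radial_collapse_segment[OF that] by (simp add: \<psi>'_def mult.commute)
    show "p = q" if "c p = c q" "p \<notin> \<psi> ` closed_segment 0 a" for p q
    proof -
      have pp: "p \<notin> \<psi>' ` complex_of_real ` {0..1}"
        using that(2) by (force simp: \<psi>'_def closed_segment_def scaleR_conv_of_real mult.commute)
      have rng: "c y \<in> range \<psi>' \<longleftrightarrow> y \<in> range \<psi>'" for y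
        unfolding c_def chart_extend_def by auto
      show ?thesis
      proof (cases "p \<in> range \<psi>'")
        case True
        then have "q \<in> range \<psi>'" using rng[of p] rng[of q] that(1) by simp
        then obtain z w where zw: "p = \<psi>' z" "q = \<psi>' w" using True by auto
        then have "radial_collapse z = radial_collapse w" using that(1) ap inj by (auto dest: injD)
        moreover have "z \<notin> complex_of_real ` {0..1}" using pp zw by auto
        ultimately have "z = w" by (rule radial_collapse_eqD)
        then show ?thesis using zw by simp
      next
        case False
        then have "q \<notin> range \<psi>'" using rng[of p] rng[of q] that(1) by simp
        then show ?thesis using False that(1) by (simp add: c_def chart_extend_outside)
      qed
    qed
    show "c p = p" if "p \<notin> \<psi> ` ball 0 (cmod a)" for p
    proof (cases "p \<in> range \<psi>'")
      case True
      then obtain z where z: "p = \<psi>' z" by auto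
      have "cmod z \<ge> 1"
      proof (rule ccontr)
        assume "\<not> ?thesis"
        then have "a * z \<in> ball 0 (cmod a)" using a by (simp add: norm_mult)
        then show False using that z by (auto simp: \<psi>'_def)
      qed
      then show ?thesis using z ap radial_collapse_outside by simp
    qed (simp add: c_def chart_extend_outside)
  qed
qed

section \<open>Arcs and drawings\<close>

text \<open>Edges are unordered, so an arc is recorded as a point set with an unordered pair of
  ends; \<open>arc_set_param\<close> chooses a direction when one is needed.\<close>

definition arc_set :: "'s topology \<Rightarrow> 's set \<Rightarrow> 's set \<Rightarrow> bool" where
  "arc_set S A e \<longleftrightarrow>
     (\<exists>\<alpha>. pathin S \<alpha> \<and> inj_on \<alpha> {0..1} \<and> \<alpha> ` {0..1} = A \<and> {\<alpha> 0, \<alpha> 1} = e)"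

lemma arc_setI_interval:
  fixes a b :: real
  assumes "a < b" and cont: "continuous_map (top_of_set {a..b}) S \<gamma>" and inj: "inj_on \<gamma> {a..b}"
  shows "arc_set S (\<gamma> ` {a..b}) {\<gamma> a, \<gamma> b}"
proof -
  define g where "g t = a + (b - a) * t" for t :: real
  have g: "g ` {0..1} = {a..b}"
  proof
    show "g ` {0..1} \<subseteq> {a..b}"
    proof clarify
      fix t :: real assume "t \<in> {0..1}"
      then have "0 \<le> (b - a) * t" "(b - a) * t \<le> (b - a) * 1"
        using assms(1) by (auto intro: mult_left_mono)
      then show "g t \<in> {a..b}" by (simp add: g_def)
    qed
    show "{a..b} \<subseteq> g ` {0..1}"
    proof
      fix x assume "x \<in> {a..b}"
      then have "g ((x - a) / (b - a)) = x" "(x - a) / (b - a) \<in> {0..1}"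
        using assms(1) by (auto simp: g_def divide_simps)
      then show "x \<in> g ` {0..1}" by (metis image_eqI)
    qed
  qed
  have "continuous_map (top_of_set {0..1}) (top_of_set {a..b}) g"
  proof -
    have "continuous_map (top_of_set {0..1}) euclidean g"
      unfolding g_def by (auto intro!: continuous_intros)
    then show ?thesis using g by (auto simp: continuous_map_in_subtopology)
  qed
  then have "pathin S (\<gamma> \<circ> g)"
    unfolding pathin_def using cont continuous_map_compose by blast
  moreover have "inj_on (\<gamma> \<circ> g) {0..1}"
    by (rule comp_inj_on) (use assms(1) g inj in \<open>auto simp: inj_on_def g_def\<close>)
  moreover have "(\<gamma> \<circ> g) ` {0..1} = \<gamma> ` {a..b}" using g by (metis image_comp)
  moreover have "{(\<gamma> \<circ> g) 0, (\<gamma> \<circ> g) 1} = {\<gamma> a, \<gamma> b}" by (simp add: g_def)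
  ultimately show ?thesis unfolding arc_set_def by blast
qed

lemma arc_set_param:
  assumes "arc_set S A {p, q}"
  obtains \<alpha> where "pathin S \<alpha>" "inj_on \<alpha> {0..1}" "\<alpha> ` {0..1} = A" "\<alpha> 0 = p" "\<alpha> 1 = q"
proof -
  obtain \<alpha> where \<alpha>: "pathin S \<alpha>" "inj_on \<alpha> {0..1}" "\<alpha> ` {0..1} = A" "{\<alpha> 0, \<alpha> 1} = {p, q}"
    using assms unfolding arc_set_def by blast
  show ?thesis
  proof (cases "\<alpha> 0 = p")
    case True
    then have "\<alpha> 1 = q" using \<alpha>(4) by (auto simp: doubleton_eq_iff)
    then show ?thesis using that \<alpha> True by blast
  next
    case False
    then have e: "\<alpha> 0 = q" "\<alpha> 1 = p" using \<alpha>(4) by (auto simp: doubleton_eq_iff)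
    have im: "(\<lambda>t. 1 - t) ` {0..1::real} = {0..1}" by (auto simp: image_iff intro!: bexI[of _ "1 - _"])
    have "continuous_map (top_of_set {0..1}) (top_of_set {0..1::real}) (\<lambda>t. 1 - t)"
      by (auto simp: continuous_map_in_subtopology intro!: continuous_intros)
    then have "pathin S (\<alpha> \<circ> (\<lambda>t. 1 - t))"
      using \<alpha>(1) unfolding pathin_def using continuous_map_compose by blast
    moreover have "inj_on (\<alpha> \<circ> (\<lambda>t. 1 - t)) {0..1}"
      by (rule comp_inj_on) (use \<alpha>(2) im in \<open>auto simp: inj_on_def\<close>)
    moreover have "(\<alpha> \<circ> (\<lambda>t. 1 - t)) ` {0..1} = A" using im \<alpha>(3) by (metis image_comp)
    ultimately show ?thesis using that e by simp
  qed
qed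

lemma arc_set_ends:
  assumes "arc_set S A {p, q}" shows "p \<noteq> q" "p \<in> A" "q \<in> A" "A \<subseteq> topspace S"
proof -
  obtain \<alpha> where \<alpha>: "pathin S \<alpha>" "inj_on \<alpha> {0..1}" "\<alpha> ` {0..1} = A" "\<alpha> 0 = p" "\<alpha> 1 = q"
    using arc_set_param[OF assms] .
  show "p \<noteq> q" using \<alpha> by (metis atLeastAtMost_iff inj_on_eq_iff le_numeral_extra(3) zero_less_one less_eq_real_def zero_neq_one)
  show "p \<in> A" "q \<in> A" using \<alpha> by (force intro: rev_image_eqI)+
  show "A \<subseteq> topspace S" using \<alpha>(1,3) path_image_subset_topspace by (metis image_subset_iff_funcset)
qed

lemma arc_set_closedin:
  assumes "Hausdorff_space S" "arc_set S A e" shows "closedin S A"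
proof -
  obtain \<alpha> where \<alpha>: "pathin S \<alpha>" "\<alpha> ` {0..1} = A" using assms(2) unfolding arc_set_def by blast
  have "compactin (top_of_set {0..1::real}) {0..1}"
    by (simp add: compactin_subtopology)
  then have "compactin S (\<alpha> ` {0..1})"
    using \<alpha>(1) image_compactin unfolding pathin_def by blast
  then show ?thesis using \<alpha>(2) assms(1) compactin_imp_closedin by blast
qed

lemma arc_set_image:
  assumes "continuous_map S S' c" "inj_on c A" "arc_set S A e"
  shows "arc_set S' (c ` A) (c ` e)"
proof -
  obtain \<alpha> where \<alpha>: "pathin S \<alpha>" "inj_on \<alpha> {0..1}" "\<alpha> ` {0..1} = A" "{\<alpha> 0, \<alpha> 1} = e"
    using assms(3) unfolding arc_set_def by blast
  have "inj_on (c \<circ> \<alpha>) {0..1}" using \<alpha> assms(2) comp_inj_on by blast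
  moreover have "(c \<circ> \<alpha>) ` {0..1} = c ` A" using \<alpha>(3) by (metis image_comp)
  moreover have "{(c \<circ> \<alpha>) 0, (c \<circ> \<alpha>) 1} = c ` e" using \<alpha>(4) by auto
  ultimately show ?thesis unfolding arc_set_def using pathin_compose[OF \<alpha>(1) assms(1)] by blast
qed

lemma arc_set_sub:
  assumes \<alpha>: "pathin S \<alpha>" "inj_on \<alpha> {0..1}" and "0 \<le> a" "a < b" "b \<le> 1"
  shows "arc_set S (\<alpha> ` {a..b}) {\<alpha> a, \<alpha> b}"
proof (rule arc_setI_interval)
  have "top_of_set {a..b} = subtopology (top_of_set {0..1}) {a..b}"
    using assms by (simp add: subtopology_subtopology Int_absorb1)
  then show "continuous_map (top_of_set {a..b}) S \<alpha>"
    using \<alpha>(1) continuous_map_from_subtopology unfolding pathin_def by metis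
  show "inj_on \<alpha> {a..b}" using \<alpha>(2) by (rule inj_on_subset) (use assms in auto)
qed (use assms in auto)

lemma arc_set_Un:
  assumes A: "arc_set S A {p, q}" and B: "arc_set S B {q, r}" and AB: "A \<inter> B = {q}"
  shows "arc_set S (A \<union> B) {p, r}"
proof -
  obtain \<alpha> where \<alpha>: "pathin S \<alpha>" "inj_on \<alpha> {0..1}" "\<alpha> ` {0..1} = A" "\<alpha> 0 = p" "\<alpha> 1 = q"
    using arc_set_param[OF A] .
  obtain \<beta> where \<beta>: "pathin S \<beta>" "inj_on \<beta> {0..1}" "\<beta> ` {0..1} = B" "\<beta> 0 = q" "\<beta> 1 = r"
    using arc_set_param[OF B] .
  define \<gamma> where "\<gamma> t = (if t \<le> 1 then \<alpha> t else \<beta> (t - 1))" for t :: real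
  have cont: "continuous_map (top_of_set {0..2}) S \<gamma>"
    unfolding \<gamma>_def
  proof (rule continuous_map_cases_le)
    have "subtopology (top_of_set {0..2}) {x \<in> topspace (top_of_set {0..2}). x \<le> 1} = top_of_set {0..1::real}"
      by (auto simp: subtopology_subtopology intro!: arg_cong[of _ _ "subtopology _"])
    then show "continuous_map (subtopology (top_of_set {0..2}) {x \<in> topspace (top_of_set {0..2}). x \<le> 1}) S \<alpha>"
      using \<alpha>(1) unfolding pathin_def by metis
    have e: "subtopology (top_of_set {0..2}) {x \<in> topspace (top_of_set {0..2}). 1 \<le> x} = top_of_set {1..2::real}"
      by (auto simp: subtopology_subtopology intro!: arg_cong[of _ _ "subtopology _"])
    have "continuous_map (top_of_set {1..2}) (top_of_set {0..1::real}) (\<lambda>t. t - 1)"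
      by (auto simp: continuous_map_in_subtopology intro!: continuous_intros)
    then have "continuous_map (top_of_set {1..2}) S (\<beta> \<circ> (\<lambda>t. t - 1))"
      using \<beta>(1) unfolding pathin_def using continuous_map_compose by blast
    then show "continuous_map (subtopology (top_of_set {0..2}) {x \<in> topspace (top_of_set {0..2}). 1 \<le> x}) S (\<lambda>t. \<beta> (t - 1))"
      unfolding e by (simp add: o_def)
  qed (use \<alpha> \<beta> in auto)
  have im1: "\<gamma> ` {0..1} = A" using \<alpha>(3) by (auto simp: \<gamma>_def image_iff)
  have im2: "\<gamma> ` {1<..2} = B - {q}"
  proof -
    have "B - {q} = \<beta> ` {0<..1}"
    proof -
      have "\<beta> ` ({0..1} - {0}) = \<beta> ` {0..1} - \<beta> ` {0}"
        using \<beta>(2) by (intro inj_on_image_set_diff) auto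
      moreover have "{0..1} - {0::real} = {0<..1}" by auto
      ultimately show ?thesis using \<beta>(3,4) by simp
    qed
    also have "{0<..1} = (\<lambda>t. t - 1) ` {1<..2::real}"
      by (auto simp: image_iff intro!: bexI[of _ "_ + 1"])
    finally show ?thesis by (auto simp: \<gamma>_def image_iff)
  qed
  have split: "{0..2} = {0..1} \<union> {1<..2::real}" by auto
  have "inj_on \<gamma> ({0..1} \<union> {1<..2})"
  proof (subst inj_on_Un, intro conjI)
    show "inj_on \<gamma> {0..1}" using \<alpha>(2) by (auto simp: \<gamma>_def inj_on_def)
    show "inj_on \<gamma> {1<..2}"
    proof (rule inj_onI)
      fix x y assume "x \<in> {1<..2}" "y \<in> {1<..2}" "\<gamma> x = \<gamma> y"
      then have "x - 1 = y - 1" by (intro inj_onD[OF \<beta>(2)]) (auto simp: \<gamma>_def)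
      then show "x = y" by simp
    qed
    have "\<gamma> ` {0..1} \<inter> \<gamma> ` {1<..2} = {}" using im1 im2 AB by auto
    then show "\<gamma> ` ({0..1} - {1<..2}) \<inter> \<gamma> ` ({1<..2} - {0..1}) = {}" by blast
  qed
  then have "arc_set S (\<gamma> ` {0..2}) {\<gamma> 0, \<gamma> 2}"
    using cont by (intro arc_setI_interval) (auto simp: split)
  moreover have "\<gamma> ` {0..2} = A \<union> (B - {q})" unfolding split image_Un im1 im2 ..
  then have "\<gamma> ` {0..2} = A \<union> B" using AB by blast
  moreover have "\<gamma> 0 = p" "\<gamma> 2 = r" using \<alpha> \<beta> by (auto simp: \<gamma>_def)
  ultimately show ?thesis by simp
qed

lemma arc_set_split:
  assumes A: "arc_set S A {p, q}" and y: "y \<in> A" "y \<noteq> p" "y \<noteq> q"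
  obtains B C where "A = B \<union> C" "B \<inter> C = {y}" "arc_set S B {p, y}" "arc_set S C {y, q}"
proof -
  obtain \<alpha> where \<alpha>: "pathin S \<alpha>" "inj_on \<alpha> {0..1}" "\<alpha> ` {0..1} = A" "\<alpha> 0 = p" "\<alpha> 1 = q"
    using arc_set_param[OF A] .
  obtain s where s: "s \<in> {0..1}" "\<alpha> s = y" using y \<alpha>(3) by blast
  then have s': "0 < s" "s < 1" using y \<alpha>(4,5) by (auto simp: less_le)
  show ?thesis
  proof (rule that[of "\<alpha> ` {0..s}" "\<alpha> ` {s..1}"])
    have "{0..1} = {0..s} \<union> {s..1}" using s' by auto
    then show "A = \<alpha> ` {0..s} \<union> \<alpha> ` {s..1}" using \<alpha>(3) by (metis image_Un)
    have "\<alpha> ` {0..s} \<inter> \<alpha> ` {s..1} = \<alpha> ` ({0..s} \<inter> {s..1})"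
      by (rule inj_on_image_Int[OF \<alpha>(2), symmetric]) (use s' in auto)
    moreover have "{0..s} \<inter> {s..1} = {s}" using s' by auto
    ultimately show "\<alpha> ` {0..s} \<inter> \<alpha> ` {s..1} = {y}" using s by simp
    show "arc_set S (\<alpha> ` {0..s}) {p, y}" using arc_set_sub[OF \<alpha>(1,2), of 0 s] s s' \<alpha> by simp
    show "arc_set S (\<alpha> ` {s..1}) {y, q}" using arc_set_sub[OF \<alpha>(1,2), of s 1] s s' \<alpha> by simp
  qed
qed

lemma first_hit:
  assumes C: "closed C" and "0 \<notin> C" "t1 \<in> C" "0 \<le> (t1::real)"
  obtains s where "0 < s" "s \<le> t1" "s \<in> C" "\<And>t. 0 \<le> t \<Longrightarrow> t < s \<Longrightarrow> t \<notin> C"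
proof -
  have "compact (C \<inter> {0..t1})" using C by (simp add: closed_Int_compact)
  moreover have "C \<inter> {0..t1} \<noteq> {}" using assms by auto
  ultimately obtain s where s: "s \<in> C \<inter> {0..t1}" "\<forall>t \<in> C \<inter> {0..t1}. s \<le> t"
    using compact_attains_inf by blast
  have "s \<noteq> 0" using s assms by auto
  show ?thesis
    by (rule that[of s]) (use s \<open>s \<noteq> 0\<close> in \<open>force+\<close>)
qed

lemma pathin_closed_vimage:
  assumes "pathin S \<alpha>" "closedin S M"
  shows "closed ({0..1} \<inter> \<alpha> -` M)"
proof -
  have "closedin (top_of_set {0..1}) {x \<in> topspace (top_of_set {0..1}). \<alpha> x \<in> M}"
    using assms closedin_continuous_map_preimage unfolding pathin_def by blast
  moreover have "{x \<in> topspace (top_of_set {0..1}). \<alpha> x \<in> M} = {0..1} \<inter> \<alpha> -` M" by auto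
  ultimately show ?thesis by (metis closed_atLeastAtMost closedin_closed_trans)
qed

lemma pathin_near_start:
  assumes "pathin S \<alpha>" "openin S U" "\<alpha> 0 \<in> U"
  obtains t where "0 < t" "t < 1" "\<alpha> t \<in> U"
proof -
  have "closedin S (topspace S - U)" using assms(2) by blast
  then have cl: "closed ({0..1} \<inter> \<alpha> -` (topspace S - U))" using assms(1) by (rule pathin_closed_vimage[rotated])
  have "\<exists>t. 0 < t \<and> t < 1 \<and> \<alpha> t \<in> U"
  proof (rule ccontr)
    assume n: "\<not> ?thesis"
    have "{0<..<1} \<subseteq> {0..1} \<inter> \<alpha> -` (topspace S - U)"
      using n path_image_subset_topspace[OF assms(1)] by (auto simp: Pi_iff)
    then have "closure {0<..<1} \<subseteq> {0..1} \<inter> \<alpha> -` (topspace S - U)"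
      using cl by (rule closure_minimal)
    moreover have "(0::real) \<in> closure {0<..<1}" by simp
    ultimately have "0 \<in> \<alpha> -` (topspace S - U)" by blast
    then show False using assms(3) by auto
  qed
  then show ?thesis using that by blast
qed

lemma arc_set_chart_segment:
  assumes \<psi>: "chart S \<psi>" and "a \<noteq> b"
  shows "arc_set S (\<psi> ` closed_segment a b) {\<psi> a, \<psi> b}"
proof -
  have "continuous_map (top_of_set {0..1}) euclidean (\<lambda>t. (1 - t) *\<^sub>R a + t *\<^sub>R b)"
    by (auto intro!: continuous_intros)
  from continuous_map_compose[OF this chartD(1)[OF \<psi>]]
  have "arc_set S ((\<psi> \<circ> (\<lambda>t. (1 - t) *\<^sub>R a + t *\<^sub>R b)) ` {0..1})
      {(\<psi> \<circ> (\<lambda>t. (1 - t) *\<^sub>R a + t *\<^sub>R b)) 0, (\<psi> \<circ> (\<lambda>t. (1 - t) *\<^sub>R a + t *\<^sub>R b)) 1}"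
  proof (intro arc_setI_interval)
    have "inj_on (\<lambda>t. (1 - t) *\<^sub>R a + t *\<^sub>R b) {0..1}"
    proof (rule inj_onI)
      fix x y :: real assume "(1 - x) *\<^sub>R a + x *\<^sub>R b = (1 - y) *\<^sub>R a + y *\<^sub>R b"
      then have "(x - y) *\<^sub>R (b - a) = 0" by (simp add: algebra_simps)
      then show "x = y" using \<open>a \<noteq> b\<close> by simp
    qed
    then show "inj_on (\<psi> \<circ> (\<lambda>t. (1 - t) *\<^sub>R a + t *\<^sub>R b)) {0..1}"
      using chartD(2)[OF \<psi>] by (meson comp_inj_on inj_on_subset subset_UNIV)
  qed auto
  moreover have "(\<psi> \<circ> (\<lambda>t. (1 - t) *\<^sub>R a + t *\<^sub>R b)) ` {0..1} = \<psi> ` closed_segment a b"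
    unfolding image_comp[symmetric] closed_segment_image_interval ..
  ultimately show ?thesis by simp
qed

text \<open>The arc is cut at its first point in the closed disc. That point lies on the boundary
  circle, since an arc arriving at an interior point of the disc has been inside a moment before.
  Whatever the arc does after the cut is forgotten.\<close>

lemma arc_enter_disc:
  assumes \<psi>: "chart S \<psi>" and S: "Hausdorff_space S" and A: "arc_set S A {u, v}"
    and u: "u \<notin> \<psi> ` cball 0 1" and v: "v \<in> \<psi> ` cball 0 1"
  obtains B \<zeta> where "cmod \<zeta> = 1" "B \<subseteq> A" "arc_set S B {u, \<psi> \<zeta>}" "B \<inter> \<psi> ` cball 0 1 = {\<psi> \<zeta>}"
proof -
  let ?M = "\<psi> ` cball 0 1"
  obtain \<alpha> where \<alpha>: "pathin S \<alpha>" "inj_on \<alpha> {0..1}" "\<alpha> ` {0..1} = A" "\<alpha> 0 = u" "\<alpha> 1 = v"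
    using arc_set_param[OF A] .
  have "closed ({0..1} \<inter> \<alpha> -` ?M)"
    by (rule pathin_closed_vimage[OF \<alpha>(1) chart_closedin_image[OF \<psi> S]]) auto
  then obtain s where s: "0 < s" "s \<le> 1" "\<alpha> s \<in> ?M" and
      before: "\<And>t. 0 \<le> t \<Longrightarrow> t < s \<Longrightarrow> \<alpha> t \<notin> ?M"
    using first_hit[of "{0..1} \<inter> \<alpha> -` ?M" 1] u v \<alpha> by (auto; metis)
  obtain \<zeta> where \<zeta>: "cmod \<zeta> \<le> 1" "\<alpha> s = \<psi> \<zeta>" using s(3) by auto
  have arc: "arc_set S (\<alpha> ` {0..s}) {u, \<psi> \<zeta>}" using arc_set_sub[OF \<alpha>(1,2), of 0 s] s \<alpha> \<zeta> by simp
  have "cmod \<zeta> = 1"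
  proof (rule ccontr)
    assume "cmod \<zeta> \<noteq> 1"
    then have "\<alpha> s \<in> \<psi> ` ball 0 1" using \<zeta> by auto
    moreover have "openin S (\<psi> ` ball 0 1)" by (rule chartD(4)[OF \<psi>]) auto
    ultimately have op: "openin S (\<psi> ` ball 0 1)" "\<psi> \<zeta> \<in> \<psi> ` ball 0 1" using \<zeta> by auto
    \<comment> \<open>The cut arc is read backwards from \<open>\<psi> \<zeta>\<close>: some further
      point of it lies in the open disc, although it precedes the first hit.\<close>
    have "arc_set S (\<alpha> ` {0..s}) {\<psi> \<zeta>, u}" using arc by (simp add: insert_commute)
    then obtain \<beta> where \<beta>: "pathin S \<beta>" "inj_on \<beta> {0..1}" "\<beta> ` {0..1} = \<alpha> ` {0..s}" "\<beta> 0 = \<psi> \<zeta>" "\<beta> 1 = u"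
      by (rule arc_set_param)
    obtain t where t: "0 < t" "t < 1" "\<beta> t \<in> \<psi> ` ball 0 1"
      using pathin_near_start[OF \<beta>(1) op(1)] \<beta>(4) op(2) by metis
    have "\<beta> t \<in> \<beta> ` {0..1}" using t by (intro imageI) auto
    then have "\<beta> t \<in> \<alpha> ` {0..s}" using \<beta>(3) by blast
    then obtain t' where t': "0 \<le> t'" "t' \<le> s" "\<beta> t = \<alpha> t'" by auto
    have "\<beta> t \<noteq> \<beta> 0" using inj_onD[OF \<beta>(2), of t 0] t by auto
    then have "t' < s" using t' \<beta>(4) \<zeta> by (metis less_le)
    then have "\<beta> t \<notin> ?M" using before t' by metis
    moreover have "\<psi> ` ball 0 1 \<subseteq> ?M" by (rule image_mono) auto
    ultimately show False using t(3) by blast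
  qed
  moreover have "\<alpha> ` {0..s} \<subseteq> A" using \<alpha>(3) s by auto
  moreover have "\<alpha> ` {0..s} \<inter> ?M = {\<psi> \<zeta>}"
  proof -
    have "t = s" if "0 \<le> t" "t \<le> s" "\<alpha> t \<in> ?M" for t
      using before[of t] that by linarith
    note last = this
    have "\<alpha> ` {0..s} \<inter> ?M \<subseteq> {\<alpha> s}"
    proof
      fix p assume "p \<in> \<alpha> ` {0..s} \<inter> ?M"
      then obtain t where t: "t \<in> {0..s}" "p = \<alpha> t" "\<alpha> t \<in> ?M" by blast
      then have "t = s" using last[of t] by simp
      then show "p \<in> {\<alpha> s}" using t by simp
    qed
    moreover have "\<alpha> s \<in> \<alpha> ` {0..s} \<inter> ?M" by (rule IntI[OF _ s(3)], rule imageI) (use s(1) in simp)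
    ultimately have "\<alpha> ` {0..s} \<inter> ?M = {\<alpha> s}" by (intro subset_antisym) simp_all
    then show ?thesis by (simp only: \<zeta>(2))
  qed
  ultimately show ?thesis by (rule that[OF _ _ arc])
qed

text \<open>Graphs whose vertices are points of the surface; \<open>A e\<close> is the arc drawn for the edge \<open>e\<close>.\<close>

definition drawn :: "'s topology \<Rightarrow> 's set \<Rightarrow> 's set set \<Rightarrow> ('s set \<Rightarrow> 's set) \<Rightarrow> bool" where
  "drawn S V E A \<longleftrightarrow> finite V \<and> V \<subseteq> topspace S \<and>
     (\<forall>e\<in>E. arc_set S (A e) e \<and> A e \<inter> V = e) \<and>
     (\<forall>e\<in>E. \<forall>f\<in>E. e \<noteq> f \<longrightarrow> A e \<inter> A f \<subseteq> V)"

lemma drawnD: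
  assumes "drawn S V E A"
  shows "finite V" "V \<subseteq> topspace S" "e \<in> E \<Longrightarrow> arc_set S (A e) e" "e \<in> E \<Longrightarrow> A e \<inter> V = e"
    "e \<in> E \<Longrightarrow> f \<in> E \<Longrightarrow> e \<noteq> f \<Longrightarrow> A e \<inter> A f \<subseteq> V" "finite E" "e \<in> E \<Longrightarrow> e \<subseteq> V"
    "e \<in> E \<Longrightarrow> A e \<subseteq> topspace S"
proof -
  show "finite V" "V \<subseteq> topspace S" "e \<in> E \<Longrightarrow> arc_set S (A e) e" "e \<in> E \<Longrightarrow> A e \<inter> V = e"
    "e \<in> E \<Longrightarrow> f \<in> E \<Longrightarrow> e \<noteq> f \<Longrightarrow> A e \<inter> A f \<subseteq> V"
    using assms unfolding drawn_def by auto
  have sub: "e \<subseteq> V" if "e \<in> E" for e using assms that unfolding drawn_def by blast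
  then show "e \<in> E \<Longrightarrow> e \<subseteq> V" .
  have "E \<subseteq> Pow V" using sub by blast
  then show "finite E" using assms unfolding drawn_def by (meson finite_Pow_iff finite_subset)
  show "A e \<subseteq> topspace S" if "e \<in> E"
  proof -
    have "arc_set S (A e) e" using assms that unfolding drawn_def by blast
    then obtain \<alpha> where "pathin S \<alpha>" "\<alpha> ` {0..1} = A e" unfolding arc_set_def by blast
    then show ?thesis using path_image_subset_topspace[of S \<alpha>] by (metis image_subset_iff_funcset)
  qed
qed

lemma drawn_subset:
  assumes "drawn S V E A" "E' \<subseteq> E" "V' \<subseteq> V" "\<And>e. e \<in> E' \<Longrightarrow> e \<subseteq> V'"
  shows "drawn S V' E' A"
  unfolding drawn_def
proof (intro conjI ballI impI)
  show "finite V'" using drawnD(1)[OF assms(1)] assms(3) finite_subset by blast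
  show "V' \<subseteq> topspace S" using drawnD(2)[OF assms(1)] assms(3) by blast
  fix e assume e: "e \<in> E'"
  then show "arc_set S (A e) e" using drawnD(3)[OF assms(1)] assms(2) by blast
  show eV: "A e \<inter> V' = e" using drawnD(4)[OF assms(1), of e] assms(2,3,4) e by blast
  fix f assume f: "f \<in> E'" "e \<noteq> f"
  have "A e \<inter> A f \<subseteq> V" using drawnD(5)[OF assms(1), of e f] e f assms(2) by blast
  then have "A e \<inter> A f \<subseteq> e" using drawnD(4)[OF assms(1), of e] e assms(2) by blast
  then show "A e \<inter> A f \<subseteq> V'" using eV by blast
qed

lemma drawn_add_edge:
  assumes "drawn S V E A" "p \<in> V" "q \<in> V" "{p, q} \<notin> E" "arc_set S B {p, q}" "B \<inter> V \<subseteq> {p, q}"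
    "\<And>e. e \<in> E \<Longrightarrow> B \<inter> A e \<subseteq> V"
  shows "drawn S V (insert {p, q} E) (A({p, q} := B))"
proof -
  have BV: "B \<inter> V = {p, q}" using assms(2,3,6) arc_set_ends[OF assms(5)] by auto
  note D = assms(1)
  have A': "(A({p, q} := B)) e = A e" if "e \<in> E" for e using that assms(4) by auto
  show ?thesis unfolding drawn_def
  proof (intro conjI ballI impI)
    fix e assume e: "e \<in> insert {p, q} E"
    show "arc_set S ((A({p, q} := B)) e) e"
      using e assms(5) drawnD(3)[OF D, of e] by auto
    show "(A({p, q} := B)) e \<inter> V = e" using e BV drawnD(4)[OF D, of e] by auto
    fix f assume f: "f \<in> insert {p, q} E" "e \<noteq> f"
    consider "e = {p, q}" "f \<in> E" | "f = {p, q}" "e \<in> E" | "e \<in> E" "f \<in> E" using e f by blast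
    then show "(A({p, q} := B)) e \<inter> (A({p, q} := B)) f \<subseteq> V"
    proof cases
      case 1 then show ?thesis using A'[of f] assms(7)[of f] by simp
    next
      case 2 then show ?thesis using A'[of e] assms(7)[of e] by (simp add: Int_commute)
    next
      case 3 then show ?thesis using A'[of e] A'[of f] drawnD(5)[OF D, of e f] f(2) by simp
    qed
  qed (use drawnD(1,2)[OF D] in auto)
qed

lemma drawn_add_vertex:
  assumes "drawn S V E A" "p \<in> topspace S" "p \<notin> V" "\<And>e. e \<in> E \<Longrightarrow> p \<notin> A e"
  shows "drawn S (insert p V) E A"
  unfolding drawn_def
proof (intro conjI ballI impI)
  fix e assume e: "e \<in> E"
  show "arc_set S (A e) e" using drawnD(3)[OF assms(1) e] .
  show "A e \<inter> insert p V = e" using drawnD(4)[OF assms(1) e] assms(4)[OF e] by simp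
  fix f assume "f \<in> E" "e \<noteq> f"
  then show "A e \<inter> A f \<subseteq> insert p V" using drawnD(5)[OF assms(1) e, of f] by blast
qed (use drawnD(1,2)[OF assms(1)] assms(2) in auto)

lemma drawn_subdivide:
  assumes D: "drawn S V E A" and e: "{p, q} \<in> E" and y: "y \<in> A {p, q}" "y \<notin> V"
    and BC: "A {p, q} = B \<union> C" "B \<inter> C = {y}" "arc_set S B {p, y}" "arc_set S C {y, q}"
  shows "drawn S (insert y V) (insert {p, y} (insert {y, q} (E - {{p, q}}))) (A({p, y} := B, {y, q} := C))"
proof -
  have pq: "p \<in> V" "q \<in> V" using drawnD(7)[OF D e] by auto
  have "p \<noteq> q" by (rule arc_set_ends(1)[OF drawnD(3)[OF D e]])
  have AV: "A {p, q} \<inter> V = {p, q}" using drawnD(4)[OF D e] .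
  have ends: "p \<in> B" "q \<in> C" using arc_set_ends(2)[OF BC(3)] arc_set_ends(3)[OF BC(4)] by auto
  have ynot: "y \<notin> A f" if "f \<in> E - {{p, q}}" for f
    using drawnD(5)[OF D e, of f] that y(1,2) by auto
  have py: "p \<noteq> y" "q \<noteq> y" using pq y(2) by metis+
  have "p \<notin> C" "q \<notin> B" using BC(2) ends py by (metis IntI singletonD)+
  have sub: "B \<subseteq> A {p, q}" "C \<subseteq> A {p, q}" using BC(1) by simp_all
  have yBC: "y \<in> B" "y \<in> C" using BC(2) by (metis IntD1 IntD2 singletonI)+
  have AV': "x = p \<or> x = q" if "x \<in> A {p, q}" "x \<in> V" for x
    using AV that by auto
  have "B \<inter> V = {p}" using sub(1) AV' \<open>q \<notin> B\<close> ends(1) pq(1) by auto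
  then have BV1: "B \<inter> insert y V = {p, y}" using yBC by auto
  have "C \<inter> V = {q}" using sub(2) AV' \<open>p \<notin> C\<close> ends(2) pq(2) by auto
  then have BV2: "C \<inter> insert y V = {y, q}" using yBC by auto
  note BV = BV1 BV2
  have yE: "y \<notin> f" if "f \<in> E" for f using drawnD(7)[OF D that] y by blast
  have other: "A f \<inter> B \<subseteq> insert y V" "A f \<inter> C \<subseteq> insert y V" if "f \<in> E - {{p, q}}" for f
    using drawnD(5)[OF D e, of f] that sub by blast+
  have "{p, y} \<noteq> {y, q}" using \<open>p \<noteq> q\<close> by (auto simp: doubleton_eq_iff)
  define A' where "A' = A({p, y} := B, {y, q} := C)"
  have A1: "A' {p, y} = B" "A' {y, q} = C" using \<open>{p, y} \<noteq> {y, q}\<close> by (auto simp: A'_def)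
  have A2: "A' f = A f" if "f \<in> E - {{p, q}}" for f using yE[of f] that by (auto simp: A'_def)
  show ?thesis unfolding A'_def[symmetric] drawn_def
  proof (intro conjI ballI impI)
    show "finite (insert y V)" using drawnD(1)[OF D] by simp
    show "insert y V \<subseteq> topspace S" using drawnD(2,8)[OF D] e y by blast
    fix f assume f: "f \<in> insert {p, y} (insert {y, q} (E - {{p, q}}))"
    then consider "f = {p, y}" | "f = {y, q}" | "f \<in> E - {{p, q}}" by blast
    note cf = this
    show "arc_set S (A' f) f" using cf
    proof cases
      case 3 then show ?thesis using A2[OF 3] drawnD(3)[OF D, of f] by simp
    qed (use A1 BC in simp_all)
    show "A' f \<inter> insert y V = f" using cf
    proof cases
      case 3 then show ?thesis using A2[OF 3] ynot[OF 3] drawnD(4)[OF D, of f] by auto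
    qed (use A1 BV in auto)
    fix g assume g: "g \<in> insert {p, y} (insert {y, q} (E - {{p, q}}))" "f \<noteq> g"
    then consider "g = {p, y}" | "g = {y, q}" | "g \<in> E - {{p, q}}" by blast
    then show "A' f \<inter> A' g \<subseteq> insert y V"
    proof cases
      case 1 note g1 = 1
      show ?thesis using cf
      proof cases
        case 1 then show ?thesis using g1 g(2) by simp
      next
        case 2 show ?thesis unfolding 2 g1 A1 using BC(2) by (simp add: Int_commute)
      next
        case 3 show ?thesis unfolding g1 A1 A2[OF 3] using other(1)[OF 3] .
      qed
    next
      case 2 note g2 = 2
      show ?thesis using cf
      proof cases
        case 1 show ?thesis unfolding 1 g2 A1 using BC(2) by simp
      next
        case 2 then show ?thesis using g2 g(2) by simp
      next
        case 3 show ?thesis unfolding g2 A1 A2[OF 3] using other(2)[OF 3] .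
      qed
    next
      case 3 note g3 = 3
      show ?thesis using cf
      proof cases
        case 1 show ?thesis unfolding 1 A1 A2[OF g3] using other(1)[OF g3] by (simp add: Int_commute)
      next
        case 2 show ?thesis unfolding 2 A1 A2[OF g3] using other(2)[OF g3] by (simp add: Int_commute)
      next
        case 3 then show ?thesis using A2[OF 3] A2[OF g3] drawnD(5)[OF D, of f g] g(2) g3 by auto
      qed
    qed
  qed
qed

text \<open>A map that identifies only points of \<open>K\<close> is injective on every arc that
  meets \<open>K\<close> at most once. \<open>KA\<close> and \<open>one\<close> ensure this: arcs
  meet \<open>K\<close> in vertices only, and no edge has two ends there.\<close>

lemma drawn_collapse:
  assumes D: "drawn S V E A" and c: "continuous_map S S c"
    and ck: "\<And>p q. c p = c q \<Longrightarrow> p \<noteq> q \<Longrightarrow> p \<in> K \<and> q \<in> K"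
    and KA: "\<And>f. f \<in> E \<Longrightarrow> A f \<inter> K \<subseteq> V"
    and one: "\<And>f a b. f \<in> E \<Longrightarrow> a \<in> f \<Longrightarrow> b \<in> f \<Longrightarrow> a \<in> K \<Longrightarrow> b \<in> K \<Longrightarrow> a = b"
  shows "\<exists>A'. drawn S (c ` V) ((`) c ` E) A'"
proof -
  \<comment> \<open>Edges that become parallel have the same image; \<open>r\<close> keeps one of
    them, together with its arc.\<close>
  define r where "r = inv_into E ((`) c)"
  have r: "r f \<in> E" "c ` r f = f" if "f \<in> (`) c ` E" for f
    using inv_into_into[OF that] f_inv_into_f[OF that] by (auto simp: r_def)
  have Af: "A f \<inter> V = f" if "f \<in> E" for f using drawnD(4)[OF D that] .
  have inj: "inj_on c (A f)" if f: "f \<in> E" for f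
  proof (rule inj_onI, rule ccontr)
    fix a b assume ab: "a \<in> A f" "b \<in> A f" "c a = c b" "a \<noteq> b"
    then have "a \<in> K" "b \<in> K" using ck by blast+
    then have "a \<in> V" "b \<in> V" using KA[OF f] ab by blast+
    then have "a \<in> f" "b \<in> f" using Af[OF f] ab by auto
    then show False using one[OF f] \<open>a \<in> K\<close> \<open>b \<in> K\<close> ab by blast
  qed
  show ?thesis
  proof (rule exI[of _ "\<lambda>f. c ` A (r f)"], unfold drawn_def, intro conjI ballI impI)
    show "finite (c ` V)" using drawnD(1)[OF D] by simp
    show "c ` V \<subseteq> topspace S" using drawnD(2)[OF D] c by (auto simp: continuous_map_def)
    fix f assume f: "f \<in> (`) c ` E"
    show "arc_set S (c ` A (r f)) f"
      using arc_set_image[OF c inj[OF r(1)[OF f]] drawnD(3)[OF D r(1)[OF f]]] r(2)[OF f] by simp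
    show "c ` A (r f) \<inter> c ` V = f"
    proof
      have "r f \<subseteq> A (r f)" "r f \<subseteq> V" using Af[OF r(1)[OF f]] by auto
      then have "c ` r f \<subseteq> c ` A (r f) \<inter> c ` V" by blast
      then show "f \<subseteq> c ` A (r f) \<inter> c ` V" using r(2)[OF f] by simp
      show "c ` A (r f) \<inter> c ` V \<subseteq> f"
      proof
        fix x assume "x \<in> c ` A (r f) \<inter> c ` V"
        then obtain a u where a: "a \<in> A (r f)" and u: "u \<in> V" "c a = c u" "x = c u" by auto
        have "a \<in> V"
        proof (cases "a = u")
          case False
          then show ?thesis using ck[OF u(2)] KA[OF r(1)[OF f]] a by blast
        qed (use u in simp)
        then have "a \<in> r f" using Af[OF r(1)[OF f]] a by auto
        then show "x \<in> f" using r(2)[OF f] u by (metis image_eqI)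
      qed
    qed
    fix g assume g: "g \<in> (`) c ` E" "f \<noteq> g"
    show "c ` A (r f) \<inter> c ` A (r g) \<subseteq> c ` V"
    proof
      fix x assume "x \<in> c ` A (r f) \<inter> c ` A (r g)"
      then obtain a b where ab: "a \<in> A (r f)" "b \<in> A (r g)" "c a = c b" "x = c b" by auto
      have "r f \<noteq> r g" using r(2)[OF f] r(2)[OF g(1)] g(2) by metis
      then have "b \<in> V"
        using ab ck[OF ab(3)] KA[OF r(1)[OF g(1)]] drawnD(5)[OF D r(1)[OF f] r(1)[OF g(1)]] by blast
      then show "x \<in> c ` V" using ab(4) by blast
    qed
  qed
qed

section \<open>Contracting an edge of a drawing\<close>

lemma closed_segment_0_iff: "x \<in> closed_segment 0 z \<longleftrightarrow> (\<exists>t. 0 \<le> t \<and> t \<le> 1 \<and> x = complex_of_real t * z)"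
  by (auto simp: closed_segment_def scaleR_conv_of_real)

lemma closed_segment_0_subset_cball: "cmod z \<le> 1 \<Longrightarrow> closed_segment 0 z \<subseteq> cball 0 1"
  by (rule closed_segment_subset) auto

text \<open>Two segments from 0 with a common point other than 0 lie on one ray. Together with
  \<open>closed_segment_0_unit\<close> this shows that distinct radii meet in the centre
  only.\<close>

lemma closed_segment_0_overlap:
  assumes "x \<in> closed_segment 0 z" "x \<in> closed_segment 0 w" "x \<noteq> 0" "cmod z \<le> cmod w"
  shows "z \<in> closed_segment 0 w"
proof -
  obtain a b where a: "0 \<le> a" "x = complex_of_real a * z" and b: "0 \<le> b" "x = complex_of_real b * w"
    using assms(1,2) unfolding closed_segment_0_iff by blast
  have "a \<noteq> 0" using a assms(3) by auto
  then have z: "z = complex_of_real (b / a) * w" using a b by (simp add: field_simps)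
  have "w \<noteq> 0" using b assms(3) by auto
  have "cmod z = b / a * cmod w" using z a b by (simp add: norm_mult norm_divide)
  then have "b / a * cmod w \<le> 1 * cmod w" using assms(4) by simp
  then have "b / a \<le> 1" using \<open>w \<noteq> 0\<close> by (meson mult_right_le_imp_le zero_less_norm_iff)
  then show ?thesis unfolding closed_segment_0_iff using z a b by (intro exI[of _ "b / a"]) auto
qed

lemma closed_segment_0_unit:
  assumes "z \<in> closed_segment 0 w" "cmod z = cmod w" shows "z = w"
proof (cases "w = 0")
  case False
  obtain t where t: "0 \<le> t" "t \<le> 1" "z = complex_of_real t * w"
    using assms(1) unfolding closed_segment_0_iff by blast
  then have "cmod z = t * cmod w" by (simp add: norm_mult)
  then have "t = 1" using assms(2) False by simp
  then show ?thesis using t by simp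
qed (use assms in simp)

text \<open>The disc around \<open>v\<close> avoids the other vertices and the arcs of all edges not
  at \<open>v\<close>. Every arc at \<open>v\<close> is cut where it first enters the disc and is
  continued along a radius. Distinct arcs enter at distinct points, as they share vertices only, so
  the radii are distinct. The set \<open>W\<close> serves to keep the disc away from another
  disc.\<close>

lemma radialise:
  assumes S: "surface S" and D: "drawn S V E A" and v: "v \<in> V" and W: "openin S W" "v \<in> W"
  obtains A' \<psi> \<zeta> where "drawn S V E A'" "chart S \<psi>" "\<psi> 0 = v" "\<psi> ` cball 0 1 \<subseteq> W"
    "\<psi> ` cball 0 1 \<inter> V = {v}"
    "\<And>e. e \<in> E \<Longrightarrow> v \<notin> e \<Longrightarrow> A' e = A e \<and> A e \<inter> \<psi> ` cball 0 1 = {}"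
    "\<And>e. e \<in> E \<Longrightarrow> v \<in> e \<Longrightarrow> cmod (\<zeta> e) = 1 \<and> A' e \<inter> \<psi> ` cball 0 1 = \<psi> ` closed_segment 0 (\<zeta> e)
        \<and> A' e \<subseteq> A e \<union> \<psi> ` cball 0 1"
    "\<And>e f. e \<in> E \<Longrightarrow> f \<in> E \<Longrightarrow> v \<in> e \<Longrightarrow> v \<in> f \<Longrightarrow> \<zeta> e = \<zeta> f \<Longrightarrow> e = f"
proof -
  have HS: "Hausdorff_space S" using S unfolding surface_def by blast
  have vS: "v \<in> topspace S" using W openin_subset by blast
  define L where "L = (V - {v}) \<union> (\<Union>e\<in>{e \<in> E. v \<notin> e}. A e)"
  have "closedin S L"
    unfolding L_def
  proof (intro closedin_Un closedin_Union)
    show "closedin S (V - {v})"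
      using drawnD(1,2)[OF D] HS
      by (metis Diff_subset Hausdorff_imp_t1_space finite_Diff order_trans t1_space_closedin_finite)
    show "finite (A ` {e \<in> E. v \<notin> e})" using drawnD(6)[OF D] by simp
    show "closedin S T" if "T \<in> A ` {e \<in> E. v \<notin> e}" for T
      using that arc_set_closedin[OF HS drawnD(3)[OF D]] by auto
  qed
  then have op: "openin S (W - L)" using W by blast
  have vL: "v \<notin> L"
  proof
    assume "v \<in> L"
    then obtain e where "e \<in> E" "v \<notin> e" "v \<in> A e" unfolding L_def by auto
    then show False using drawnD(4)[OF D, of e] v by auto
  qed
  obtain \<psi>0 where \<psi>0: "chart S \<psi>0" "\<psi>0 0 = v" using S vS unfolding surface_def by blast
  have "open (\<psi>0 -` (W - L))" "0 \<in> \<psi>0 -` (W - L)"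
    using chart_open_vimage[OF \<psi>0(1) op] W \<psi>0 vL by auto
  then obtain r where r: "r > 0" "cball 0 r \<subseteq> \<psi>0 -` (W - L)" using open_contains_cball by blast
  define \<psi> where "\<psi> z = \<psi>0 (of_real r * z)" for z
  define M where "M = \<psi> ` cball 0 1"
  have \<psi>: "chart S \<psi>" unfolding \<psi>_def using chart_scale[OF \<psi>0(1), of "of_real r"] r by simp
  have inj: "inj \<psi>" by (rule chartD(2)[OF \<psi>])
  have \<psi>v: "\<psi> 0 = v" using \<psi>0 by (simp add: \<psi>_def)
  have MWL: "M \<subseteq> W - L"
  proof
    fix p assume "p \<in> M"
    then obtain z where z: "cmod z \<le> 1" "p = \<psi> z" unfolding M_def by auto
    have "of_real r * z \<in> cball 0 r" using z r by (simp add: norm_mult)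
    then show "p \<in> W - L" using r z unfolding \<psi>_def by auto
  qed
  have vM: "v \<in> M" unfolding M_def using \<psi>v by (intro image_eqI[of _ _ 0]) auto
  have MV: "M \<inter> V = {v}" using MWL vM v unfolding L_def by auto
  have AM: "A e \<inter> M = {}" if "e \<in> E" "v \<notin> e" for e using MWL that unfolding L_def by auto
  have ex: "\<exists>u B z. e = {u, v} \<and> cmod z = 1 \<and> B \<subseteq> A e \<and> arc_set S B {u, \<psi> z} \<and> B \<inter> M = {\<psi> z}"
    if e: "e \<in> E" "v \<in> e" for e
  proof -
    have arc: "arc_set S (A e) e" using drawnD(3)[OF D e(1)] .
    then obtain p q where "e = {p, q}" unfolding arc_set_def by blast
    then obtain u where u: "e = {u, v}" using e(2) by auto
    have "u \<noteq> v" using arc_set_ends(1) arc u by metis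
    moreover have "u \<in> V" using drawnD(7)[OF D e(1)] u by auto
    ultimately have "u \<notin> M" using MV by auto
    obtain z B where "cmod z = 1" "B \<subseteq> A e" "arc_set S B {u, \<psi> z}" "B \<inter> \<psi> ` cball 0 1 = {\<psi> z}"
      by (rule arc_enter_disc[OF \<psi> HS arc[unfolded u]]) (use \<open>u \<notin> M\<close> vM u in \<open>auto simp: M_def\<close>)
    then show ?thesis using u unfolding M_def by metis
  qed
  have "\<forall>e\<in>{e \<in> E. v \<in> e}. \<exists>uBz. case uBz of (u, B, z) \<Rightarrow>
      e = {u, v} \<and> cmod z = 1 \<and> B \<subseteq> A e \<and> arc_set S B {u, \<psi> z} \<and> B \<inter> M = {\<psi> z}"
    using ex by force
  then obtain F where F: "\<forall>e\<in>{e \<in> E. v \<in> e}. case F e of (u, B, z) \<Rightarrow>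
      e = {u, v} \<and> cmod z = 1 \<and> B \<subseteq> A e \<and> arc_set S B {u, \<psi> z} \<and> B \<inter> M = {\<psi> z}"
    by (rule bchoice[THEN exE])
  define u where "u e = fst (F e)" for e
  define B where "B e = fst (snd (F e))" for e
  define \<zeta> where "\<zeta> e = snd (snd (F e))" for e
  have FE: "e = {u e, v}" "cmod (\<zeta> e) = 1" "B e \<subseteq> A e" "arc_set S (B e) {u e, \<psi> (\<zeta> e)}" "B e \<inter> M = {\<psi> (\<zeta> e)}"
    if "e \<in> E" "v \<in> e" for e
    using F that by (auto simp: u_def B_def \<zeta>_def split_def)
  define s where "s e = \<psi> ` closed_segment 0 (\<zeta> e)" for e
  define A' where "A' e = (if v \<in> e then B e \<union> s e else A e)" for e
  have sM: "s e \<subseteq> M" if "e \<in> E" "v \<in> e" for e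
    unfolding s_def M_def using closed_segment_0_subset_cball FE(2)[OF that] by (simp add: image_mono)
  have zs: "\<psi> (\<zeta> e) \<in> s e" for e unfolding s_def by simp
  have zB: "\<psi> (\<zeta> e) \<in> B e" if "e \<in> E" "v \<in> e" for e using FE(5)[OF that] by blast
  have zv: "\<psi> (\<zeta> e) \<noteq> v" if "e \<in> E" "v \<in> e" for e
    using FE(2)[OF that] inj \<psi>v by (metis inj_eq norm_zero zero_neq_one)
  have BM: "p = \<psi> (\<zeta> e)" if "e \<in> E" "v \<in> e" "p \<in> B e" "p \<in> M" for e p
    using FE(5)[OF that(1,2)] that(3,4) by (metis IntI singletonD)
  have vB: "v \<notin> B e" if "e \<in> E" "v \<in> e" for e
    using BM[OF that] vM zv[OF that] by metis
  have zV: "\<psi> (\<zeta> e) \<notin> V" if "e \<in> E" "v \<in> e" for e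
    using zv[OF that] MV FE(5)[OF that] by auto
  have injz: "e = f" if "e \<in> E" "f \<in> E" "v \<in> e" "v \<in> f" "\<zeta> e = \<zeta> f" for e f
  proof (rule ccontr)
    assume "e \<noteq> f"
    have "\<psi> (\<zeta> e) \<in> A e \<inter> A f" using zB[of e] zB[of f] FE(3)[of e] FE(3)[of f] that by auto
    then show False using drawnD(5)[OF D that(1,2) \<open>e \<noteq> f\<close>] zV[of e] that by auto
  qed
  have Bs: "B e \<inter> s e = {\<psi> (\<zeta> e)}" if "e \<in> E" "v \<in> e" for e
    using FE(5)[OF that] sM[OF that] zs[of e] zB[OF that] by auto
  have Bs': "B e \<inter> s f = {}" if "e \<in> E" "f \<in> E" "v \<in> e" "v \<in> f" "e \<noteq> f" for e f
  proof (rule ccontr)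
    assume "B e \<inter> s f \<noteq> {}"
    then obtain p where p: "p \<in> B e" "p \<in> s f" by auto
    then have "p = \<psi> (\<zeta> e)" using FE(5)[of e] sM[of f] that by auto
    then have "\<zeta> e \<in> closed_segment 0 (\<zeta> f)" using p(2) inj unfolding s_def by (auto dest: injD)
    then have "\<zeta> e = \<zeta> f" using closed_segment_0_unit FE(2) that by simp
    then show False using injz that by blast
  qed
  have ss: "s e \<inter> s f \<subseteq> V" if "e \<in> E" "f \<in> E" "v \<in> e" "v \<in> f" "e \<noteq> f" for e f
  proof
    fix p assume "p \<in> s e \<inter> s f"
    then obtain x where x: "p = \<psi> x" "x \<in> closed_segment 0 (\<zeta> e)" "x \<in> closed_segment 0 (\<zeta> f)"
      using inj unfolding s_def by (auto dest: injD)
    have "x = 0"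
    proof (rule ccontr)
      assume "x \<noteq> 0"
      then have "\<zeta> e \<in> closed_segment 0 (\<zeta> f)"
        using closed_segment_0_overlap[OF x(2,3)] FE(2) that by simp
      then have "\<zeta> e = \<zeta> f" using closed_segment_0_unit FE(2) that by simp
      then show False using injz that by blast
    qed
    then show "p \<in> V" using x v \<psi>v by simp
  qed
  have D': "drawn S V E A'"
    unfolding drawn_def
  proof (intro conjI ballI impI)
    fix e assume e: "e \<in> E"
    show "arc_set S (A' e) e"
    proof (cases "v \<in> e")
      case True
      have "arc_set S (s e) {\<psi> (\<zeta> e), \<psi> 0}"
        unfolding s_def using arc_set_chart_segment[OF \<psi>, of 0 "\<zeta> e"] FE(2)[OF e True]
        by (metis insert_commute norm_zero zero_neq_one)
      then have "arc_set S (B e \<union> s e) {u e, \<psi> 0}"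
        using arc_set_Un[OF FE(4)[OF e True]] Bs[OF e True] by blast
      then show ?thesis using True FE(1)[OF e True] \<psi>v unfolding A'_def by simp
    qed (use drawnD(3)[OF D e] in \<open>simp add: A'_def\<close>)
    show "A' e \<inter> V = e"
    proof (cases "v \<in> e")
      case True
      have "B e \<inter> V \<subseteq> {u e}"
        using FE(1,3)[OF e True] drawnD(4)[OF D e] vB[OF e True] by auto
      moreover have "u e \<in> B e" using arc_set_ends(2)[OF FE(4)[OF e True]] .
      moreover have "u e \<in> V" using FE(1)[OF e True] drawnD(7)[OF D e] by auto
      ultimately have "B e \<inter> V = {u e}" by auto
      moreover have "v \<in> s e" unfolding s_def using \<psi>v by (intro image_eqI[of _ _ 0]) auto
      then have "s e \<inter> V = {v}" using sM[OF e True] MV v by auto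
      ultimately have "(B e \<union> s e) \<inter> V = {u e, v}" by (simp add: Int_Un_distrib2 insert_commute)
      then show ?thesis using FE(1)[OF e True] True unfolding A'_def by simp
    qed (use drawnD(4)[OF D e] in \<open>simp add: A'_def\<close>)
    fix f assume f: "f \<in> E" "e \<noteq> f"
    have AA: "A e \<inter> A f \<subseteq> V" using drawnD(5)[OF D e f] .
    show "A' e \<inter> A' f \<subseteq> V"
    proof (cases "v \<in> e")
      case ve: True
      show ?thesis
      proof (cases "v \<in> f")
        case True
        have "B e \<inter> B f \<subseteq> V" using FE(3)[OF e ve] FE(3)[OF f(1) True] AA by auto
        moreover have "B e \<inter> s f = {}" "B f \<inter> s e = {}"
          using Bs'[of e f] Bs'[of f e] e f ve True by auto
        moreover have "s e \<inter> s f \<subseteq> V" using ss[of e f] e f ve True by simp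
        ultimately show ?thesis unfolding A'_def using ve True by auto
      next
        case False
        then show ?thesis unfolding A'_def
          using ve FE(3)[OF e ve] AA sM[OF e ve] AM[OF f(1) False] by auto
      qed
    next
      case ve: False
      show ?thesis
      proof (cases "v \<in> f")
        case True
        then show ?thesis unfolding A'_def
          using ve FE(3)[OF f(1) True] AA sM[OF f(1) True] AM[OF e ve] by auto
      next
        case False
        then show ?thesis using ve AA unfolding A'_def by simp
      qed
    qed
  qed (use drawnD(1,2)[OF D] in auto)
  show ?thesis
  proof (rule that[of A' \<psi> \<zeta>])
    show "A' e = A e \<and> A e \<inter> \<psi> ` cball 0 1 = {}" if "e \<in> E" "v \<notin> e" for e
      using AM[OF that] that unfolding A'_def M_def by simp
    show "cmod (\<zeta> e) = 1 \<and> A' e \<inter> \<psi> ` cball 0 1 = \<psi> ` closed_segment 0 (\<zeta> e)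
        \<and> A' e \<subseteq> A e \<union> \<psi> ` cball 0 1" if "e \<in> E" "v \<in> e" for e
    proof -
      have "A' e \<inter> M = s e"
        using BM[OF that] sM[OF that] zs[of e] that unfolding A'_def by auto
      moreover have "A' e \<subseteq> A e \<union> M" using FE(3)[OF that] sM[OF that] that unfolding A'_def by auto
      ultimately show ?thesis using FE(2)[OF that] unfolding M_def s_def by simp
    qed
  qed (use D' \<psi> \<psi>v MWL MV injz in \<open>auto simp: M_def\<close>)
qed

text \<open>The arc of the edge may be wild and need not lie in a single chart, so it is replaced by
  a path \<open>K = G \<union> Y\<close> of two straight pieces from \<open>v\<close> to
  \<open>w\<close> that avoids the rest of the drawing. Collapsing first \<open>Y\<close> and then
  \<open>G\<close> to their common point \<open>y\<close> contracts the edge, and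
  \<open>drawn_collapse\<close> transfers the remaining arcs.\<close>

lemma drawn_contract:
  assumes S: "surface S" and D: "drawn S V E A" and vw: "{v, w} \<in> E"
  obtains c A' where "c v = c w"
    "\<And>a b. a \<in> V \<Longrightarrow> b \<in> V \<Longrightarrow> c a = c b \<Longrightarrow> a = b \<or> {a, b} = {v, w}"
    "drawn S (c ` V) ((`) c ` (E - {{v, w}})) A'"
proof -
  have HS: "Hausdorff_space S" using S unfolding surface_def by blast
  have v: "v \<in> V" and w: "w \<in> V" using drawnD(7)[OF D vw] by auto
  have neq: "v \<noteq> w" using arc_set_ends(1)[OF drawnD(3)[OF D vw]] .
  have VS: "V \<subseteq> topspace S" using drawnD(2)[OF D] .
  have wS: "w \<in> topspace S" using w VS by blast
  obtain A1 \<psi>w \<xi> where D1: "drawn S V E A1" and \<psi>w: "chart S \<psi>w" "\<psi>w 0 = w"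
    and MwV: "\<psi>w ` cball 0 1 \<inter> V = {w}"
    and away1: "\<And>e. e \<in> E \<Longrightarrow> w \<notin> e \<Longrightarrow> A1 e = A e \<and> A e \<inter> \<psi>w ` cball 0 1 = {}"
    and rad1: "\<And>e. e \<in> E \<Longrightarrow> w \<in> e \<Longrightarrow> cmod (\<xi> e) = 1 \<and> A1 e \<inter> \<psi>w ` cball 0 1 = \<psi>w ` closed_segment 0 (\<xi> e)
        \<and> A1 e \<subseteq> A e \<union> \<psi>w ` cball 0 1"
    by (rule radialise[OF S D w openin_topspace wS]) blast
  define Mw where "Mw = \<psi>w ` cball 0 1"
  have injw: "inj \<psi>w" by (rule chartD(2)[OF \<psi>w(1)])
  have clMw: "closedin S Mw" unfolding Mw_def by (rule chart_closedin_image[OF \<psi>w(1) HS compact_cball])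
  have "v \<notin> Mw" using MwV v neq unfolding Mw_def by auto
  have opMw: "openin S (topspace S - Mw)" "v \<in> topspace S - Mw"
    using clMw \<open>v \<notin> Mw\<close> v VS by auto
  obtain A2 \<psi>v \<zeta> where D2: "drawn S V E A2" and \<psi>v: "chart S \<psi>v" "\<psi>v 0 = v"
    and MvW: "\<psi>v ` cball 0 1 \<subseteq> topspace S - Mw"
    and MvV: "\<psi>v ` cball 0 1 \<inter> V = {v}"
    and away2: "\<And>e. e \<in> E \<Longrightarrow> v \<notin> e \<Longrightarrow> A2 e = A1 e \<and> A1 e \<inter> \<psi>v ` cball 0 1 = {}"
    and rad2: "\<And>e. e \<in> E \<Longrightarrow> v \<in> e \<Longrightarrow> cmod (\<zeta> e) = 1 \<and> A2 e \<inter> \<psi>v ` cball 0 1 = \<psi>v ` closed_segment 0 (\<zeta> e)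
        \<and> A2 e \<subseteq> A1 e \<union> \<psi>v ` cball 0 1"
    by (rule radialise[OF S D1 v opMw]) blast
  define E' where "E' = E - {{v, w}}"
  define e0 where "e0 = {v, w}"
  have e0: "e0 \<in> E" "v \<in> e0" "w \<in> e0" using vw by (auto simp: e0_def)
  have arc0: "arc_set S (A2 e0) {v, w}" using drawnD(3)[OF D2 e0(1)] unfolding e0_def .
  define X where "X = V \<union> (\<Union>e\<in>E'. A2 e)"
  have "closedin S X"
    unfolding X_def
  proof (intro closedin_Un closedin_Union)
    show "closedin S V"
      using drawnD(1,2)[OF D] HS by (metis Hausdorff_imp_t1_space t1_space_closedin_finite)
    show "finite (A2 ` E')" using drawnD(6)[OF D] by (simp add: E'_def)
    show "closedin S T" if "T \<in> A2 ` E'" for T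
      using that arc_set_closedin[OF HS drawnD(3)[OF D2]] by (auto simp: E'_def)
  qed
  then have opX: "openin S (topspace S - X)" by blast
  obtain \<alpha> where \<alpha>: "pathin S \<alpha>" "inj_on \<alpha> {0..1}" "\<alpha> ` {0..1} = A2 e0" "\<alpha> 0 = v" "\<alpha> 1 = w"
    using arc_set_param[OF arc0] .
  define C where "C = \<alpha> ` {0<..<1}"
  have C1: "connectedin S C"
  proof -
    have "connectedin (top_of_set {0..1::real}) {0<..<1}" by (auto simp: connectedin_subtopology)
    then show ?thesis unfolding C_def using \<alpha>(1) connectedin_continuous_map_image unfolding pathin_def by blast
  qed
  have C2: "C = A2 e0 - {v, w}"
  proof -
    have "\<alpha> ` ({0..1} - {0, 1}) = \<alpha> ` {0..1} - \<alpha> ` {0, 1}"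
      using \<alpha>(2) by (intro inj_on_image_set_diff) auto
    moreover have "{0..1} - {0, 1::real} = {0<..<1}" by auto
    ultimately show ?thesis using \<alpha> unfolding C_def by simp
  qed
  have A0V: "p = v \<or> p = w" if "p \<in> A2 e0" "p \<in> V" for p
  proof -
    have "p \<in> A2 e0 \<inter> V" using that by simp
    then show ?thesis using drawnD(4)[OF D2 e0(1)] unfolding e0_def by simp
  qed
  have CX: "C \<subseteq> topspace S - X"
  proof
    fix p assume p: "p \<in> C"
    have pV: "p \<notin> V" using p A0V unfolding C2 by blast
    moreover have "p \<notin> A2 e" if "e \<in> E'" for e
    proof
      assume "p \<in> A2 e"
      then have "p \<in> V" using drawnD(5)[OF D2 e0(1), of e] that p unfolding E'_def C2 e0_def by auto
      then show False using pV by simp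
    qed
    moreover have "p \<in> topspace S" using p drawnD(8)[OF D2 e0(1)] unfolding C2 by blast
    ultimately show "p \<in> topspace S - X" unfolding X_def by blast
  qed
  define z1 where "z1 = \<zeta> e0"
  have z1: "cmod z1 = 1" using rad2[OF e0(1,2)] by (simp add: z1_def)
  have segC: "\<psi>v (of_real t * z1) \<in> C" if "0 < t" "t \<le> 1" for t
  proof -
    have "of_real t * z1 \<in> closed_segment 0 z1" using that unfolding closed_segment_0_iff by (intro exI[of _ t]) auto
    then have "\<psi>v (of_real t * z1) \<in> A2 e0 \<inter> \<psi>v ` cball 0 1"
      using rad2[OF e0(1,2)] unfolding z1_def by blast
    moreover have "\<psi>v (of_real t * z1) \<noteq> v"
    proof
      assume "\<psi>v (of_real t * z1) = v"
      then have "of_real t * z1 = 0" using \<psi>v chartD(2)[OF \<psi>v(1)] by (metis injD)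
      then show False using that z1 by auto
    qed
    moreover have "w \<notin> \<psi>v ` cball 0 1"
    proof
      assume "w \<in> \<psi>v ` cball 0 1"
      then have "w \<in> \<psi>v ` cball 0 1 \<inter> V" using w by simp
      then show False using MvV neq by simp
    qed
    ultimately show ?thesis unfolding C2 by blast
  qed
  have "openin S (\<psi>w ` ball 0 1)" by (rule chartD(4)[OF \<psi>w(1)]) auto
  moreover have "w \<in> \<psi>w ` ball 0 1" using \<psi>w(2) by (intro image_eqI[of _ _ 0]) auto
  moreover have "arc_set S (A2 e0) {w, v}" using arc0 by (simp add: insert_commute)
  ultimately obtain q where q: "q \<in> C" "q \<in> Mw"
  proof -
    assume op: "openin S (\<psi>w ` ball 0 1)" and win: "w \<in> \<psi>w ` ball 0 1" and "arc_set S (A2 e0) {w, v}"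
      and th: "\<And>q. q \<in> C \<Longrightarrow> q \<in> Mw \<Longrightarrow> thesis"
    then obtain \<beta> where \<beta>: "pathin S \<beta>" "inj_on \<beta> {0..1}" "\<beta> ` {0..1} = A2 e0" "\<beta> 0 = w" "\<beta> 1 = v"
      by (metis arc_set_param)
    obtain t where t: "0 < t" "t < 1" "\<beta> t \<in> \<psi>w ` ball 0 1"
      using pathin_near_start[OF \<beta>(1) op] \<beta>(4) win by metis
    have "\<beta> t \<noteq> w" "\<beta> t \<noteq> v" using inj_onD[OF \<beta>(2), of t 0] inj_onD[OF \<beta>(2), of t 1] t \<beta>(4,5) by auto
    moreover have "\<beta> t \<in> \<beta> ` {0..1}" using t by (intro imageI) auto
    ultimately have "\<beta> t \<in> C" unfolding C2 using \<beta>(3) by blast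
    moreover have "\<psi>w ` ball 0 1 \<subseteq> Mw" unfolding Mw_def by (rule image_mono) auto
    ultimately show thesis using th t(3) by blast
  qed
  have p1: "\<psi>v z1 \<in> C" using segC[of 1] by simp
  \<comment> \<open>Slides the outer end of the radius at \<open>v\<close> along the open edge into
    the disc around \<open>w\<close>; all vertices and all other arcs lie in \<open>X\<close> and
    stay fixed.\<close>
  obtain h h' where h: "homeomorphic_maps S S h h'" "\<And>x. x \<notin> topspace S - X \<Longrightarrow> h x = x" "h (\<psi>v z1) = q"
    by (rule surface_homogeneous[OF S opX C1 CX p1 q(1)]) blast
  define \<psi> where "\<psi> z = (h \<circ> \<psi>v) (z1 * z)" for z
  have "chart S (h \<circ> \<psi>v)" by (rule chart_homeomorphic[OF \<psi>v(1) h(1)])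
  then have \<psi>: "chart S \<psi>" unfolding \<psi>_def using chart_scale[of S "h \<circ> \<psi>v" z1] z1 by force
  have inj: "inj \<psi>" by (rule chartD(2)[OF \<psi>])
  have vX: "v \<in> X" and wX: "w \<in> X" using v w unfolding X_def by auto
  have \<psi>0: "\<psi> 0 = v" using h(2)[of v] vX \<psi>v(2) by (simp add: \<psi>_def)
  have \<psi>1: "\<psi> 1 = q" using h(3) by (simp add: \<psi>_def)
  have \<psi>X: "\<psi> (of_real t) \<notin> X" if "0 < t" "t \<le> 1" for t
  proof
    assume bad: "\<psi> (of_real t) \<in> X"
    let ?y = "\<psi>v (of_real t * z1)"
    have y: "?y \<in> topspace S - X" using segC[OF that] CX by blast
    have hy: "h ?y \<in> X" using bad by (simp add: \<psi>_def mult.commute)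
    then have hh: "h (h ?y) = h ?y" using h(2) by blast
    have hi: "h' (h x) = x" if "x \<in> topspace S" for x using h(1) that unfolding homeomorphic_maps_def by blast
    have "h ?y \<in> topspace S" using chartD(3)[OF \<psi>, of "of_real t"] by (simp add: \<psi>_def mult.commute)
    then have "h ?y = ?y" using hi[of ?y] hi[of "h ?y"] hh y by auto
    then show False using hy y by auto
  qed
  \<comment> \<open>The dragged radius is followed only until it first enters the disc around
    \<open>w\<close>; from there a straight segment of that disc leads on to
    \<open>w\<close>.\<close>
  have "closed (complex_of_real -` (\<psi> -` Mw))"
    by (intro closed_vimage chart_closed_vimage[OF \<psi> clMw] continuous_intros)
  then obtain s where s: "0 < s" "s \<le> 1" "\<psi> (of_real s) \<in> Mw"
    and before: "\<And>t. 0 \<le> t \<Longrightarrow> t < s \<Longrightarrow> \<psi> (of_real t) \<notin> Mw"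
    by (rule first_hit[of _ 1]) (use \<psi>0 \<psi>1 q \<open>v \<notin> Mw\<close> in auto)
  obtain \<eta> where \<eta>: "cmod \<eta> \<le> 1" "\<psi> (of_real s) = \<psi>w \<eta>" using s(3) unfolding Mw_def by auto
  define y where "y = \<psi> (of_real s)"
  have yX: "y \<notin> X" unfolding y_def using \<psi>X s by simp
  have \<eta>0: "\<eta> \<noteq> 0" using yX wX \<eta>(2) \<psi>w(2) unfolding y_def by auto
  define G where "G = \<psi> ` closed_segment 0 (of_real s)"
  define Y where "Y = \<psi>w ` closed_segment 0 \<eta>"
  obtain c2 where c2: "continuous_map S S c2"
    "\<And>x. 0 \<le> x \<Longrightarrow> x \<le> 1 \<Longrightarrow> c2 (\<psi>w (of_real x * \<eta>)) = \<psi>w \<eta>"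
    "\<And>p q. c2 p = c2 q \<Longrightarrow> p \<notin> Y \<Longrightarrow> p = q"
    "\<And>p. p \<notin> \<psi>w ` ball 0 (cmod \<eta>) \<Longrightarrow> c2 p = p"
    using chart_collapse[OF \<psi>w(1) HS \<eta>0] unfolding Y_def by metis
  obtain c1 where c1: "continuous_map S S c1"
    "\<And>x. 0 \<le> x \<Longrightarrow> x \<le> 1 \<Longrightarrow> c1 (\<psi> (of_real x * of_real s)) = \<psi> (of_real s)"
    "\<And>p q. c1 p = c1 q \<Longrightarrow> p \<notin> G \<Longrightarrow> p = q"
    using chart_collapse[OF \<psi> HS, of "of_real s"] s(1) unfolding G_def by (metis of_real_eq_0_iff less_irrefl)
  define c where "c = c1 \<circ> c2"
  define K where "K = G \<union> Y"
  have yY: "y \<in> Y" unfolding Y_def y_def \<eta>(2) by (rule imageI) simp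
  have ballM: "\<psi>w ` ball 0 (cmod \<eta>) \<subseteq> Mw" unfolding Mw_def by (rule image_mono) (use \<eta>(1) in auto)
  have Gmem: "\<exists>t. 0 \<le> t \<and> t \<le> s \<and> p = \<psi> (of_real t)" if pG: "p \<in> G" for p
  proof -
    obtain t where "0 \<le> t" "t \<le> 1" "p = \<psi> (of_real t * of_real s)"
      using pG unfolding G_def by (metis imageE closed_segment_0_iff)
    then show ?thesis using s(1) by (intro exI[of _ "t * s"]) (auto intro: mult_left_le_one_le)
  qed
  have GM: "p = y" if pG: "p \<in> G" and pM: "p \<in> Mw" for p
  proof -
    obtain t where t: "0 \<le> t" "t \<le> s" "p = \<psi> (of_real t)" using Gmem[OF pG] by blast
    then have "t = s" using before[of t] pM by force
    then show ?thesis using t by (simp add: y_def)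
  qed
  have GX: "p = v" if pG: "p \<in> G" and pX: "p \<in> X" for p
  proof -
    obtain t where t: "0 \<le> t" "t \<le> s" "p = \<psi> (of_real t)" using Gmem[OF pG] by blast
    then have "t = 0" using \<psi>X[of t] pX s by force
    then show ?thesis using t \<psi>0 by simp
  qed
  have c2y: "c2 y = y" using c2(2)[of 1] \<eta>(2) by (simp add: y_def)
  \<comment> \<open>\<open>c2\<close> moves points inside the disc around \<open>w\<close> only, and
    \<open>G\<close> meets that disc only in \<open>y\<close>, which \<open>c2\<close> fixes. So no
    point outside \<open>K\<close> is sent into \<open>G\<close>.\<close>
  have preG: "p \<in> K" if "c2 p \<in> G" for p
  proof (rule ccontr)
    assume n: "p \<notin> K"
    then have pY: "p \<notin> Y" and pG: "p \<notin> G" unfolding K_def by auto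
    have pb: "p \<in> \<psi>w ` ball 0 (cmod \<eta>)" using c2(4)[of p] that pG by metis
    have "c2 (c2 p) = c2 p"
    proof (cases "c2 p = y")
      case True then show ?thesis using c2y by simp
    next
      case False
      then have "c2 p \<notin> Mw" using GM that by blast
      then show ?thesis using c2(4)[of "c2 p"] ballM by blast
    qed
    then have "p = c2 p" using c2(3)[of p "c2 p"] pY by simp
    then show False using that pG by simp
  qed
  have cK: "p \<in> K \<and> q \<in> K" if "c p = c q" "p \<noteq> q" for p q
  proof (cases "c2 p = c2 q")
    case True
    then show ?thesis using c2(3)[of p q] c2(3)[of q p] that unfolding K_def by auto
  next
    case False
    then have "c2 p \<in> G" "c2 q \<in> G" using c1(3)[of "c2 p" "c2 q"] c1(3)[of "c2 q" "c2 p"] that unfolding c_def by auto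
    then show ?thesis using preG by blast
  qed
  \<comment> \<open>In the disc around \<open>w\<close> all arcs are radii. If \<open>Y\<close> met
    the radius of another edge outside the centre, then \<open>y\<close> would lie on that radius
    too, hence in \<open>X\<close>.\<close>
  have YX: "p = w" if pY: "p \<in> Y" and pX: "p \<in> X" for p
  proof (rule ccontr)
    assume pw: "p \<noteq> w"
    obtain x where x: "p = \<psi>w x" "x \<in> closed_segment 0 \<eta>" using pY unfolding Y_def by auto
    have x0: "x \<noteq> 0" using x pw \<psi>w(2) by auto
    have pM: "p \<in> Mw" using x closed_segment_0_subset_cball[OF \<eta>(1)] unfolding Mw_def by blast
    have "p \<notin> V"
    proof
      assume "p \<in> V"
      then have "p \<in> \<psi>w ` cball 0 1 \<inter> V" using pM unfolding Mw_def by simp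
      then show False using MwV pw by simp
    qed
    then obtain e where e: "e \<in> E'" "p \<in> A2 e" using pX unfolding X_def by auto
    have eE: "e \<in> E" "e \<noteq> {v, w}" using e(1) unfolding E'_def by auto
    have pMv: "p \<notin> \<psi>v ` cball 0 1" using MvW pM by blast
    have pA1: "p \<in> A1 e"
    proof (cases "v \<in> e")
      case True then show ?thesis using rad2[OF eE(1) True] e(2) pMv by blast
    next
      case False then show ?thesis using away2[OF eE(1) False] e(2) by simp
    qed
    have we: "w \<in> e"
    proof (rule ccontr)
      assume "w \<notin> e"
      then have "A1 e \<inter> Mw = {}" using away1[OF eE(1)] unfolding Mw_def by simp
      then show False using pA1 pM by blast
    qed
    have ve: "v \<notin> e"
    proof
      assume "v \<in> e"
      moreover obtain a b where "e = {a, b}" using drawnD(3)[OF D eE(1)] unfolding arc_set_def by blast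
      ultimately have "e = {v, w}" using we neq by auto
      then show False using eE by simp
    qed
    have "p \<in> A1 e \<inter> \<psi>w ` cball 0 1" using pA1 pM unfolding Mw_def by simp
    then have "p \<in> \<psi>w ` closed_segment 0 (\<xi> e)" using rad1[OF eE(1) we] by simp
    then have "x \<in> closed_segment 0 (\<xi> e)" using x(1) injw by (auto dest: injD)
    then have "\<eta> \<in> closed_segment 0 (\<xi> e)"
      using closed_segment_0_overlap[OF x(2)] x0 rad1[OF eE(1) we] \<eta>(1) by simp
    then have "y \<in> \<psi>w ` closed_segment 0 (\<xi> e)" unfolding y_def \<eta>(2) by (rule imageI)
    then have "y \<in> A1 e" using rad1[OF eE(1) we] by blast
    then have "y \<in> X" using away2[OF eE(1) ve] e(1) unfolding X_def by auto
    then show False using yX by simp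
  qed
  have KX: "p = v \<or> p = w" if "p \<in> K" "p \<in> X" for p
    using that GX YX unfolding K_def by blast
  have DE': "drawn S V E' A2" by (rule drawn_subset[OF D2]) (use drawnD(7)[OF D2] in \<open>auto simp: E'_def\<close>)
  have contc: "continuous_map S S c" unfolding c_def using c1(1) c2(1) by (rule continuous_map_compose[rotated])
  have "\<exists>A'. drawn S (c ` V) ((`) c ` E') A'"
  proof (rule drawn_collapse[OF DE' contc cK])
    fix f assume f: "f \<in> E'"
    show "A2 f \<inter> K \<subseteq> V"
    proof
      fix p assume "p \<in> A2 f \<inter> K"
      then have "p = v \<or> p = w" using KX[of p] f unfolding X_def by auto
      then show "p \<in> V" using v w by auto
    qed
    fix a b assume ab: "a \<in> f" "b \<in> f" "a \<in> K" "b \<in> K"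
    have fV: "f \<subseteq> V" using drawnD(7)[OF DE' f] .
    have "a \<in> {v, w}" "b \<in> {v, w}" using KX[of a] KX[of b] ab fV unfolding X_def by auto
    moreover obtain x y where xy: "f = {x, y}" using drawnD(3)[OF DE' f] unfolding arc_set_def by blast
    moreover have "f \<noteq> {v, w}" using f unfolding E'_def by simp
    ultimately show "a = b" using ab by auto
  qed auto
  then obtain A' where A': "drawn S (c ` V) ((`) c ` E') A'" by blast
  show ?thesis
  proof (rule that[of c A'])
    have "c2 v = v" using c2(4)[of v] ballM \<open>v \<notin> Mw\<close> by blast
    moreover have "c1 v = y" using c1(2)[of 0] \<psi>0 by (simp add: y_def)
    moreover have "c2 w = y" using c2(2)[of 0] \<psi>w(2) \<eta>(2) by (simp add: y_def)
    moreover have "c1 y = y" using c1(2)[of 1] by (simp add: y_def)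
    ultimately show "c v = c w" by (simp add: c_def)
    show "a = b \<or> {a, b} = {v, w}" if "a \<in> V" "b \<in> V" "c a = c b" for a b
    proof (rule disjCI)
      assume n: "{a, b} \<noteq> {v, w}"
      show "a = b"
      proof (rule ccontr)
        assume "a \<noteq> b"
        then have "a \<in> K" "b \<in> K" using cK[OF that(3)] by auto
        then have "a \<in> {v, w}" "b \<in> {v, w}" using KX[of a] KX[of b] that unfolding X_def by auto
        then show False using n \<open>a \<noteq> b\<close> by auto
      qed
    qed
    show "drawn S (c ` V) ((`) c ` (E - {{v, w}})) A'" using A' unfolding E'_def .
  qed
qed

section \<open>Embeddable graphs\<close>

lemma embeddable_drawn:
  assumes G: "simple_graph G" and emb: "embeddable G S"
  obtains \<phi> A where "inj_on \<phi> (verts G)" "drawn S (\<phi> ` verts G) ((`) \<phi> ` edges G) A"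
proof -
  obtain \<phi> \<alpha> where inj: "inj_on \<phi> (verts G)" and top: "\<phi> ` verts G \<subseteq> topspace S"
    and e1: "\<And>e. e \<in> edges G \<Longrightarrow> pathin S (\<alpha> e) \<and> inj_on (\<alpha> e) {0..1} \<and>
            {\<alpha> e 0, \<alpha> e 1} = \<phi> ` e \<and> \<alpha> e ` {0<..<1} \<inter> \<phi> ` verts G = {}"
    and e2: "\<And>e f. e \<in> edges G \<Longrightarrow> f \<in> edges G \<Longrightarrow> e \<noteq> f \<Longrightarrow> \<alpha> e ` {0<..<1} \<inter> \<alpha> f ` {0<..<1} = {}"
    using emb unfolding embeddable_def by metis
  have EV: "edges G \<subseteq> Pow (verts G)" using G unfolding simple_graph_def by auto
  have injE: "inj_on ((`) \<phi>) (edges G)"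
    using inj_on_image_Pow[OF inj] EV by (rule inj_on_subset)
  define A where "A f = \<alpha> (inv_into (edges G) ((`) \<phi>) f) ` {0..1}" for f
  have A: "A (\<phi> ` e) = \<alpha> e ` {0..1}" if "e \<in> edges G" for e
    unfolding A_def using inv_into_f_f[OF injE that] by simp
  have split: "p \<in> \<phi> ` e \<or> p \<in> \<alpha> e ` {0<..<1}" if e: "e \<in> edges G" and p: "p \<in> \<alpha> e ` {0..1}" for e p
  proof -
    obtain t where t: "t \<in> {0..1}" "p = \<alpha> e t" using p by blast
    have "\<alpha> e 0 \<in> \<phi> ` e" "\<alpha> e 1 \<in> \<phi> ` e" using e1[OF e] by (metis insertCI)+
    moreover have "t = 0 \<or> t = 1 \<or> t \<in> {0<..<1}" using t(1) by auto
    ultimately show ?thesis using t(2) by blast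
  qed
  have eV: "\<phi> ` e \<subseteq> \<phi> ` verts G" if "e \<in> edges G" for e using EV that by blast
  have "drawn S (\<phi> ` verts G) ((`) \<phi> ` edges G) A"
    unfolding drawn_def
  proof (intro conjI ballI impI)
    show "finite (\<phi> ` verts G)" using G unfolding simple_graph_def by simp
    fix f assume "f \<in> (`) \<phi> ` edges G"
    then obtain e where e: "e \<in> edges G" "f = \<phi> ` e" by blast
    show "arc_set S (A f) f" unfolding e(2) A[OF e(1)] arc_set_def
      by (intro exI[of _ "\<alpha> e"]) (use e1[OF e(1)] in simp)
    have dis: "\<alpha> e ` {0<..<1} \<inter> \<phi> ` verts G = {}" using e1[OF e(1)] by simp
    show "A f \<inter> \<phi> ` verts G = f"
    proof
      show "A f \<inter> \<phi> ` verts G \<subseteq> f"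
        unfolding e(2) A[OF e(1)] using split[OF e(1)] dis by blast
      have "\<alpha> e 0 \<in> \<alpha> e ` {0..1}" "\<alpha> e 1 \<in> \<alpha> e ` {0..1}" by auto
      then have "{\<alpha> e 0, \<alpha> e 1} \<subseteq> \<alpha> e ` {0..1}" by blast
      then have "f \<subseteq> A f" unfolding e(2) A[OF e(1)] using e1[OF e(1)] by simp
      then show "f \<subseteq> A f \<inter> \<phi> ` verts G" using eV[OF e(1)] e(2) by blast
    qed
    fix g assume "g \<in> (`) \<phi> ` edges G" and fg: "f \<noteq> g"
    then obtain e' where e': "e' \<in> edges G" "g = \<phi> ` e'" by blast
    have "e \<noteq> e'" using fg e e' by blast
    show "A f \<inter> A g \<subseteq> \<phi> ` verts G"
    proof
      fix p assume p: "p \<in> A f \<inter> A g"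
      then have "p \<in> \<phi> ` e \<or> p \<in> \<alpha> e ` {0<..<1}" "p \<in> \<phi> ` e' \<or> p \<in> \<alpha> e' ` {0<..<1}"
        using split e e' A by auto
      then show "p \<in> \<phi> ` verts G" using e2[OF e(1) e'(1) \<open>e \<noteq> e'\<close>] eV[OF e(1)] eV[OF e'(1)] by blast
    qed
  qed (rule top)
  then show ?thesis using that inj by blast
qed

text \<open>\<open>T\<close> may be any subgraph of the drawing, so deletions of vertices and edges
  come along with each redrawing.\<close>

lemma drawn_embeddable:
  assumes D: "drawn S V E A" and T: "simple_graph T" and inj: "inj_on \<phi> (verts T)"
    and V: "\<phi> ` verts T \<subseteq> V" and E: "\<And>e. e \<in> edges T \<Longrightarrow> \<phi> ` e \<in> E"
  shows "embeddable T S"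
proof -
  have EV: "edges T \<subseteq> Pow (verts T)" using T unfolding simple_graph_def by auto
  have ex: "\<exists>\<beta>. pathin S \<beta> \<and> inj_on \<beta> {0..1} \<and> \<beta> ` {0..1} = A (\<phi> ` e) \<and> {\<beta> 0, \<beta> 1} = \<phi> ` e"
    if "e \<in> edges T" for e
    using drawnD(3)[OF D E[OF that]] unfolding arc_set_def .
  then obtain \<alpha> where \<alpha>: "\<And>e. e \<in> edges T \<Longrightarrow> pathin S (\<alpha> e) \<and> inj_on (\<alpha> e) {0..1} \<and>
      \<alpha> e ` {0..1} = A (\<phi> ` e) \<and> {\<alpha> e 0, \<alpha> e 1} = \<phi> ` e"
    by metis
  have inter: "p \<notin> V" if e: "e \<in> edges T" and p: "p \<in> \<alpha> e ` {0<..<1}" for e p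
  proof
    assume pV: "p \<in> V"
    obtain t where t: "0 < t" "t < 1" "p = \<alpha> e t" using p by auto
    have "p \<in> \<alpha> e ` {0..1}" using t by (intro image_eqI[of _ _ t]) auto
    then have "p \<in> A (\<phi> ` e) \<inter> V" using \<alpha>[OF e] pV by simp
    then have "p \<in> {\<alpha> e 0, \<alpha> e 1}" using drawnD(4)[OF D E[OF e]] \<alpha>[OF e] by simp
    then have "\<alpha> e t = \<alpha> e 0 \<or> \<alpha> e t = \<alpha> e 1" using t by simp
    moreover have "inj_on (\<alpha> e) {0..1}" using \<alpha>[OF e] by simp
    ultimately show False using t inj_onD[of "\<alpha> e" "{0..1}" t 0] inj_onD[of "\<alpha> e" "{0..1}" t 1] by auto
  qed
  show ?thesis unfolding embeddable_def
  proof (intro exI[of _ \<phi>] exI[of _ \<alpha>] conjI ballI impI)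
    show "inj_on \<phi> (verts T)" by (rule inj)
    show "\<phi> ` verts T \<subseteq> topspace S" using V drawnD(2)[OF D] by blast
    fix e assume e: "e \<in> edges T"
    show "pathin S (\<alpha> e)" "inj_on (\<alpha> e) {0..1}" "{\<alpha> e 0, \<alpha> e 1} = \<phi> ` e" using \<alpha>[OF e] by simp_all
    show "\<alpha> e ` {0<..<1} \<inter> \<phi> ` verts T = {}" using inter[OF e] V by blast
    fix f assume f: "f \<in> edges T" "e \<noteq> f"
    have "\<phi> ` e \<noteq> \<phi> ` f"
      using inj_on_image_eq_iff[OF inj, of e f] EV e f by blast
    then have "A (\<phi> ` e) \<inter> A (\<phi> ` f) \<subseteq> V" using drawnD(5)[OF D E[OF e] E[OF f(1)]] by blast
    moreover have "\<alpha> g ` {0<..<1} \<subseteq> A (\<phi> ` g)" if "g \<in> edges T" for g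
    proof -
      have "\<alpha> g ` {0<..<1} \<subseteq> \<alpha> g ` {0..1}" by (rule image_mono) auto
      then show ?thesis using \<alpha>[OF that] by simp
    qed
    ultimately show "\<alpha> e ` {0<..<1} \<inter> \<alpha> f ` {0<..<1} = {}" using inter[OF e] e f(1) by blast
  qed
qed

lemma embeddable_subgraph:
  assumes G: "simple_graph G" and emb: "embeddable G S" and T: "simple_graph T"
    and f: "inj_on f (verts G)" and V: "verts T \<subseteq> f ` verts G"
    and E: "\<And>e. e \<in> edges T \<Longrightarrow> \<exists>e'\<in>edges G. f ` e' = e"
  shows "embeddable T S"
proof -
  obtain \<phi> A where \<phi>: "inj_on \<phi> (verts G)" and D: "drawn S (\<phi> ` verts G) ((`) \<phi> ` edges G) A"
    using embeddable_drawn[OF G emb] .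
  define g where "g = inv_into (verts G) f"
  have gf: "g (f u) = u" if "u \<in> verts G" for u unfolding g_def using inv_into_f_f[OF f that] .
  have fg: "g t \<in> verts G" "f (g t) = t" if "t \<in> verts T" for t
    unfolding g_def using that V f_inv_into_f[of t f "verts G"] inv_into_into[of t f "verts G"] by blast+
  show ?thesis
  proof (rule drawn_embeddable[OF D T, of "\<phi> \<circ> g"])
    show "inj_on (\<phi> \<circ> g) (verts T)"
    proof (rule inj_onI)
      fix s t assume st: "s \<in> verts T" "t \<in> verts T" "(\<phi> \<circ> g) s = (\<phi> \<circ> g) t"
      then have "g s = g t" using inj_onD[OF \<phi>, of "g s" "g t"] fg(1) by simp
      then show "s = t" using fg(2) st by metis
    qed
    show "(\<phi> \<circ> g) ` verts T \<subseteq> \<phi> ` verts G" using fg(1) by auto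
    fix e assume "e \<in> edges T"
    then obtain e' where e': "e' \<in> edges G" "f ` e' = e" using E by blast
    have "e' \<subseteq> verts G" using e'(1) G unfolding simple_graph_def by blast
    then have "g ` e = e'" unfolding e'(2)[symmetric] image_image using gf by force
    then have "(\<phi> \<circ> g) ` e = \<phi> ` e'" by (metis image_comp)
    then show "(\<phi> \<circ> g) ` e \<in> (`) \<phi> ` edges G" using e'(1) by simp
  qed
qed

text \<open>\<open>f\<close> presents \<open>T\<close> as a subgraph of the contraction of the edge
  \<open>ab\<close>: it identifies only the ends of that edge, and every edge of \<open>T\<close>
  has a preimage. Later redrawings are given by such maps, often with a renaming of vertices hidden
  in them.\<close>

lemma embeddable_contract:
  assumes S: "surface S" and G: "simple_graph G" and emb: "embeddable G S" and T: "simple_graph T"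
    and ab: "{a, b} \<in> edges G" "f a = f b"
    and f: "\<And>u u'. u \<in> verts G \<Longrightarrow> u' \<in> verts G \<Longrightarrow> f u = f u' \<Longrightarrow> u = u' \<or> {u, u'} = {a, b}"
    and V: "verts T \<subseteq> f ` verts G"
    and E: "\<And>e. e \<in> edges T \<Longrightarrow> \<exists>e'\<in>edges G. f ` e' = e"
  shows "embeddable T S"
proof -
  obtain \<phi> A where \<phi>: "inj_on \<phi> (verts G)" and D: "drawn S (\<phi> ` verts G) ((`) \<phi> ` edges G) A"
    using embeddable_drawn[OF G emb] .
  have abV: "a \<in> verts G" "b \<in> verts G" using ab(1) G unfolding simple_graph_def by auto
  have "{\<phi> a, \<phi> b} \<in> (`) \<phi> ` edges G" using ab(1) by (metis image_empty image_eqI image_insert)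
  then obtain c A' where c: "c (\<phi> a) = c (\<phi> b)"
    "\<And>p q. p \<in> \<phi> ` verts G \<Longrightarrow> q \<in> \<phi> ` verts G \<Longrightarrow> c p = c q \<Longrightarrow> p = q \<or> {p, q} = {\<phi> a, \<phi> b}"
    and D': "drawn S (c ` \<phi> ` verts G) ((`) c ` ((`) \<phi> ` edges G - {{\<phi> a, \<phi> b}})) A'"
    by (rule drawn_contract[OF S D]) blast
  have cc: "u = u' \<or> {u, u'} = {a, b}" if "u \<in> verts G" "u' \<in> verts G" "c (\<phi> u) = c (\<phi> u')" for u u'
  proof -
    have "\<phi> u = \<phi> u' \<or> \<phi> ` {u, u'} = \<phi> ` {a, b}" using c(2)[of "\<phi> u" "\<phi> u'"] that by auto
    then show ?thesis
      using inj_onD[OF \<phi>, of u u'] inj_on_image_eq_iff[OF \<phi>, of "{u, u'}" "{a, b}"] that abV by auto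
  qed
  have pair: "c (\<phi> u) = c (\<phi> u')" if "{u, u'} = {a, b}" for u u'
    using that c(1) by (auto simp: doubleton_eq_iff)
  have pairf: "f u = f u'" if "{u, u'} = {a, b}" for u u'
    using that ab(2) by (auto simp: doubleton_eq_iff)
  \<comment> \<open>A representative for each vertex of \<open>T\<close>; either of \<open>a\<close>
    and \<open>b\<close> will do, because \<open>c\<close> identifies their points.\<close>
  define g where "g = inv_into (verts G) f"
  have fg: "g t \<in> verts G" "f (g t) = t" if "t \<in> verts T" for t
    unfolding g_def using that V f_inv_into_f[of t f "verts G"] inv_into_into[of t f "verts G"] by blast+
  have gf: "c (\<phi> (g (f u))) = c (\<phi> u)" if u: "u \<in> verts G" for u
  proof -
    have "g (f u) \<in> verts G" "f (g (f u)) = f u"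
      unfolding g_def using u f_inv_into_f[of "f u" f "verts G"] inv_into_into[of "f u" f "verts G"] by blast+
    then have "g (f u) = u \<or> {g (f u), u} = {a, b}" using f u by blast
    then show ?thesis using pair by metis
  qed
  show ?thesis
  proof (rule drawn_embeddable[OF D' T, of "\<lambda>t. c (\<phi> (g t))"])
    show "inj_on (\<lambda>t. c (\<phi> (g t))) (verts T)"
    proof (rule inj_onI)
      fix s t assume st: "s \<in> verts T" "t \<in> verts T" "c (\<phi> (g s)) = c (\<phi> (g t))"
      then have "g s = g t \<or> {g s, g t} = {a, b}" using cc fg(1) by blast
      then have "f (g s) = f (g t)" using pairf by metis
      then show "s = t" using fg(2) st by metis
    qed
    show "(\<lambda>t. c (\<phi> (g t))) ` verts T \<subseteq> c ` \<phi> ` verts G" using fg(1) by auto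
    fix e assume e: "e \<in> edges T"
    then obtain e' where e': "e' \<in> edges G" "f ` e' = e" using E by blast
    have e'V: "e' \<subseteq> verts G" using e'(1) G unfolding simple_graph_def by blast
    have "card e = 2" using e T unfolding simple_graph_def by auto
    then have "e' \<noteq> {a, b}" using e'(2) ab(2) by auto
    then have "\<phi> ` e' \<noteq> {\<phi> a, \<phi> b}"
      using inj_on_image_eq_iff[OF \<phi> e'V, of "{a, b}"] abV by auto
    moreover have "(\<lambda>t. c (\<phi> (g t))) ` e = c ` \<phi> ` e'"
      unfolding e'(2)[symmetric] image_image by (rule image_cong) (use gf e'V in auto)
    ultimately show "(\<lambda>t. c (\<phi> (g t))) ` e \<in> (`) c ` ((`) \<phi> ` edges G - {{\<phi> a, \<phi> b}})"
      using e'(1) by auto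
  qed
qed

text \<open>The option type supplies the fresh name \<open>None\<close> over any vertex type, even a
  finite one.\<close>

definition add_vertex :: "'a sgraph \<Rightarrow> 'a set \<Rightarrow> 'a option sgraph" where
  "add_vertex G X = \<lparr>verts = insert None (Some ` verts G),
     edges = (`) Some ` edges G \<union> (\<lambda>u. {None, Some u}) ` X\<rparr>"

lemma simple_graph_add_vertex:
  assumes "simple_graph G" "X \<subseteq> verts G" shows "simple_graph (add_vertex G X)"
  using assms unfolding simple_graph_def add_vertex_def
  by (auto simp: card_image subset_iff)

lemma cis_inj:
  assumes "cis s = cis t" "\<bar>s - t\<bar> < 2 * pi" shows "s = t"
proof -
  have "cis (s - t) = 1" using assms(1) by (simp add: cis_divide[symmetric])
  then have "cos (s - t) = 1" by (metis cis.simps(1) one_complex.simps(1))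
  then obtain n :: int where n: "s - t = of_int n * 2 * pi" using cos_one_2pi_int by blast
  have "\<bar>of_int n :: real\<bar> * (2 * pi) < 1 * (2 * pi)" using assms(2) n by (simp add: abs_mult)
  then have "\<bar>of_int n :: real\<bar> < 1" by (simp only: mult_less_cancel_right_pos pi_gt_zero mult_pos_pos zero_less_numeral)
  then have "n = 0" by linarith
  then show ?thesis using n by simp
qed

text \<open>Besides the drawing, the union of its arcs is tracked: later arcs can then be tested
  against one set that a subdivision does not change.\<close>

lemma drawn_subdivide_exists:
  assumes D: "drawn S V E A" and e: "{p, q} \<in> E" and y: "y \<in> A {p, q}" "y \<notin> V"
  obtains A' where "drawn S (insert y V) (insert {p, y} (insert {y, q} (E - {{p, q}}))) A'"
    "\<Union> (A' ` insert {p, y} (insert {y, q} (E - {{p, q}}))) = \<Union> (A ` E)"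
    "\<And>g. g \<in> E \<Longrightarrow> g \<noteq> {p, q} \<Longrightarrow> A' g = A g"
proof -
  have pq: "p \<in> V" "q \<in> V" "p \<noteq> q"
    using drawnD(7)[OF D e] arc_set_ends(1)[OF drawnD(3)[OF D e]] by auto
  then have "y \<noteq> p" "y \<noteq> q" using y(2) by auto
  then obtain B C where BC: "A {p, q} = B \<union> C" "B \<inter> C = {y}" "arc_set S B {p, y}" "arc_set S C {y, q}"
    using arc_set_split[OF drawnD(3)[OF D e] y(1)] by metis
  let ?A = "A({p, y} := B, {y, q} := C)"
  have ne: "{p, y} \<noteq> {y, q}" using pq by (auto simp: doubleton_eq_iff)
  have same: "?A g = A g" if "g \<in> E" for g
  proof -
    have "y \<notin> g" using drawnD(7)[OF D that] y(2) by blast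
    then show ?thesis by auto
  qed
  have "\<Union> (?A ` insert {p, y} (insert {y, q} (E - {{p, q}}))) = B \<union> C \<union> \<Union> (?A ` (E - {{p, q}}))"
    using ne by auto
  also have "?A ` (E - {{p, q}}) = A ` (E - {{p, q}})" using same by (intro image_cong) auto
  also have "B \<union> C \<union> \<Union> (A ` (E - {{p, q}})) = \<Union> (A ` insert {p, q} (E - {{p, q}}))"
    unfolding image_insert Union_insert BC(1) ..
  also have "insert {p, q} (E - {{p, q}}) = E" using e by blast
  finally show ?thesis
    using that[of ?A] drawn_subdivide[OF D e y BC] same by blast
qed

lemma drawn_add_edge_exists:
  assumes D: "drawn S V E A" and "p \<in> V" "q \<in> V" "{p, q} \<notin> E" "arc_set S B {p, q}" "B \<inter> V \<subseteq> {p, q}"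
    "B \<inter> \<Union> (A ` E) \<subseteq> V"
  obtains A' where "drawn S V (insert {p, q} E) A'" "\<Union> (A' ` insert {p, q} E) = B \<union> \<Union> (A ` E)"
proof -
  let ?A = "A({p, q} := B)"
  have "drawn S V (insert {p, q} E) ?A" by (rule drawn_add_edge) (use assms in auto)
  moreover have "?A ` E = A ` E" using assms(4) by (intro image_cong) auto
  then have "\<Union> (?A ` insert {p, q} E) = B \<union> \<Union> (A ` E)"
    unfolding image_insert Union_insert fun_upd_same by (simp only:)
  ultimately show ?thesis by (rule that)
qed

section \<open>Rotations around a vertex\<close>

lemma arc_set_chart_circle:
  assumes \<psi>: "chart S \<psi>" and "r > 0" "s < t" "t - s < 2 * pi"
  shows "arc_set S ((\<lambda>x. \<psi> (of_real r * cis x)) ` {s..t}) {\<psi> (of_real r * cis s), \<psi> (of_real r * cis t)}"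
proof (rule arc_setI_interval[OF \<open>s < t\<close>])
  have "continuous_on {s..t} (\<lambda>x. complex_of_real r * cis x)"
    unfolding cis_conv_exp by (intro continuous_intros)
  then have "continuous_map (top_of_set {s..t}) euclidean (\<lambda>x. complex_of_real r * cis x)" by simp
  from continuous_map_compose[OF this chartD(1)[OF \<psi>]]
  show "continuous_map (top_of_set {s..t}) S (\<lambda>x. \<psi> (of_real r * cis x))" by (simp add: o_def)
  show "inj_on (\<lambda>x. \<psi> (of_real r * cis x)) {s..t}"
  proof (rule inj_onI)
    fix x y assume xy: "x \<in> {s..t}" "y \<in> {s..t}" "\<psi> (of_real r * cis x) = \<psi> (of_real r * cis y)"
    then have "cis x = cis y" using injD[OF chartD(2)[OF \<psi>]] \<open>r > 0\<close> by fastforce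
    then show "x = y" by (rule cis_inj) (use xy assms in auto)
  qed
qed

text \<open>The new vertex \<open>w\<close> sits in the open sector between two consecutive radii,
  halfway to the circle. It reaches \<open>v\<close> along its own radius and the two neighbouring
  radii along the circle of radius 1/2, at the points \<open>ya\<close> and \<open>yb\<close>, which
  subdivide the edges there and are contracted away in \<open>corner_embeddable\<close>.\<close>

lemma drawn_corner:
  assumes D: "drawn S V E A" and \<psi>: "chart S \<psi>" "\<psi> 0 = v" and v: "v \<in> V"
    and MV: "\<psi> ` cball 0 1 \<inter> V = {v}"
    and away: "\<And>e. e \<in> E \<Longrightarrow> v \<notin> e \<Longrightarrow> A e \<inter> \<psi> ` cball 0 1 = {}"
    and rad: "\<And>e. e \<in> E \<Longrightarrow> v \<in> e \<Longrightarrow> cmod (\<zeta> e) = 1 \<and> A e \<inter> \<psi> ` cball 0 1 = \<psi> ` closed_segment 0 (\<zeta> e)"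
    and a: "{v, a} \<in> E" "\<zeta> {v, a} = cis \<theta>0" and b: "{v, b} \<in> E" "\<zeta> {v, b} = cis \<theta>1" and ab: "a \<noteq> b"
    and \<theta>: "\<theta>0 < \<theta>1" "\<theta>1 < \<theta>0 + 2 * pi"
    and sector: "\<And>e t. e \<in> E \<Longrightarrow> v \<in> e \<Longrightarrow> \<theta>0 < t \<Longrightarrow> t < \<theta>1 \<Longrightarrow> \<zeta> e \<noteq> cis t"
  obtains w ya yb A' where "w \<notin> V" "ya \<notin> V" "yb \<notin> V" "w \<noteq> ya" "w \<noteq> yb" "ya \<noteq> yb"
    "drawn S (insert w (insert yb (insert ya V)))
      (E - {{v, a}, {v, b}} \<union> {{v, ya}, {ya, a}, {v, yb}, {yb, b}, {w, v}, {w, ya}, {w, yb}}) A'"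
proof -
  define M where "M = \<psi> ` cball 0 1"
  have inj: "inj \<psi>" by (rule chartD(2)[OF \<psi>(1)])
  have \<psi>eq: "\<psi> x = \<psi> y \<longleftrightarrow> x = y" for x y using inj by (auto dest: injD)
  define m where "m = (\<theta>0 + \<theta>1) / 2"
  define h where "h t = complex_of_real (1 / 2) * cis t" for t
  have hn: "cmod (h t) = 1 / 2" for t by (simp add: h_def norm_mult)
  have h0: "h t \<noteq> 0" for t using hn[of t] by auto
  have hM: "\<psi> (h t) \<in> M" for t unfolding M_def using hn[of t] by (intro imageI) simp
  have heq: "h s = h t \<longleftrightarrow> s = t" if "\<bar>s - t\<bar> < 2 * pi" for s t
    using cis_inj[of s t] that by (auto simp: h_def)
  have m1: "\<theta>0 < m" "m < \<theta>1" using \<theta> by (auto simp: m_def)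
  have m2: "m - \<theta>0 < 2 * pi" "\<theta>1 - m < 2 * pi" using \<theta> m1 by linarith+
  note m = m1 m2
  define w where "w = \<psi> (h m)"
  define ya where "ya = \<psi> (h \<theta>0)"
  define yb where "yb = \<psi> (h \<theta>1)"
  have MVv: "p = v" if "p \<in> M" "p \<in> V" for p
  proof -
    have "p \<in> M \<inter> V" using that by simp
    then show ?thesis using MV unfolding M_def by simp
  qed
  have hV: "\<psi> (h t) \<notin> V" for t
    using MVv[OF hM, of t] h0[of t] \<psi>eq[of "h t" 0] \<psi>(2) by metis
  have new: "w \<notin> V" "ya \<notin> V" "yb \<notin> V" unfolding w_def ya_def yb_def using hV by auto
  have dist: "w \<noteq> ya" "w \<noteq> yb" "ya \<noteq> yb" unfolding w_def ya_def yb_def \<psi>eq using m \<theta> by (simp_all add: heq)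
  \<comment> \<open>A point of the circle of radius 1/2 lies on an arc only if the arc runs along
    the radius with the same angle.\<close>
  have hA: "\<zeta> e = cis t \<and> v \<in> e" if e: "e \<in> E" and t: "\<psi> (h t) \<in> A e" for e t
  proof -
    have ve: "v \<in> e"
    proof (rule ccontr)
      assume "v \<notin> e"
      then have "A e \<inter> M = {}" using away[OF e] unfolding M_def by simp
      then show False using t hM[of t] by blast
    qed
    have "\<psi> (h t) \<in> A e \<inter> \<psi> ` cball 0 1" using t hM[of t] unfolding M_def by simp
    then have "\<psi> (h t) \<in> \<psi> ` closed_segment 0 (\<zeta> e)" using rad[OF e ve] by simp
    then have "h t \<in> closed_segment 0 (\<zeta> e)" using \<psi>eq by auto
    then obtain x where x: "0 \<le> x" "h t = complex_of_real x * \<zeta> e" unfolding closed_segment_0_iff by blast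
    then have xh: "x = 1 / 2" using hn[of t] rad[OF e ve] by (simp add: norm_mult)
    have "\<zeta> e = cis t" using x(2)[unfolded xh h_def] by simp
    then show ?thesis using ve by simp
  qed
  define U where "U = \<Union> (A ` E)"
  have hU: "\<psi> (h t) \<notin> U" if "\<theta>0 < t" "t < \<theta>1" for t
    unfolding U_def using hA sector that by blast
  define B1 where "B1 = \<psi> ` closed_segment (h m) 0"
  define B2 where "B2 = (\<lambda>x. \<psi> (h x)) ` {\<theta>0..m}"
  define B3 where "B3 = (\<lambda>x. \<psi> (h x)) ` {m..\<theta>1}"
  have B1M: "B1 \<subseteq> M" unfolding B1_def M_def
    using closed_segment_0_subset_cball[of "h m"] hn[of m] by (subst closed_segment_commute) (simp add: image_mono)
  have B2M: "B2 \<subseteq> M" and B3M: "B3 \<subseteq> M" unfolding B2_def B3_def using hM by auto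
  have B1arc: "arc_set S B1 {w, v}" unfolding B1_def w_def using arc_set_chart_segment[OF \<psi>(1) h0[of m]] \<psi>(2) by simp
  have B2arc: "arc_set S B2 {w, ya}"
    using arc_set_chart_circle[OF \<psi>(1), of "1/2" \<theta>0 m] m unfolding B2_def w_def ya_def h_def by (simp add: insert_commute)
  have B3arc: "arc_set S B3 {w, yb}"
    using arc_set_chart_circle[OF \<psi>(1), of "1/2" m \<theta>1] m unfolding B3_def w_def yb_def h_def by simp
  have B1U: "p = v" if p: "p \<in> B1" and pU: "p \<in> U" for p
  proof (rule ccontr)
    assume pv: "p \<noteq> v"
    obtain x where x: "p = \<psi> x" "x \<in> closed_segment 0 (h m)"
      using p unfolding B1_def by (metis closed_segment_commute imageE)
    have x0: "x \<noteq> 0" using pv x \<psi>(2) by auto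
    obtain e where e: "e \<in> E" "p \<in> A e" using pU unfolding U_def by blast
    have pM: "p \<in> M" using p B1M by blast
    have ve: "v \<in> e"
    proof (rule ccontr)
      assume "v \<notin> e"
      then have "A e \<inter> M = {}" using away[OF e(1)] unfolding M_def by simp
      then show False using e pM by blast
    qed
    have "p \<in> A e \<inter> \<psi> ` cball 0 1" using e pM unfolding M_def by simp
    then have "x \<in> closed_segment 0 (\<zeta> e)" using rad[OF e(1) ve] x(1) \<psi>eq by auto
    then have "h m \<in> closed_segment 0 (\<zeta> e)"
      using closed_segment_0_overlap[OF x(2)] x0 rad[OF e(1) ve] hn by simp
    then have "\<psi> (h m) \<in> \<psi> ` closed_segment 0 (\<zeta> e)" by (rule imageI)
    then have "\<psi> (h m) \<in> A e" using rad[OF e(1) ve] by blast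
    then show False using hU[of m] m e(1) unfolding U_def by blast
  qed
  have B2U: "p = ya" if p: "p \<in> B2" and pU: "p \<in> U" for p
  proof -
    obtain t where t: "\<theta>0 \<le> t" "t \<le> m" "p = \<psi> (h t)" using p unfolding B2_def by auto
    have "t < \<theta>1" using t(2) m by linarith
    then have "\<not> \<theta>0 < t" using hU[of t] pU t(3) by metis
    then have "t = \<theta>0" using t by linarith
    then show ?thesis using t by (simp add: ya_def)
  qed
  have B3U: "p = yb" if p: "p \<in> B3" and pU: "p \<in> U" for p
  proof -
    obtain t where t: "m \<le> t" "t \<le> \<theta>1" "p = \<psi> (h t)" using p unfolding B3_def by auto
    have "\<theta>0 < t" using t(1) m by linarith
    then have "\<not> t < \<theta>1" using hU[of t] pU t(3) by metis
    then have "t = \<theta>1" using t by linarith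
    then show ?thesis using t by (simp add: yb_def)
  qed
  have B12: "p = w" if p: "p \<in> B1" and q: "p = \<psi> (h t)" for p t
  proof -
    obtain x where x: "p = \<psi> x" "x \<in> closed_segment 0 (h m)"
      using p unfolding B1_def by (metis closed_segment_commute imageE)
    then have "h t \<in> closed_segment 0 (h m)" using q \<psi>eq by simp
    then have "h t = h m" by (rule closed_segment_0_unit) (simp add: hn)
    then show ?thesis using q by (simp add: w_def)
  qed
  have B23: "p = w" if p: "p \<in> B2" and q: "p \<in> B3" for p
  proof -
    obtain t where t: "\<theta>0 \<le> t" "t \<le> m" "p = \<psi> (h t)" using p unfolding B2_def by auto
    obtain s where s: "m \<le> s" "s \<le> \<theta>1" "p = \<psi> (h s)" using q unfolding B3_def by auto
    have "h s = h t" using s t \<psi>eq by simp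
    then have "s = t" using heq[of s t] s t \<theta> by (simp add: abs_if split: if_splits)
    then have "t = m" using s t by simp
    then show ?thesis using t by (simp add: w_def)
  qed
  have yA: "ya \<in> A {v, a}" "yb \<in> A {v, b}"
  proof -
    have half: "h t \<in> closed_segment 0 (cis t)" for t
      unfolding closed_segment_0_iff h_def by (intro exI[of _ "1/2"]) simp
    have "ya \<in> \<psi> ` closed_segment 0 (\<zeta> {v, a})" unfolding ya_def a(2) using half by (rule imageI)
    then show "ya \<in> A {v, a}" using rad[OF a(1)] by blast
    have "yb \<in> \<psi> ` closed_segment 0 (\<zeta> {v, b})" unfolding yb_def b(2) using half by (rule imageI)
    then show "yb \<in> A {v, b}" using rad[OF b(1)] by blast
  qed
  define E1 where "E1 = insert {v, ya} (insert {ya, a} (E - {{v, a}}))"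
  obtain A1 where D1: "drawn S (insert ya V) E1 A1" and U1: "\<Union> (A1 ` E1) = U"
    and A1: "\<And>g. g \<in> E \<Longrightarrow> g \<noteq> {v, a} \<Longrightarrow> A1 g = A g"
    unfolding E1_def U_def by (rule drawn_subdivide_exists[OF D a(1) yA(1) new(2)]) blast
  have vab: "{v, b} \<noteq> {v, a}" using ab by (auto simp: doubleton_eq_iff)
  have f1: "{v, b} \<in> E1" using b(1) vab unfolding E1_def by simp
  have yb1: "yb \<in> A1 {v, b}" using A1[OF b(1) vab] yA(2) by simp
  have ybn: "yb \<notin> insert ya V" using new dist by auto
  define E2 where "E2 = insert {v, yb} (insert {yb, b} (E1 - {{v, b}}))"
  obtain A2 where D2: "drawn S (insert yb (insert ya V)) E2 A2" and U2: "\<Union> (A2 ` E2) = U"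
    unfolding E2_def U1[symmetric] by (rule drawn_subdivide_exists[OF D1 f1 yb1 ybn]) blast
  define V3 where "V3 = insert w (insert yb (insert ya V))"
  have wU: "w \<notin> U" unfolding w_def using hU m by blast
  have D3: "drawn S V3 E2 A2" unfolding V3_def
  proof (rule drawn_add_vertex[OF D2])
    show "w \<in> topspace S" unfolding w_def by (rule chartD(3)[OF \<psi>(1)])
    show "w \<notin> insert yb (insert ya V)" using new dist by auto
    show "w \<notin> A2 e" if "e \<in> E2" for e using wU U2 that by blast
  qed
  have wE2: "{w, p} \<notin> E2" for p
  proof
    assume "{w, p} \<in> E2"
    then have "{w, p} \<subseteq> insert yb (insert ya V)" by (rule drawnD(7)[OF D2])
    then show False using new dist by auto
  qed
  have V3: "v \<in> V3" "w \<in> V3" "ya \<in> V3" "yb \<in> V3" using v unfolding V3_def by auto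
  have vB: "v \<noteq> \<psi> (h t)" for t using hV[of t] v by auto
  obtain A4 where D4: "drawn S V3 (insert {w, v} E2) A4" and U4: "\<Union> (A4 ` insert {w, v} E2) = B1 \<union> U"
  proof (rule drawn_add_edge_exists[OF D3 V3(2,1) wE2 B1arc, unfolded U2])
    show "B1 \<inter> V3 \<subseteq> {w, v}"
    proof
      fix p assume p: "p \<in> B1 \<inter> V3"
      then consider "p = w" | "p = yb" | "p = ya" | "p \<in> V" unfolding V3_def by auto
      then show "p \<in> {w, v}"
      proof cases
        case 2 then show ?thesis using p B12[of p \<theta>1] by (simp add: yb_def)
      next
        case 3 then show ?thesis using p B12[of p \<theta>0] by (simp add: ya_def)
      next
        case 4
        have "p \<in> M" using p B1M by blast
        then show ?thesis using MVv 4 by simp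
      qed simp
    qed
    show "B1 \<inter> U \<subseteq> V3"
    proof
      fix p assume "p \<in> B1 \<inter> U"
      then show "p \<in> V3" using B1U[of p] V3(1) by simp
    qed
  qed
  have BV: "p \<notin> V" if "p \<in> B2 \<or> p \<in> B3" for p using that hV unfolding B2_def B3_def by auto
  have wya: "{w, ya} \<notin> insert {w, v} E2" using wE2 new v by (auto simp: doubleton_eq_iff)
  obtain A5 where D5: "drawn S V3 (insert {w, ya} (insert {w, v} E2)) A5"
    and U5: "\<Union> (A5 ` insert {w, ya} (insert {w, v} E2)) = B2 \<union> (B1 \<union> U)"
  proof (rule drawn_add_edge_exists[OF D4 V3(2,3) wya B2arc, unfolded U4])
    show "B2 \<inter> V3 \<subseteq> {w, ya}"
    proof
      fix p assume p: "p \<in> B2 \<inter> V3"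
      have "yb \<notin> B2"
      proof
        assume "yb \<in> B2"
        moreover have "yb \<in> B3" using arc_set_ends(3)[OF B3arc] .
        ultimately show False using B23 dist by auto
      qed
      then show "p \<in> {w, ya}" using p BV[of p] unfolding V3_def by auto
    qed
    show "B2 \<inter> (B1 \<union> U) \<subseteq> V3"
    proof
      fix p assume p: "p \<in> B2 \<inter> (B1 \<union> U)"
      then obtain t where t: "p = \<psi> (h t)" unfolding B2_def by auto
      have "p = w \<or> p = ya" using p B12[OF _ t] B2U[of p] by auto
      then show "p \<in> V3" using V3 by auto
    qed
  qed
  have wyb: "{w, yb} \<notin> insert {w, ya} (insert {w, v} E2)" using wE2 new v dist by (auto simp: doubleton_eq_iff)
  obtain A6 where D6: "drawn S V3 (insert {w, yb} (insert {w, ya} (insert {w, v} E2))) A6"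
  proof (rule drawn_add_edge_exists[OF D5 V3(2,4) wyb B3arc, unfolded U5])
    show "B3 \<inter> V3 \<subseteq> {w, yb}"
    proof
      fix p assume p: "p \<in> B3 \<inter> V3"
      have "ya \<notin> B3"
      proof
        assume "ya \<in> B3"
        moreover have "ya \<in> B2" using arc_set_ends(3)[OF B2arc] .
        ultimately show False using B23 dist by auto
      qed
      then show "p \<in> {w, yb}" using p BV[of p] unfolding V3_def by auto
    qed
    show "B3 \<inter> (B2 \<union> (B1 \<union> U)) \<subseteq> V3"
    proof
      fix p assume p: "p \<in> B3 \<inter> (B2 \<union> (B1 \<union> U))"
      then obtain t where t: "p = \<psi> (h t)" unfolding B3_def by auto
      have "p = w \<or> p = yb" using p B12[OF _ t] B3U[of p] B23[of p] by auto
      then show "p \<in> V3" using V3 by auto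
    qed
  qed
  define E6 where "E6 = E - {{v, a}, {v, b}} \<union> {{v, ya}, {ya, a}, {v, yb}, {yb, b}, {w, v}, {w, ya}, {w, yb}}"
  have bV: "b \<in> V" "a \<in> V" using drawnD(7)[OF D b(1)] drawnD(7)[OF D a(1)] by auto
  have ne: "{v, ya} \<noteq> {v, b}" "{ya, a} \<noteq> {v, b}" using new bV v by (auto simp: doubleton_eq_iff)
  have "E - {{v, a}, {v, b}} \<subseteq> E2" unfolding E2_def E1_def by blast
  then have s1: "E - {{v, a}, {v, b}} \<subseteq> insert {w, yb} (insert {w, ya} (insert {w, v} E2))"
    by (intro subset_insertI2)
  have s2: "{v, ya} \<in> E2" "{ya, a} \<in> E2" unfolding E2_def E1_def using ne by simp_all
  have s3: "{v, yb} \<in> E2" "{yb, b} \<in> E2" unfolding E2_def by simp_all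
  have sub: "E6 \<subseteq> insert {w, yb} (insert {w, ya} (insert {w, v} E2))"
    unfolding E6_def
    by (intro Un_least insert_subsetI empty_subsetI s1) (simp_all only: insert_iff s2 s3 simp_thms)
  have "e \<subseteq> V3" if "e \<in> E6" for e using drawnD(7)[OF D6 subsetD[OF sub that]] .
  then have D7: "drawn S V3 E6 A6" by (rule drawn_subset[OF D6 sub subset_refl])
  show ?thesis
    by (rule that[OF new dist]) (use D7 in \<open>simp only: V3_def E6_def\<close>)
qed

lemma drawn_simple:
  assumes "drawn S V E A" shows "simple_graph \<lparr>verts = V, edges = E\<rparr>"
proof -
  have "card e = 2" if e: "e \<in> E" for e
  proof -
    note arc = drawnD(3)[OF assms e]
    then obtain a b where ab: "e = {a, b}" unfolding arc_set_def by blast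
    have "a \<noteq> b" using arc_set_ends(1)[OF arc[unfolded ab]] .
    with ab show ?thesis by simp
  qed
  then show ?thesis using drawnD(1,7)[OF assms] unfolding simple_graph_def by auto
qed

lemma simple_graph_edgeD:
  assumes "simple_graph G" "{a, b} \<in> edges G" shows "a \<noteq> b" "a \<in> verts G" "b \<in> verts G"
  using assms unfolding simple_graph_def by auto

text \<open>Contracting \<open>yb\<close> into \<open>b\<close> and then \<open>ya\<close> into
  \<open>a\<close> restores the edges at \<open>v\<close> and turns the neighbours
  \<open>ya\<close>, \<open>yb\<close> of \<open>w\<close> into \<open>a\<close>,
  \<open>b\<close>.\<close>

lemma corner_embeddable:
  assumes S: "surface S" and G: "simple_graph G" and inj: "inj_on \<phi> (verts G)"
    and new: "w \<notin> \<phi> ` verts G" "ya \<notin> \<phi> ` verts G" "yb \<notin> \<phi> ` verts G" "w \<noteq> ya" "w \<noteq> yb" "ya \<noteq> yb"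
    and D: "drawn S (insert w (insert yb (insert ya (\<phi> ` verts G))))
      ((`) \<phi> ` edges G - {{\<phi> v, \<phi> a}, {\<phi> v, \<phi> b}} \<union>
       {{\<phi> v, ya}, {ya, \<phi> a}, {\<phi> v, yb}, {yb, \<phi> b}, {w, \<phi> v}, {w, ya}, {w, yb}}) A"
    and va: "{v, a} \<in> edges G" and vb: "{v, b} \<in> edges G" and ab: "a \<noteq> b"
  shows "embeddable (add_vertex G {v, a, b}) S"
proof -
  define V where "V = \<phi> ` verts G"
  define E where "E = (`) \<phi> ` edges G"
  define v' where "v' = \<phi> v"
  define a' where "a' = \<phi> a"
  define b' where "b' = \<phi> b"
  have vab: "v \<in> verts G" "a \<in> verts G" "b \<in> verts G" "v \<noteq> a" "v \<noteq> b"
    using simple_graph_edgeD[OF G va] simple_graph_edgeD[OF G vb] by auto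
  have vab': "v' \<in> V" "a' \<in> V" "b' \<in> V" unfolding V_def v'_def a'_def b'_def using vab by auto
  have ne: "v' \<noteq> a'" "v' \<noteq> b'" "a' \<noteq> b'"
    unfolding v'_def a'_def b'_def using inj_on_eq_iff[OF inj] vab ab by auto
  have EV: "e \<subseteq> V \<and> card e = 2" if e: "e \<in> E" for e
  proof -
    obtain d where d: "d \<in> edges G" "e = \<phi> ` d" using e unfolding E_def by blast
    then have "d \<subseteq> verts G" "card d = 2" using G unfolding simple_graph_def by auto
    then show ?thesis using d inj unfolding V_def by (auto simp: card_image inj_on_subset)
  qed
  have finV: "finite V" using G unfolding V_def simple_graph_def by simp
  have newV: "w \<notin> V" "ya \<notin> V" "yb \<notin> V" using new unfolding V_def by auto
  have nin: "w \<notin> e" "ya \<notin> e" "yb \<notin> e" if "e \<in> E" for e using EV[OF that] newV by auto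
  have dist: "w \<noteq> v'" "w \<noteq> a'" "w \<noteq> b'" "ya \<noteq> v'" "ya \<noteq> a'" "ya \<noteq> b'" "yb \<noteq> v'" "yb \<noteq> a'" "yb \<noteq> b'"
    using newV vab' by metis+
  define G2 where "G2 = \<lparr>verts = insert w (insert yb (insert ya V)),
     edges = E - {{v', a'}, {v', b'}} \<union> {{v', ya}, {ya, a'}, {v', yb}, {yb, b'}, {w, v'}, {w, ya}, {w, yb}}\<rparr>"
  have s2: "simple_graph G2"
    using drawn_simple[OF D] unfolding G2_def V_def E_def v'_def a'_def b'_def .
  have e2: "embeddable G2 S"
    by (rule drawn_embeddable[OF D s2, of id]) (auto simp: G2_def V_def E_def v'_def a'_def b'_def)
  define G3 where "G3 = \<lparr>verts = insert w (insert ya V),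
     edges = E - {{v', a'}, {v', b'}} \<union> {{v', ya}, {ya, a'}, {v', b'}, {w, v'}, {w, ya}, {w, b'}}\<rparr>"
  have s3: "simple_graph G3"
    unfolding simple_graph_def G3_def using EV finV vab' ne dist new by (auto simp: subset_iff)
  define f3 where "f3 u = (if u = yb then b' else u)" for u
  have f3E: "f3 ` e = e" if "e \<in> E" for e
    using nin[OF that] unfolding f3_def by (auto simp: image_iff)
  have e3: "embeddable G3 S"
  proof (rule embeddable_contract[OF S s2 e2 s3, of yb b' f3])
    show "{yb, b'} \<in> edges G2" by (simp add: G2_def)
    show "f3 yb = f3 b'" by (simp add: f3_def)
    show "u = u' \<or> {u, u'} = {yb, b'}" if "f3 u = f3 u'" for u u'
      using that unfolding f3_def by (auto split: if_splits)
    show "verts G3 \<subseteq> f3 ` verts G2"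
    proof
      fix p assume "p \<in> verts G3"
      then have "p \<in> verts G2" "p \<noteq> yb" using newV new dist by (auto simp: G2_def G3_def)
      then show "p \<in> f3 ` verts G2" by (intro image_eqI[of _ _ p]) (auto simp: f3_def)
    qed
    fix e assume "e \<in> edges G3"
    then consider "e \<in> E - {{v', a'}, {v', b'}}" | "e \<in> {{v', ya}, {ya, a'}, {w, v'}, {w, ya}}"
      | "e = {v', b'}" | "e = {w, b'}" unfolding G3_def by auto
    then show "\<exists>e'\<in>edges G2. f3 ` e' = e"
    proof cases
      case 1 then show ?thesis using f3E[of e] by (intro bexI[of _ e]) (auto simp: G2_def)
    next
      case 2
      then have "yb \<notin> e" using dist new by auto
      then have "f3 ` e = e" unfolding f3_def by (auto simp: image_iff)
      then show ?thesis using 2 by (intro bexI[of _ e]) (auto simp: G2_def)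
    next
      case 3
      have "f3 ` {v', yb} = e" using 3 dist by (simp add: f3_def)
      then show ?thesis by (intro bexI[of _ "{v', yb}"]) (auto simp: G2_def)
    next
      case 4
      have "f3 ` {w, yb} = e" using 4 new by (simp add: f3_def)
      then show ?thesis by (intro bexI[of _ "{w, yb}"]) (auto simp: G2_def)
    qed
  qed
  define G4 where "G4 = \<lparr>verts = insert w V, edges = E \<union> {{w, v'}, {w, a'}, {w, b'}}\<rparr>"
  have s4: "simple_graph G4"
    unfolding simple_graph_def G4_def using EV finV vab' ne dist new by (auto simp: subset_iff)
  define f4 where "f4 u = (if u = ya then a' else u)" for u
  have f4E: "f4 ` e = e" if "e \<in> E" for e
    using nin[OF that] unfolding f4_def by (auto simp: image_iff)
  have e4: "embeddable G4 S"
  proof (rule embeddable_contract[OF S s3 e3 s4, of ya a' f4])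
    show "{ya, a'} \<in> edges G3" by (simp add: G3_def)
    show "f4 ya = f4 a'" by (simp add: f4_def)
    show "u = u' \<or> {u, u'} = {ya, a'}" if "f4 u = f4 u'" for u u'
      using that unfolding f4_def by (auto split: if_splits)
    show "verts G4 \<subseteq> f4 ` verts G3"
    proof
      fix p assume "p \<in> verts G4"
      then have "p \<in> verts G3" "p \<noteq> ya" using newV new dist by (auto simp: G4_def G3_def)
      then show "p \<in> f4 ` verts G3" by (intro image_eqI[of _ _ p]) (auto simp: f4_def)
    qed
    fix e assume "e \<in> edges G4"
    then consider "e \<in> E - {{v', a'}, {v', b'}}" | "e = {v', b'}" | "e = {v', a'}" | "e = {w, v'}"
      | "e = {w, a'}" | "e = {w, b'}" unfolding G4_def by auto
    then show "\<exists>e'\<in>edges G3. f4 ` e' = e"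
    proof cases
      case 1 then show ?thesis using f4E[of e] by (intro bexI[of _ e]) (auto simp: G3_def)
    next
      case 2
      have "f4 ` {v', b'} = e" using 2 dist by (simp add: f4_def)
      then show ?thesis by (intro bexI[of _ "{v', b'}"]) (auto simp: G3_def)
    next
      case 3
      have "f4 ` {v', ya} = e" using 3 dist by (simp add: f4_def)
      then show ?thesis by (intro bexI[of _ "{v', ya}"]) (auto simp: G3_def)
    next
      case 4
      have "f4 ` {w, v'} = e" using 4 dist new by (simp add: f4_def)
      then show ?thesis by (intro bexI[of _ "{w, v'}"]) (auto simp: G3_def)
    next
      case 5
      have "f4 ` {w, ya} = e" using 5 new by (simp add: f4_def)
      then show ?thesis by (intro bexI[of _ "{w, ya}"]) (auto simp: G3_def)
    next
      case 6
      have "f4 ` {w, b'} = e" using 6 new dist by (simp add: f4_def)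
      then show ?thesis by (intro bexI[of _ "{w, b'}"]) (auto simp: G3_def)
    qed
  qed
  define F where "F p = (if p \<in> V then Some (inv_into (verts G) \<phi> p) else None)" for p
  have F\<phi>: "F (\<phi> u) = Some u" if "u \<in> verts G" for u
    unfolding F_def V_def using that inv_into_f_f[OF inj that] by simp
  have Fw: "F w = None" using newV by (simp add: F_def)
  show ?thesis
  proof (rule embeddable_subgraph[OF s4 e4, of _ F])
    show "simple_graph (add_vertex G {v, a, b})" by (rule simple_graph_add_vertex[OF G]) (use vab in auto)
    show "inj_on F (verts G4)"
    proof (rule inj_onI)
      fix p q assume pq: "p \<in> verts G4" "q \<in> verts G4" "F p = F q"
      have cs: "p = w \<or> p \<in> V" "q = w \<or> q \<in> V" using pq by (auto simp: G4_def)
      have "inv_into (verts G) \<phi> p = inv_into (verts G) \<phi> q \<Longrightarrow> p \<in> V \<Longrightarrow> q \<in> V \<Longrightarrow> p = q"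
        unfolding V_def by (metis f_inv_into_f)
      then show "p = q" using cs pq(3) newV unfolding F_def by (auto split: if_splits)
    qed
    show "verts (add_vertex G {v, a, b}) \<subseteq> F ` verts G4"
    proof
      fix x assume "x \<in> verts (add_vertex G {v, a, b})"
      then consider "x = None" | u where "x = Some u" "u \<in> verts G" unfolding add_vertex_def by auto
      then show "x \<in> F ` verts G4"
      proof cases
        case 1 then show ?thesis using Fw by (intro image_eqI[of _ _ w]) (auto simp: G4_def)
      next
        case 2 then show ?thesis using F\<phi>[OF 2(2)] by (intro image_eqI[of _ _ "\<phi> u"]) (auto simp: G4_def V_def)
      qed
    qed
    fix e assume "e \<in> edges (add_vertex G {v, a, b})"
    then consider d where "d \<in> edges G" "e = Some ` d" | u where "u \<in> {v, a, b}" "e = {None, Some u}"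
      unfolding add_vertex_def by auto
    then show "\<exists>e'\<in>edges G4. F ` e' = e"
    proof cases
      case 1
      have "d \<subseteq> verts G" using 1(1) G unfolding simple_graph_def by auto
      then have "F ` \<phi> ` d = e" unfolding 1(2) image_image using F\<phi> by (intro image_cong) auto
      then show ?thesis using 1(1) by (intro bexI[of _ "\<phi> ` d"]) (auto simp: G4_def E_def)
    next
      case 2
      then have "u \<in> verts G" using vab by auto
      then have "F ` {w, \<phi> u} = e" using 2(2) Fw F\<phi> by simp
      moreover have "{w, \<phi> u} \<in> edges G4" using 2(1) by (auto simp: G4_def v'_def a'_def b'_def)
      ultimately show ?thesis by blast
    qed
  qed
qed

text \<open>The rotation is the order of the angles at which the radii leave \<open>v\<close>.
  Between cyclically consecutive angles the sector is empty, so \<open>drawn_corner\<close> applies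
  to it.\<close>

lemma embeddable_rotation:
  assumes S: "surface S" and G: "simple_graph G" and emb: "embeddable G S" and v: "v \<in> verts G"
    and N: "card {u. {v, u} \<in> edges G} \<ge> 2"
  obtains L where "distinct L" "set L = {u. {v, u} \<in> edges G}"
    "\<And>i. i < length L \<Longrightarrow> embeddable (add_vertex G {v, L ! i, L ! (Suc i mod length L)}) S"
proof -
  obtain \<phi> A0 where inj: "inj_on \<phi> (verts G)" and D0: "drawn S (\<phi> ` verts G) ((`) \<phi> ` edges G) A0"
    using embeddable_drawn[OF G emb] .
  define V where "V = \<phi> ` verts G"
  define E where "E = (`) \<phi> ` edges G"
  define v' where "v' = \<phi> v"
  have v': "v' \<in> V" unfolding V_def v'_def using v by simp
  have vS: "v' \<in> topspace S" using v' drawnD(2)[OF D0] unfolding V_def by blast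
  obtain A \<psi> \<zeta> where D: "drawn S V E A" and \<psi>: "chart S \<psi>" "\<psi> 0 = v'"
    and MV: "\<psi> ` cball 0 1 \<inter> V = {v'}"
    and away: "\<And>e. e \<in> E \<Longrightarrow> v' \<notin> e \<Longrightarrow> A e = A0 e \<and> A0 e \<inter> \<psi> ` cball 0 1 = {}"
    and rad: "\<And>e. e \<in> E \<Longrightarrow> v' \<in> e \<Longrightarrow> cmod (\<zeta> e) = 1 \<and> A e \<inter> \<psi> ` cball 0 1 = \<psi> ` closed_segment 0 (\<zeta> e)
        \<and> A e \<subseteq> A0 e \<union> \<psi> ` cball 0 1"
    and injz: "\<And>e f. e \<in> E \<Longrightarrow> f \<in> E \<Longrightarrow> v' \<in> e \<Longrightarrow> v' \<in> f \<Longrightarrow> \<zeta> e = \<zeta> f \<Longrightarrow> e = f"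
    by (rule radialise[OF S D0[folded V_def E_def] v' openin_topspace vS]) blast
  define N where "N = {u. {v, u} \<in> edges G}"
  have NV: "N \<subseteq> verts G" using simple_graph_edgeD[OF G] unfolding N_def by blast
  have finN: "finite N" using NV G unfolding simple_graph_def by (meson finite_subset)
  have NE: "{v', \<phi> u} \<in> E" if "u \<in> N" for u
    using that unfolding N_def E_def v'_def by (metis (no_types, lifting) image_empty image_eqI image_insert mem_Collect_eq)
  have EN: "\<exists>u\<in>N. e = {v', \<phi> u}" if e: "e \<in> E" "v' \<in> e" for e
  proof -
    obtain d where d: "d \<in> edges G" "e = \<phi> ` d" using e unfolding E_def by blast
    have dV: "d \<subseteq> verts G" "card d = 2" using d(1) G unfolding simple_graph_def by auto
    then obtain x y where xy: "d = {x, y}" by (meson card_2_iff)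
    have "x \<in> verts G" "y \<in> verts G" using dV xy by auto
    moreover have "\<phi> v = \<phi> x \<or> \<phi> v = \<phi> y" using e(2) d(2) xy unfolding v'_def by auto
    ultimately have "v = x \<or> v = y" using inj_onD[OF inj] v by metis
    then show ?thesis
    proof
      assume "v = x" then show ?thesis using d xy by (intro bexI[of _ y]) (auto simp: v'_def N_def)
    next
      assume "v = y" then show ?thesis using d xy by (intro bexI[of _ x]) (auto simp: v'_def N_def insert_commute)
    qed
  qed
  define \<theta> where "\<theta> u = Arg2pi (\<zeta> {v', \<phi> u})" for u
  have unit: "cmod (\<zeta> {v', \<phi> u}) = 1" if "u \<in> N" for u using rad[OF NE[OF that]] by simp
  have \<zeta>: "\<zeta> {v', \<phi> u} = cis (\<theta> u)" if "u \<in> N" for u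
    using unit[OF that] unfolding \<theta>_def cis_conv_exp complex_norm_eq_1_exp by simp
  have \<theta>r: "0 \<le> \<theta> u" "\<theta> u < 2 * pi" for u unfolding \<theta>_def using Arg2pi_ge_0 Arg2pi_lt_2pi by auto
  have \<theta>inj: "u = u'" if u: "u \<in> N" "u' \<in> N" "\<theta> u = \<theta> u'" for u u'
  proof -
    have "\<zeta> {v', \<phi> u} = \<zeta> {v', \<phi> u'}" using \<zeta> u by simp
    then have "{v', \<phi> u} = {v', \<phi> u'}" using injz[OF NE[OF u(1)] NE[OF u(2)]] by simp
    then have "\<phi> u = \<phi> u'" by (auto simp: doubleton_eq_iff)
    then show ?thesis using inj_onD[OF inj] NV u by blast
  qed
  obtain xs where xs: "set xs = N" "distinct xs" using finite_distinct_list[OF finN] by blast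
  define L where "L = sort_key \<theta> xs"
  have L: "set L = N" "distinct L" using xs by (simp_all add: L_def)
  have sorted: "\<theta> (L ! i) \<le> \<theta> (L ! j)" if "i \<le> j" "j < length L" for i j
  proof -
    have "sorted (map \<theta> L)" by (simp add: L_def)
    then show ?thesis using sorted_nth_mono[of "map \<theta> L" i j] that by simp
  qed
  have strict: "\<theta> (L ! i) < \<theta> (L ! j)" if ij: "i < j" "j < length L" for i j
  proof -
    have "L ! i \<noteq> L ! j" using ij L(2) by (simp add: nth_eq_iff_index_eq)
    moreover have "L ! i \<in> N" "L ! j \<in> N" using ij L(1) nth_mem[of i L] nth_mem[of j L] by auto
    ultimately have "\<theta> (L ! i) \<noteq> \<theta> (L ! j)" using \<theta>inj by blast
    then show ?thesis using sorted[of i j] ij by simp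
  qed
  have len: "length L \<ge> 2" using N L distinct_card[OF L(2)] unfolding N_def by simp
  \<comment> \<open>The angles \<open>t0\<close> and \<open>t1\<close> are lifts, so that the last
    sector, which passes the angle 0, is treated like the others with the smallest angle raised by a
    full turn.\<close>
  have main: "embeddable (add_vertex G {v, a, b}) S"
    if ab: "a \<in> N" "b \<in> N" "a \<noteq> b" and t0: "cis t0 = cis (\<theta> a)" and t1: "cis t1 = cis (\<theta> b)"
      and t01: "t0 < t1" "t1 < t0 + 2 * pi"
      and sec: "\<And>u t. u \<in> N \<Longrightarrow> t0 < t \<Longrightarrow> t < t1 \<Longrightarrow> cis (\<theta> u) \<noteq> cis t" for a b t0 t1
  proof -
    have "\<phi> a \<noteq> \<phi> b" using inj_onD[OF inj, of a b] NV ab by blast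
    obtain w ya yb A' where "w \<notin> V" "ya \<notin> V" "yb \<notin> V" "w \<noteq> ya" "w \<noteq> yb" "ya \<noteq> yb"
      "drawn S (insert w (insert yb (insert ya V)))
      (E - {{v', \<phi> a}, {v', \<phi> b}} \<union> {{v', ya}, {ya, \<phi> a}, {v', yb}, {yb, \<phi> b}, {w, v'}, {w, ya}, {w, yb}}) A'"
    proof (rule drawn_corner[OF D \<psi> v' MV, of \<zeta> "\<phi> a" t0 "\<phi> b" t1])
      show "A e \<inter> \<psi> ` cball 0 1 = {}" if "e \<in> E" "v' \<notin> e" for e using away[OF that] by simp
      show "cmod (\<zeta> e) = 1 \<and> A e \<inter> \<psi> ` cball 0 1 = \<psi> ` closed_segment 0 (\<zeta> e)" if "e \<in> E" "v' \<in> e" for e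
        using rad[OF that] by simp
      show "\<zeta> e \<noteq> cis t" if et: "e \<in> E" "v' \<in> e" "t0 < t" "t < t1" for e t
      proof -
        obtain u where u: "u \<in> N" "e = {v', \<phi> u}" using EN[OF et(1,2)] by blast
        then show ?thesis using sec[OF u(1) et(3,4)] \<zeta>[OF u(1)] by simp
      qed
    qed (use NE ab \<zeta> t0 t1 t01 \<open>\<phi> a \<noteq> \<phi> b\<close> in simp_all)
    then show ?thesis
      using corner_embeddable[OF S G inj, of w ya yb v a b A'] ab unfolding V_def E_def v'_def N_def by simp
  qed
  have "embeddable (add_vertex G {v, L ! i, L ! (Suc i mod length L)}) S" if i: "i < length L" for i
  proof (cases "Suc i < length L")
    case True
    have "L ! i \<in> N" "L ! Suc i \<in> N" "L ! i \<noteq> L ! Suc i"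
      using True L nth_mem[of i L] nth_mem[of "Suc i" L] i by (auto simp: nth_eq_iff_index_eq)
    then have "embeddable (add_vertex G {v, L ! i, L ! Suc i}) S"
    proof (rule main[of _ _ "\<theta> (L ! i)" "\<theta> (L ! Suc i)"])
      show "\<theta> (L ! i) < \<theta> (L ! Suc i)" using strict[of i "Suc i"] True by simp
      show "\<theta> (L ! Suc i) < \<theta> (L ! i) + 2 * pi" using \<theta>r(2)[of "L ! Suc i"] \<theta>r(1)[of "L ! i"] by linarith
      show "cis (\<theta> u) \<noteq> cis t" if ut: "u \<in> N" "\<theta> (L ! i) < t" "t < \<theta> (L ! Suc i)" for u t
      proof
        assume "cis (\<theta> u) = cis t"
        moreover have "\<bar>\<theta> u - t\<bar> < 2 * pi"
          using ut \<theta>r(1)[of u] \<theta>r(2)[of u] \<theta>r(1)[of "L ! i"] \<theta>r(2)[of "L ! Suc i"] by linarith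
        ultimately have "\<theta> u = t" by (rule cis_inj)
        moreover obtain j where j: "j < length L" "u = L ! j" using ut(1) L(1) by (metis in_set_conv_nth)
        ultimately have "i < j" "j < Suc i"
          using ut sorted[of j i] sorted[of "Suc i" j] i by (auto simp: not_less[symmetric])
        then show False by simp
      qed
    qed simp_all
    then show ?thesis using True by simp
  next
    case False
    then have ie: "i = length L - 1" "Suc i = length L" using i by auto
    have i0: "0 < i" using ie len by simp
    have "L ! i \<in> N" "L ! 0 \<in> N" "L ! i \<noteq> L ! 0"
    proof -
      have l0: "0 < length L" using i by linarith
      show "L ! i \<in> N" "L ! 0 \<in> N" using nth_mem[OF i] nth_mem[OF l0] L(1) by blast+
      show "L ! i \<noteq> L ! 0" using nth_eq_iff_index_eq[OF L(2) i l0] i0 by simp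
    qed
    then have "embeddable (add_vertex G {v, L ! i, L ! 0}) S"
    proof (rule main[of _ _ "\<theta> (L ! i)" "\<theta> (L ! 0) + 2 * pi"])
      show "cis (\<theta> (L ! 0) + 2 * pi) = cis (\<theta> (L ! 0))" by (simp add: cis_mult[symmetric])
      show "\<theta> (L ! i) < \<theta> (L ! 0) + 2 * pi" using \<theta>r(2)[of "L ! i"] \<theta>r(1)[of "L ! 0"] by linarith
      show "\<theta> (L ! 0) + 2 * pi < \<theta> (L ! i) + 2 * pi" using strict[of 0 i] i0 i by simp
      show "cis (\<theta> u) \<noteq> cis t" if ut: "u \<in> N" "\<theta> (L ! i) < t" "t < \<theta> (L ! 0) + 2 * pi" for u t
      proof
        assume eq: "cis (\<theta> u) = cis t"
        obtain j where j: "j < length L" "u = L ! j" using ut(1) L(1) by (metis in_set_conv_nth)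
        have "\<theta> (L ! 0) \<le> \<theta> u" "\<theta> u \<le> \<theta> (L ! i)" using sorted[of 0 j] sorted[of j i] j ie by auto
        then have "\<bar>\<theta> u - t\<bar> < 2 * pi" "\<theta> u < t" using ut by linarith+
        then show False using cis_inj[OF eq] by simp
      qed
    qed simp_all
    then show ?thesis using ie by simp
  qed
  then show ?thesis using that L unfolding N_def by blast
qed

section \<open>Closed surfaces are surfaces\<close>

text \<open>The plane is squeezed onto a ball inside \<open>D\<close> by
  \<open>z \<mapsto> u0 + r * z / (1 + |z|)\<close>, so a parametrised neighbourhood becomes a chart
  on the whole plane.\<close>

lemma chart_of_local:
  fixes D :: "complex set" and f :: "complex \<Rightarrow> 's"
  assumes D: "open D" "u0 \<in> D" and cont: "continuous_map (top_of_set D) S f" and inj: "inj_on f D"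
    and op: "\<And>U. open U \<Longrightarrow> U \<subseteq> D \<Longrightarrow> openin S (f ` U)"
  shows "\<exists>\<psi>. chart S \<psi> \<and> \<psi> 0 = f u0"
proof -
  obtain r where r: "r > 0" "ball u0 r \<subseteq> D" using D openE by blast
  define s where "s z = u0 + of_real (r / (1 + cmod z)) * z" for z
  define s' where "s' w = of_real (1 / (r - cmod (w - u0))) * (w - u0)" for w
  have pos: "1 + cmod z > 0" for z by (simp add: add_pos_nonneg)
  have pos': "1 + cmod z \<noteq> 0" for z using pos[of z] by simp
  have posc: "1 + complex_of_real (cmod z) \<noteq> 0" for z
    using pos'[of z] by (metis of_real_1 of_real_add of_real_eq_0_iff)
  have sn: "cmod (s z - u0) = r * cmod z / (1 + cmod z)" for z
  proof -
    have "s z - u0 = of_real (r / (1 + cmod z)) * z" unfolding s_def by (simp only: add_diff_cancel_left')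
    then have "cmod (s z - u0) = \<bar>r / (1 + cmod z)\<bar> * cmod z" by (simp only: norm_mult norm_of_real)
    then show ?thesis using r pos[of z] by simp
  qed
  have sb: "s z \<in> ball u0 r" for z
  proof -
    have "r * cmod z < r * (1 + cmod z)" using r by simp
    then have "cmod (s z - u0) < r" unfolding sn using pos[of z] by (simp add: pos_divide_less_eq)
    then show ?thesis by (simp add: dist_norm norm_minus_commute)
  qed
  have s's: "s' (s z) = z" for z
  proof -
    have "r - r * cmod z / (1 + cmod z) = r / (1 + cmod z)" using pos'[of z] by (simp add: field_simps)
    then have "s' (s z) = of_real (1 / (r / (1 + cmod z))) * (s z - u0)" unfolding s'_def sn by simp
    also have "\<dots> = of_real ((1 + cmod z) / r * (r / (1 + cmod z))) * z" unfolding s_def by simp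
    also have "(1 + cmod z) / r * (r / (1 + cmod z)) = 1" using r pos'[of z] by simp
    finally show ?thesis by simp
  qed
  have ss': "s (s' w) = w" if w: "w \<in> ball u0 r" for w
  proof -
    define d where "d = r - cmod (w - u0)"
    have d: "d > 0" using w by (simp add: d_def dist_norm norm_minus_commute)
    have "cmod (s' w) = \<bar>1 / d\<bar> * cmod (w - u0)" unfolding s'_def d_def[symmetric] by (simp only: norm_mult norm_of_real)
    then have "cmod (s' w) = cmod (w - u0) / d" using d by simp
    then have "1 + cmod (s' w) = r / d" using d by (simp add: d_def field_simps)
    then have "s (s' w) = u0 + of_real (r / (r / d)) * (of_real (1 / d) * (w - u0))"
      unfolding s_def by (simp add: s'_def d_def)
    also have "\<dots> = u0 + of_real (r / (r / d) * (1 / d)) * (w - u0)" by simp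
    also have "r / (r / d) * (1 / d) = 1" using d r by simp
    finally show ?thesis by simp
  qed
  have conts: "continuous_on UNIV s" unfolding s_def by (intro continuous_intros) (use pos' posc in auto)
  have conts': "continuous_on (ball u0 r) s'"
    unfolding s'_def by (intro continuous_intros) (auto simp: dist_norm norm_minus_commute)
  have "chart S (f \<circ> s)"
    unfolding chart_def
  proof (intro conjI)
    have "continuous_map euclidean (top_of_set D) s"
      using conts sb r by (auto simp: continuous_map_in_subtopology)
    then show "continuous_map euclidean S (f \<circ> s)" using cont by (rule continuous_map_compose)
    show "inj (f \<circ> s)"
    proof (rule injI)
      fix x y assume "(f \<circ> s) x = (f \<circ> s) y"
      moreover have "s x \<in> D" "s y \<in> D" using sb r by blast+
      ultimately have "s x = s y" using inj_onD[OF inj, of "s x" "s y"] by simp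
      then show "x = y" using s's by metis
    qed
    have "openin S ((f \<circ> s) ` U)" if U: "open U" for U
    proof -
      have eq: "s ` U = ball u0 r \<inter> s' -` U"
      proof
        show "s ` U \<subseteq> ball u0 r \<inter> s' -` U" using sb s's by auto
        show "ball u0 r \<inter> s' -` U \<subseteq> s ` U"
        proof
          fix w assume w: "w \<in> ball u0 r \<inter> s' -` U"
          then show "w \<in> s ` U" using ss'[of w] by (intro image_eqI[of _ _ "s' w"]) auto
        qed
      qed
      have "open (s ` U)" unfolding eq using conts' U by (metis continuous_on_open_vimage open_ball Int_commute)
      moreover have "s ` U \<subseteq> D" using sb r by blast
      ultimately have "openin S (f ` (s ` U))" by (rule op)
      then show ?thesis by (simp add: image_comp)
    qed
    then show "open_map euclidean S (f \<circ> s)" by (simp add: open_map_def)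
  qed
  moreover have "(f \<circ> s) 0 = f u0" by (simp add: s_def)
  ultimately show ?thesis by blast
qed

text \<open>The boundary circle \<open>k\<close> is sewn to the circle \<open>sewn_index h k\<close> by \<open>sewn_map h k\<close>, which extends
  to an involution exchanging the inside and the outside of the unit circle.\<close>

definition sewn_index :: "nat \<Rightarrow> nat \<Rightarrow> nat" where
  "sewn_index h k = (if k < 2 * h then (if even k then k + 1 else k - 1) else k)"

definition sewn_map :: "nat \<Rightarrow> nat \<Rightarrow> complex \<Rightarrow> complex" where
  "sewn_map h k u = (if k < 2 * h then inverse u else - inverse (cnj u))"

lemma sewn_map_simps:
  "sewn_map h k (sewn_map h k u) = u" "cmod (sewn_map h k u) = inverse (cmod u)"
  by (auto simp: sewn_map_def norm_inverse)

lemma continuous_on_sewn_map: "continuous_on (- {0}) (sewn_map h k)"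
  unfolding sewn_map_def by (cases "k < 2 * h") (auto intro!: continuous_intros)

lemma inverse_unit: "cmod z = 1 \<Longrightarrow> inverse z = cnj z"
  by (simp add: inverse_complex_def cmod_def complex_eq_iff)

text \<open>On the unit circle \<open>cnj z = inverse z\<close> and
  \<open>- z = - inverse (cnj z)\<close>. Handles and cross-caps thus share one description, by maps
  that also make sense off the circle, where they exchange its two sides.\<close>

lemma sewn_iff:
  "sewn h c w w' \<longleftrightarrow> (\<exists>k < 2 * h + c. \<exists>z. cmod z = 1 \<and> w = centre k + z \<and>
     w' = centre (sewn_index h k) + sewn_map h k z)" (is "_ \<longleftrightarrow> ?R")
proof
  assume "sewn h c w w'"
  then consider j z where "j < h" "cmod z = 1" "w = centre (2 * j) + z" "w' = centre (2 * j + 1) + cnj z"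
    | j z where "j < h" "cmod z = 1" "w = centre (2 * j + 1) + cnj z" "w' = centre (2 * j) + z"
    | k z where "2 * h \<le> k" "k < 2 * h + c" "cmod z = 1" "w = centre k + z" "w' = centre k - z"
    unfolding sewn_def by (metis atLeastLessThan_iff)
  then show ?R
  proof cases
    case 1 then show ?thesis
      by (intro exI[of _ "2 * j"] conjI exI[of _ z]) (auto simp: sewn_index_def sewn_map_def inverse_unit)
  next
    case 2 then show ?thesis
      by (intro exI[of _ "2 * j + 1"] conjI exI[of _ "cnj z"]) (auto simp: sewn_index_def sewn_map_def inverse_unit)
  next
    case 3 then show ?thesis
      by (intro exI[of _ k] conjI exI[of _ z]) (auto simp: sewn_index_def sewn_map_def inverse_unit)
  qed
next
  assume ?R
  then obtain k z where k: "k < 2 * h + c" "cmod z = 1" "w = centre k + z"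
    "w' = centre (sewn_index h k) + sewn_map h k z" by blast
  consider j where "k = 2 * j" "j < h" | j where "k = 2 * j + 1" "j < h" | "2 * h \<le> k"
  proof (cases "k < 2 * h")
    case True
    show ?thesis
    proof (cases "even k")
      case True then obtain j where "k = 2 * j" by (auto elim: evenE)
      then show ?thesis using that(1)[of j] \<open>k < 2 * h\<close> by simp
    next
      case False then obtain j where "k = 2 * j + 1" by (auto elim: oddE)
      then show ?thesis using that(2)[of j] \<open>k < 2 * h\<close> by simp
    qed
  qed (use that in simp)
  then show "sewn h c w w'"
  proof cases
    case 1
    then have "w' = centre (2 * j + 1) + cnj z" using k by (simp add: sewn_index_def sewn_map_def inverse_unit)
    then show ?thesis unfolding sewn_def using 1 k(2,3) by blast
  next
    case 2
    then have "w' = centre (2 * j) + cnj z" using k by (simp add: sewn_index_def sewn_map_def inverse_unit)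
    moreover have "w = centre (2 * j + 1) + cnj (cnj z)" "cmod (cnj z) = 1" using 2 k by simp_all
    ultimately show ?thesis unfolding sewn_def using 2 by blast
  next
    case 3
    then have "w' = centre k - z" using k by (simp add: sewn_index_def sewn_map_def inverse_unit)
    then show ?thesis unfolding sewn_def using 3 k by auto
  qed
qed

section \<open>Stereographic projection as the inverse of \<open>stereo\<close>\<close>

definition unstereo :: "complex \<times> real \<Rightarrow> complex" where
  "unstereo p = (1 / (1 - snd p)) *\<^sub>R fst p"

lemma one_plus_square_pos: "(cmod z)\<^sup>2 + 1 > 0"
  by (simp add: add_nonneg_pos)

lemma snd_stereo: "snd (stereo z) \<noteq> 1"
  using one_plus_square_pos[of z] by (simp add: stereo_def)

lemma unstereo_stereo: "unstereo (stereo z) = z"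
proof -
  have "1 - snd (stereo z) = 2 / ((cmod z)\<^sup>2 + 1)"
    using one_plus_square_pos[of z] by (simp add: stereo_def field_simps)
  then have one: "(1 / (1 - snd (stereo z))) * (2 / ((cmod z)\<^sup>2 + 1)) = 1"
    using one_plus_square_pos[of z] by simp
  have "fst (stereo z) = (2 / ((cmod z)\<^sup>2 + 1)) *\<^sub>R z" by (simp add: stereo_def)
  then have "unstereo (stereo z) = ((1 / (1 - snd (stereo z))) * (2 / ((cmod z)\<^sup>2 + 1))) *\<^sub>R z"
    unfolding unstereo_def by (simp only: scaleR_scaleR)
  then show ?thesis unfolding one by simp
qed

lemma stereo_unstereo:
  assumes "p \<in> sphere 0 1" "snd p \<noteq> 1" shows "stereo (unstereo p) = p"
proof -
  obtain u t where p: "p = (u, t)" by fastforce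
  have "(cmod u)\<^sup>2 + t\<^sup>2 = 1" using assms(1) p by (simp add: norm_Pair)
  then have ut: "(cmod u)\<^sup>2 = (1 - t) * (1 + t)" by (simp add: power2_eq_square algebra_simps)
  have t: "1 - t \<noteq> 0" using assms(2) p by simp
  have "(cmod (unstereo p))\<^sup>2 = (cmod u)\<^sup>2 / (1 - t)\<^sup>2"
    by (simp add: unstereo_def p power_divide)
  also have "\<dots> = (1 + t) / (1 - t)" unfolding ut using t by (simp add: power2_eq_square)
  finally have n: "(cmod (unstereo p))\<^sup>2 = (1 + t) / (1 - t)" .
  have n1: "(cmod (unstereo p))\<^sup>2 + 1 = 2 / (1 - t)" unfolding n using t by (simp add: field_simps)
  have n2: "(cmod (unstereo p))\<^sup>2 - 1 = 2 * t / (1 - t)" unfolding n using t by (simp add: field_simps)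
  have "stereo (unstereo p) = ((1 - t) *\<^sub>R unstereo p, t)"
    unfolding stereo_def n1 n2 using t by simp
  also have "\<dots> = p" using t by (simp add: unstereo_def p)
  finally show ?thesis .
qed

lemma stereo_image_iff:
  assumes "p \<in> sphere 0 1" shows "p \<in> stereo ` B \<longleftrightarrow> snd p \<noteq> 1 \<and> unstereo p \<in> B"
proof
  assume "p \<in> stereo ` B"
  then show "snd p \<noteq> 1 \<and> unstereo p \<in> B" using snd_stereo unstereo_stereo by auto
next
  assume "snd p \<noteq> 1 \<and> unstereo p \<in> B"
  then show "p \<in> stereo ` B" using stereo_unstereo[OF assms] by (metis image_eqI)
qed

lemma continuous_on_stereo: "continuous_on UNIV stereo"
  unfolding stereo_def using one_plus_square_pos
  by (intro continuous_intros) (metis less_irrefl)+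

lemma continuous_on_unstereo: "continuous_on {p. snd p \<noteq> 1} unstereo"
  unfolding unstereo_def by (intro continuous_intros) auto

lemma open_unstereo_vimage:
  assumes "open U" shows "open {p. snd p \<noteq> 1 \<and> unstereo p \<in> U}"
proof -
  have "open {p :: complex \<times> real. snd p \<noteq> 1}"
    by (intro open_Collect_neq continuous_intros)
  then have "open (unstereo -` U \<inter> {p. snd p \<noteq> 1})"
    using continuous_on_open_vimage continuous_on_unstereo assms by blast
  moreover have "unstereo -` U \<inter> {p. snd p \<noteq> 1} = {p. snd p \<noteq> 1 \<and> unstereo p \<in> U}" by auto
  ultimately show ?thesis by simp
qed

section \<open>Separation: the quotient is Hausdorff\<close>

lemma topspace_holed_sphere: "topspace (holed_sphere m) = sphere 0 1 - stereo ` (\<Union>k<m. ball (centre k) 1)"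
  by (simp add: holed_sphere_def)

lemma stereo_in_holed_sphere: "stereo w \<in> topspace (holed_sphere m) \<longleftrightarrow> (\<forall>k<m. w \<notin> ball (centre k) 1)"
  unfolding topspace_holed_sphere using stereo_in_sphere[of w]
  by (auto simp: inj_image_mem_iff[OF inj_stereo])

lemma compact_holed_sphere: "compact (topspace (holed_sphere m))"
proof -
  have "open (stereo ` (\<Union>k<m. ball (centre k) 1) \<union> - sphere 0 1)"
  proof -
    have "stereo ` (\<Union>k<m. ball (centre k) 1) \<union> - sphere 0 1
        = {p. snd p \<noteq> 1 \<and> unstereo p \<in> (\<Union>k<m. ball (centre k) 1)} \<union> - sphere 0 1"
      using stereo_image_iff by blast
    moreover have "open {p. snd p \<noteq> 1 \<and> unstereo p \<in> (\<Union>k<m. ball (centre k) 1)}"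
      by (rule open_unstereo_vimage) auto
    moreover have "open (- sphere (0 :: complex \<times> real) 1)" by auto
    ultimately show ?thesis by (simp only: open_Un)
  qed
  then have "closed (- (stereo ` (\<Union>k<m. ball (centre k) 1) \<union> - sphere 0 1))" by blast
  moreover have "- (stereo ` (\<Union>k<m. ball (centre k) 1) \<union> - sphere 0 1)
      = topspace (holed_sphere m)" by (auto simp: topspace_holed_sphere)
  ultimately have "closed (topspace (holed_sphere m))" by simp
  moreover have "topspace (holed_sphere m) \<subseteq> sphere 0 1" by (auto simp: topspace_holed_sphere)
  ultimately show ?thesis using compact_sphere by (metis closed_Int_compact inf.absorb1)
qed

text \<open>The relation is a finite union of continuous images of compact sets: the diagonal of the
  holed sphere and one circle for each hole.\<close>

lemma compact_sewing: "compact (sewing h c)"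
proof -
  let ?g = "\<lambda>k z. (stereo (centre k + z), stereo (centre (sewn_index h k) + sewn_map h k z))"
  have "{(stereo w, stereo w') | w w'. sewn h c w w'} = (\<Union>k<2 * h + c. ?g k ` sphere 0 1)"
  proof (intro set_eqI iffI)
    fix p assume "p \<in> {(stereo w, stereo w') | w w'. sewn h c w w'}"
    then obtain w w' where p: "p = (stereo w, stereo w')" "sewn h c w w'" by blast
    then obtain k z where kz: "k < 2 * h + c" "cmod z = 1" "w = centre k + z"
      "w' = centre (sewn_index h k) + sewn_map h k z" unfolding sewn_iff by blast
    then have "p \<in> ?g k ` sphere 0 1" unfolding p(1) by (intro image_eqI[of _ _ z]) auto
    then show "p \<in> (\<Union>k<2 * h + c. ?g k ` sphere 0 1)" using kz(1) by blast
  next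
    fix p assume "p \<in> (\<Union>k<2 * h + c. ?g k ` sphere 0 1)"
    then obtain k z where kz: "k < 2 * h + c" "z \<in> sphere 0 1" "p = ?g k z" by blast
    then have "sewn h c (centre k + z) (centre (sewn_index h k) + sewn_map h k z)"
      unfolding sewn_iff by auto
    then show "p \<in> {(stereo w, stereo w') | w w'. sewn h c w w'}" unfolding kz(3) by blast
  qed
  moreover have "Id_on (topspace (holed_sphere (2 * h + c))) = (\<lambda>p. (p, p)) ` topspace (holed_sphere (2 * h + c))"
    by (auto simp: Id_on_def)
  ultimately have eqS: "sewing h c = (\<lambda>p. (p, p)) ` topspace (holed_sphere (2 * h + c)) \<union> (\<Union>k<2 * h + c. ?g k ` sphere 0 1)"
    unfolding sewing_def by simp
  have cId: "compact ((\<lambda>p. (p, p)) ` topspace (holed_sphere (2 * h + c)))"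
    by (intro compact_continuous_image continuous_intros compact_holed_sphere)
  have cg: "compact (?g k ` sphere 0 1)" for k
  proof (intro compact_continuous_image compact_sphere continuous_on_Pair)
    have c1: "continuous_on A (\<lambda>z. stereo (F z))" if "continuous_on A F" for A :: "complex set" and F
      using continuous_on_compose2[OF continuous_on_stereo that] by simp
    show "continuous_on (sphere 0 1) (\<lambda>z. stereo (centre k + z))" by (intro c1 continuous_intros)
    have "continuous_on (sphere 0 1) (sewn_map h k)"
      by (rule continuous_on_subset[OF continuous_on_sewn_map]) auto
    then show "continuous_on (sphere 0 1) (\<lambda>z. stereo (centre (sewn_index h k) + sewn_map h k z))"
      by (intro c1 continuous_intros)
  qed
  show ?thesis unfolding eqS by (intro compact_Un compact_UN finite_lessThan cId cg)
qed

text \<open>The saturation of a closed set \<open>C\<close> is the projection of the compact set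
  \<open>sewing h c \<inter> (UNIV \<times> C)\<close>, so the quotient map is closed; a closed
  continuous image of a normal Hausdorff space is Hausdorff.\<close>

lemma Hausdorff_closed_surface: "Hausdorff_space (closed_surface h c)"
proof -
  let ?X = "holed_sphere (2 * h + c)"
  let ?q = "\<lambda>p. sewing h c `` {p}"
  have qm: "quotient_map ?X (closed_surface h c) ?q" by (rule quotient_map_closed_surface)
  have X: "?X = top_of_set (topspace ?X)" unfolding holed_sphere_def by simp
  have met: "metrizable_space ?X"
    by (subst X) (intro metrizable_space_subtopology metrizable_space_euclidean)
  have eqv: "equiv (topspace ?X) (sewing h c)" by (rule equiv_sewing)
  have "closed_map ?X (closed_surface h c) ?q"
    unfolding closed_map_def
  proof (intro allI impI)
    fix C assume C: "closedin ?X C"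
    then have CX: "C \<subseteq> topspace ?X" by (rule closedin_subset)
    have "compact C"
    proof -
      have "closedin (top_of_set (topspace ?X)) C" using C X by metis
      then show ?thesis using compact_holed_sphere closedin_compact by blast
    qed
    define P where "P = {p \<in> topspace ?X. ?q p \<in> ?q ` C}"
    have "P = fst ` (sewing h c \<inter> (UNIV \<times> C))"
    proof
      show "P \<subseteq> fst ` (sewing h c \<inter> (UNIV \<times> C))"
      proof
        fix p assume "p \<in> P"
        then obtain x where x: "x \<in> C" "?q p = ?q x" "p \<in> topspace ?X" unfolding P_def by auto
        then have "(p, x) \<in> sewing h c" using eq_equiv_class[OF x(2) eqv] CX by blast
        then show "p \<in> fst ` (sewing h c \<inter> (UNIV \<times> C))" using x(1) by force
      qed
      show "fst ` (sewing h c \<inter> (UNIV \<times> C)) \<subseteq> P"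
      proof
        fix p assume "p \<in> fst ` (sewing h c \<inter> (UNIV \<times> C))"
        then obtain x where x: "(p, x) \<in> sewing h c" "x \<in> C" by auto
        then have "?q p = ?q x" using equiv_class_eq[OF eqv] by simp
        moreover have "p \<in> topspace ?X" using x(1) eqv unfolding equiv_def refl_on_def by blast
        ultimately show "p \<in> P" using x(2) unfolding P_def by blast
      qed
    qed
    moreover have "compact (fst ` (sewing h c \<inter> (UNIV \<times> C)))"
    proof (intro compact_continuous_image continuous_intros)
      have "closed (UNIV \<times> C :: ((complex \<times> real) \<times> (complex \<times> real)) set)"
        using \<open>compact C\<close> by (intro closed_Times closed_UNIV compact_imp_closed)
      then show "compact (sewing h c \<inter> (UNIV \<times> C))" using compact_sewing by (metis compact_Int_closed)
    qed
    ultimately have "closed P" by (simp add: compact_imp_closed)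
    then have "closedin ?X P" by (subst X) (auto simp: closedin_closed P_def)
    moreover have "?q ` C \<subseteq> topspace (closed_surface h c)"
      using qm CX unfolding quotient_map_def by blast
    ultimately show "closedin (closed_surface h c) (?q ` C)"
      using qm unfolding quotient_map_closedin P_def by blast
  qed
  moreover have "continuous_map ?X (closed_surface h c) ?q" "?q ` topspace ?X = topspace (closed_surface h c)"
    using qm quotient_imp_continuous_map quotient_imp_surjective_map by blast+
  ultimately show ?thesis
    using normal_Hausdorff_space_closed_continuous_map_image metrizable_imp_normal_space[OF met]
      metrizable_imp_Hausdorff_space[OF met] by blast
qed

section \<open>Charts of the closed surfaces\<close>

lemma openin_closed_surface:
  assumes "U \<subseteq> topspace (closed_surface h c)" "open W"
    "{p \<in> topspace (holed_sphere (2 * h + c)). sewing h c `` {p} \<in> U} = topspace (holed_sphere (2 * h + c)) \<inter> W"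
  shows "openin (closed_surface h c) U"
proof -
  have "openin (top_of_set (topspace (holed_sphere (2 * h + c)))) (topspace (holed_sphere (2 * h + c)) \<inter> W)"
    using assms(2) by (rule openin_open_Int)
  moreover have "top_of_set (topspace (holed_sphere (2 * h + c))) = holed_sphere (2 * h + c)"
    unfolding holed_sphere_def by simp
  ultimately have "openin (holed_sphere (2 * h + c)) {p \<in> topspace (holed_sphere (2 * h + c)). sewing h c `` {p} \<in> U}"
    using assms(3) by simp
  then show ?thesis using quotient_map_closed_surface[of h c] assms(1) unfolding quotient_map_def by blast
qed

lemma sewing_class_eq_iff:
  assumes "p \<in> topspace (holed_sphere (2 * h + c))" "q \<in> topspace (holed_sphere (2 * h + c))"
  shows "sewing h c `` {p} = sewing h c `` {q} \<longleftrightarrow> p = q \<or> (\<exists>w w'. p = stereo w \<and> q = stereo w' \<and> sewn h c w w')"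
proof -
  have "sewing h c `` {p} = sewing h c `` {q} \<longleftrightarrow> (p, q) \<in> sewing h c"
    using eq_equiv_class_iff[OF equiv_sewing] assms by blast
  also have "\<dots> \<longleftrightarrow> p = q \<or> (\<exists>w w'. p = stereo w \<and> q = stereo w' \<and> sewn h c w w')"
    using assms unfolding sewing_def by auto
  finally show ?thesis .
qed

lemma sewing_class_in_surface:
  "p \<in> topspace (holed_sphere (2 * h + c)) \<Longrightarrow> sewing h c `` {p} \<in> topspace (closed_surface h c)"
  using quotient_map_closed_surface[of h c] unfolding quotient_map_def by blast

text \<open>Away from the closed discs every class is a singleton and the sphere itself provides the
  chart. The involution \<open>F\<close> will be the identity, or the reflection in the equator,
  which brings the north pole missed by \<open>stereo\<close> into view.\<close>

lemma interior_chart: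
  assumes F: "continuous_on UNIV F" "\<And>p. F (F p) = p" "\<And>p. p \<in> sphere 0 1 \<Longrightarrow> F p \<in> sphere 0 1"
    and w0: "F (stereo w0) \<notin> stereo ` (\<Union>k<2 * h + c. cball (centre k) 1)"
  shows "\<exists>\<psi>. chart (closed_surface h c) \<psi> \<and> \<psi> 0 = sewing h c `` {F (stereo w0)}"
proof -
  define Z where "Z = stereo ` (\<Union>k<2 * h + c. cball (centre k) 1)"
  define D where "D = {w. F (stereo w) \<notin> Z}"
  let ?X = "holed_sphere (2 * h + c)"
  let ?q = "\<lambda>p. sewing h c `` {p}"
  have contF: "continuous_on UNIV (\<lambda>w. F (stereo w))"
    by (rule continuous_on_compose2[OF F(1) continuous_on_stereo]) auto
  have "compact Z" unfolding Z_def
    by (intro compact_continuous_image compact_UN continuous_on_subset[OF continuous_on_stereo]) auto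
  then have "closed ((\<lambda>w. F (stereo w)) -` Z)"
    using contF by (metis closed_vimage compact_imp_closed)
  moreover have "D = - ((\<lambda>w. F (stereo w)) -` Z)" by (auto simp: D_def)
  ultimately have D: "open D" by (metis open_Compl)
  have inX: "F (stereo w) \<in> topspace ?X" if "w \<in> D" for w
  proof -
    have "stereo ` (\<Union>k<2 * h + c. ball (centre k) 1) \<subseteq> Z"
      unfolding Z_def by (intro image_mono UN_mono) auto
    then show ?thesis using that F(3)[OF stereo_in_sphere] unfolding D_def topspace_holed_sphere by blast
  qed
  have single: "p = F (stereo w)" if w: "w \<in> D" and p: "p \<in> topspace ?X" and eq: "?q p = ?q (F (stereo w))" for p w
  proof (rule ccontr)
    assume "p \<noteq> F (stereo w)"
    then obtain v v' where v: "F (stereo w) = stereo v'" "sewn h c v v'"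
      using eq sewing_class_eq_iff[OF p inX[OF w]] by blast
    obtain k z where "k < 2 * h + c" "cmod z = 1" "v' = centre k + z"
      using sewn_on_circle[OF sewn_sym[OF v(2)]] by blast
    then have "v' \<in> cball (centre k) 1" by (simp add: dist_norm)
    then have "v' \<in> (\<Union>k<2 * h + c. cball (centre k) 1)" using \<open>k < 2 * h + c\<close> by blast
    then have "F (stereo w) \<in> Z" unfolding v(1) Z_def by (rule imageI)
    then show False using w unfolding D_def by simp
  qed
  show ?thesis
  proof (rule chart_of_local[OF D, of w0 _ "\<lambda>w. ?q (F (stereo w))", simplified])
    show "w0 \<in> D" using w0 unfolding D_def Z_def by simp
    have "continuous_map (top_of_set D) ?X (\<lambda>w. F (stereo w))"
      unfolding holed_sphere_def
      using inX continuous_on_subset[OF contF, of D] unfolding topspace_holed_sphere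
      by (auto simp: continuous_map_in_subtopology)
    from continuous_map_compose[OF this quotient_imp_continuous_map[OF quotient_map_closed_surface]]
    show "continuous_map (top_of_set D) (closed_surface h c) (\<lambda>w. ?q (F (stereo w)))" by (simp add: o_def)
    show "inj_on (\<lambda>w. ?q (F (stereo w))) D"
    proof (rule inj_onI)
      fix x y assume xy: "x \<in> D" "y \<in> D" "?q (F (stereo x)) = ?q (F (stereo y))"
      then have "F (stereo x) = F (stereo y)" using single inX by blast
      then show "x = y" using F(2) inj_stereo by (metis injD)
    qed
    fix U assume U: "open U" "U \<subseteq> D"
    have "F -` {p. snd p \<noteq> 1 \<and> unstereo p \<in> U} = {p. snd (F p) \<noteq> 1 \<and> unstereo (F p) \<in> U}" by auto
    moreover have "open (F -` {p. snd p \<noteq> 1 \<and> unstereo p \<in> U})"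
      using open_vimage[OF open_unstereo_vimage[OF U(1)] F(1)] .
    ultimately have op: "open {p. snd (F p) \<noteq> 1 \<and> unstereo (F p) \<in> U}" by simp
    show "openin (closed_surface h c) ((\<lambda>w. ?q (F (stereo w))) ` U)"
    proof (rule openin_closed_surface[OF _ op])
      show "(\<lambda>w. ?q (F (stereo w))) ` U \<subseteq> topspace (closed_surface h c)"
        using sewing_class_in_surface inX U by blast
      show "{p \<in> topspace ?X. ?q p \<in> (\<lambda>w. ?q (F (stereo w))) ` U}
          = topspace ?X \<inter> {p. snd (F p) \<noteq> 1 \<and> unstereo (F p) \<in> U}"
      proof (intro set_eqI iffI)
        fix p assume "p \<in> {p \<in> topspace ?X. ?q p \<in> (\<lambda>w. ?q (F (stereo w))) ` U}"
        then obtain w where w: "w \<in> U" "p \<in> topspace ?X" "?q p = ?q (F (stereo w))" by auto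
        then have "p = F (stereo w)" using single[of w p] U by blast
        then show "p \<in> topspace ?X \<inter> {p. snd (F p) \<noteq> 1 \<and> unstereo (F p) \<in> U}"
          using w F(2) by (simp add: snd_stereo unstereo_stereo)
      next
        fix p assume p: "p \<in> topspace ?X \<inter> {p. snd (F p) \<noteq> 1 \<and> unstereo (F p) \<in> U}"
        then have "p \<in> sphere 0 1" unfolding topspace_holed_sphere by blast
        then have "stereo (unstereo (F p)) = F p" using stereo_unstereo F(3) p by blast
        then have "F (stereo (unstereo (F p))) = p" using F(2) by simp
        then show "p \<in> {p \<in> topspace ?X. ?q p \<in> (\<lambda>w. ?q (F (stereo w))) ` U}"
          using p by (auto intro!: image_eqI[of _ _ "unstereo (F p)"])
      qed
    qed
  qed
qed

lemma sewn_index_less: "k < 2 * h + c \<Longrightarrow> sewn_index h k < 2 * h + c"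
proof -
  assume k: "k < 2 * h + c"
  show ?thesis
  proof (cases "k < 2 * h \<and> even k")
    case True
    then obtain j where "k = 2 * j" by (auto elim: evenE)
    then show ?thesis using True unfolding sewn_index_def by simp
  qed (use k in \<open>auto simp: sewn_index_def\<close>)
qed

lemma centre_far:
  assumes "cmod x + cmod y < 3" "centre k + x = centre l + y" shows "k = l"
proof (rule ccontr)
  assume "k \<noteq> l"
  then have "3 \<le> dist (centre k) (centre l)" by (rule dist_centre)
  also have "centre k - centre l = y - x" using assms(2) by (simp add: algebra_simps)
  then have "dist (centre k) (centre l) \<le> cmod y + cmod x"
    unfolding dist_norm by (metis norm_triangle_ineq4)
  finally show False using assms(1) by simp
qed

lemma annulus_in_holed_sphere:
  assumes "1 \<le> cmod x" "cmod x < 2" shows "stereo (centre k + x) \<in> topspace (holed_sphere m)"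
  unfolding stereo_in_holed_sphere
proof (intro allI impI notI)
  fix l assume l: "centre k + x \<in> ball (centre l) 1"
  define y where "y = centre k + x - centre l"
  have y: "cmod y < 1" using l by (simp add: y_def dist_norm norm_minus_commute)
  have "k = l" by (rule centre_far[of x y]) (use y assms in \<open>auto simp: y_def\<close>)
  then show False using y assms by (simp add: y_def)
qed

text \<open>One part of a small disc around \<open>z0\<close> lies outside the unit circle and is
  used as it is; \<open>J\<close> turns the other part out into the neighbourhood of the partner
  circle. The two parts agree on the circle because it is sewn by \<open>J\<close>.\<close>

lemma seam_chart:
  assumes k: "k < 2 * h + c" and z0: "cmod z0 = 1"
  shows "\<exists>\<psi>. chart (closed_surface h c) \<psi> \<and> \<psi> 0 = sewing h c `` {stereo (centre k + z0)}"
proof -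
  let ?X = "holed_sphere (2 * h + c)"
  let ?q = "\<lambda>p. sewing h c `` {p}"
  define k' where "k' = sewn_index h k"
  define J where "J = sewn_map h k"
  have JJ: "J (J u) = u" and Jn: "cmod (J u) = inverse (cmod u)" for u
    unfolding J_def by (simp_all add: sewn_map_simps)
  have kk: "J u = - inverse (cnj u)" if "k = k'" for u
    using that unfolding J_def k'_def sewn_index_def sewn_map_def
    by (auto split: if_splits dest: odd_pos)
  \<comment> \<open>Radius 1/4 keeps \<open>cmod u\<close> between 3/4 and 5/4, and
    \<open>cmod (J u)\<close> below 4/3 on the inner part. So all images stay in the annulus between
    the radii 1 and 2 around their centre, which no removed disc meets.\<close>
  define D where "D = ball z0 (1 / 4)"
  have Dn: "3 / 4 < cmod u" "cmod u < 5 / 4" if "u \<in> D" for u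
  proof -
    have d: "cmod (u - z0) < 1 / 4" using that by (simp add: D_def dist_norm norm_minus_commute)
    show "3 / 4 < cmod u" "cmod u < 5 / 4"
      using norm_triangle_ineq2[of z0 u] norm_triangle_ineq2[of u z0] d z0 by (auto simp: norm_minus_commute)
  qed
  \<comment> \<open>\<open>D\<close> lies in an open half-plane bounded by a line through 0. For a
    cross-cap \<open>J\<close> maps it into the opposite half-plane, so sewing cannot identify two
    different points of \<open>D\<close>; this is used in \<open>injneg\<close>.\<close>
  have DRe: "Re (u * cnj z0) > 0" if "u \<in> D" for u
  proof -
    have d: "cmod (u - z0) < 1 / 4" using that by (simp add: D_def dist_norm norm_minus_commute)
    have "u * cnj z0 = z0 * cnj z0 + (u - z0) * cnj z0" by (simp add: algebra_simps)
    moreover have "z0 * cnj z0 = 1" using complex_norm_square[of z0] z0 by simp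
    ultimately have "Re (u * cnj z0) = 1 + Re ((u - z0) * cnj z0)" by (metis plus_complex.simps(1) one_complex.simps(1))
    moreover have "\<bar>Re ((u - z0) * cnj z0)\<bar> \<le> cmod ((u - z0) * cnj z0)" by (rule abs_Re_le_cmod)
    then have "\<bar>Re ((u - z0) * cnj z0)\<bar> < 1 / 4" using d z0 by (simp add: norm_mult)
    ultimately show ?thesis by linarith
  qed
  have Jbig: "1 \<le> cmod (J u)" "cmod (J u) < 4 / 3" if "u \<in> D" "cmod u \<le> 1" for u
  proof -
    have pos: "0 < cmod u" using Dn[OF that(1)] by linarith
    show "1 \<le> cmod (J u)" unfolding Jn using one_le_inverse[OF pos that(2)] .
    have "inverse (cmod u) < inverse (3 / 4)" using Dn(1)[OF that(1)] by (intro less_imp_inverse_less) auto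
    then show "cmod (J u) < 4 / 3" unfolding Jn by simp
  qed
  define f where "f u = (if 1 \<le> cmod u then ?q (stereo (centre k + u)) else ?q (stereo (centre k' + J u)))" for u
  have in1: "stereo (centre k + u) \<in> topspace ?X" if "u \<in> D" "1 \<le> cmod u" for u
    by (rule annulus_in_holed_sphere) (use Dn[OF that(1)] that in auto)
  have in2: "stereo (centre k' + J u) \<in> topspace ?X" if "u \<in> D" "cmod u \<le> 1" for u
    by (rule annulus_in_holed_sphere) (use Jbig[OF that] in auto)
  have sew: "sewn h c (centre k + u) (centre k' + J u)" if "cmod u = 1" for u
    unfolding sewn_iff k'_def J_def using that k by blast
  have agree: "?q (stereo (centre k + u)) = ?q (stereo (centre k' + J u))" if "u \<in> D" "cmod u = 1" for u
  proof -
    have "1 \<le> cmod u" "cmod u \<le> 1" using that by auto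
    then show ?thesis
      using sewing_class_eq_iff[OF in1[OF that(1)] in2[OF that(1)]] sew[OF that(2)] by blast
  qed
  have circ: "l = i \<and> cmod x = 1 \<and> x = y" if "centre l + x = centre i + y" "cmod y = 1" "cmod x < 2" for l i x y
    using centre_far[of x y l i] that by auto
  have same1: "cmod u = 1 \<and> w' = centre k' + J u" if s: "sewn h c (centre k + u) w'" and u: "u \<in> D" for u w'
  proof -
    obtain l z where "cmod z = 1" "centre k + u = centre l + z" using sewn_on_circle[OF s] by blast
    then have "cmod u = 1" using circ[of k u l z] Dn[OF u] by auto
    then show ?thesis using sewn_unique[OF s sew] by blast
  qed
  have same2: "cmod u = 1" if s: "sewn h c (centre k' + J u) w'" and u: "u \<in> D" "cmod u \<le> 1" for u w'
  proof -
    obtain l z where "cmod z = 1" "centre k' + J u = centre l + z" using sewn_on_circle[OF s] by blast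
    then have "cmod (J u) = 1" using circ[of k' "J u" l z] Jbig[OF u] by auto
    then show ?thesis unfolding Jn by simp
  qed
  have injneg: "\<not> (k = k' \<and> u = J u')" if u: "u \<in> D" "u' \<in> D" for u u'
  proof
    assume a: "k = k' \<and> u = J u'"
    have "u' \<noteq> 0" using Dn[OF u(2)] by auto
    then have "J u' * (u' * cnj u') = - u'" using kk[of u'] a by simp
    then have "J u' * of_real ((cmod u')\<^sup>2) = - u'" by (simp only: complex_norm_square)
    then have "(J u' * of_real ((cmod u')\<^sup>2)) * cnj z0 = - (u' * cnj z0)" by (simp only: mult_minus_left)
    moreover have "(u * cnj z0) * of_real ((cmod u')\<^sup>2) = (J u' * of_real ((cmod u')\<^sup>2)) * cnj z0"
      using a by (simp only: mult_ac)
    ultimately have "(u * cnj z0) * of_real ((cmod u')\<^sup>2) = - (u' * cnj z0)" by (simp only:)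
    then have "Re ((u * cnj z0) * of_real ((cmod u')\<^sup>2)) = - Re (u' * cnj z0)" by (metis uminus_complex.simps(1))
    moreover have "Re ((u * cnj z0) * of_real ((cmod u')\<^sup>2)) = Re (u * cnj z0) * (cmod u')\<^sup>2" for u
      by (simp only: times_complex.simps Re_complex_of_real Im_complex_of_real mult_zero_right diff_zero)
    ultimately have "Re (u * cnj z0) * (cmod u')\<^sup>2 = - Re (u' * cnj z0)" by metis
    moreover have "Re (u * cnj z0) * (cmod u')\<^sup>2 > 0" using DRe[OF u(1)] \<open>u' \<noteq> 0\<close> by (intro mult_pos_pos) auto
    ultimately show False using DRe[OF u(2)] by linarith
  qed
  have out_out: "u = u'" if u: "u \<in> D" "u' \<in> D" "1 \<le> cmod u" "1 \<le> cmod u'"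
    and eq: "?q (stereo (centre k + u)) = ?q (stereo (centre k + u'))" for u u'
  proof (rule ccontr)
    assume "u \<noteq> u'"
    then have "stereo (centre k + u) \<noteq> stereo (centre k + u')" using inj_stereo by (auto dest: injD)
    then obtain v v' where "stereo (centre k + u) = stereo v" "stereo (centre k + u') = stereo v'" "sewn h c v v'"
      using eq sewing_class_eq_iff[OF in1[OF u(1,3)] in1[OF u(2,4)]] by blast
    then have s: "sewn h c (centre k + u) (centre k + u')" using inj_stereo by (metis injD)
    then have e: "cmod u = 1" "centre k + u' = centre k' + J u" using same1 u by blast+
    then have "k = k' \<and> u' = J u" using circ[of k u' k' "J u"] Dn[OF u(2)] Jn[of u] by auto
    then show False using injneg u by blast
  qed
  have in_in: "u = u'" if u: "u \<in> D" "u' \<in> D" "cmod u < 1" "cmod u' < 1"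
    and eq: "?q (stereo (centre k' + J u)) = ?q (stereo (centre k' + J u'))" for u u'
  proof (rule ccontr)
    assume "u \<noteq> u'"
    then have "J u \<noteq> J u'" using JJ by metis
    then have "stereo (centre k' + J u) \<noteq> stereo (centre k' + J u')" using inj_stereo by (auto dest: injD)
    then obtain v v' where "stereo (centre k' + J u) = stereo v" "stereo (centre k' + J u') = stereo v'" "sewn h c v v'"
      using eq sewing_class_eq_iff[OF in2[OF u(1)] in2[OF u(2)]] u(3,4) by auto
    then have "sewn h c (centre k' + J u) v'" using inj_stereo by (metis injD)
    then have "cmod u = 1" using same2 u by auto
    then show False using u by simp
  qed
  have out_in: False if u: "u \<in> D" "u' \<in> D" "1 \<le> cmod u" "cmod u' < 1"
    and eq: "?q (stereo (centre k + u)) = ?q (stereo (centre k' + J u'))" for u u'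
  proof (cases "stereo (centre k + u) = stereo (centre k' + J u')")
    case True
    then have "centre k + u = centre k' + J u'" using inj_stereo by (auto dest: injD)
    moreover have "cmod (J u') < 4 / 3" using Jbig u by simp
    ultimately have "k = k'" using centre_far[of u "J u'" k k'] Dn[OF u(1)] by simp
    then show False using injneg[OF u(1,2)] \<open>centre k + u = centre k' + J u'\<close> by simp
  next
    case False
    then obtain v v' where "stereo (centre k' + J u') = stereo v'" "sewn h c v v'"
      using eq sewing_class_eq_iff[OF in1[OF u(1,3)] in2[OF u(2)]] u(4) by auto
    then have "sewn h c (centre k' + J u') v" using inj_stereo sewn_sym by (metis injD)
    then have "cmod u' = 1" using same2 u by auto
    then show False using u by simp
  qed
  have contq: "continuous_map ?X (closed_surface h c) ?q"
    by (rule quotient_imp_continuous_map[OF quotient_map_closed_surface])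
  have contX: "continuous_map (top_of_set A) (closed_surface h c) (\<lambda>u. ?q (stereo (G u)))"
    if G: "continuous_on A G" "\<And>u. u \<in> A \<Longrightarrow> stereo (G u) \<in> topspace ?X" for A :: "complex set" and G
  proof -
    have "continuous_on A (\<lambda>u. stereo (G u))" by (rule continuous_on_compose2[OF continuous_on_stereo G(1)]) auto
    then have "continuous_map (top_of_set A) ?X (\<lambda>u. stereo (G u))"
      using G(2) unfolding holed_sphere_def topspace_holed_sphere
      by (auto simp: continuous_map_in_subtopology)
    from continuous_map_compose[OF this contq] show ?thesis by (simp add: o_def)
  qed
  have "\<exists>\<psi>. chart (closed_surface h c) \<psi> \<and> \<psi> 0 = f z0"
  proof (rule chart_of_local)
    show "open D" "z0 \<in> D" unfolding D_def by auto
    show "continuous_map (top_of_set D) (closed_surface h c) f"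
      unfolding f_def
    proof (rule continuous_map_cases_le)
      show "continuous_map (top_of_set D) euclideanreal (\<lambda>u. 1)" by simp
      show "continuous_map (top_of_set D) euclideanreal cmod" by (simp add: continuous_on_norm_id)
      have e1: "subtopology (top_of_set D) {u \<in> topspace (top_of_set D). 1 \<le> cmod u} = top_of_set {u \<in> D. 1 \<le> cmod u}"
        by (simp add: subtopology_subtopology Int_def)
      show "continuous_map (subtopology (top_of_set D) {u \<in> topspace (top_of_set D). 1 \<le> cmod u}) (closed_surface h c)
          (\<lambda>u. ?q (stereo (centre k + u)))"
        unfolding e1 by (rule contX) (auto intro!: continuous_intros in1)
      have e2: "subtopology (top_of_set D) {u \<in> topspace (top_of_set D). cmod u \<le> 1} = top_of_set {u \<in> D. cmod u \<le> 1}"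
        by (simp add: subtopology_subtopology Int_def)
      have "continuous_on {u \<in> D. cmod u \<le> 1} J"
        unfolding J_def by (rule continuous_on_subset[OF continuous_on_sewn_map]) (use Dn in force)
      then show "continuous_map (subtopology (top_of_set D) {u \<in> topspace (top_of_set D). cmod u \<le> 1}) (closed_surface h c)
          (\<lambda>u. ?q (stereo (centre k' + J u)))"
        unfolding e2 by (intro contX continuous_intros in2) auto
      show "?q (stereo (centre k + u)) = ?q (stereo (centre k' + J u))" if "u \<in> topspace (top_of_set D)" "1 = cmod u" for u
        using agree that by simp
    qed
    show "inj_on f D"
    proof (rule inj_onI)
      fix u u' assume u: "u \<in> D" "u' \<in> D" "f u = f u'"
      show "u = u'"
      proof (cases "1 \<le> cmod u")
        case True
        show ?thesis
        proof (cases "1 \<le> cmod u'")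
          case True then show ?thesis using out_out[OF u(1,2)] u(3) \<open>1 \<le> cmod u\<close> unfolding f_def by simp
        next
          case False then show ?thesis using out_in[OF u(1,2)] u(3) \<open>1 \<le> cmod u\<close> unfolding f_def by simp
        qed
      next
        case f: False
        show ?thesis
        proof (cases "1 \<le> cmod u'")
          case True then show ?thesis using out_in[OF u(2,1)] u(3) f unfolding f_def by simp
        next
          case False then show ?thesis using in_in[OF u(1,2)] u(3) f unfolding f_def by simp
        qed
      qed
    qed
    fix U assume U: "open U" "U \<subseteq> D"
    \<comment> \<open>The points whose class lies in the image of \<open>U\<close> are found near
      the circle \<open>k\<close> and near its partner; each case is an open condition on the
      stereographic coordinate.\<close>
    define W1 where "W1 = {p. snd p \<noteq> 1 \<and> unstereo p \<in> (\<lambda>w. w - centre k) -` U}"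
    define W2 where "W2 = {p. snd p \<noteq> 1 \<and> unstereo p \<in> {w. w \<noteq> centre k' \<and> J (w - centre k') \<in> U}}"
    have "open W1" unfolding W1_def
      by (intro open_unstereo_vimage open_vimage U(1) continuous_intros)
    have "open (J -` U \<inter> - {0})"
      using continuous_on_open_vimage[of "- {0}" J] continuous_on_sewn_map[of h k] U(1) unfolding J_def by blast
    then have "open ((\<lambda>w. w - centre k') -` (J -` U \<inter> - {0}))"
      by (intro open_vimage continuous_intros)
    moreover have "(\<lambda>w. w - centre k') -` (J -` U \<inter> - {0}) = {w. w \<noteq> centre k' \<and> J (w - centre k') \<in> U}" by auto
    ultimately have "open W2" unfolding W2_def by (intro open_unstereo_vimage) simp
    show "openin (closed_surface h c) (f ` U)"
    proof (rule openin_closed_surface[OF _ open_Un[OF \<open>open W1\<close> \<open>open W2\<close>]])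
      have fS: "f u \<in> topspace (closed_surface h c)" if "u \<in> D" for u
        unfolding f_def using sewing_class_in_surface[OF in1[OF that]] sewing_class_in_surface[OF in2[OF that]] by auto
      then show "f ` U \<subseteq> topspace (closed_surface h c)" using U(2) by blast
      show "{p \<in> topspace ?X. ?q p \<in> f ` U} = topspace ?X \<inter> (W1 \<union> W2)"
      proof (intro set_eqI iffI)
        fix p assume "p \<in> {p \<in> topspace ?X. ?q p \<in> f ` U}"
        then obtain u where u: "u \<in> U" "p \<in> topspace ?X" "?q p = f u" by auto
        have uD: "u \<in> D" using u U by blast
        have w1: "p \<in> W1" if "p = stereo (centre k + u)"
          using that u(1) unfolding W1_def by (simp add: snd_stereo unstereo_stereo)
        have w2: "p \<in> W2" if "p = stereo (centre k' + J u)" "cmod u \<le> 1"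
        proof -
          have "J u \<noteq> 0" using Jbig[OF uD that(2)] by auto
          then show ?thesis using that u(1) JJ unfolding W2_def by (simp add: snd_stereo unstereo_stereo)
        qed
        have "p \<in> W1 \<union> W2"
        proof (cases "1 \<le> cmod u")
          case True
          then have eq: "?q p = ?q (stereo (centre k + u))" using u(3) unfolding f_def by simp
          show ?thesis
          proof (cases "p = stereo (centre k + u)")
            case False
            then obtain v v' where v: "p = stereo v" "stereo (centre k + u) = stereo v'" "sewn h c v v'"
              using eq sewing_class_eq_iff[OF u(2) in1[OF uD True]] by blast
            then have "sewn h c (centre k + u) v" using inj_stereo sewn_sym by (metis injD)
            then have "cmod u = 1 \<and> v = centre k' + J u" using same1 uD by blast
            then show ?thesis using w2 v(1) by simp
          qed (use w1 in simp)
        next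
          case False
          then have lt: "cmod u < 1" by simp
          then have eq: "?q p = ?q (stereo (centre k' + J u))" using u(3) unfolding f_def by simp
          have "p = stereo (centre k' + J u)"
          proof (rule ccontr)
            assume "p \<noteq> stereo (centre k' + J u)"
            then obtain v v' where v: "stereo (centre k' + J u) = stereo v'" "sewn h c v v'"
              using eq sewing_class_eq_iff[OF u(2) in2[OF uD]] lt by auto
            then have "sewn h c (centre k' + J u) v" using inj_stereo sewn_sym by (metis injD)
            then have "cmod u = 1" using same2 uD lt by auto
            then show False using lt by simp
          qed
          then show ?thesis using w2 lt by simp
        qed
        then show "p \<in> topspace ?X \<inter> (W1 \<union> W2)" using u(2) by simp
      next
        fix p assume p: "p \<in> topspace ?X \<inter> (W1 \<union> W2)"
        define w where "w = unstereo p"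
        have "p \<in> sphere 0 1" "snd p \<noteq> 1" using p unfolding topspace_holed_sphere W1_def W2_def by auto
        then have pw: "p = stereo w" unfolding w_def using stereo_unstereo by simp
        have away: "1 \<le> cmod (w - centre l)" if "l < 2 * h + c" for l
        proof -
          have "w \<notin> ball (centre l) 1" using p that pw stereo_in_holed_sphere by blast
          then show ?thesis by (simp add: dist_norm norm_minus_commute not_less)
        qed
        have "?q p \<in> f ` U"
        proof (cases "p \<in> W1")
          case True
          then have "w - centre k \<in> U" unfolding W1_def w_def by simp
          moreover have "f (w - centre k) = ?q p" unfolding f_def using away[OF k] pw by simp
          ultimately show ?thesis by (metis imageI)
        next
          case False
          then have w2: "w \<noteq> centre k'" "J (w - centre k') \<in> U" using p unfolding W2_def w_def by auto
          define u where "u = J (w - centre k')"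
          have Ju: "J u = w - centre k'" unfolding u_def by (rule JJ)
          have uD: "u \<in> D" using w2 U unfolding u_def by blast
          have "1 \<le> cmod (J u)" unfolding Ju by (rule away) (simp add: k'_def sewn_index_less[OF k])
          moreover have "0 < cmod u" using Dn[OF uD] by linarith
          ultimately have "cmod u \<le> 1" unfolding Jn by (simp add: field_simps)
          then have "f u = ?q (stereo (centre k' + J u))" unfolding f_def using agree[OF uD] by auto
          then have "f u = ?q p" using pw Ju by simp
          then show ?thesis using w2(2) unfolding u_def by (metis imageI)
        qed
        then show "p \<in> {p \<in> topspace ?X. ?q p \<in> f ` U}" using p by simp
      qed
    qed
  qed
  then show ?thesis using z0 unfolding f_def by simp
qed

theorem surface_closed_surface: "surface (closed_surface h c)"
  unfolding surface_def
proof (intro conjI ballI Hausdorff_closed_surface)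
  let ?X = "holed_sphere (2 * h + c)"
  fix P assume "P \<in> topspace (closed_surface h c)"
  then obtain p where p: "p \<in> topspace ?X" "P = sewing h c `` {p}"
    using quotient_map_closed_surface[of h c] unfolding quotient_map_def by blast
  have ps: "p \<in> sphere 0 1" using p(1) unfolding topspace_holed_sphere by blast
  show "\<exists>\<psi>. chart (closed_surface h c) \<psi> \<and> \<psi> 0 = P"
  proof (cases "p \<in> stereo ` (\<Union>k<2 * h + c. cball (centre k) 1)")
    case True
    then obtain w k where w: "p = stereo w" "k < 2 * h + c" "w \<in> cball (centre k) 1" by blast
    moreover have "w \<notin> ball (centre k) 1" using p(1) w stereo_in_holed_sphere by blast
    ultimately have "cmod (w - centre k) = 1" by (auto simp: dist_norm norm_minus_commute)
    from seam_chart[OF w(2) this] show ?thesis using p(2) w(1) by simp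
  next
    case outside: False
    show ?thesis
    proof (cases "snd p = 1")
      case True
      obtain a b where ab: "p = (a, b)" by fastforce
      define F :: "complex \<times> real \<Rightarrow> complex \<times> real" where "F p = (fst p, - snd p)" for p
      have "(cmod a)\<^sup>2 + b\<^sup>2 = 1" using ps ab by (simp add: norm_Pair)
      then have "p = (0, 1)" using True ab by simp
      then have "p = F (stereo 0)" by (simp add: F_def stereo_def)
      moreover have "continuous_on UNIV F" unfolding F_def by (intro continuous_intros)
      moreover have "F (F p) = p" "p \<in> sphere 0 1 \<Longrightarrow> F p \<in> sphere 0 1" for p
        by (cases p; simp add: F_def norm_Pair)+
      ultimately show ?thesis using interior_chart[of F 0 h c] outside p(2) by simp
    next
      case False
      then have "p = stereo (unstereo p)" using stereo_unstereo[OF ps] by simp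
      then show ?thesis using interior_chart[of id "unstereo p" h c] outside p(2) by simp
    qed
  qed
qed

section \<open>The spectral radius of a join\<close>

definition quad_form :: "'a sgraph \<Rightarrow> ('a \<Rightarrow> real) \<Rightarrow> real" where
  "quad_form G z = (\<Sum>v\<in>verts G. \<Sum>w\<in>verts G. adj G v w * z v * z w)"

definition sq_norm :: "'a sgraph \<Rightarrow> ('a \<Rightarrow> real) \<Rightarrow> real" where
  "sq_norm G z = (\<Sum>v\<in>verts G. (z v)\<^sup>2)"

lemma adj_commute: "adj G v w = adj G w v"
  by (simp add: adj_def insert_commute)

text \<open>First-order condition at a maximum: for small \<open>t\<close> the linear term would
  win, as \<open>t = \<alpha> / b\<close> with \<open>b \<ge> \<beta>\<close> shows.\<close>

lemma linear_term_zero: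
  fixes \<alpha> \<beta> :: real
  assumes "\<And>t. 2 * t * \<alpha> \<le> t\<^sup>2 * \<beta>" shows "\<alpha> = 0"
proof (rule ccontr)
  assume a: "\<alpha> \<noteq> 0"
  define b where "b = \<bar>\<beta>\<bar> + 1"
  have b: "b > 0" "\<beta> \<le> b" by (auto simp: b_def)
  have "2 * (\<alpha> / b) * \<alpha> \<le> (\<alpha> / b)\<^sup>2 * \<beta>" by (rule assms)
  also have "\<dots> \<le> (\<alpha> / b)\<^sup>2 * b" using b by (intro mult_left_mono) auto
  also have "\<dots> = \<alpha>\<^sup>2 / b" using b by (simp add: power2_eq_square)
  finally have "2 * (\<alpha>\<^sup>2 / b) \<le> \<alpha>\<^sup>2 / b" by (simp add: power2_eq_square)
  moreover have "\<alpha>\<^sup>2 / b > 0" using a b by simp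
  ultimately show False by linarith
qed

text \<open>Vectors live in a product topology over \<open>verts G\<close>, whose points are
  extensional functions. Hence they are restricted to \<open>verts G\<close> before the compactness
  of the unit sphere inside a cube is applied.\<close>

lemma max_quad_form:
  assumes fin: "finite (verts G)" and ne: "verts G \<noteq> {}"
  obtains z where "sq_norm G z = 1" "\<And>y. sq_norm G y = 1 \<Longrightarrow> quad_form G y \<le> quad_form G z"
proof -
  let ?V = "verts G"
  let ?T = "product_topology (\<lambda>_. euclideanreal) ?V"
  let ?B = "PiE ?V (\<lambda>_. {-1..1::real})"
  have proj: "continuous_map ?T euclideanreal (\<lambda>z. z v)" if "v \<in> ?V" for v
    using continuous_map_product_projection[OF that] .
  have cq: "continuous_map ?T euclideanreal (quad_form G)"
    unfolding quad_form_def
    by (intro continuous_map_sum continuous_map_real_mult continuous_map_canonical_const proj fin)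
  have cn: "continuous_map ?T euclideanreal (sq_norm G)"
    unfolding sq_norm_def power2_eq_square
    by (intro continuous_map_sum continuous_map_real_mult proj fin)
  have B: "compactin ?T ?B" by (simp add: compactin_PiE)
  define K where "K = ?B \<inter> {z \<in> topspace ?T. sq_norm G z \<in> {1}}"
  have cl: "closedin ?T {z \<in> topspace ?T. sq_norm G z \<in> {1}}"
    by (rule closedin_continuous_map_preimage[OF cn]) simp
  have "compactin ?T K" unfolding K_def by (rule compact_Int_closedin[OF B cl])
  then have "compactin euclideanreal (quad_form G ` K)" using cq by (rule image_compactin)
  then have comp: "compact (quad_form G ` K)" by simp
  have inK: "restrict y ?V \<in> K" if y: "sq_norm G y = 1" for y
  proof -
    have "y v \<in> {-1..1}" if v: "v \<in> ?V" for v
    proof -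
      have "(y v)\<^sup>2 \<le> 1" using member_le_sum[OF v _ fin, of "\<lambda>v. (y v)\<^sup>2"] y unfolding sq_norm_def by simp
      then show ?thesis by (simp add: power2_le_iff_abs_le[of 1 "y v", simplified] abs_le_iff abs_square_le_1)
    qed
    moreover have "sq_norm G (restrict y ?V) = 1" using y unfolding sq_norm_def by simp
    ultimately show ?thesis unfolding K_def by (auto simp: topspace_product_topology)
  qed
  have eqr: "quad_form G (restrict y ?V) = quad_form G y" for y unfolding quad_form_def by simp
  obtain v0 where v0: "v0 \<in> ?V" using ne by blast
  have "sq_norm G (\<lambda>v. if v = v0 then 1 else 0) = (\<Sum>v\<in>?V. if v = v0 then 1 else 0)"
    unfolding sq_norm_def by (rule sum.cong) auto
  then have "sq_norm G (\<lambda>v. if v = v0 then 1 else 0) = 1" using v0 fin by simp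
  then have "K \<noteq> {}" using inK by blast
  then obtain z where z: "z \<in> K" "\<And>y. y \<in> K \<Longrightarrow> quad_form G y \<le> quad_form G z"
    using compact_attains_sup[OF comp] by blast
  show ?thesis
  proof (rule that[of z])
    show "sq_norm G z = 1" using z(1) unfolding K_def by simp
    show "quad_form G y \<le> quad_form G z" if "sq_norm G y = 1" for y
      using z(2)[OF inK[OF that]] eqr[of y] by simp
  qed
qed

text \<open>A maximiser of the Rayleigh quotient may be replaced by its absolute value, since the
  adjacency matrix is nonnegative. It is an eigenvector because the variation in each single
  coordinate vanishes, and every eigenvalue is a Rayleigh quotient, so \<open>GREATEST\<close> is
  attained at the maximum.\<close>

lemma spectral_radius_perron:
  assumes fin: "finite (verts G)" and ne: "verts G \<noteq> {}" and loopless: "\<And>v. adj G v v = 0"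
  obtains z where "\<And>v. z v \<ge> 0" "\<exists>v\<in>verts G. z v \<noteq> 0"
    "\<And>v. v \<in> verts G \<Longrightarrow> (\<Sum>w\<in>verts G. adj G v w * z w) = spectral_radius G * z v"
    "\<And>y. quad_form G y \<le> spectral_radius G * sq_norm G y"
proof -
  let ?V = "verts G"
  obtain z0 where z0: "sq_norm G z0 = 1" "\<And>y. sq_norm G y = 1 \<Longrightarrow> quad_form G y \<le> quad_form G z0"
    by (rule max_quad_form[OF fin ne]) blast
  define \<mu> where "\<mu> = quad_form G z0"
  define z where "z v = \<bar>z0 v\<bar>" for v
  have zn: "sq_norm G z = 1" using z0(1) unfolding sq_norm_def z_def by simp
  have "quad_form G z0 \<le> quad_form G z"
    unfolding quad_form_def z_def
    by (intro sum_mono) (auto simp: adj_def abs_mult[symmetric])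
  then have qz: "quad_form G z = \<mu>" using z0(2)[OF zn] unfolding \<mu>_def by simp
  have bound: "quad_form G y \<le> \<mu> * sq_norm G y" for y
  proof (cases "sq_norm G y = 0")
    case True
    then have "y v = 0" if "v \<in> ?V" for v
      using that fin unfolding sq_norm_def by (simp add: sum_nonneg_eq_0_iff)
    then have "quad_form G y = 0" unfolding quad_form_def by simp
    then show ?thesis using True by simp
  next
    case False
    have nn: "sq_norm G y \<ge> 0" unfolding sq_norm_def by (rule sum_nonneg) simp
    define s where "s = sqrt (sq_norm G y)"
    have s: "s\<^sup>2 = sq_norm G y" "s \<noteq> 0" using nn False by (auto simp: s_def)
    have "sq_norm G (\<lambda>v. y v / s) = sq_norm G y / s\<^sup>2"
      unfolding sq_norm_def by (simp add: power_divide sum_divide_distrib)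
    then have "sq_norm G (\<lambda>v. y v / s) = 1" using s False by simp
    then have "quad_form G (\<lambda>v. y v / s) \<le> \<mu>" using z0(2) unfolding \<mu>_def by blast
    moreover have "quad_form G (\<lambda>v. y v / s) = quad_form G y / s\<^sup>2"
      unfolding quad_form_def by (simp add: sum_divide_distrib power2_eq_square)
    moreover have "s\<^sup>2 > 0" using s(2) by simp
    ultimately show ?thesis using s(1) by (simp add: pos_divide_le_eq)
  qed
  have eig: "(\<Sum>w\<in>?V. adj G v w * z w) = \<mu> * z v" if v: "v \<in> ?V" for v
  proof -
    define \<alpha> where "\<alpha> = (\<Sum>w\<in>?V. adj G v w * z w) - \<mu> * z v"
    have "2 * t * \<alpha> \<le> t\<^sup>2 * \<mu>" for t
    proof -
      define d where "d u = (if u = v then t else 0)" for u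
      have D1: "(\<Sum>w\<in>?V. h w * d w) = h v * t" for h :: "_ \<Rightarrow> real"
      proof -
        have "(\<Sum>w\<in>?V. h w * d w) = (\<Sum>w\<in>?V. if w = v then h v * t else 0)"
          by (rule sum.cong) (auto simp: d_def)
        then show ?thesis using v fin by simp
      qed
      have "quad_form G (\<lambda>u. z u + d u) = quad_form G z + (\<Sum>u\<in>?V. \<Sum>w\<in>?V. adj G u w * z u * d w)
          + (\<Sum>u\<in>?V. (\<Sum>w\<in>?V. adj G u w * z w) * d u) + (\<Sum>u\<in>?V. (\<Sum>w\<in>?V. adj G u w * d w) * d u)"
        unfolding quad_form_def sum_distrib_right sum.distrib[symmetric]
        by (intro sum.cong refl) (simp add: algebra_simps)
      also have "(\<Sum>u\<in>?V. \<Sum>w\<in>?V. adj G u w * z u * d w) = (\<Sum>u\<in>?V. adj G u v * z u * t)"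
        unfolding D1[of "\<lambda>w. adj G _ w * z _"] ..
      also have "\<dots> = t * (\<Sum>w\<in>?V. adj G v w * z w)"
        unfolding sum_distrib_left by (rule sum.cong) (auto simp: adj_commute[of G v])
      also have "(\<Sum>u\<in>?V. (\<Sum>w\<in>?V. adj G u w * z w) * d u) = t * (\<Sum>w\<in>?V. adj G v w * z w)"
        unfolding D1 by simp
      also have "(\<Sum>u\<in>?V. (\<Sum>w\<in>?V. adj G u w * d w) * d u) = 0" unfolding D1 by (simp add: loopless)
      finally have q: "quad_form G (\<lambda>u. z u + d u) = \<mu> + 2 * t * (\<Sum>w\<in>?V. adj G v w * z w)" using qz by simp
      have "sq_norm G (\<lambda>u. z u + d u) = sq_norm G z + 2 * (\<Sum>u\<in>?V. z u * d u) + (\<Sum>u\<in>?V. d u * d u)"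
        unfolding sq_norm_def sum_distrib_left sum.distrib[symmetric]
        by (intro sum.cong refl) (simp add: power2_eq_square algebra_simps)
      also have "\<dots> = 1 + 2 * t * z v + t\<^sup>2" unfolding D1 zn by (simp add: d_def power2_eq_square)
      finally have "\<mu> + 2 * t * (\<Sum>w\<in>?V. adj G v w * z w) \<le> \<mu> * (1 + 2 * t * z v + t\<^sup>2)"
        using bound[of "\<lambda>u. z u + d u"] q by simp
      then show ?thesis unfolding \<alpha>_def by (simp add: algebra_simps)
    qed
    then have "\<alpha> = 0" by (rule linear_term_zero)
    then show ?thesis unfolding \<alpha>_def by simp
  qed
  have nz: "\<exists>v\<in>?V. z v \<noteq> 0"
  proof (rule ccontr)
    assume "\<not> ?thesis"
    then have "sq_norm G z = 0" unfolding sq_norm_def by simp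
    then show False using zn by simp
  qed
  have "spectral_radius G = \<mu>"
    unfolding spectral_radius_def
  proof (rule Greatest_equality)
    show "adj_eigenvalue G \<mu>" unfolding adj_eigenvalue_def using nz eig by blast
    fix l assume "adj_eigenvalue G l"
    then obtain x where x: "\<exists>v\<in>?V. x v \<noteq> 0" "\<And>v. v \<in> ?V \<Longrightarrow> (\<Sum>w\<in>?V. adj G v w * x w) = l * x v"
      unfolding adj_eigenvalue_def by blast
    have "quad_form G x = (\<Sum>v\<in>?V. x v * (\<Sum>w\<in>?V. adj G v w * x w))"
      unfolding quad_form_def sum_distrib_left by (intro sum.cong refl) (simp add: mult_ac)
    also have "\<dots> = (\<Sum>v\<in>?V. x v * (l * x v))"
      by (intro sum.cong refl) (simp only: x(2))
    also have "\<dots> = l * sq_norm G x"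
      unfolding sq_norm_def sum_distrib_left
      by (intro sum.cong refl) (simp add: power2_eq_square)
    finally have "l * sq_norm G x \<le> \<mu> * sq_norm G x" using bound[of x] by simp
    moreover have "sq_norm G x > 0"
    proof -
      obtain v where v: "v \<in> ?V" "x v \<noteq> 0" using x(1) by blast
      have "(x v)\<^sup>2 \<le> sq_norm G x" unfolding sq_norm_def by (rule member_le_sum) (use v fin in auto)
      moreover have "(x v)\<^sup>2 > 0" using v by simp
      ultimately show ?thesis by linarith
    qed
    ultimately show "l \<le> \<mu>" by simp
  qed
  then show ?thesis using that[of z] nz eig bound unfolding z_def by auto
qed

text \<open>The part depending on \<open>f\<close> of the quadratic form minus \<open>\<rho>\<close>
  times the squared norm, for the vector that is \<open>f\<close> on \<open>H\<close> and 1/2 on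
  each vertex of \<open>K2\<close>; see \<open>quad_form_join\<close>. With 1/2 the two apexes
  together contribute the term 1 to the eigenvalue equation.\<close>

definition energy :: "'a sgraph \<Rightarrow> real \<Rightarrow> ('a \<Rightarrow> real) \<Rightarrow> real" where
  "energy H \<rho> f = 2 * (\<Sum>v\<in>verts H. f v) - \<rho> * (\<Sum>v\<in>verts H. (f v)\<^sup>2) + 2 * (\<Sum>e\<in>edges H. prod f e)"

lemma simple_graph_finite_edges: "simple_graph G \<Longrightarrow> finite (edges G)"
  unfolding simple_graph_def by (rule finite_subset[of _ "Pow (verts G)"]) auto

lemma sum_adj_neighbours:
  assumes "simple_graph G"
  shows "(\<Sum>w\<in>verts G. adj G v w * f w) = (\<Sum>w | {v, w} \<in> edges G. f w)"
proof -
  have fin: "finite (verts G)" using assms unfolding simple_graph_def by simp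
  have "(\<Sum>w\<in>verts G. adj G v w * f w) = (\<Sum>w\<in>verts G. if {v, w} \<in> edges G then f w else 0)"
    by (rule sum.cong) (auto simp: adj_def)
  also have "\<dots> = (\<Sum>w\<in>{w \<in> verts G. {v, w} \<in> edges G}. f w)" using fin by (rule sum.inter_filter[symmetric])
  also have "{w \<in> verts G. {v, w} \<in> edges G} = {w. {v, w} \<in> edges G}" using simple_graph_edgeD[OF assms] by blast
  finally show ?thesis .
qed

text \<open>Induction on a set of edges: each further edge contributes its two ordered
  pairs.\<close>

lemma quad_form_edges:
  assumes G: "simple_graph G"
  shows "quad_form G f = 2 * (\<Sum>e\<in>edges G. prod f e)"
proof -
  have fin: "finite (verts G)" using G unfolding simple_graph_def by simp
  define Q where "Q E = (\<Sum>v\<in>verts G. \<Sum>w\<in>verts G. (if {v, w} \<in> E then 1 else 0) * f v * f w)" for E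
  have "E \<subseteq> edges G \<Longrightarrow> Q E = 2 * (\<Sum>e\<in>E. prod f e)" if "finite E" for E
    using that
  proof (induction E rule: finite_induct)
    case empty then show ?case by (simp add: Q_def)
  next
    case (insert e E)
    then have "e \<in> edges G" by simp
    then have e: "e \<subseteq> verts G" "card e = 2" using G unfolding simple_graph_def by auto
    then obtain a b where ab: "e = {a, b}" "a \<noteq> b" by (meson card_2_iff)
    have abV: "a \<in> verts G" "b \<in> verts G" using e ab by auto
    have ind: "(if {v, w} \<in> insert e E then 1 else 0) * f v * f w = (if {v, w} \<in> E then 1 else 0) * f v * f w
        + ((if w = b then (if v = a then f v * f w else 0) else 0) + (if w = a then (if v = b then f v * f w else 0) else 0))" for v w
    proof (cases "{v, w} = e")
      case True
      then have "(v = a \<and> w = b) \<or> (v = b \<and> w = a)" using ab by (auto simp: doubleton_eq_iff)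
      moreover have "{v, w} \<notin> E" using True insert by simp
      ultimately show ?thesis using ab True by auto
    next
      case False
      then have "\<not> (v = a \<and> w = b)" "\<not> (v = b \<and> w = a)" using ab by (auto simp: insert_commute)
      then show ?thesis using False by auto
    qed
    have "Q (insert e E) = Q E + ((\<Sum>v\<in>verts G. (if v = a then f v * f b else 0)) + (\<Sum>v\<in>verts G. (if v = b then f v * f a else 0)))"
      unfolding Q_def ind sum.distrib using abV fin by simp
    also have "\<dots> = Q E + 2 * (f a * f b)" using abV fin by simp
    finally show ?case using insert ab by simp
  qed
  moreover have "quad_form G f = Q (edges G)" unfolding quad_form_def Q_def adj_def ..
  ultimately show ?thesis using simple_graph_finite_edges[OF G] by simp
qed

section \<open>The join with \<open>K2\<close>\<close>

lemma join_edge_iff: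
  fixes H :: "'a sgraph"
  shows
  "{Inl i, Inl j} \<in> edges (K2 \<nabla> H) \<longleftrightarrow> i \<noteq> j"
  "{Inl i, Inr v} \<in> edges (K2 \<nabla> H) \<longleftrightarrow> v \<in> verts H"
  "{Inr v, Inl i} \<in> edges (K2 \<nabla> H) \<longleftrightarrow> v \<in> verts H"
  "{Inr v, Inr w} \<in> edges (K2 \<nabla> H) \<longleftrightarrow> {v, w} \<in> edges H"
proof -
  have e: "edges (K2 \<nabla> H) = (`) Inl ` {e. card e = 2} \<union> (`) Inr ` edges H
      \<union> {{Inl a, Inr b} | a b. b \<in> verts H}"
    unfolding join_def complete_sgraph_def by auto
  have l: "{Inl i, Inl j :: bool + 'a} = Inl ` e \<longleftrightarrow> e = {i, j}" for i j :: bool and e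
    using inj_image_eq_iff[of "Inl :: bool \<Rightarrow> bool + 'a" "{i, j}" e] by (auto simp: inj_def)
  have r: "{Inr v, Inr w :: bool + 'a} = Inr ` e \<longleftrightarrow> e = {v, w}" for v w :: 'a and e
    using inj_image_eq_iff[of "Inr :: 'a \<Rightarrow> bool + 'a" "{v, w}" e] by (auto simp: inj_def)
  have x1: "{Inl i, Inr v} \<noteq> Inl ` d" "{Inl i, Inr v} \<noteq> Inr ` d'" "{Inl i, Inl j} \<noteq> Inr ` d'"
    "{Inr v, Inr w} \<noteq> Inl ` d" for i j :: bool and v w :: 'a and d d'
    by (metis Inl_Inr_False Inr_Inl_False imageE insertCI)+
  show "{Inl i, Inl j} \<in> edges (K2 \<nabla> H) \<longleftrightarrow> i \<noteq> j"
    unfolding e using l x1 by (auto simp: image_iff doubleton_eq_iff card_insert_if)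
  show *: "{Inl i, Inr v} \<in> edges (K2 \<nabla> H) \<longleftrightarrow> v \<in> verts H"
    unfolding e using x1 by (auto simp: image_iff doubleton_eq_iff)
  then show "{Inr v, Inl i} \<in> edges (K2 \<nabla> H) \<longleftrightarrow> v \<in> verts H" by (simp add: insert_commute)
  show "{Inr v, Inr w} \<in> edges (K2 \<nabla> H) \<longleftrightarrow> {v, w} \<in> edges H"
    unfolding e using r x1 by (auto simp: image_iff doubleton_eq_iff)
qed

lemma join_edge_cases:
  assumes "e \<in> edges (K2 \<nabla> H)"
  obtains "e = {Inl True, Inl False}" | i v where "e = {Inl i, Inr v}" "v \<in> verts H" | d where "d \<in> edges H" "e = Inr ` d"
proof -
  have "e \<in> (`) Inl ` {e. card e = 2} \<union> (`) Inr ` edges H \<union> {{Inl a, Inr b} | a b. b \<in> verts H}"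
    using assms unfolding join_def complete_sgraph_def by auto
  then show ?thesis
  proof (elim UnE)
    assume "e \<in> (`) Inl ` {e. card e = 2}"
    then obtain d :: "bool set" where "e = Inl ` d" "d \<in> {e. card e = 2}" by (rule imageE)
    then have d: "card d = 2" "e = Inl ` d" by simp_all
    have "d = UNIV" by (rule card_subset_eq) (simp_all add: d)
    then have "d = {True, False}" by (simp add: UNIV_bool insert_commute)
    then have "e = {Inl True, Inl False}" using d(2) by simp
    then show ?thesis by (rule that(1))
  next
    assume "e \<in> (`) Inr ` edges H"
    then obtain d where "e = Inr ` d" "d \<in> edges H" by (rule imageE)
    then show ?thesis using that(3) by metis
  next
    assume "e \<in> {{Inl a, Inr b} | a b. b \<in> verts H}"
    then obtain i v where "e = {Inl i, Inr v}" "v \<in> verts H" by auto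
    then show ?thesis by (rule that(2))
  qed
qed

lemma verts_join: "verts (K2 \<nabla> H) = UNIV <+> verts H"
  by (simp add: join_def complete_sgraph_def)

lemma simple_graph_join:
  assumes "simple_graph H" shows "simple_graph (K2 \<nabla> H)"
  unfolding simple_graph_def
proof (intro conjI subsetI)
  show "finite (verts (K2 \<nabla> H))" using assms unfolding verts_join simple_graph_def by simp
  fix e assume "e \<in> edges (K2 \<nabla> H)"
  then show "e \<in> {e. e \<subseteq> verts (K2 \<nabla> H) \<and> card e = 2}"
  proof (cases rule: join_edge_cases)
    case (3 d)
    then have "d \<subseteq> verts H" "card d = 2" using assms unfolding simple_graph_def by auto
    then show ?thesis using 3 by (auto simp: verts_join card_image)
  qed (auto simp: verts_join)
qed

lemma sum_join:
  assumes "finite (verts H)"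
  shows "(\<Sum>v\<in>verts (K2 \<nabla> H). h v) = h (Inl True) + h (Inl False) + (\<Sum>v\<in>verts H. h (Inr v) :: real)"
  unfolding verts_join using assms by (simp add: sum.Plus UNIV_bool)

lemma adj_join:
  "adj (K2 \<nabla> H) (Inl i) (Inl j) = (if i \<noteq> j then 1 else 0)"
  "v \<in> verts H \<Longrightarrow> adj (K2 \<nabla> H) (Inl i) (Inr v) = 1"
  "v \<in> verts H \<Longrightarrow> adj (K2 \<nabla> H) (Inr v) (Inl i) = 1"
  "adj (K2 \<nabla> H) (Inr v) (Inr w) = adj H v w"
  unfolding adj_def join_edge_iff by auto

lemma quad_form_join:
  assumes H: "simple_graph H"
  shows "quad_form (K2 \<nabla> H) (case_sum (\<lambda>_. 1 / 2) f) - \<rho> * sq_norm (K2 \<nabla> H) (case_sum (\<lambda>_. 1 / 2) f)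
    = (1 - \<rho>) / 2 + energy H \<rho> f"
proof -
  have fin: "finite (verts H)" using H unfolding simple_graph_def by simp
  have "quad_form (K2 \<nabla> H) (case_sum (\<lambda>_. 1 / 2) f) = 1 / 2 + 2 * (\<Sum>v\<in>verts H. f v) + quad_form H f"
    unfolding quad_form_def by (simp add: sum_join[OF fin] adj_join sum.distrib sum_divide_distrib[symmetric])
  moreover have "sq_norm (K2 \<nabla> H) (case_sum (\<lambda>_. 1 / 2) f) = 1 / 2 + (\<Sum>v\<in>verts H. (f v)\<^sup>2)"
    unfolding sq_norm_def by (simp add: sum_join[OF fin] power2_eq_square)
  ultimately show ?thesis unfolding energy_def quad_form_edges[OF H] by (simp add: algebra_simps diff_divide_distrib)
qed

lemma loopless: "simple_graph G \<Longrightarrow> adj G v v = 0"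
  unfolding adj_def simple_graph_def by auto

text \<open>Subtracting the two apex equations shows that the apexes have equal values. The apex
  equation then fixes the sum of \<open>f\<close> as \<open>(\<rho> - 1) / 2\<close>; together with
  \<open>\<rho> * f v \<ge> 1\<close> this yields the lower bound for
  \<open>\<rho>\<^sup>2\<close>.\<close>

lemma spectral_radius_join:
  assumes H: "simple_graph H" and ne: "verts H \<noteq> {}"
  defines "\<rho> \<equiv> spectral_radius (K2 \<nabla> H)"
  obtains f where "\<And>v. v \<in> verts H \<Longrightarrow> f v > 0"
    "\<And>v. v \<in> verts H \<Longrightarrow> \<rho> * f v = 1 + (\<Sum>w | {v, w} \<in> edges H. f w)"
    "energy H \<rho> f = (\<rho> - 1) / 2" "\<rho> > 0" "\<rho>\<^sup>2 \<ge> 2 * real (card (verts H))"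
proof -
  let ?G = "K2 \<nabla> H"
  have fin: "finite (verts H)" using H unfolding simple_graph_def by simp
  have G: "simple_graph ?G" by (rule simple_graph_join[OF H])
  have finG: "finite (verts ?G)" "verts ?G \<noteq> {}" using G unfolding simple_graph_def by (auto simp: verts_join)
  obtain z where z: "\<And>v. z v \<ge> 0" "\<exists>v\<in>verts ?G. z v \<noteq> 0"
    and eig: "\<And>v. v \<in> verts ?G \<Longrightarrow> (\<Sum>w\<in>verts ?G. adj ?G v w * z w) = \<rho> * z v"
    and bound: "\<And>y. quad_form ?G y \<le> \<rho> * sq_norm ?G y"
    unfolding \<rho>_def by (rule spectral_radius_perron[OF finG loopless[OF G]]) blast
  \<comment> \<open>The indicator of the two apexes bounds \<open>\<rho>\<close> below by 1, so that
    \<open>\<rho> + 1\<close> can be cancelled.\<close>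
  have "quad_form ?G (case_sum (\<lambda>_. 1) (\<lambda>_. 0)) = 2" "sq_norm ?G (case_sum (\<lambda>_. 1) (\<lambda>_. 0)) = 2"
    unfolding quad_form_def sq_norm_def by (simp_all add: sum_join[OF fin] adj_join)
  then have \<rho>1: "\<rho> \<ge> 1" using bound[of "case_sum (\<lambda>_. 1) (\<lambda>_. 0)"] by simp
  define s where "s = (\<Sum>v\<in>verts H. z (Inr v))"
  have eT: "z (Inl False) + s = \<rho> * z (Inl True)" "z (Inl True) + s = \<rho> * z (Inl False)"
    using eig[of "Inl True"] eig[of "Inl False"] unfolding s_def
    by (simp_all add: verts_join InlI sum_join[OF fin, unfolded verts_join] adj_join)
  have "(\<rho> + 1) * (z (Inl True) - z (Inl False)) = 0" using eT by (simp add: algebra_simps)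
  then have eq: "z (Inl True) = z (Inl False)" using \<rho>1 by simp
  define a where "a = z (Inl True)"
  have eR: "2 * a + (\<Sum>w\<in>verts H. adj H v w * z (Inr w)) = \<rho> * z (Inr v)" if "v \<in> verts H" for v
    using eig[of "Inr v"] that eq unfolding a_def
    by (simp add: verts_join InrI sum_join[OF fin, unfolded verts_join] adj_join)
  have "a \<noteq> 0"
  proof
    assume a0: "a = 0"
    then have "s = 0" using eT eq unfolding a_def by simp
    then have "z (Inr v) = 0" if "v \<in> verts H" for v
      using that fin z(1) unfolding s_def by (simp add: sum_nonneg_eq_0_iff)
    moreover have "z (Inl i) = 0" for i using a0 eq unfolding a_def by (cases i) auto
    ultimately show False using z(2) unfolding verts_join by auto
  qed
  then have a: "a > 0" using z(1)[of "Inl True"] unfolding a_def by simp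
  \<comment> \<open>Scaled so that each apex has the value 1/2.\<close>
  define f where "f v = z (Inr v) / (2 * a)" for v
  have f0: "f v \<ge> 0" for v unfolding f_def using z(1)[of "Inr v"] a by simp
  have fe: "\<rho> * f v = 1 + (\<Sum>w | {v, w} \<in> edges H. f w)" if "v \<in> verts H" for v
  proof -
    have "\<rho> * f v = (2 * a + (\<Sum>w\<in>verts H. adj H v w * z (Inr w))) / (2 * a)"
      unfolding f_def eR[OF that] by simp
    also have "\<dots> = 1 + (\<Sum>w\<in>verts H. adj H v w * f w)"
      using a unfolding f_def by (simp add: add_divide_distrib sum_divide_distrib)
    also have "(\<Sum>w\<in>verts H. adj H v w * f w) = (\<Sum>w | {v, w} \<in> edges H. f w)" by (rule sum_adj_neighbours[OF H])
    finally show ?thesis .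
  qed
  have f1: "\<rho> * f v \<ge> 1" if "v \<in> verts H" for v using fe[OF that] f0 by (simp add: sum_nonneg)
  have fpos: "f v > 0" if "v \<in> verts H" for v
  proof (rule ccontr)
    assume "\<not> f v > 0"
    then have "f v = 0" using f0[of v] by simp
    then show False using f1[OF that] by simp
  qed
  have "s + a = \<rho> * a" using eT eq unfolding a_def by simp
  then have sf: "(\<Sum>v\<in>verts H. f v) = (\<rho> - 1) / 2"
    unfolding f_def s_def[symmetric] sum_divide_distrib[symmetric] using a by (simp add: field_simps)
  have "quad_form H f = (\<Sum>v\<in>verts H. f v * (\<Sum>w\<in>verts H. adj H v w * f w))"
    unfolding quad_form_def sum_distrib_left by (intro sum.cong refl) (simp add: mult_ac)
  also have "\<dots> = (\<Sum>v\<in>verts H. f v * (\<rho> * f v - 1))"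
    using fe unfolding sum_adj_neighbours[OF H] by (intro sum.cong refl) simp
  also have "\<dots> = \<rho> * (\<Sum>v\<in>verts H. (f v)\<^sup>2) - (\<Sum>v\<in>verts H. f v)"
    unfolding sum_distrib_left sum_subtractf[symmetric] by (intro sum.cong refl) (simp add: power2_eq_square algebra_simps)
  finally have qe: "quad_form H f = \<rho> * (\<Sum>v\<in>verts H. (f v)\<^sup>2) - (\<Sum>v\<in>verts H. f v)" .
  have en: "energy H \<rho> f = (\<rho> - 1) / 2"
    unfolding energy_def quad_form_edges[OF H, symmetric] qe sf by (simp add: field_simps)
  have "real (card (verts H)) \<le> (\<Sum>v\<in>verts H. \<rho> * f v)"
    using sum_mono[of "verts H" "\<lambda>_. 1" "\<lambda>v. \<rho> * f v"] f1 by simp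
  also have "\<dots> = \<rho> * ((\<rho> - 1) / 2)" unfolding sum_distrib_left[symmetric] sf ..
  finally have "2 * real (card (verts H)) \<le> \<rho>\<^sup>2 - \<rho>" by (simp add: power2_eq_square algebra_simps)
  then show ?thesis using that[of f] fpos fe en \<rho>1 by force
qed

lemma spectral_radius_less_by_energy:
  assumes H: "simple_graph H" and "energy H \<rho> f > (\<rho> - 1) / 2"
  shows "\<rho> < spectral_radius (K2 \<nabla> H)"
proof -
  let ?G = "K2 \<nabla> H" and ?z = "case_sum (\<lambda>_. 1 / 2) f"
  have fin: "finite (verts H)" using H unfolding simple_graph_def by simp
  have G: "simple_graph ?G" by (rule simple_graph_join[OF H])
  have finG: "finite (verts ?G)" "verts ?G \<noteq> {}" using G unfolding simple_graph_def by (auto simp: verts_join)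
  have "quad_form ?G ?z \<le> spectral_radius ?G * sq_norm ?G ?z"
    by (rule spectral_radius_perron[OF finG loopless[OF G]]) blast
  moreover have "quad_form ?G ?z - \<rho> * sq_norm ?G ?z > 0"
    unfolding quad_form_join[OF H] using assms(2) by (simp add: field_simps)
  ultimately have "\<rho> * sq_norm ?G ?z < spectral_radius ?G * sq_norm ?G ?z" by linarith
  moreover have "sq_norm ?G ?z \<ge> 0" unfolding sq_norm_def by (rule sum_nonneg) simp
  ultimately show ?thesis by (metis mult_less_cancel_right not_less)
qed

section \<open>Moving a vertex of degree two\<close>

text \<open>The energy gained by a vertex that is inserted into an edge whose ends have the values \<open>p\<close>
  and \<open>q\<close> and receives the optimal value \<open>(1 + p + q) / \<rho>\<close>. For \<open>p = 0\<close> this is the gain of a leaf.\<close>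

definition insertion_gain :: "real \<Rightarrow> real \<Rightarrow> real \<Rightarrow> real" where
  "insertion_gain \<rho> p q = (1 + p + q)\<^sup>2 / \<rho> - 2 * p * q"

text \<open>\<open>c\<close> is the constant solution along an untouched path,
  \<open>\<rho> * c = 1 + 2 * c\<close>. In deviations from \<open>c\<close> the linear terms
  cancel. An insertion between two vertices of value \<open>c\<close> gains exactly
  \<open>c\<close>, and only the surplus over this matters when a vertex is moved.\<close>

lemma insertion_gain_deviation:
  assumes "\<rho> > 2" and c: "c = 1 / (\<rho> - 2)"
  shows "insertion_gain \<rho> (c + x) (c + y) = c + (x + y)\<^sup>2 / \<rho> - 2 * x * y"
proof -
  have rc: "\<rho> * c = 1 + 2 * c" using assms by (simp add: field_simps)
  have "1 + (c + x) + (c + y) = \<rho> * c + (x + y)" using rc by simp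
  then have "(1 + (c + x) + (c + y))\<^sup>2 / \<rho> = (\<rho> * c)\<^sup>2 / \<rho> + 2 * (\<rho> * c) * (x + y) / \<rho> + (x + y)\<^sup>2 / \<rho>"
    by (simp only: power2_sum add_divide_distrib)
  also have "(\<rho> * c)\<^sup>2 / \<rho> = (\<rho> * c) * c" using assms by (simp add: power2_eq_square)
  also have "2 * (\<rho> * c) * (x + y) / \<rho> = 2 * c * (x + y)" using assms by simp
  finally show ?thesis unfolding insertion_gain_def rc by (simp add: algebra_simps)
qed

text \<open>The vertex \<open>r\<close> is suppressed between \<open>a\<close> and \<open>b\<close>,
  the edges \<open>D\<close> are deleted, and \<open>r\<close> reappears with the edges
  \<open>N\<close>; \<open>s\<close> stands for the sum of the values of its new neighbours. The
  value \<open>(1 + s) / \<rho>\<close> maximises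
  \<open>2 * \<xi> - \<rho> * \<xi>\<^sup>2 + 2 * \<xi> * s\<close>, and the maximum is
  \<open>(1 + s)\<^sup>2 / \<rho>\<close>.\<close>

lemma energy_move:
  assumes H: "simple_graph H" and H': "simple_graph H'" "verts H' = verts H"
    and r: "r \<in> verts H" "{w. {r, w} \<in> edges H} = {a, b}" "a \<noteq> b" "{a, b} \<notin> edges H"
    and fr: "\<rho> * f r = 1 + (f a + f b)" "\<rho> > 0"
    and E': "edges H' = insert {a, b} (edges H - {{a, r}, {b, r}} - D) \<union> N"
    and D: "D \<subseteq> edges H - {{a, r}, {b, r}}"
    and N: "\<And>e. e \<in> N \<Longrightarrow> r \<in> e"
    and s: "(\<Sum>e\<in>N. prod (f(r := (1 + s) / \<rho>)) e) = (1 + s) / \<rho> * s"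
  shows "energy H' \<rho> (f(r := (1 + s) / \<rho>)) = energy H \<rho> f
     + ((1 + s)\<^sup>2 / \<rho> - 2 * (\<Sum>e\<in>D. prod f e)) - insertion_gain \<rho> (f a) (f b)"
proof -
  define \<xi> where "\<xi> = (1 + s) / \<rho>"
  define f' where "f' = f(r := \<xi>)"
  have fin: "finite (verts H)" "finite (edges H)" "finite (edges H')"
    using H simple_graph_finite_edges[OF H] simple_graph_finite_edges[OF H'(1)] by (auto simp: simple_graph_def)
  have V: "(\<Sum>v\<in>verts H. h v) = h r + (\<Sum>v\<in>verts H - {r}. h v)" for h :: "_ \<Rightarrow> real"
    using r(1) fin(1) by (rule sum.remove[rotated])
  have V1: "(\<Sum>v\<in>verts H. f' v) = \<xi> + (\<Sum>v\<in>verts H - {r}. f v)"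
    unfolding V[of f'] by (simp add: f'_def)
  have V2: "(\<Sum>v\<in>verts H. (f' v)\<^sup>2) = \<xi>\<^sup>2 + (\<Sum>v\<in>verts H - {r}. (f v)\<^sup>2)"
    unfolding V[of "\<lambda>v. (f' v)\<^sup>2"] by (simp add: f'_def)
  define E0 where "E0 = edges H - {{a, r}, {b, r}}"
  have ar: "{a, r} \<in> edges H" "{b, r} \<in> edges H" using r(2) by (auto simp: insert_commute)
  have neq: "a \<noteq> r" "b \<noteq> r" using simple_graph_edgeD(1)[OF H] ar by auto
  have ne: "{a, r} \<noteq> {b, r}" using r(3) by (auto simp: doubleton_eq_iff)
  have rE0: "r \<notin> e" if e: "e \<in> E0" for e
  proof
    assume "r \<in> e"
    have "e \<in> edges H" using e unfolding E0_def by simp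
    then have "card e = 2" using H unfolding simple_graph_def by auto
    then obtain w where w: "e = {r, w}" using \<open>r \<in> e\<close> by (metis card_2_iff insertE insert_commute singletonD)
    then have "w \<in> {a, b}" using \<open>e \<in> edges H\<close> r(2) by blast
    then show False using e w unfolding E0_def by (auto simp: insert_commute)
  qed
  have abE0: "{a, b} \<notin> E0" using r(4) unfolding E0_def by simp
  have finE0: "finite E0" using fin unfolding E0_def by simp
  have EH: "edges H = insert {a, r} (insert {b, r} E0)" using ar unfolding E0_def by blast
  have S1: "(\<Sum>e\<in>edges H. prod f e) = f a * f r + (f b * f r + (\<Sum>e\<in>E0. prod f e))"
    unfolding EH using finE0 ne neq by (subst sum.insert; simp add: E0_def)+
  have EH': "edges H' = insert {a, b} (E0 - D) \<union> N" using E' unfolding E0_def by simp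
  have disj: "insert {a, b} (E0 - D) \<inter> N = {}" using N rE0 neq by fastforce
  have finN: "finite N" using fin(3) unfolding EH' by simp
  have "(\<Sum>e\<in>edges H'. prod f' e) = (\<Sum>e\<in>insert {a, b} (E0 - D). prod f' e) + (\<Sum>e\<in>N. prod f' e)"
    unfolding EH' using finE0 finN disj by (intro sum.union_disjoint) auto
  also have "(\<Sum>e\<in>N. prod f' e) = \<xi> * s" using s unfolding f'_def \<xi>_def .
  also have "(\<Sum>e\<in>insert {a, b} (E0 - D). prod f' e) = prod f' {a, b} + (\<Sum>e\<in>E0 - D. prod f' e)"
    using abE0 finE0 by (intro sum.insert) auto
  also have "prod f' {a, b} = f a * f b" using neq r(3) by (simp add: f'_def)
  also have "(\<Sum>e\<in>E0 - D. prod f' e) = (\<Sum>e\<in>E0 - D. prod f e)"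
  proof (intro sum.cong refl)
    fix e assume "e \<in> E0 - D"
    then show "prod f' e = prod f e" using rE0[of e] by (intro prod.cong) (auto simp: f'_def)
  qed
  also have "(\<Sum>e\<in>E0 - D. prod f e) = (\<Sum>e\<in>E0. prod f e) - (\<Sum>e\<in>D. prod f e)"
    using D finE0 unfolding E0_def[symmetric] by (rule sum_diff[rotated])
  finally have S2: "(\<Sum>e\<in>edges H'. prod f' e) = f a * f b + ((\<Sum>e\<in>E0. prod f e) - (\<Sum>e\<in>D. prod f e)) + \<xi> * s" .
  have x1: "2 * \<xi> - \<rho> * \<xi>\<^sup>2 + 2 * (\<xi> * s) = (1 + s)\<^sup>2 / \<rho>"
    unfolding \<xi>_def using fr(2) by (simp add: power2_eq_square field_simps)
  have frv: "f r = (1 + (f a + f b)) / \<rho>" using fr by (simp add: field_simps)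
  \<comment> \<open>The same optimality at the old place: the eigenvalue equation gives
    \<open>f r\<close> the optimal value between \<open>a\<close> and \<open>b\<close>.\<close>
  have x2: "2 * f r - \<rho> * (f r)\<^sup>2 + 2 * (f a * f r + f b * f r) = (1 + f a + f b)\<^sup>2 / \<rho>"
    unfolding frv using fr(2) by (simp add: power2_eq_square field_simps)
  have e1: "energy H' \<rho> f' = 2 * (\<xi> + (\<Sum>v\<in>verts H - {r}. f v)) - \<rho> * (\<xi>\<^sup>2 + (\<Sum>v\<in>verts H - {r}. (f v)\<^sup>2))
     + 2 * (f a * f b + ((\<Sum>e\<in>E0. prod f e) - (\<Sum>e\<in>D. prod f e)) + \<xi> * s)"
    unfolding energy_def H'(2) V1 V2 S2 ..
  have e2: "energy H \<rho> f = 2 * (f r + (\<Sum>v\<in>verts H - {r}. f v)) - \<rho> * ((f r)\<^sup>2 + (\<Sum>v\<in>verts H - {r}. (f v)\<^sup>2))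
     + 2 * (f a * f r + (f b * f r + (\<Sum>e\<in>E0. prod f e)))"
    unfolding energy_def S1 V[of f] V[of "\<lambda>v. (f v)\<^sup>2"] ..
  have "energy H' \<rho> f' - energy H \<rho> f = (2 * \<xi> - \<rho> * \<xi>\<^sup>2 + 2 * (\<xi> * s))
     - (2 * f r - \<rho> * (f r)\<^sup>2 + 2 * (f a * f r + f b * f r)) + 2 * f a * f b - 2 * (\<Sum>e\<in>D. prod f e)"
    unfolding e1 e2 by (simp add: algebra_simps)
  then have "energy H' \<rho> f' = energy H \<rho> f + ((1 + s)\<^sup>2 / \<rho> - 2 * (\<Sum>e\<in>D. prod f e)) - insertion_gain \<rho> (f a) (f b)"
    unfolding x1 x2 insertion_gain_def by simp
  then show ?thesis unfolding f'_def \<xi>_def .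
qed

section \<open>Deviations along a pendant path\<close>

text \<open>Chebyshev polynomials of the second kind: \<open>cheb \<rho> (n + 1)\<close> is
  \<open>U n\<close> evaluated at \<open>\<rho> / 2\<close>. They solve the recurrence for the
  deviations on an untouched stretch.\<close>

fun cheb :: "real \<Rightarrow> nat \<Rightarrow> real" where
  "cheb \<rho> 0 = 0" | "cheb \<rho> (Suc 0) = 1" | "cheb \<rho> (Suc (Suc n)) = \<rho> * cheb \<rho> (Suc n) - cheb \<rho> n"

lemma cheb_growth:
  assumes "\<rho> \<ge> 2" shows "cheb \<rho> n \<ge> 0 \<and> cheb \<rho> (Suc n) \<ge> (\<rho> - 1) * cheb \<rho> n"
proof (induction n)
  case (Suc n)
  have "cheb \<rho> (Suc n) \<ge> (\<rho> - 1) * cheb \<rho> n" "cheb \<rho> n \<ge> 0" using Suc by auto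
  moreover have "(\<rho> - 1) * cheb \<rho> n \<ge> 1 * cheb \<rho> n" using assms Suc by (intro mult_right_mono) auto
  ultimately show ?case by (simp add: algebra_simps)
qed simp

lemma cheb_invariant: "(cheb \<rho> (Suc n))\<^sup>2 + (cheb \<rho> n)\<^sup>2 - \<rho> * cheb \<rho> (Suc n) * cheb \<rho> n = 1"
proof (induction n)
  case (Suc n)
  then show ?case by (simp add: power2_eq_square algebra_simps)
qed simp

text \<open>A pendant path with \<open>n\<close> vertices before the first fork, seen through its
  deviations: \<open>x i\<close> belongs to the \<open>i\<close>-th vertex counted from the end and
  \<open>x (Suc n)\<close> to the fork. The start value \<open>- c\<close> is the deviation of a
  missing neighbour, whose value is 0.\<close>

locale pendant_sequence =
  fixes \<rho> c E :: real and x :: "nat \<Rightarrow> real" and n :: nat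
  assumes \<rho>: "\<rho> > 2" and c: "c > 0" and E: "E > 0"
    and x0: "x 0 = - c" and xn: "x (Suc n) = E"
    and rec: "\<And>i. 1 \<le> i \<Longrightarrow> i \<le> n \<Longrightarrow> \<rho> * x i = x (i - 1) + x (i + 1)"
begin

definition invariant :: real where "invariant = (x 0)\<^sup>2 + (x 1)\<^sup>2 - \<rho> * x 0 * x 1"

lemma invariant_eq: "i \<le> n \<Longrightarrow> invariant = (x i)\<^sup>2 + (x (Suc i))\<^sup>2 - \<rho> * x i * x (Suc i)"
proof (induction i)
  case (Suc i)
  then have eq: "x (Suc (Suc i)) = \<rho> * x (Suc i) - x i" using rec[of "Suc i"] by simp
  have "invariant = (x i)\<^sup>2 + (x (Suc i))\<^sup>2 - \<rho> * x i * x (Suc i)" using Suc by simp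
  then show ?case unfolding eq by (simp add: power2_eq_square algebra_simps)
qed (simp add: invariant_def)

lemma closed_form: "i \<le> n \<Longrightarrow> x (Suc i) = cheb \<rho> (Suc i) * x 1 + c * cheb \<rho> i"
proof (induction i rule: induct_nat_012)
  case 1
  then have "x (Suc (Suc 0)) = \<rho> * x 1 - x 0" using rec[of 1] by simp
  then show ?case using x0 by simp
next
  case (ge2 i)
  then have eq: "x (Suc (Suc (Suc i))) = \<rho> * x (Suc (Suc i)) - x (Suc i)" using rec[of "Suc (Suc i)"] by simp
  have ih: "x (Suc i) = cheb \<rho> (Suc i) * x 1 + c * cheb \<rho> i"
    "x (Suc (Suc i)) = cheb \<rho> (Suc (Suc i)) * x 1 + c * cheb \<rho> (Suc i)" using ge2 by auto
  show ?case unfolding eq ih by (simp add: algebra_simps)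
qed simp

lemma cheb_pos: "cheb \<rho> (Suc i) \<ge> (\<rho> - 1) ^ i"
proof (induction i)
  case (Suc i)
  have "(\<rho> - 1) * (\<rho> - 1) ^ i \<le> (\<rho> - 1) * cheb \<rho> (Suc i)" using Suc \<rho> by (intro mult_left_mono) auto
  also have "\<dots> \<le> cheb \<rho> (Suc (Suc i))" using cheb_growth[of \<rho> "Suc i"] \<rho> by simp
  finally show ?case by simp
qed simp

text \<open>The closed form eliminates \<open>x 1\<close>, so the conserved quantity is expressed by
  the boundary values \<open>- c\<close> and \<open>E\<close> alone; \<open>cheb_invariant\<close>
  simplifies the coefficient of \<open>c\<^sup>2\<close>.\<close>

lemma invariant_formula:
  "invariant * (cheb \<rho> (Suc n))\<^sup>2 = E\<^sup>2 + c\<^sup>2 + c * E * (\<rho> * cheb \<rho> (Suc n) - 2 * cheb \<rho> n)"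
proof -
  let ?U = "cheb \<rho> (Suc n)" and ?u = "cheb \<rho> n"
  have x1: "?U * x 1 = E - c * ?u" using closed_form[of n] xn by simp
  have "invariant * ?U\<^sup>2 = c\<^sup>2 * ?U\<^sup>2 + (?U * x 1)\<^sup>2 + \<rho> * c * (?U * x 1) * ?U"
    unfolding invariant_def x0 by (simp add: power2_eq_square algebra_simps)
  also have "\<dots> = E\<^sup>2 + c * E * (\<rho> * ?U - 2 * ?u) + c\<^sup>2 * (?U\<^sup>2 + ?u\<^sup>2 - \<rho> * ?U * ?u)"
    unfolding x1 by (simp add: power2_eq_square algebra_simps)
  finally show ?thesis unfolding cheb_invariant by simp
qed

lemma cheb_ge_1: "cheb \<rho> (Suc i) \<ge> 1"
proof -
  have "(\<rho> - 1) ^ i \<ge> 1" using \<rho> by (intro one_le_power) simp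
  then show ?thesis using cheb_pos[of i] by linarith
qed

lemma cheb_mono: "cheb \<rho> i \<le> cheb \<rho> (Suc i)"
proof -
  have "cheb \<rho> i \<ge> 0" "cheb \<rho> (Suc i) \<ge> (\<rho> - 1) * cheb \<rho> i" using cheb_growth[of \<rho> i] \<rho> by auto
  moreover have "1 * cheb \<rho> i \<le> (\<rho> - 1) * cheb \<rho> i" using \<rho> \<open>cheb \<rho> i \<ge> 0\<close> by (intro mult_right_mono) auto
  ultimately show ?thesis by linarith
qed

text \<open>In \<open>invariant_formula\<close> the squares are dropped and
  \<open>cheb \<rho> n\<close> is replaced by the larger \<open>cheb \<rho> (Suc n)\<close>.\<close>

lemma invariant_lower: "invariant * cheb \<rho> (Suc n) \<ge> c * E * (\<rho> - 2)"
proof -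
  let ?U = "cheb \<rho> (Suc n)"
  have "c * E * ((\<rho> - 2) * ?U) \<le> c * E * (\<rho> * ?U - 2 * cheb \<rho> n)"
    using cheb_mono[of n] c E by (intro mult_left_mono) (auto simp: algebra_simps)
  also have "\<dots> \<le> invariant * ?U\<^sup>2" unfolding invariant_formula by simp
  finally have "(c * E * (\<rho> - 2)) * ?U \<le> (invariant * ?U) * ?U" by (simp add: power2_eq_square mult_ac)
  then show ?thesis using cheb_ge_1[of n] by (meson mult_right_le_imp_le less_le_trans zero_less_one)
qed

lemma invariant_positive: "invariant > 0"
proof -
  have "0 < c * E * (\<rho> - 2)" using c E \<rho> by simp
  then have "0 < invariant * cheb \<rho> (Suc n)" using invariant_lower by linarith
  then show ?thesis using cheb_ge_1[of n] by (simp add: zero_less_mult_iff)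
qed

lemma sign_change: "\<exists>j\<le>n. x j \<le> 0 \<and> 0 \<le> x (Suc j)"
proof (rule ccontr)
  assume n: "\<not> ?thesis"
  have "x i < 0" if "i \<le> Suc n" for i
    using that
  proof (induction i)
    case 0 then show ?case using x0 c by simp
  next
    case (Suc i)
    then have "x i < 0" "i \<le> n" by auto
    then show ?case using n by (meson less_eq_real_def not_less)
  qed
  then have "x (Suc n) < 0" by simp
  then show False using xn E by simp
qed

text \<open>Multiplied by \<open>\<rho>\<close>, the left side differs from the invariant by
  \<open>- (\<rho> - 2) * x j * x (Suc j)\<close>, which is nonnegative where the sign
  changes.\<close>

lemma gain_at_sign_change:
  assumes "j \<le> n" "x j \<le> 0" "0 \<le> x (Suc j)"
  shows "(x j + x (Suc j))\<^sup>2 / \<rho> - 2 * x j * x (Suc j) \<ge> invariant / \<rho>"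
proof -
  have "x j * x (Suc j) \<le> 0" using assms by (simp add: mult_nonpos_nonneg)
  then have "(\<rho> - 2) * (x j * x (Suc j)) \<le> 0"
    by (rule mult_nonneg_nonpos[rotated]) (use \<rho> in simp)
  then have "invariant \<le> (x j + x (Suc j))\<^sup>2 - \<rho> * (2 * x j * x (Suc j))"
    unfolding invariant_eq[OF assms(1)] by (simp add: power2_eq_square algebra_simps)
  then have "invariant / \<rho> \<le> ((x j + x (Suc j))\<^sup>2 - \<rho> * (2 * x j * x (Suc j))) / \<rho>"
    using \<rho> by (intro divide_right_mono) auto
  also have "\<dots> = (x j + x (Suc j))\<^sup>2 / \<rho> - 2 * x j * x (Suc j)" using \<rho> by (simp add: diff_divide_distrib)
  finally show ?thesis .
qed

text \<open>By the recurrence the first term is \<open>\<rho> * (x i)\<^sup>2\<close>, and the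
  product of the outer values is \<open>(x i)\<^sup>2 - invariant\<close>.\<close>

lemma removal_cost:
  assumes "1 \<le> i" "i \<le> n"
  shows "(x (i - 1) + x (i + 1))\<^sup>2 / \<rho> - 2 * x (i - 1) * x (i + 1) = (\<rho> - 2) * (x i)\<^sup>2 + 2 * invariant"
proof -
  have r: "x (i - 1) + x (i + 1) = \<rho> * x i" using rec[OF assms] by simp
  have "(x (i - 1) + x (i + 1))\<^sup>2 / \<rho> = \<rho> * (x i)\<^sup>2" unfolding r using \<rho> by (simp add: power2_eq_square)
  moreover have "invariant = (x (i - 1))\<^sup>2 + (x i)\<^sup>2 - \<rho> * x (i - 1) * x i"
    using invariant_eq[of "i - 1"] assms by simp
  moreover have "x (i - 1) * x (i + 1) = \<rho> * x i * x (i - 1) - (x (i - 1))\<^sup>2"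
    using r by (simp add: power2_eq_square algebra_simps) (metis distrib_left mult.left_commute mult.commute)
  ultimately show ?thesis by (simp add: algebra_simps)
qed

text \<open>If the terminal value is neither too small nor too large, one of the vertices next to the
  sign change is an inner vertex of the pendant path, and it is cheap to remove.\<close>

lemma cheap_removal:
  fixes d :: real
  assumes d: "d \<ge> 3" "\<rho> \<ge> 200 * d\<^sup>2" and E1: "c / (2 * \<rho>) \<le> E" and E2: "E \<le> 2 * d * c / \<rho>" and n: "n \<ge> 3"
  shows "\<exists>i. 2 \<le> i \<and> i \<le> n \<and> (\<rho> - 2) * (x i)\<^sup>2 + 2 * invariant < 3 * invariant"
    "invariant * cheb \<rho> (Suc n) \<le> 4 * d * c\<^sup>2"
proof -
  let ?U = "cheb \<rho> (Suc n)"
  have dd: "d * d \<ge> 3 * d" using d(1) by (intro mult_right_mono) auto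
  have "\<rho> \<ge> 200 * (d * d)" using d(2) by (simp add: power2_eq_square)
  then have r1: "\<rho> \<ge> 600 * d" using dd by linarith
  then have r2: "\<rho> \<ge> 1800" using d(1) by linarith
  note \<rho>d = r1 r2
  have U1: "?U \<ge> 1" by (rule cheb_ge_1)
  have "2 * d * c / \<rho> \<le> c" using \<rho>d c d by (simp add: pos_divide_le_eq mult.commute)
  then have Ec: "E \<le> c" using E2 by simp
  have "E\<^sup>2 \<le> c\<^sup>2" using Ec E by (intro power_mono) auto
  moreover have "c * E * (\<rho> * ?U - 2 * cheb \<rho> n) \<le> c * E * (\<rho> * ?U)"
    using c E cheb_growth[of \<rho> n] \<rho> by (intro mult_left_mono) auto
  moreover have "c * E * (\<rho> * ?U) \<le> c * (2 * d * c / \<rho>) * (\<rho> * ?U)"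
    using c E2 U1 \<rho> by (intro mult_right_mono mult_left_mono) auto
  moreover have "c * (2 * d * c / \<rho>) * (\<rho> * ?U) = 2 * d * c\<^sup>2 * ?U" using \<rho> by (simp add: power2_eq_square)
  moreover have "2 * c\<^sup>2 \<le> 2 * d * c\<^sup>2 * ?U"
  proof -
    have "2 * 1 \<le> 2 * d * ?U" using d U1 by (intro mult_mono) auto
    then have "(2 * 1) * c\<^sup>2 \<le> (2 * d * ?U) * c\<^sup>2" by (intro mult_right_mono) auto
    then show ?thesis by (simp add: mult_ac)
  qed
  ultimately have "invariant * ?U\<^sup>2 \<le> 4 * d * c\<^sup>2 * ?U" unfolding invariant_formula by linarith
  then have "(invariant * ?U) * ?U \<le> (4 * d * c\<^sup>2) * ?U" by (simp add: power2_eq_square mult_ac)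
  then show IU: "invariant * ?U \<le> 4 * d * c\<^sup>2" using U1 by (meson mult_right_le_imp_le less_le_trans zero_less_one)
  have I0: "invariant > 0" by (rule invariant_positive)
  have U3: "?U \<ge> (\<rho> - 1) ^ 3"
  proof -
    have "(\<rho> - 1) ^ 3 \<le> (\<rho> - 1) ^ n" using n \<rho> by (intro power_increasing) auto
    then show ?thesis using cheb_pos[of n] by linarith
  qed
  \<comment> \<open>The invariant is at most \<open>32 * d * c\<^sup>2 / \<rho>\<^sup>3\<close>. If
    both values at the sign change were at least \<open>c / (2 * \<rho>)\<close> in modulus, it
    would be at least about \<open>c\<^sup>2 / (4 * \<rho>)\<close>.\<close>
  have small: "invariant < (\<rho> + 2) * (c\<^sup>2 / (4 * \<rho>\<^sup>2))"
  proof -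
    have "invariant * (\<rho> - 1) ^ 3 \<le> invariant * ?U" using U3 I0 by (intro mult_left_mono) auto
    then have a: "invariant * (\<rho> - 1) ^ 3 \<le> 4 * d * c\<^sup>2" using IU by linarith
    have b1: "\<rho> / 2 \<le> \<rho> - 1" using \<rho>d by simp
    have "(\<rho> / 2) ^ 3 \<le> (\<rho> - 1) ^ 3" using b1 \<rho> by (intro power_mono) auto
    then have "invariant * (\<rho> / 2) ^ 3 \<le> 4 * d * c\<^sup>2" using a I0 by (meson mult_left_mono less_imp_le order_trans)
    then have "invariant * \<rho>\<^sup>2 * \<rho> \<le> 32 * d * c\<^sup>2" by (simp add: power2_eq_square power3_eq_cube field_simps)
    moreover have "32 * d * c\<^sup>2 < \<rho> * (c\<^sup>2 / 4) * \<rho>"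
    proof -
      have "32 * d < \<rho> * (1 / 4) * \<rho>"
      proof -
        have "600 * d * 1800 \<le> \<rho> * \<rho>" using \<rho>d d by (intro mult_mono) auto
        then show ?thesis using d by simp
      qed
      then have "32 * d * c\<^sup>2 < \<rho> * (1 / 4) * \<rho> * c\<^sup>2" using c by (intro mult_strict_right_mono) auto
      then show ?thesis by (simp add: mult_ac)
    qed
    ultimately have "(invariant * \<rho>\<^sup>2) * \<rho> < (\<rho> * (c\<^sup>2 / 4)) * \<rho>" by linarith
    then have "invariant * \<rho>\<^sup>2 < \<rho> * (c\<^sup>2 / 4)" by (rule mult_right_less_imp_less) (use \<rho> in simp)
    also have "\<dots> \<le> (\<rho> + 2) * (c\<^sup>2 / 4)" by (intro mult_right_mono) auto
    finally have "invariant < (\<rho> + 2) * (c\<^sup>2 / 4) / \<rho>\<^sup>2" using \<rho> by (simp add: pos_less_divide_eq)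
    then show ?thesis by simp
  qed
  have big: "invariant < (\<rho> + 2) * y\<^sup>2" if y: "\<bar>y\<bar> \<ge> c / (2 * \<rho>)" for y
  proof -
    have "(c / (2 * \<rho>))\<^sup>2 \<le> \<bar>y\<bar>\<^sup>2" using y c \<rho> by (intro power_mono) auto
    then have "c\<^sup>2 / (4 * \<rho>\<^sup>2) \<le> y\<^sup>2" by (simp add: power_divide power_mult_distrib)
    then have "(\<rho> + 2) * (c\<^sup>2 / (4 * \<rho>\<^sup>2)) \<le> (\<rho> + 2) * y\<^sup>2" using \<rho> by (intro mult_left_mono) auto
    then show ?thesis using small by linarith
  qed
  have y0: "\<bar>x 0\<bar> \<ge> c / (2 * \<rho>)"
  proof -
    have "c / (2 * \<rho>) \<le> c / 1" using \<rho> c by (intro divide_left_mono) auto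
    then show ?thesis using x0 c by simp
  qed
  have yn: "\<bar>x (Suc n)\<bar> \<ge> c / (2 * \<rho>)" using xn E1 E by simp
  \<comment> \<open>Next to the missing neighbour the deviation is close to
    \<open>- c / \<rho>\<close>, because \<open>E\<close> is dominated by
    \<open>c * cheb \<rho> n\<close>.\<close>
  have y1: "\<bar>x 1\<bar> \<ge> c / (2 * \<rho>)"
  proof -
    let ?u = "cheb \<rho> n"
    obtain l where l: "n = Suc l" using n by (cases n) auto
    have u2: "?u \<ge> 2"
    proof -
      have "(\<rho> - 1) ^ 1 \<le> (\<rho> - 1) ^ l" using l n \<rho> by (intro power_increasing) auto
      then show ?thesis using cheb_pos[of l] l \<rho>d by simp
    qed
    have Uu: "?U \<le> \<rho> * ?u" using cheb_growth[of \<rho> l] \<rho> l by simp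
    have "?U * x 1 = E - c * ?u" using closed_form[of n] xn by simp
    then have "?U * (- x 1) = c * ?u - E" by simp
    also have "\<dots> \<ge> c * ?u / 2"
    proof -
      have "c * 2 \<le> c * ?u" using u2 c by (intro mult_left_mono) auto
      then show ?thesis using Ec by simp
    qed
    finally have h: "c * ?u / 2 \<le> ?U * (- x 1)" .
    then have pos: "- x 1 > 0"
    proof -
      have "0 < ?U * (- x 1)" using h c u2 by (smt (verit) divide_pos_pos mult_pos_pos)
      then show ?thesis by (rule zero_less_mult_pos) (use U1 in linarith)
    qed
    have "?U * (- x 1) \<le> (\<rho> * ?u) * (- x 1)" using Uu pos by (intro mult_right_mono) auto
    then have "c * ?u / 2 \<le> (\<rho> * ?u) * (- x 1)" using h by linarith
    then have "(c / 2) * ?u \<le> (\<rho> * (- x 1)) * ?u" by (simp add: mult_ac)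
    then have "c / 2 \<le> \<rho> * (- x 1)" using u2 by (meson mult_right_le_imp_le less_le_trans zero_less_numeral)
    then have "c / (2 * \<rho>) \<le> - x 1" using \<rho> by (simp add: pos_divide_le_eq mult.commute mult.left_commute)
    then show ?thesis by linarith
  qed
  obtain j where j: "j \<le> n" "x j \<le> 0" "0 \<le> x (Suc j)" using sign_change by blast
  have prodneg: "x j * x (Suc j) \<le> 0" using j by (simp add: mult_nonpos_nonneg)
  \<comment> \<open>At the sign change the three terms of the invariant are nonnegative, and both
    squares and the product of the moduli are at least the square of the smaller modulus.\<close>
  have sq: "(min \<bar>x j\<bar> \<bar>x (Suc j)\<bar>)\<^sup>2 * (\<rho> + 2) \<le> invariant"
  proof -
    define a where "a = \<bar>x j\<bar>"
    define b where "b = \<bar>x (Suc j)\<bar>"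
    define mm where "mm = min a b"
    have mm: "0 \<le> mm" "mm \<le> a" "mm \<le> b" by (auto simp: mm_def a_def b_def)
    have "invariant = a\<^sup>2 + b\<^sup>2 + \<rho> * (a * b)"
      unfolding invariant_eq[OF j(1)] a_def b_def using j by (simp add: abs_if)
    moreover have "mm\<^sup>2 \<le> a\<^sup>2" "mm\<^sup>2 \<le> b\<^sup>2" using mm by (auto intro: power_mono)
    moreover have "mm\<^sup>2 \<le> a * b" unfolding power2_eq_square using mm by (intro mult_mono) auto
    then have "\<rho> * mm\<^sup>2 \<le> \<rho> * (a * b)" using \<rho> by (intro mult_left_mono) auto
    ultimately show ?thesis unfolding mm_def[symmetric] a_def[symmetric] b_def[symmetric] by (simp add: algebra_simps)
  qed
  obtain i where i: "i = j \<or> i = Suc j" "(x i)\<^sup>2 * (\<rho> + 2) \<le> invariant"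
    using sq by (cases "\<bar>x j\<bar> \<le> \<bar>x (Suc j)\<bar>") (auto simp: min_def)
  then have nbig: "\<not> \<bar>x i\<bar> \<ge> c / (2 * \<rho>)" using big[of "x i"] by (auto simp: mult.commute)
  \<comment> \<open>The small value sits neither at the virtual vertex 0, nor at the end of the
    path, nor at the fork, so it belongs to a vertex that can be suppressed.\<close>
  then have "i \<noteq> 0" "i \<noteq> 1" "i \<noteq> Suc n" using y0 y1 yn by metis+
  then have rng: "2 \<le> i" "i \<le> n" using i(1) j(1) by auto
  have "(\<rho> - 2) * (x i)\<^sup>2 < invariant"
  proof (cases "x i = 0")
    case False
    then have "(\<rho> - 2) * (x i)\<^sup>2 < (x i)\<^sup>2 * (\<rho> + 2)" by (simp add: algebra_simps)
    then show ?thesis using i(2) by linarith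
  qed (use I0 in simp)
  then show "\<exists>i. 2 \<le> i \<and> i \<le> n \<and> (\<rho> - 2) * (x i)\<^sup>2 + 2 * invariant < 3 * invariant"
    using rng by (intro exI[of _ i]) auto
qed

end

lemma cheb_two_steps:
  assumes \<rho>: "\<rho> \<ge> 2" and "n + 2 \<le> m"
  shows "cheb \<rho> (Suc m) \<ge> (\<rho> - 1)\<^sup>2 * cheb \<rho> (Suc n)"
  using assms(2)
proof (induction m rule: dec_induct)
  case base
  have "(\<rho> - 1) * ((\<rho> - 1) * cheb \<rho> (Suc n)) \<le> (\<rho> - 1) * cheb \<rho> (Suc (Suc n))"
    using cheb_growth[OF \<rho>, of "Suc n"] \<rho> by (intro mult_left_mono) auto
  also have "\<dots> \<le> cheb \<rho> (Suc (Suc (Suc n)))" using cheb_growth[OF \<rho>, of "Suc (Suc n)"] by blast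
  finally show ?case by (simp add: power2_eq_square mult.assoc)
next
  case (step m)
  have "cheb \<rho> (Suc m) \<ge> 0" "cheb \<rho> (Suc (Suc m)) \<ge> (\<rho> - 1) * cheb \<rho> (Suc m)"
    using cheb_growth[OF \<rho>, of "Suc m"] by auto
  moreover have "1 * cheb \<rho> (Suc m) \<le> (\<rho> - 1) * cheb \<rho> (Suc m)" using \<rho> calculation by (intro mult_right_mono) auto
  ultimately show ?case using step by linarith
qed

text \<open>Two further vertices multiply the Chebyshev factor by at least
  \<open>(\<rho> - 1)\<^sup>2\<close> and shrink the invariant of the longer path accordingly. A
  removal there costs less than three times its invariant; an insertion into the shorter path gains
  at least the other invariant divided by \<open>\<rho>\<close>. One of the two factors
  \<open>\<rho>\<close> pays for this division, the other for \<open>d\<close> and the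
  constants.\<close>

lemma pendant_balance:
  fixes d :: real
  assumes X: "pendant_sequence \<rho> c E1 x a" and Y: "pendant_sequence \<rho> c E2 y b"
    and d: "d \<ge> 3" "\<rho> \<ge> 200 * d\<^sup>2" and E1: "c / (2 * \<rho>) \<le> E1"
    and E2: "c / (2 * \<rho>) \<le> E2" "E2 \<le> 2 * d * c / \<rho>" and ab: "a + 2 \<le> b" "1 \<le> a"
  shows "\<exists>i. 2 \<le> i \<and> i \<le> b \<and> (y (i - 1) + y (i + 1))\<^sup>2 / \<rho> - 2 * y (i - 1) * y (i + 1)
      < pendant_sequence.invariant \<rho> x / \<rho>"
proof -
  interpret X: pendant_sequence \<rho> c E1 x a by (rule X)
  interpret Y: pendant_sequence \<rho> c E2 y b by (rule Y)
  have b3: "b \<ge> 3" using ab by simp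
  obtain i where i: "2 \<le> i" "i \<le> b" "(\<rho> - 2) * (y i)\<^sup>2 + 2 * Y.invariant < 3 * Y.invariant"
    using Y.cheap_removal(1)[OF d E2 b3] by blast
  let ?U = "cheb \<rho> (Suc a)" and ?W = "cheb \<rho> (Suc b)"
  have dd: "d * d \<ge> 3 * d" using d(1) by (intro mult_right_mono) auto
  have "\<rho> \<ge> 200 * (d * d)" using d(2) by (simp add: power2_eq_square)
  then have r1: "\<rho> \<ge> 600 * d" using dd by linarith
  then have r2: "\<rho> \<ge> 1800" using d(1) by linarith
  note \<rho>d = r1 r2
  have U: "?U \<ge> 1" by (rule X.cheb_ge_1)
  have W: "?W \<ge> (\<rho> - 1)\<^sup>2 * ?U" by (rule cheb_two_steps) (use \<rho>d ab in auto)
  have IY: "Y.invariant * ?W \<le> 4 * d * c\<^sup>2" by (rule Y.cheap_removal(2)[OF d E2 b3])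
  have IX: "c * E1 * (\<rho> - 2) \<le> X.invariant * ?U" by (rule X.invariant_lower)
  have "c * (c / (2 * \<rho>)) * (\<rho> - 2) \<le> c * E1 * (\<rho> - 2)"
    using E1 X.c X.\<rho> by (intro mult_right_mono mult_left_mono) auto
  then have IX': "c * (c / (2 * \<rho>)) * (\<rho> - 2) \<le> X.invariant * ?U" using IX by linarith
  have "Y.invariant * ((\<rho> - 1)\<^sup>2 * ?U) \<le> 4 * d * c\<^sup>2"
    using W IY Y.invariant_positive by (meson mult_left_mono less_imp_le order_trans)
  moreover have "(\<rho> / 2)\<^sup>2 \<le> (\<rho> - 1)\<^sup>2" using \<rho>d by (intro power_mono) auto
  then have "Y.invariant * ((\<rho> / 2)\<^sup>2 * ?U) \<le> Y.invariant * ((\<rho> - 1)\<^sup>2 * ?U)"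
    using U Y.invariant_positive by (intro mult_left_mono mult_right_mono) auto
  ultimately have "Y.invariant * ((\<rho> / 2)\<^sup>2 * ?U) \<le> 4 * d * c\<^sup>2" by linarith
  then have A: "(Y.invariant * ?U) * \<rho>\<^sup>2 \<le> 16 * d * c\<^sup>2" by (simp add: power_divide field_simps)
  have B: "c\<^sup>2 * (\<rho> - 2) \<le> (X.invariant * ?U) * (2 * \<rho>)"
  proof -
    have "c * (c / (2 * \<rho>)) * (\<rho> - 2) * (2 * \<rho>) \<le> X.invariant * ?U * (2 * \<rho>)"
      using IX' X.\<rho> by (intro mult_right_mono) auto
    moreover have "c * (c / (2 * \<rho>)) * (\<rho> - 2) * (2 * \<rho>) = c\<^sup>2 * (\<rho> - 2)" using X.\<rho> by (simp add: power2_eq_square)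
    ultimately show ?thesis by linarith
  qed
  \<comment> \<open>96 is \<open>6 * 16\<close>: the factor 16 comes from \<open>A\<close>, the
    factor 6 from the three invariants and the 2 in \<open>B\<close>.\<close>
  have "96 * d * c\<^sup>2 < c\<^sup>2 * (\<rho> - 2)"
  proof -
    have "96 * d < \<rho> - 2" using \<rho>d d by linarith
    then have "96 * d * c\<^sup>2 < (\<rho> - 2) * c\<^sup>2" using X.c by (intro mult_strict_right_mono) auto
    then show ?thesis by (simp add: mult.commute)
  qed
  then have "6 * ((Y.invariant * ?U) * \<rho>\<^sup>2) < (X.invariant * ?U) * (2 * \<rho>)" using A B by linarith
  then have "(3 * \<rho> * Y.invariant) * (2 * ?U * \<rho>) < X.invariant * (2 * ?U * \<rho>)"
    by (simp add: power2_eq_square mult_ac)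
  moreover have "2 * ?U * \<rho> > 0" using U X.\<rho> by simp
  ultimately have "3 * \<rho> * Y.invariant < X.invariant" by (meson mult_less_cancel_right_pos)
  then have "3 * Y.invariant < X.invariant / \<rho>" using X.\<rho> by (simp add: pos_less_divide_eq mult_ac)
  moreover have "(y (i - 1) + y (i + 1))\<^sup>2 / \<rho> - 2 * y (i - 1) * y (i + 1) = (\<rho> - 2) * (y i)\<^sup>2 + 2 * Y.invariant"
    by (rule Y.removal_cost) (use i in auto)
  ultimately show ?thesis using i by (intro exI[of _ i]) auto
qed

section \<open>Attachable vertices\<close>

lemma add_vertex_edgeI:
  "e \<in> edges G \<Longrightarrow> Some ` e \<in> edges (add_vertex G X)"
  "{p, q} \<in> edges G \<Longrightarrow> {Some p, Some q} \<in> edges (add_vertex G X)"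
  "w \<in> X \<Longrightarrow> {None, Some w} \<in> edges (add_vertex G X)"
  using imageI[of "{p, q}" "edges G" "(`) Some"] by (auto simp: add_vertex_def)

lemma verts_add_vertex: "verts (add_vertex G X) = insert None (Some ` verts G)"
  by (simp add: add_vertex_def)

lemma join_edgeI: "d \<in> edges H \<Longrightarrow> Inr ` d \<in> edges (K2 \<nabla> H)"
  by (simp add: join_def)

lemma simple_graph_change:
  assumes "simple_graph H" "verts H' = verts H"
    and "\<And>e. e \<in> edges H' \<Longrightarrow> e \<in> edges H \<or> (\<exists>a\<in>verts H. \<exists>b\<in>verts H. a \<noteq> b \<and> e = {a, b})"
  shows "simple_graph H'"
  unfolding simple_graph_def
proof (intro conjI subsetI)
  show "finite (verts H')" using assms(1,2) unfolding simple_graph_def by simp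
  fix e assume e: "e \<in> edges H'"
  show "e \<in> {e. e \<subseteq> verts H' \<and> card e = 2}"
    using assms(3)[OF e]
  proof (elim disjE bexE conjE)
    assume "e \<in> edges H"
    then show ?thesis using assms(1) unfolding assms(2) simple_graph_def by (auto dest: subsetD)
  next
    fix a b assume "a \<in> verts H" "b \<in> verts H" "a \<noteq> b" "e = {a, b}"
    then show ?thesis unfolding assms(2) by simp
  qed
qed

text \<open>Expresses that \<open>v\<close> and both vertices of \<open>K2\<close> lie on a common
  face, by the possibility of drawing a new vertex there.\<close>

definition attachable :: "'a sgraph \<Rightarrow> 's topology \<Rightarrow> 'a \<Rightarrow> bool" where
  "attachable H S v \<longleftrightarrow> embeddable (add_vertex (K2 \<nabla> H) {Inl True, Inl False, Inr v}) S"

text \<open>The new vertex at \<open>v\<close> takes over the name \<open>r\<close>, while the old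
  \<open>r\<close> is contracted into its neighbour \<open>a\<close>, which leaves the edge
  \<open>ab\<close> behind.\<close>

lemma embeddable_leaf_move:
  fixes H :: "'a sgraph"
  assumes S: "surface S" and H: "simple_graph H" and att: "attachable H S v"
    and v: "v \<in> verts H" "r \<in> verts H" "r \<noteq> v"
    and r: "{w. {r, w} \<in> edges H} = {a, b}" "a \<noteq> b"
    and H': "simple_graph H'" "verts H' = verts H"
      "edges H' \<subseteq> insert {v, r} (insert {a, b} (edges H - {{a, r}, {b, r}}))"
  shows "embeddable (K2 \<nabla> H') S"
proof -
  let ?X = "{Inl True, Inl False, Inr v}"
  let ?A = "add_vertex (K2 \<nabla> H) ?X"
  define \<phi> where "\<phi> x = (case x of None \<Rightarrow> Inr r | Some z \<Rightarrow> if z = Inr r then Inr a else z)" for x :: "(bool + 'a) option"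
  have A: "simple_graph ?A"
    by (rule simple_graph_add_vertex[OF simple_graph_join[OF H]]) (use v in \<open>auto simp: verts_join\<close>)
  have er: "{r, a} \<in> edges H" "{r, b} \<in> edges H" using r(1) by auto
  have ab: "a \<noteq> r" "b \<noteq> r" "a \<in> verts H" "b \<in> verts H"
    using simple_graph_edgeD[OF H er(1)] simple_graph_edgeD[OF H er(2)] by auto
  have keep: "\<exists>e'\<in>edges ?A. \<phi> ` e' = e" if e: "e \<in> edges (K2 \<nabla> H)" "Inr r \<notin> e" for e
  proof (rule bexI[of _ "Some ` e"])
    have "\<phi> ` Some ` e = (\<lambda>z. z) ` e" unfolding image_image by (rule image_cong) (use e in \<open>auto simp: \<phi>_def\<close>)
    then show "\<phi> ` Some ` e = e" by simp
  qed (use e in \<open>simp add: add_vertex_edgeI\<close>)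
  show ?thesis
  proof (rule embeddable_contract[OF S A att[unfolded attachable_def] simple_graph_join[OF H'(1)], of "Some (Inr a)" "Some (Inr r)" \<phi>])
    show "{Some (Inr a), Some (Inr r)} \<in> edges ?A"
      by (rule add_vertex_edgeI) (use er in \<open>simp add: join_edge_iff insert_commute\<close>)
    show "\<phi> (Some (Inr a)) = \<phi> (Some (Inr r))" by (simp add: \<phi>_def)
  next
    fix x x' assume "x \<in> verts ?A" "x' \<in> verts ?A" "\<phi> x = \<phi> x'"
    then show "x = x' \<or> {x, x'} = {Some (Inr a), Some (Inr r)}"
      using ab by (cases x; cases x') (auto simp: \<phi>_def split: if_splits)
  next
    show "verts (K2 \<nabla> H') \<subseteq> \<phi> ` verts ?A"
    proof
      fix x :: "bool + 'a" assume x: "x \<in> verts (K2 \<nabla> H')"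
      have "x = \<phi> (if x = Inr r then None else Some x)" by (simp add: \<phi>_def)
      moreover have "(if x = Inr r then None else Some x) \<in> verts ?A"
        using x H'(2) by (simp add: verts_add_vertex verts_join)
      ultimately show "x \<in> \<phi> ` verts ?A" by (rule image_eqI)
    qed
  next
    fix e assume "e \<in> edges (K2 \<nabla> H')"
    then show "\<exists>e'\<in>edges ?A. \<phi> ` e' = e"
    proof (cases rule: join_edge_cases)
      case 1
      show ?thesis by (rule keep) (simp_all add: 1 join_edge_iff)
    next
      case (2 i w)
      show ?thesis
      proof (cases "w = r")
        case True
        have "\<phi> ` {None, Some (Inl i)} = e" using 2 True by (auto simp: \<phi>_def)
        moreover have "{None, Some (Inl i)} \<in> edges ?A" by (rule add_vertex_edgeI) (cases i; simp)
        ultimately show ?thesis by blast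
      next
        case False
        show ?thesis by (rule keep) (use 2 False H'(2) in \<open>simp_all add: join_edge_iff\<close>)
      qed
    next
      case (3 d)
      then consider "d = {v, r}" | "d = {a, b}" | "d \<in> edges H" "d \<noteq> {a, r}" "d \<noteq> {b, r}" using H'(3) by blast
      then show ?thesis
      proof cases
        case 1
        have "\<phi> ` {None, Some (Inr v)} = e" using 1 3 v by (auto simp: \<phi>_def)
        moreover have "{None, Some (Inr v)} \<in> edges ?A" by (rule add_vertex_edgeI) simp
        ultimately show ?thesis by blast
      next
        case 2
        have "\<phi> ` {Some (Inr r), Some (Inr b)} = e" using 2 3 ab by (auto simp: \<phi>_def)
        moreover have "{Some (Inr r), Some (Inr b)} \<in> edges ?A"
          by (rule add_vertex_edgeI) (use er in \<open>simp add: join_edge_iff\<close>)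
        ultimately show ?thesis by blast
      next
        case c: 3
        have "r \<notin> d"
        proof
          assume "r \<in> d"
          have "card d = 2" using c(1) H unfolding simple_graph_def by auto
          then obtain w where w: "d = {r, w}" using \<open>r \<in> d\<close> by (metis card_2_iff insertE insert_commute singletonD)
          then have "w \<in> {a, b}" using c(1) r(1) by blast
          then show False using c w by (auto simp: insert_commute)
        qed
        then show ?thesis by (intro keep) (use c 3 in \<open>auto intro: join_edgeI\<close>)
      qed
    qed
  qed
qed

text \<open>The corner vertex, contracted into \<open>x\<close>, leaves the edge \<open>xy\<close>
  behind.\<close>

lemma embeddable_add_edge:
  fixes H :: "'a sgraph"
  assumes S: "surface S" and H: "simple_graph H" and v: "v \<in> verts (K2 \<nabla> H)"
    and emb: "embeddable (add_vertex (K2 \<nabla> H) {v, Inr x, Inr y}) S"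
    and xy: "x \<in> verts H" "y \<in> verts H" "x \<noteq> y"
  shows "embeddable (K2 \<nabla> \<lparr>verts = verts H, edges = insert {x, y} (edges H)\<rparr>) S"
proof -
  let ?A = "add_vertex (K2 \<nabla> H) {v, Inr x, Inr y}" and ?H = "\<lparr>verts = verts H, edges = insert {x, y} (edges H)\<rparr>"
  define \<phi> where "\<phi> z = (case z of None \<Rightarrow> Inr x | Some z \<Rightarrow> z)" for z :: "(bool + 'a) option"
  have A: "simple_graph ?A"
    by (rule simple_graph_add_vertex[OF simple_graph_join[OF H]]) (use v xy in \<open>auto simp: verts_join\<close>)
  have H': "simple_graph ?H" by (rule simple_graph_change[OF H]) (use xy in auto)
  have keep: "\<exists>e'\<in>edges ?A. \<phi> ` e' = e" if e: "e \<in> edges (K2 \<nabla> H)" for e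
    by (rule bexI[of _ "Some ` e"]) (use e in \<open>simp_all add: add_vertex_edgeI image_image \<phi>_def\<close>)
  show ?thesis
  proof (rule embeddable_contract[OF S A emb simple_graph_join[OF H'], of None "Some (Inr x)" \<phi>])
    show "{None, Some (Inr x)} \<in> edges ?A" by (rule add_vertex_edgeI) simp
    show "\<phi> None = \<phi> (Some (Inr x))" by (simp add: \<phi>_def)
  next
    fix z z' assume "z \<in> verts ?A" "z' \<in> verts ?A" "\<phi> z = \<phi> z'"
    then show "z = z' \<or> {z, z'} = {None, Some (Inr x)}" by (cases z; cases z') (auto simp: \<phi>_def)
  next
    show "verts (K2 \<nabla> ?H) \<subseteq> \<phi> ` verts ?A"
    proof
      fix z assume "z \<in> verts (K2 \<nabla> ?H)"
      then show "z \<in> \<phi> ` verts ?A" by (intro image_eqI[of _ _ "Some z"]) (auto simp: verts_add_vertex verts_join \<phi>_def)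
    qed
  next
    fix e assume "e \<in> edges (K2 \<nabla> ?H)"
    then show "\<exists>e'\<in>edges ?A. \<phi> ` e' = e"
    proof (cases rule: join_edge_cases)
      case (3 d)
      show ?thesis
      proof (cases "d = {x, y}")
        case True
        have "\<phi> ` {None, Some (Inr y)} = e" using 3 True by (auto simp: \<phi>_def)
        moreover have "{None, Some (Inr y)} \<in> edges ?A" by (rule add_vertex_edgeI) simp
        ultimately show ?thesis by blast
      next
        case False
        then show ?thesis using 3 keep[OF join_edgeI] by auto
      qed
    qed (use keep in \<open>simp_all add: join_edge_iff\<close>)
  qed
qed

text \<open>This is \<open>insertion_gain\<close> minus \<open>c\<close>, written in deviations; see
  \<open>excess_insertion_gain\<close>.\<close>

definition excess :: "real \<Rightarrow> real \<Rightarrow> real \<Rightarrow> real" where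
  "excess \<rho> x y = (x + y)\<^sup>2 / \<rho> - 2 * x * y"

text \<open>Here \<open>a\<close> and \<open>b\<close> are the deviations on both sides of a
  suppressed vertex, and \<open>z\<close> is that of a vertex receiving a leaf. The first excess is
  quadratic in small quantities; the second contains \<open>c\<^sup>2 / \<rho>\<close>, since the
  absent second neighbour of a leaf has deviation \<open>- c\<close>.\<close>

lemma excess_small:
  fixes c d :: real
  assumes c: "c > 0" and d: "d \<ge> 3" "\<rho> \<ge> 200 * d\<^sup>2" and a: "\<bar>a\<bar> \<le> 2 * d * c / \<rho>" "\<bar>b\<bar> \<le> 2 * d * c / \<rho>"
    and z: "- (4 * d * c / \<rho>\<^sup>2) \<le> z" "\<bar>z\<bar> \<le> 2 * d * c / \<rho>"
  shows "excess \<rho> a b < excess \<rho> (- c) z"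
proof -
  have dd: "d * d \<ge> 3 * d" using d(1) by (intro mult_right_mono) auto
  have d2: "\<rho> \<ge> 200 * (d * d)" using d(2) by (simp add: power2_eq_square)
  have r: "\<rho> \<ge> 600 * d" "\<rho> \<ge> 1800" using d2 dd d(1) by linarith+
  define e where "e = 2 * d * c / \<rho>"
  have e0: "e \<ge> 0" "e * \<rho> = 2 * d * c" unfolding e_def using r c d(1) by auto
  have "e * \<rho> \<le> \<rho> * (c / 300)" unfolding e0(2) using mult_right_mono[OF r(1), of "c / 300"] c by simp
  then have e1: "e \<le> c / 300" using r by (simp add: mult.commute)
  \<comment> \<open>The source of the constant 200: \<open>\<rho> * e\<^sup>2\<close> equals
    \<open>4 * d\<^sup>2 * c\<^sup>2 / \<rho>\<close>. It makes \<open>\<rho>\<close> times the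
    first excess at most \<open>6 / 50\<close> of \<open>c\<^sup>2\<close>, while
    \<open>\<rho>\<close> times the second is at least \<open>1 / 4 - 4 / 300\<close> of it.\<close>
  have e2: "\<rho> * (e * e) \<le> c * c / 50"
  proof -
    have "(\<rho> * (e * e)) * \<rho> = (e * \<rho>) * (e * \<rho>)" by simp
    also have "\<dots> = 4 * (d * d) * (c * c)" unfolding e0(2) by simp
    also have "\<dots> \<le> (\<rho> / 50) * (c * c)" using d2 by (intro mult_right_mono) auto
    finally have "(\<rho> * (e * e)) * \<rho> \<le> (c * c / 50) * \<rho>" by (simp add: mult.commute)
    then show ?thesis using r by (simp only: mult_le_cancel_right_pos)
  qed
  have ab: "\<bar>a\<bar> * \<bar>b\<bar> \<le> e * e" using a e0 unfolding e_def[symmetric] by (intro mult_mono) auto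
  have "\<bar>a + b\<bar> \<le> 2 * e" using a unfolding e_def[symmetric] by linarith
  then have "\<bar>a + b\<bar>\<^sup>2 \<le> (2 * e)\<^sup>2" by (intro power_mono) auto
  then have s: "(a + b)\<^sup>2 \<le> 4 * (e * e)" by (simp add: power2_eq_square)
  have "\<rho> * excess \<rho> a b = (a + b)\<^sup>2 - 2 * (\<rho> * (a * b))" using r unfolding excess_def by (simp add: algebra_simps)
  moreover have "\<rho> * (- (e * e)) \<le> \<rho> * (a * b)"
    using ab r abs_ge_minus_self[of "a * b"] by (intro mult_left_mono) (auto simp: abs_mult)
  ultimately have L: "\<rho> * excess \<rho> a b \<le> 4 * (e * e) + 2 * (\<rho> * (e * e))" using s by simp
  have ee: "e * e \<le> \<rho> * (e * e)" using r mult_right_mono[of 1 \<rho> "e * e"] by simp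
  have "\<rho> * excess \<rho> (- c) z = (z - c)\<^sup>2 + 2 * c * (\<rho> * z)" using r unfolding excess_def by (simp add: algebra_simps)
  moreover have "(z - c)\<^sup>2 \<ge> (c / 2)\<^sup>2"
    using power_mono[of "c / 2" "c - z" 2] z(2) e1 c unfolding e_def[symmetric] by (simp add: power2_commute)
  moreover have "\<rho> * z \<ge> - 2 * e"
  proof -
    have "\<rho> * (- (4 * d * c / \<rho>\<^sup>2)) \<le> \<rho> * z" using z(1) r by (intro mult_left_mono) auto
    moreover have "\<rho> * (- (4 * d * c / \<rho>\<^sup>2)) = - 2 * e" unfolding e_def using r by (simp add: power2_eq_square)
    ultimately show ?thesis by simp
  qed
  then have "c * (- 2 * e) \<le> c * (\<rho> * z)" using c by (intro mult_left_mono) auto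
  moreover have "c * e \<le> c * (c / 300)" using e1 c by (intro mult_left_mono) auto
  ultimately have R: "\<rho> * excess \<rho> (- c) z \<ge> c * c / 4 - 4 * (c * c / 300)" by (simp add: power2_eq_square)
  have "c * c > 0" using c by simp
  then have "\<rho> * excess \<rho> a b < \<rho> * excess \<rho> (- c) z" using L R e2 ee by linarith
  then show ?thesis using r by simp
qed

section \<open>Extremal graphs on a path\<close>

text \<open>Only the comparison \<open>opt\<close> remains of the extremality of \<open>K2 \<nabla> H\<close>; the vector \<open>f\<close> is its Perron
  vector on \<open>H\<close>, normalised to be \<open>1\<close> on \<open>K2\<close>.\<close>

locale spex_path =
  fixes H :: "'a sgraph" and u :: "nat \<Rightarrow> 'a" and m k :: nat and F :: "'a set set" and S :: "'s topology"
    and \<rho> :: real and f :: "'a \<Rightarrow> real"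
  assumes H: "simple_graph H" and u: "bij_betw u {1..m} (verts H)"
    and F: "finite F" "card F = k" "F \<inter> {{u i, u (i + 1)} | i. i \<in> {1..<m}} = {}"
    and E: "edges H = {{u i, u (i + 1)} | i. i \<in> {1..<m}} \<union> F"
    and S: "surface S" and emb: "embeddable (K2 \<nabla> H) S"
    and f_pos: "\<And>v. v \<in> verts H \<Longrightarrow> f v > 0"
    and f_eq: "\<And>v. v \<in> verts H \<Longrightarrow> \<rho> * f v = 1 + (\<Sum>w | {v, w} \<in> edges H. f w)"
    and opt: "\<And>H' f'. simple_graph H' \<Longrightarrow> verts H' = verts H \<Longrightarrow> embeddable (K2 \<nabla> H') S
      \<Longrightarrow> energy H' \<rho> f' \<le> energy H \<rho> f"
    and k: "k \<ge> 1" and m: "m > 3 * k + 4" and \<rho>: "\<rho> \<ge> 200 * (real k + 2)\<^sup>2"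
begin

definition c :: real where "c = 1 / (\<rho> - 2)"
definition g :: "'a \<Rightarrow> real" where "g v = f v - c"
definition nb :: "'a \<Rightarrow> 'a set" where "nb v = {w. {v, w} \<in> edges H}"
text \<open>Ends of extra edges. They turn out to be exactly the forks (\<open>fork_iff\<close>),
  but only after \<open>ends\<close> has shown that the ends of the path are untouched: a touched
  end could have degree 2.\<close>

definition touched :: "nat \<Rightarrow> bool" where "touched i \<longleftrightarrow> u i \<in> \<Union>F"
text \<open>The condition on \<open>u (l - 1)\<close> and \<open>u (l + 1)\<close> prevents the
  suppression from doubling an edge.\<close>

definition suppressible :: "nat \<Rightarrow> bool" where
  "suppressible l \<longleftrightarrow> 1 < l \<and> l < m \<and> \<not> touched l \<and> {u (l - 1), u (l + 1)} \<notin> edges H"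

section \<open>Adjacency and degrees along the path\<close>

lemma u_eq_iff: "i \<in> {1..m} \<Longrightarrow> j \<in> {1..m} \<Longrightarrow> u i = u j \<longleftrightarrow> i = j"
  using u unfolding bij_betw_def by (auto dest: inj_onD)

lemma u_vert: "i \<in> {1..m} \<Longrightarrow> u i \<in> verts H"
  using u unfolding bij_betw_def by auto

lemma vert_u: assumes "v \<in> verts H" obtains i where "i \<in> {1..m}" "v = u i"
proof -
  have "v \<in> u ` {1..m}" using assms u unfolding bij_betw_def by blast
  then show ?thesis using that by blast
qed

lemma edge_iff:
  assumes "i \<in> {1..m}" "j \<in> {1..m}"
  shows "{u i, u j} \<in> edges H \<longleftrightarrow> i + 1 = j \<or> j + 1 = i \<or> {u i, u j} \<in> F"
proof -
  have "{u i, u j} \<in> {{u i, u (i + 1)} | i. i \<in> {1..<m}} \<longleftrightarrow> i + 1 = j \<or> j + 1 = i"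
  proof
    assume "{u i, u j} \<in> {{u i, u (i + 1)} | i. i \<in> {1..<m}}"
    then obtain l where l: "l \<in> {1..<m}" "{u i, u j} = {u l, u (l + 1)}" by blast
    then have "l \<in> {1..m}" "l + 1 \<in> {1..m}" by auto
    then show "i + 1 = j \<or> j + 1 = i" using l(2) assms by (auto simp: doubleton_eq_iff u_eq_iff)
  next
    assume "i + 1 = j \<or> j + 1 = i"
    then have "i \<in> {1..<m} \<and> {u i, u j} = {u i, u (i + 1)} \<or> j \<in> {1..<m} \<and> {u i, u j} = {u j, u (j + 1)}"
      using assms by (auto simp: insert_commute)
    then show "{u i, u j} \<in> {{u i, u (i + 1)} | i. i \<in> {1..<m}}" by blast
  qed
  then show ?thesis unfolding E by blast
qed

lemma path_edge: "1 \<le> i \<Longrightarrow> i < m \<Longrightarrow> {u i, u (i + 1)} \<in> edges H"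
  using edge_iff[of i "i + 1"] by simp

lemma F_edge: "e \<in> F \<Longrightarrow> e \<in> edges H"
  unfolding E by blast

lemma finite_verts: "finite (verts H)"
  using H unfolding simple_graph_def by simp

lemma nb_verts: "nb v \<subseteq> verts H"
  unfolding nb_def using simple_graph_edgeD(3)[OF H] by blast

lemma finite_nb: "finite (nb v)"
  using finite_subset[OF nb_verts finite_verts] .

lemma nb_sym: "w \<in> nb v \<longleftrightarrow> v \<in> nb w"
  unfolding nb_def by (simp add: insert_commute)

lemma degree_nb: "degree H v = card (nb v)"
proof -
  have "bij_betw (\<lambda>w. {v, w}) (nb v) {e \<in> edges H. v \<in> e}"
    unfolding bij_betw_def
  proof (intro conjI set_eqI iffI)
    show "inj_on (\<lambda>w. {v, w}) (nb v)" by (auto simp: inj_on_def doubleton_eq_iff)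
    fix e assume e: "e \<in> {e \<in> edges H. v \<in> e}"
    then have "card e = 2" using H unfolding simple_graph_def by (auto dest: subsetD)
    then obtain w where "e = {v, w}" using e by (metis (no_types, lifting) card_2_iff insertE insert_commute mem_Collect_eq singletonD)
    then show "e \<in> (\<lambda>w. {v, w}) ` nb v" using e unfolding nb_def by blast
  qed (auto simp: nb_def)
  then show ?thesis unfolding degree_def by (simp add: bij_betw_same_card)
qed

lemma touchedE:
  assumes "touched i" "i \<in> {1..m}"
  obtains j where "j \<in> {1..m}" "{u i, u j} \<in> F" "i \<noteq> j" "j \<noteq> i + 1" "i \<noteq> j + 1"
proof -
  obtain e where e: "e \<in> F" "u i \<in> e" using assms(1) unfolding touched_def by blast
  have eE: "e \<in> edges H" by (rule F_edge[OF e(1)])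
  then have "card e = 2" using H unfolding simple_graph_def by (auto dest: subsetD)
  then obtain w where w: "e = {u i, w}" using e(2) by (metis card_2_iff insertE insert_commute singletonD)
  have "w \<in> verts H" "u i \<noteq> w" using simple_graph_edgeD[OF H eE[unfolded w]] by auto
  then obtain j where j: "j \<in> {1..m}" "w = u j" by (blast elim: vert_u)
  have n: "{u i, u j} \<notin> {{u i, u (i + 1)} | i. i \<in> {1..<m}}" using e(1) F(3) unfolding w j(2) by blast
  have "j \<noteq> i + 1"
  proof
    assume "j = i + 1"
    then have "i \<in> {1..<m}" "{u i, u j} = {u i, u (i + 1)}" using assms(2) j(1) by auto
    then show False using n by blast
  qed
  moreover have "i \<noteq> j + 1"
  proof
    assume "i = j + 1"
    then have "j \<in> {1..<m}" "{u i, u j} = {u j, u (j + 1)}" using assms(2) j(1) by (auto simp: insert_commute)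
    then show False using n by blast
  qed
  ultimately show ?thesis using that[of j] e w j \<open>u i \<noteq> w\<close> by auto
qed

lemma touchedI: "{u i, u j} \<in> F \<Longrightarrow> touched i \<and> touched j"
  unfolding touched_def by blast

lemma nb_path: "1 < i \<Longrightarrow> i \<le> m \<Longrightarrow> u (i - 1) \<in> nb (u i)" "1 \<le> i \<Longrightarrow> i < m \<Longrightarrow> u (i + 1) \<in> nb (u i)"
  unfolding nb_def using path_edge[of "i - 1"] path_edge[of i] by (simp_all add: insert_commute)

lemma nb_untouched_subset:
  assumes "\<not> touched i" "i \<in> {1..m}" shows "nb (u i) \<subseteq> {u (i - 1), u (i + 1)}"
proof
  fix w assume w: "w \<in> nb (u i)"
  then obtain j where j: "j \<in> {1..m}" "w = u j" using nb_verts by (blast elim: vert_u)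
  then have "i + 1 = j \<or> j + 1 = i" using w edge_iff[OF assms(2) j(1)] assms(1) touchedI unfolding nb_def by blast
  then show "w \<in> {u (i - 1), u (i + 1)}" using j by auto
qed

lemma nb_untouched: "\<not> touched i \<Longrightarrow> 1 < i \<Longrightarrow> i < m \<Longrightarrow> nb (u i) = {u (i - 1), u (i + 1)}"
  using nb_untouched_subset[of i] nb_path[of i] by auto

lemma u_skip_neq: "1 < i \<Longrightarrow> i < m \<Longrightarrow> u (i - 1) \<noteq> u (i + 1)"
proof -
  assume "1 < i" "i < m"
  then have "i - 1 \<in> {1..m}" "i + 1 \<in> {1..m}" by auto
  then show ?thesis using u_eq_iff[of "i - 1" "i + 1"] by linarith
qed

lemma card_nb_untouched: "\<not> touched i \<Longrightarrow> 1 < i \<Longrightarrow> i < m \<Longrightarrow> card (nb (u i)) = 2"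
  using u_skip_neq[of i] by (simp add: nb_untouched)

lemma card_nb_inner: "1 < i \<Longrightarrow> i < m \<Longrightarrow> card (nb (u i)) \<ge> 2"
  using card_mono[OF finite_nb, of "{u (i - 1), u (i + 1)}" "u i"] nb_path[of i] u_skip_neq[of i] by auto

lemma card_nb_touched: assumes "touched i" "1 < i" "i < m" shows "card (nb (u i)) \<ge> 3"
proof -
  obtain j where j: "j \<in> {1..m}" "{u i, u j} \<in> F" "i \<noteq> j" "j \<noteq> i + 1" "i \<noteq> j + 1"
    by (rule touchedE[OF assms(1)]) (use assms in auto)
  have i: "i - 1 \<in> {1..m}" "i + 1 \<in> {1..m}" using assms by auto
  have "u j \<noteq> u (i - 1)" "u j \<noteq> u (i + 1)" using u_eq_iff[OF j(1) i(1)] u_eq_iff[OF j(1) i(2)] j by auto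
  then have "card {u j, u (i - 1), u (i + 1)} = 3" using u_skip_neq[of i] assms by simp
  moreover have "{u j, u (i - 1), u (i + 1)} \<subseteq> nb (u i)"
    using nb_path[of i] assms F_edge[OF j(2)] unfolding nb_def by auto
  ultimately show ?thesis using card_mono[OF finite_nb] by metis
qed

lemma card_nb_touched_end: assumes "touched i" "i = 1 \<or> i = m" shows "card (nb (u i)) \<ge> 2"
proof -
  have i: "i \<in> {1..m}" using assms(2) m by auto
  obtain j where j: "j \<in> {1..m}" "{u i, u j} \<in> F" "i \<noteq> j" "j \<noteq> i + 1" "i \<noteq> j + 1"
    by (rule touchedE[OF assms(1) i])
  define p where "p = (if i = 1 then 2 else m - 1)"
  have p: "u p \<in> nb (u i)" using nb_path(2)[of 1] nb_path(1)[of m] assms(2) m unfolding p_def by (auto simp: numeral_2_eq_2)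
  have "p \<noteq> j" using j assms(2) m unfolding p_def by auto
  moreover have "p \<in> {1..m}" using m unfolding p_def by auto
  ultimately have "u p \<noteq> u j" using u_eq_iff[of p j] j(1) by blast
  with p have "{u p, u j} \<subseteq> nb (u i)" "card {u p, u j} = 2" using F_edge[OF j(2)] unfolding nb_def by auto
  then show ?thesis using card_mono[OF finite_nb] by metis
qed

lemma card_nb_le: assumes "i \<in> {1..m}" shows "card (nb (u i)) \<le> k + 2"
proof -
  let ?W = "{w. {u i, w} \<in> F}"
  have sub: "?W \<subseteq> nb (u i)" using F_edge unfolding nb_def by blast
  then have fin: "finite ?W" using finite_nb finite_subset by blast
  have "card ?W \<le> card F"
    by (rule card_inj_on_le[of "\<lambda>w. {u i, w}"]) (use F(1) in \<open>auto simp: inj_on_def doubleton_eq_iff\<close>)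
  moreover have "nb (u i) \<subseteq> {u (i - 1), u (i + 1)} \<union> ?W"
  proof
    fix w assume w: "w \<in> nb (u i)"
    then obtain j where j: "j \<in> {1..m}" "w = u j" using nb_verts by (blast elim: vert_u)
    then have "i + 1 = j \<or> j + 1 = i \<or> {u i, u j} \<in> F" using w edge_iff[OF assms j(1)] unfolding nb_def by blast
    then show "w \<in> {u (i - 1), u (i + 1)} \<union> ?W" using j by auto
  qed
  then have "card (nb (u i)) \<le> card ({u (i - 1), u (i + 1)} \<union> ?W)" by (rule card_mono[rotated]) (use fin in simp)
  moreover have "\<dots> \<le> card {u (i - 1), u (i + 1)} + card ?W" by (rule card_Un_le)
  moreover have "card {u (i - 1), u (i + 1)} \<le> 2" by (simp add: card_insert_if)
  ultimately show ?thesis using F(2) by linarith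
qed

lemma card_touched: "card {i \<in> {1..m}. touched i} \<le> 2 * k"
proof -
  have c2: "card e = 2" if "e \<in> F" for e using F_edge[OF that] H unfolding simple_graph_def by (auto dest: subsetD)
  have fin: "finite (\<Union>F)" using F(1) c2 by (intro finite_Union) (auto intro: card_ge_0_finite)
  have "card {i \<in> {1..m}. touched i} \<le> card (\<Union>F)"
  proof (rule card_inj_on_le[of u])
    show "inj_on u {i \<in> {1..m}. touched i}" using u unfolding bij_betw_def by (auto intro: inj_on_subset)
    show "u ` {i \<in> {1..m}. touched i} \<subseteq> \<Union>F" unfolding touched_def by auto
  qed (rule fin)
  also have "\<dots> \<le> (\<Sum>e\<in>F. card e)" by (rule card_Union_le_sum_card)
  also have "\<dots> = 2 * k" using c2 F(2) by simp
  finally show ?thesis .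
qed

text \<open>Among the \<open>m - 2\<close> inner indices at most \<open>2 * k\<close> are touched,
  at most \<open>k\<close> are bridged by an extra edge, and one is \<open>i\<close>;
  \<open>m > 3 * k + 4\<close> leaves room for another.\<close>

lemma suppressible_exists: obtains l where "suppressible l" "l \<noteq> i"
proof -
  let ?T = "{i \<in> {1..m}. touched i}" and ?C = "{l. 1 < l \<and> l < m \<and> {u (l - 1), u (l + 1)} \<in> F}"
  have finC: "finite ?C" by (rule finite_subset[of _ "{..m}"]) auto
  have "card ?C \<le> card F"
  proof (rule card_inj_on_le[of "\<lambda>l. {u (l - 1), u (l + 1)}"])
    show "inj_on (\<lambda>l. {u (l - 1), u (l + 1)}) ?C"
    proof (rule inj_onI)
      fix l l' assume l: "l \<in> ?C" "l' \<in> ?C" "{u (l - 1), u (l + 1)} = {u (l' - 1), u (l' + 1)}"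
      have r: "l - 1 \<in> {1..m}" "l + 1 \<in> {1..m}" "l' - 1 \<in> {1..m}" "l' + 1 \<in> {1..m}" using l by auto
      have "l - 1 = l' - 1 \<or> l - 1 = l' + 1 \<and> l + 1 = l' - 1"
        using l(3) unfolding doubleton_eq_iff u_eq_iff[OF r(1) r(3)] u_eq_iff[OF r(1) r(4)] u_eq_iff[OF r(2) r(3)] u_eq_iff[OF r(2) r(4)] by blast
      then show "l = l'" using r by auto
    qed
  qed (use F(1) in auto)
  then have "card (?T \<union> ?C \<union> {i}) \<le> 2 * k + k + 1"
    using card_Un_le[of ?T ?C] card_Un_le[of "?T \<union> ?C" "{i}"] card_touched F(2) by simp
  moreover have "card {2..m - 1} = m - 2" using m by simp
  ultimately have "\<not> {2..m - 1} \<subseteq> ?T \<union> ?C \<union> {i}"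
    using card_mono[of "?T \<union> ?C \<union> {i}" "{2..m - 1}"] finC m by auto
  then obtain l where l: "l \<in> {2..m - 1}" "l \<notin> ?T" "l \<notin> ?C" "l \<noteq> i" by blast
  then have r: "1 < l" "l < m" "l - 1 \<in> {1..m}" "l + 1 \<in> {1..m}" using m by auto
  have "\<not> touched l" using l(2) r by auto
  moreover have "{u (l - 1), u (l + 1)} \<notin> edges H" unfolding edge_iff[OF r(3,4)] using l(3) r by auto
  ultimately show ?thesis using that[of l] r l(4) unfolding suppressible_def by blast
qed

section \<open>Bounds for the deviations\<close>

lemma rho_bounds: "\<rho> \<ge> 600 * (real k + 2)" "\<rho> \<ge> 1800" "c > 0" "\<rho> * c = 1 + 2 * c"
proof -
  have d: "real k + 2 \<ge> 3" using k by simp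
  have "(real k + 2) * (real k + 2) \<ge> 3 * (real k + 2)" using d by (intro mult_right_mono) auto
  then show r: "\<rho> \<ge> 600 * (real k + 2)" using \<rho> by (simp add: power2_eq_square)
  then show r2: "\<rho> \<ge> 1800" using mult_left_mono[OF d, of 600] by (simp add: algebra_simps)
  then show "c > 0" "\<rho> * c = 1 + 2 * c" unfolding c_def by (simp_all add: field_simps)
qed

text \<open>Degree 2 gives the homogeneous recurrence; any other degree adds a source proportional
  to its distance from 2.\<close>

lemma g_eq:
  assumes "v \<in> verts H" shows "\<rho> * g v = (\<Sum>w\<in>nb v. g w) + (real (card (nb v)) - 2) * c"
proof -
  have "(\<Sum>w\<in>nb v. f w) = (\<Sum>w\<in>nb v. g w) + real (card (nb v)) * c" unfolding g_def by (simp add: sum_subtractf)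
  then show ?thesis
    using f_eq[OF assms] rho_bounds(4) unfolding g_def[of v] nb_def[symmetric] by (simp add: algebra_simps)
qed

lemma sum_nb_le:
  assumes "v \<in> verts H" "\<And>w. w \<in> verts H \<Longrightarrow> \<bar>g w\<bar> \<le> M" "card (nb v) \<le> d"
  shows "\<bar>\<Sum>w\<in>nb v. g w\<bar> \<le> real d * M"
proof -
  have "0 \<le> M" using assms(1,2) by (meson abs_ge_zero order_trans)
  have "\<bar>\<Sum>w\<in>nb v. g w\<bar> \<le> (\<Sum>w\<in>nb v. \<bar>g w\<bar>)" by (rule sum_abs)
  also have "\<dots> \<le> real (card (nb v)) * M" using assms(2) nb_verts by (intro sum_bounded_above) blast
  also have "\<dots> \<le> real d * M" using assms(3) \<open>0 \<le> M\<close> by (intro mult_right_mono) auto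
  finally show ?thesis .
qed

text \<open>Maximum principle: at a vertex where the modulus of \<open>g\<close> has its maximum
  \<open>M\<close>, the equation gives \<open>\<rho> * M \<le> d * M + d * c\<close> with
  \<open>d = k + 2\<close>, and \<open>d\<close> is at most half of \<open>\<rho>\<close>.\<close>

lemma g_bound: assumes "v \<in> verts H" shows "\<bar>g v\<bar> \<le> 2 * (real k + 2) * c / \<rho>"
proof -
  define M where "M = Max ((\<lambda>v. \<bar>g v\<bar>) ` verts H)"
  have M: "\<bar>g w\<bar> \<le> M" if "w \<in> verts H" for w unfolding M_def using that finite_verts by (intro Max_ge) auto
  have "M \<in> (\<lambda>v. \<bar>g v\<bar>) ` verts H" unfolding M_def by (intro Max_in) (use finite_verts assms in auto)
  then obtain w where w: "w \<in> verts H" "\<bar>g w\<bar> = M" by auto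
  obtain i where i: "i \<in> {1..m}" "w = u i" using w(1) by (rule vert_u)
  have deg: "card (nb w) \<le> k + 2" unfolding i(2) by (rule card_nb_le[OF i(1)])
  have "\<rho> * M = \<bar>\<rho> * g w\<bar>" using w(2) rho_bounds(2) by (simp add: abs_mult)
  also have "\<dots> \<le> \<bar>\<Sum>w\<in>nb w. g w\<bar> + \<bar>(real (card (nb w)) - 2) * c\<bar>" unfolding g_eq[OF w(1)] by (rule abs_triangle_ineq)
  also have "\<bar>(real (card (nb w)) - 2) * c\<bar> \<le> (real k + 2) * c"
    unfolding abs_mult using rho_bounds(3) deg by (intro mult_mono) auto
  also have "\<bar>\<Sum>w\<in>nb w. g w\<bar> \<le> (real k + 2) * M" using sum_nb_le[OF w(1) M deg] by (simp add: add.commute)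
  finally have 1: "\<rho> * M \<le> (real k + 2) * M + (real k + 2) * c" by simp
  have "M \<ge> 0" using w(2) by auto
  then have "2 * (real k + 2) * M \<le> \<rho> * M" using rho_bounds(1) by (intro mult_right_mono) auto
  then have "\<rho> * M \<le> 2 * (real k + 2) * c" using 1 by (simp add: algebra_simps)
  then have "M \<le> 2 * (real k + 2) * c / \<rho>" using rho_bounds(2) by (simp add: pos_le_divide_eq mult.commute)
  then show ?thesis using M[OF assms] by linarith
qed

text \<open>The source at a fork is at least \<open>c\<close>, and by \<open>g_bound\<close> the
  neighbours take away at most half of it.\<close>

lemma g_fork: assumes "v \<in> verts H" "card (nb v) \<ge> 3" shows "g v \<ge> c / (2 * \<rho>)"
proof -
  let ?d = "real k + 2"
  obtain i where i: "i \<in> {1..m}" "v = u i" using assms(1) by (rule vert_u)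
  have deg: "card (nb v) \<le> k + 2" unfolding i(2) by (rule card_nb_le[OF i(1)])
  have "\<bar>\<Sum>w\<in>nb v. g w\<bar> \<le> ?d * (2 * ?d * c / \<rho>)" using sum_nb_le[OF assms(1) g_bound deg] by (simp add: add.commute)
  also have "\<dots> \<le> c / 2"
  proof -
    have "?d * (2 * ?d * c) = (2 * ?d\<^sup>2) * c" by (simp add: power2_eq_square)
    also have "\<dots> \<le> (\<rho> / 2) * c" using \<rho> rho_bounds(3) zero_le_power2[of ?d] by (intro mult_right_mono) linarith+
    finally show ?thesis using rho_bounds(2) by (simp add: pos_divide_le_eq mult.commute)
  qed
  finally have "(\<Sum>w\<in>nb v. g w) \<ge> - (c / 2)" by linarith
  moreover have "(real (card (nb v)) - 2) * c \<ge> 1 * c" using assms(2) rho_bounds(3) by (intro mult_right_mono) auto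
  ultimately have "\<rho> * g v \<ge> c / 2" unfolding g_eq[OF assms(1)] by linarith
  then show ?thesis using rho_bounds(2) by (simp add: pos_divide_le_eq mult.commute mult.left_commute)
qed

text \<open>At degree 2 the source vanishes, so averaging the bound for the neighbours yields one
  more factor \<open>1 / \<rho>\<close> than \<open>g_bound\<close>.\<close>

lemma g_two: assumes "v \<in> verts H" "card (nb v) = 2" shows "\<bar>g v\<bar> \<le> 4 * (real k + 2) * c / \<rho>\<^sup>2"
proof -
  define B where "B = 2 * (real k + 2) * c / \<rho>"
  have "\<bar>\<Sum>w\<in>nb v. g w\<bar> \<le> real 2 * B"
    by (rule sum_nb_le[OF assms(1)]) (use g_bound assms(2) in \<open>auto simp: B_def\<close>)
  then have "\<bar>\<rho> * g v\<bar> \<le> 2 * B" unfolding g_eq[OF assms(1)] assms(2) by simp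
  then have "\<bar>g v\<bar> * \<rho> \<le> 2 * B" using rho_bounds(2) by (simp add: abs_mult mult.commute)
  then have "\<bar>g v\<bar> \<le> 2 * B / \<rho>" using rho_bounds(2) by (simp add: pos_le_divide_eq)
  also have "2 * B / \<rho> = 4 * (real k + 2) * c / \<rho>\<^sup>2" unfolding B_def by (simp add: power2_eq_square)
  finally show ?thesis .
qed

lemma g_two_le: assumes "v \<in> verts H" "card (nb v) = 2" shows "g v \<le> c / (2 * \<rho>)"
proof -
  have "(8 * (real k + 2)) * c \<le> \<rho> * c" using rho_bounds by (intro mult_right_mono) linarith+
  then have "4 * (real k + 2) * c \<le> \<rho> * c / 2" by (simp add: algebra_simps)
  then have "4 * (real k + 2) * c / \<rho>\<^sup>2 \<le> (\<rho> * c / 2) / \<rho>\<^sup>2" by (intro divide_right_mono) auto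
  also have "\<dots> = c / (2 * \<rho>)" using rho_bounds(2) by (simp add: power2_eq_square)
  finally show ?thesis using g_two[OF assms] by linarith
qed

lemma g_inner: assumes "v \<in> verts H" "card (nb v) \<ge> 2" shows "g v \<ge> - (4 * (real k + 2) * c / \<rho>\<^sup>2)"
proof (cases "card (nb v) = 2")
  case True
  then show ?thesis using g_two[OF assms(1)] by linarith
next
  case False
  then have "g v \<ge> c / (2 * \<rho>)" using g_fork[OF assms(1)] assms(2) by linarith
  moreover have "c / (2 * \<rho>) \<ge> 0" "4 * (real k + 2) * c / \<rho>\<^sup>2 \<ge> 0" using rho_bounds(2,3) by auto
  ultimately show ?thesis by linarith
qed

lemma excess_insertion_gain: "excess \<rho> (g v) (g w) = insertion_gain \<rho> (f v) (f w) - c"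
  using insertion_gain_deviation[of \<rho> c "g v" "g w"] rho_bounds(2) by (simp add: c_def excess_def g_def)

lemma excess_leaf: "excess \<rho> (- c) (g v) = (1 + f v)\<^sup>2 / \<rho> - c"
  using insertion_gain_deviation[of \<rho> c "- c" "g v"] rho_bounds(2)
  by (simp add: c_def excess_def g_def insertion_gain_def)

section \<open>Comparing \<open>H\<close> with the graph after moving a leaf\<close>

lemma suppressibleD:
  assumes "suppressible l"
  shows "u l \<in> verts H" "{w. {u l, w} \<in> edges H} = {u (l - 1), u (l + 1)}" "u (l - 1) \<noteq> u (l + 1)"
    "{u (l - 1), u (l + 1)} \<notin> edges H" "\<rho> * f (u l) = 1 + (f (u (l - 1)) + f (u (l + 1)))"
proof -
  have l: "1 < l" "l < m" "\<not> touched l" "{u (l - 1), u (l + 1)} \<notin> edges H" using assms unfolding suppressible_def by auto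
  show 1: "u l \<in> verts H" using u_vert[of l] l by simp
  show 2: "{w. {u l, w} \<in> edges H} = {u (l - 1), u (l + 1)}" using nb_untouched[of l] l unfolding nb_def by simp
  show 3: "u (l - 1) \<noteq> u (l + 1)" using u_skip_neq l by simp
  show "\<rho> * f (u l) = 1 + (f (u (l - 1)) + f (u (l + 1)))" using f_eq[OF 1] 3 unfolding 2 by simp
qed (use assms in \<open>simp add: suppressible_def\<close>)

text \<open>\<open>opt\<close> is applied to the graph in which \<open>u l\<close> is suppressed and
  becomes a leaf at \<open>v\<close>.\<close>

lemma leaf_bound:
  assumes att: "attachable H S v" and v: "v \<in> verts H" "u l \<noteq> v" and l: "suppressible l"
  shows "excess \<rho> (- c) (g v) \<le> excess \<rho> (g (u (l - 1))) (g (u (l + 1)))"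
proof -
  let ?a = "u (l - 1)" and ?b = "u (l + 1)" and ?r = "u l"
  note r = suppressibleD[OF l]
  define E' where "E' = insert {?a, ?b} (edges H - {{?a, ?r}, {?b, ?r}} - {}) \<union> {{v, ?r}}"
  let ?H = "\<lparr>verts = verts H, edges = E'\<rparr>"
  have "l - 1 \<in> {1..m}" "l + 1 \<in> {1..m}" using l unfolding suppressible_def by auto
  then have ab: "?a \<in> verts H" "?b \<in> verts H" using u_vert by auto
  have H': "simple_graph ?H" by (rule simple_graph_change[OF H]) (use ab v r in \<open>auto simp: E'_def\<close>)
  have "embeddable (K2 \<nabla> ?H) S"
    by (rule embeddable_leaf_move[OF S H att v(1) r(1) v(2) r(2,3) H']) (auto simp: E'_def)
  then have "energy ?H \<rho> (f(?r := (1 + f v) / \<rho>)) \<le> energy H \<rho> f" by (rule opt[OF H', rotated]) simp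
  moreover have "energy ?H \<rho> (f(?r := (1 + f v) / \<rho>)) = energy H \<rho> f
     + ((1 + f v)\<^sup>2 / \<rho> - 2 * (\<Sum>e\<in>{}. prod f e)) - insertion_gain \<rho> (f ?a) (f ?b)"
    by (rule energy_move[OF H H' _ r(1-5), of "{}" "{{v, u l}}"]) (use v rho_bounds(2) in \<open>simp_all add: E'_def\<close>)
  ultimately show ?thesis unfolding excess_leaf excess_insertion_gain by simp
qed

text \<open>A leaf at a vertex of degree at least 2 would gain more than the suppression of some
  other vertex costs, by \<open>excess_small\<close>, whose lower bound for \<open>z\<close> is
  supplied by \<open>g_inner\<close>.\<close>

lemma attachable_card:
  assumes "attachable H S v" "v \<in> verts H" shows "card (nb v) < 2"
proof (rule ccontr)
  assume n: "\<not> ?thesis"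
  obtain i where i: "i \<in> {1..m}" "v = u i" using assms(2) by (rule vert_u)
  obtain l where l: "suppressible l" "l \<noteq> i" by (rule suppressible_exists)
  have lm: "l \<in> {1..m}" "l - 1 \<in> {1..m}" "l + 1 \<in> {1..m}" using l(1) unfolding suppressible_def by auto
  have "u l \<noteq> v" using u_eq_iff[OF lm(1) i(1)] l(2) i(2) by simp
  then have "excess \<rho> (- c) (g v) \<le> excess \<rho> (g (u (l - 1))) (g (u (l + 1)))"
    using leaf_bound assms l(1) by blast
  moreover have "excess \<rho> (g (u (l - 1))) (g (u (l + 1))) < excess \<rho> (- c) (g v)"
    by (rule excess_small[OF rho_bounds(3) _ \<rho>])
      (use k g_bound u_vert lm g_inner[of v] g_bound[of v] n assms(2) in auto)
  ultimately show False by linarith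
qed

end

section \<open>Cyclic orders\<close>

definition cyc_adj :: "'b list \<Rightarrow> 'b \<Rightarrow> 'b \<Rightarrow> bool" where
  "cyc_adj L x y \<longleftrightarrow> (\<exists>i<length L. {x, y} = {L ! i, L ! (Suc i mod length L)})"

lemma cyc_adj_commute: "cyc_adj L x y \<longleftrightarrow> cyc_adj L y x"
  unfolding cyc_adj_def by (simp add: insert_commute)

lemma cyc_adj_in: assumes "cyc_adj L x y" shows "x \<in> set L" "y \<in> set L"
proof -
  obtain i where i: "i < length L" "{x, y} = {L ! i, L ! (Suc i mod length L)}" using assms unfolding cyc_adj_def by blast
  then have "Suc i mod length L < length L" by (intro mod_less_divisor) auto
  then have "{x, y} \<subseteq> set L" unfolding i(2) using i(1) by auto
  then show "x \<in> set L" "y \<in> set L" by auto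
qed

lemma cyc_adj_neighbours:
  assumes L: "distinct L" "length L \<ge> 3" and x: "x \<in> set L"
  obtains a b where "a \<noteq> b" "a \<noteq> x" "b \<noteq> x" "cyc_adj L x a" "cyc_adj L x b" "\<And>z. cyc_adj L x z \<Longrightarrow> z = a \<or> z = b"
proof -
  let ?n = "length L"
  obtain i where i: "i < ?n" "x = L ! i" using x by (auto simp: in_set_conv_nth)
  define s where "s = (if Suc i = ?n then 0 else Suc i)"
  define p where "p = (if i = 0 then ?n - 1 else i - 1)"
  have suc: "Suc j mod ?n = (if Suc j = ?n then 0 else Suc j)" if "j < ?n" for j using that by auto
  have sp: "s < ?n" "p < ?n" "s \<noteq> p" "s \<noteq> i" "p \<noteq> i" using i(1) L(2) unfolding s_def p_def by auto
  have si: "Suc i mod ?n = s" and pi: "Suc p mod ?n = i"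
    using suc[OF i(1)] suc[OF sp(2)] i(1) L(2) unfolding s_def p_def by auto
  show ?thesis
  proof (rule that[of "L ! s" "L ! p"])
    show "L ! s \<noteq> L ! p" "L ! s \<noteq> x" "L ! p \<noteq> x" using sp i L(1) by (simp_all add: nth_eq_iff_index_eq)
    show "cyc_adj L x (L ! s)" unfolding cyc_adj_def using i si by blast
    show "cyc_adj L x (L ! p)" unfolding cyc_adj_def using i pi sp(2) by (metis insert_commute)
    fix z assume "cyc_adj L x z"
    then obtain j where j: "j < ?n" "{x, z} = {L ! j, L ! (Suc j mod ?n)}" unfolding cyc_adj_def by blast
    then consider "L ! i = L ! j" "z = L ! (Suc j mod ?n)" | "L ! i = L ! (Suc j mod ?n)" "z = L ! j"
      unfolding i(2) doubleton_eq_iff by blast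
    then show "z = L ! s \<or> z = L ! p"
    proof cases
      case 1
      then have "i = j" using i(1) j(1) L(1) by (simp add: nth_eq_iff_index_eq)
      then show ?thesis using 1 si by simp
    next
      case 2
      have "Suc j mod ?n < ?n" using i(1) by (intro mod_less_divisor) auto
      then have "i = Suc j mod ?n" using 2 i(1) L(1) by (simp add: nth_eq_iff_index_eq)
      then have "j = p" using suc[OF j(1)] j(1) i(1) unfolding p_def by (auto split: if_splits)
      then show ?thesis using 2 by simp
    qed
  qed
qed

text \<open>Walking once around the cycle from \<open>x\<close> never leaves
  \<open>A\<close>.\<close>

lemma cyc_adj_closed:
  assumes "x \<in> A" "x \<in> set L" and A: "\<And>a b. a \<in> A \<Longrightarrow> cyc_adj L a b \<Longrightarrow> b \<in> A"
  shows "set L \<subseteq> A"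
proof
  let ?n = "length L"
  obtain i where i: "i < ?n" "x = L ! i" using assms(2) by (auto simp: in_set_conv_nth)
  then have n: "0 < ?n" by auto
  have step: "L ! ((i + d) mod ?n) \<in> A" for d
  proof (induction d)
    case 0 then show ?case using i assms(1) by simp
  next
    case (Suc d)
    have "cyc_adj L (L ! ((i + d) mod ?n)) (L ! (Suc ((i + d) mod ?n) mod ?n))"
      unfolding cyc_adj_def using n by (intro exI[of _ "(i + d) mod ?n"]) auto
    then show ?case using A[OF Suc] by (simp add: mod_Suc_eq)
  qed
  fix y assume "y \<in> set L"
  then obtain j where j: "j < ?n" "y = L ! j" by (auto simp: in_set_conv_nth)
  have "i + (j + ?n - i) = j + ?n" using i(1) by simp
  then have "(i + (j + ?n - i)) mod ?n = j" using j(1) by simp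
  then show "y \<in> A" using step[of "j + ?n - i"] j(2) by simp
qed

lemma cyc_adj_triangle:
  assumes "distinct L" "length L = 3" "x \<in> set L" "y \<in> set L" "x \<noteq> y"
  shows "cyc_adj L x y"
proof -
  obtain a b where ab: "a \<noteq> b" "a \<noteq> x" "b \<noteq> x" "cyc_adj L x a" "cyc_adj L x b"
    by (rule cyc_adj_neighbours[of L x]) (use assms in auto)
  have "{x, a, b} \<subseteq> set L" using cyc_adj_in(2)[OF ab(4)] cyc_adj_in(2)[OF ab(5)] assms(3) by auto
  moreover have "card {x, a, b} = card (set L)" using ab assms(1,2) by (simp add: distinct_card)
  ultimately have eq: "{x, a, b} = set L" by (intro card_subset_eq) auto
  have "y \<in> {x, a, b}" using assms(4) unfolding eq .
  then show ?thesis using assms(5) ab(4,5) by auto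
qed

lemma add_vertex_edge_iff:
  "{Some p, Some q} \<in> edges (add_vertex G X) \<longleftrightarrow> {p, q} \<in> edges G"
  "{Some p, None} \<in> edges (add_vertex G X) \<longleftrightarrow> p \<in> X"
proof -
  have E: "edges (add_vertex G X) = (`) Some ` edges G \<union> (\<lambda>u. {None, Some u}) ` X" by (simp add: add_vertex_def)
  have old: "{Some p, Some q} = Some ` e \<longleftrightarrow> {p, q} = e" for e
    using inj_image_eq_iff[of Some "{p, q}" e] by simp
  have "{Some p, Some q} \<notin> (\<lambda>u. {None, Some u}) ` X" by auto
  then show "{Some p, Some q} \<in> edges (add_vertex G X) \<longleftrightarrow> {p, q} \<in> edges G"
    unfolding E Un_iff image_iff old by simp
  have "{Some p, None} \<notin> (`) Some ` edges G" by auto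
  then show "{Some p, None} \<in> edges (add_vertex G X) \<longleftrightarrow> p \<in> X"
    unfolding E Un_iff by (simp add: image_iff doubleton_eq_iff)
qed

text \<open>A vertex drawn into the triangle \<open>v p z\<close> takes over the edges from \<open>p\<close> to \<open>v\<close> and \<open>z\<close>;
  then \<open>p\<close> has only three neighbours, so that any two of them are consecutive around \<open>p\<close>, and
  contracting the new vertex into \<open>p\<close> restores the graph.\<close>

lemma attachable_corner:
  fixes H :: "'a sgraph"
  assumes S: "surface S" and H: "simple_graph H"
    and emb: "embeddable (add_vertex (K2 \<nabla> H) {Inr v, Inr p, Inr z}) S"
    and p: "{w. {p, w} \<in> edges H} = {v, z}"
  shows "attachable H S p"
proof -
  let ?G = "K2 \<nabla> H" and ?X = "{Inl True, Inl False, Inr p}"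
  let ?A = "add_vertex ?G {Inr v, Inr p, Inr z}"
  have vz: "v \<in> verts H" "z \<in> verts H" "p \<in> verts H" "v \<noteq> p" "z \<noteq> p"
    using simple_graph_edgeD[OF H, of p v] simple_graph_edgeD[OF H, of p z] p by auto
  have A: "simple_graph ?A"
    by (rule simple_graph_add_vertex[OF simple_graph_join[OF H]]) (use vz in \<open>auto simp: verts_join\<close>)
  define R where "R = {{Some (Inr p), Some (Inr z)}, {Some (Inr p), Some (Inr v)} :: (bool + 'a) option set}"
  define B where "B = \<lparr>verts = verts ?A, edges = edges ?A - R\<rparr>"
  have B: "simple_graph B" using A unfolding simple_graph_def B_def by auto
  have embB: "embeddable B S"
    by (rule embeddable_subgraph[OF A emb B, of "\<lambda>x. x"]) (auto simp: B_def)
  have nbB: "{t. {Some (Inr p), t} \<in> edges B} = {None, Some (Inl True), Some (Inl False)}"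
  proof (rule set_eqI)
    fix t :: "(bool + 'a) option"
    consider "t = None" | i where "t = Some (Inl i)" | q where "t = Some (Inr q)" by (metis option.exhaust sum.exhaust)
    then show "t \<in> {t. {Some (Inr p), t} \<in> edges B} \<longleftrightarrow> t \<in> {None, Some (Inl True), Some (Inl False)}"
    proof cases
      case 1 then show ?thesis by (simp add: B_def R_def add_vertex_edge_iff doubleton_eq_iff)
    next
      case (2 i) then show ?thesis using vz by (cases i) (simp_all add: B_def R_def add_vertex_edge_iff join_edge_iff doubleton_eq_iff)
    next
      case (3 q)
      have "{p, q} \<in> edges H \<Longrightarrow> q = v \<or> q = z" using p by blast
      then show ?thesis unfolding 3 by (auto simp: B_def R_def add_vertex_edge_iff join_edge_iff)
    qed
  qed
  have pB: "Some (Inr p) \<in> verts B" using vz by (auto simp: B_def verts_add_vertex verts_join intro!: imageI)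
  obtain L where L: "distinct L" "set L = {None, Some (Inl True), Some (Inl False)}"
    "\<And>i. i < length L \<Longrightarrow> embeddable (add_vertex B {Some (Inr p), L ! i, L ! (Suc i mod length L)}) S"
    by (rule embeddable_rotation[OF S B embB pB]) (simp_all add: nbB)
  have "length L = 3" using distinct_card[OF L(1)] unfolding L(2) by simp
  then have "cyc_adj L (Some (Inl True)) (Some (Inl False))" using L(1,2) by (intro cyc_adj_triangle) auto
  then obtain i where i: "i < length L" "{Some (Inl True), Some (Inl False)} = {L ! i, L ! (Suc i mod length L)}"
    unfolding cyc_adj_def by blast
  define Y where "Y = {Some (Inr p), Some (Inl True), Some (Inl False) :: (bool + 'a) option}"
  have embC: "embeddable (add_vertex B Y) S"
    using L(3)[OF i(1)] unfolding Y_def i(2)[symmetric] by simp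
  have C: "simple_graph (add_vertex B Y)"
    by (rule simple_graph_add_vertex[OF B]) (use vz in \<open>auto simp: Y_def B_def verts_add_vertex verts_join\<close>)
  have T: "simple_graph (add_vertex ?G ?X)"
    by (rule simple_graph_add_vertex[OF simple_graph_join[OF H]]) (use vz in \<open>auto simp: verts_join\<close>)
  \<comment> \<open>The inner \<open>None\<close> is the vertex drawn into the triangle, the outer
    \<open>None\<close> the one drawn between the apexes; only the latter survives the
    contraction.\<close>
  define \<phi> where "\<phi> t = (case t of None \<Rightarrow> None | Some None \<Rightarrow> Some (Inr p) | Some (Some t) \<Rightarrow> Some t)"
    for t :: "(bool + 'a) option option"
  have new: "{Some None, Some (Some (Inr q))} \<in> edges (add_vertex B Y)" if q: "q \<in> {v, p, z}" for q
  proof (rule add_vertex_edgeI)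
    have "{None, Some (Inr q)} \<in> edges ?A" by (rule add_vertex_edgeI) (use q in auto)
    moreover have "{None, Some (Inr q)} \<notin> R" by (auto simp: R_def doubleton_eq_iff)
    ultimately show "{None, Some (Inr q)} \<in> edges B" by (simp add: B_def)
  qed
  show ?thesis
    unfolding attachable_def
  proof (rule embeddable_contract[OF S C embC T, of "Some None" "Some (Some (Inr p))" \<phi>])
    show "{Some None, Some (Some (Inr p))} \<in> edges (add_vertex B Y)" by (rule new) simp
    show "\<phi> (Some None) = \<phi> (Some (Some (Inr p)))" by (simp add: \<phi>_def)
  next
    fix t t' assume "\<phi> t = \<phi> t'"
    then show "t = t' \<or> {t, t'} = {Some None, Some (Some (Inr p))}"
      by (auto simp: \<phi>_def split: option.splits)
  next
    show "verts (add_vertex ?G ?X) \<subseteq> \<phi> ` verts (add_vertex B Y)"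
    proof
      fix t assume t: "t \<in> verts (add_vertex ?G ?X)"
      have "t = \<phi> (case t of None \<Rightarrow> None | Some t \<Rightarrow> Some (Some t))" by (simp add: \<phi>_def split: option.splits)
      moreover have "(case t of None \<Rightarrow> None | Some t \<Rightarrow> Some (Some t)) \<in> verts (add_vertex B Y)"
        using t by (auto simp: B_def verts_add_vertex split: option.splits)
      ultimately show "t \<in> \<phi> ` verts (add_vertex B Y)" by (rule image_eqI)
    qed
  next
    fix e assume "e \<in> edges (add_vertex ?G ?X)"
    then consider e0 where "e0 \<in> edges ?G" "e = Some ` e0" | x where "x \<in> ?X" "e = {None, Some x}"
      unfolding add_vertex_def by auto
    then show "\<exists>e'\<in>edges (add_vertex B Y). \<phi> ` e' = e"
    proof cases
      case (1 e0)
      show ?thesis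
      proof (cases "Some ` e0 \<in> R")
        case True
        then have "e = {Some (Inr p), Some (Inr z)} \<or> e = {Some (Inr p), Some (Inr v)}" using 1 by (simp add: R_def)
        then obtain q where q: "q \<in> {v, p, z}" "e = {Some (Inr p), Some (Inr q)}" by blast
        have "\<phi> ` {Some None, Some (Some (Inr q))} = e" unfolding q(2) by (simp add: \<phi>_def)
        then show ?thesis using new[OF q(1)] by blast
      next
        case False
        then have "Some ` e0 \<in> edges B" using 1(1) by (simp add: B_def add_vertex_edgeI)
        then have "Some ` Some ` e0 \<in> edges (add_vertex B Y)" by (rule add_vertex_edgeI)
        moreover have "\<phi> ` Some ` Some ` e0 = e" unfolding 1(2) by (simp add: image_image \<phi>_def)
        ultimately show ?thesis by blast
      qed
    next
      case (2 x)
      have "\<phi> ` {None, Some (Some x)} = e" unfolding 2(2) by (simp add: \<phi>_def)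
      moreover have "{None, Some (Some x)} \<in> edges (add_vertex B Y)"
        by (rule add_vertex_edgeI) (use 2(1) in \<open>auto simp: Y_def\<close>)
      ultimately show ?thesis by blast
    qed
  qed
qed

context spex_path
begin

text \<open>With the same \<open>f\<close>, an additional edge raises the energy by
  \<open>2 * f x * f y\<close>.\<close>

lemma no_edge_to_add:
  assumes "x \<in> verts H" "y \<in> verts H" "x \<noteq> y" "{x, y} \<notin> edges H"
  shows "\<not> embeddable (K2 \<nabla> \<lparr>verts = verts H, edges = insert {x, y} (edges H)\<rparr>) S"
proof
  let ?H = "\<lparr>verts = verts H, edges = insert {x, y} (edges H)\<rparr>"
  assume e: "embeddable (K2 \<nabla> ?H) S"
  have "simple_graph ?H" by (rule simple_graph_change[OF H]) (use assms in auto)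
  then have "energy ?H \<rho> f \<le> energy H \<rho> f" using opt e by simp
  moreover have "energy ?H \<rho> f = energy H \<rho> f + 2 * (f x * f y)"
    using assms simple_graph_finite_edges[OF H] unfolding energy_def by simp
  moreover have "f x * f y > 0" using f_pos assms by simp
  ultimately show False by linarith
qed

text \<open>A corner between non-adjacent \<open>x\<close> and \<open>y\<close> would admit the
  missing edge, which extremality forbids. An apex is adjacent to everything, so only pairs inside
  \<open>H\<close> require this argument.\<close>

lemma rotation:
  assumes v: "v \<in> verts (K2 \<nabla> H)" and N: "card {w. {v, w} \<in> edges (K2 \<nabla> H)} \<ge> 3"
  shows "\<exists>L. distinct L \<and> set L = {w. {v, w} \<in> edges (K2 \<nabla> H)} \<and> length L \<ge> 3 \<and>
    (\<forall>x y. cyc_adj L x y \<longrightarrow> embeddable (add_vertex (K2 \<nabla> H) {v, x, y}) S \<and> {x, y} \<in> edges (K2 \<nabla> H))"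
proof -
  let ?G = "K2 \<nabla> H"
  obtain L where L: "distinct L" "set L = {w. {v, w} \<in> edges ?G}"
    "\<And>i. i < length L \<Longrightarrow> embeddable (add_vertex ?G {v, L ! i, L ! (Suc i mod length L)}) S"
    by (rule embeddable_rotation[OF S simple_graph_join[OF H] emb v]) (use N in auto)
  have len: "length L \<ge> 3" using distinct_card[OF L(1)] N L(2) by simp
  have embL: "embeddable (add_vertex ?G {v, x, y}) S" if xy: "cyc_adj L x y" for x y
  proof -
    obtain i where "i < length L" "{x, y} = {L ! i, L ! (Suc i mod length L)}" using xy unfolding cyc_adj_def by blast
    then show ?thesis using L(3)[of i] by simp
  qed
  have adjL: "{x, y} \<in> edges ?G" if xy: "cyc_adj L x y" for x y
  proof -
    have x: "x \<in> set L" and y: "y \<in> set L" using cyc_adj_in[OF xy] by auto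
    obtain a b where ab: "a \<noteq> b" "a \<noteq> x" "b \<noteq> x" "\<And>z. cyc_adj L x z \<Longrightarrow> z = a \<or> z = b"
      by (rule cyc_adj_neighbours[OF L(1) len x]) blast
    have ne: "x \<noteq> y" using ab(4)[OF xy] ab(2,3) by blast
    have "x \<in> verts ?G" "y \<in> verts ?G" using x y L(2) simple_graph_edgeD(3)[OF simple_graph_join[OF H]] by auto
    then show ?thesis
    proof (cases x; cases y)
      fix x' y' assume xy': "x = Inr x'" "y = Inr y'" and V: "x \<in> verts ?G" "y \<in> verts ?G"
      have V': "x' \<in> verts H" "y' \<in> verts H" "x' \<noteq> y'" using V ne unfolding xy' by (auto simp: verts_join)
      have "embeddable (K2 \<nabla> \<lparr>verts = verts H, edges = insert {x', y'} (edges H)\<rparr>) S"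
        using embeddable_add_edge[OF S H v _ V'] embL[OF xy] unfolding xy' by blast
      then show ?thesis using no_edge_to_add[OF V'] unfolding xy' join_edge_iff by blast
    qed (use ne in \<open>auto simp: join_edge_iff verts_join\<close>)
  qed
  show ?thesis by (intro exI[of _ L] conjI allI impI L(1,2) len embL adjL)
qed

text \<open>The two neighbours of one apex next to the other apex in the rotation are attachable,
  hence they are the ends of the path.\<close>

lemma ends: "attachable H S (u 1)" "attachable H S (u m)" "\<not> touched 1" "\<not> touched m"
proof -
  let ?G = "K2 \<nabla> H"
  have N: "{w. {Inl True, w} \<in> edges ?G} = insert (Inl False) (Inr ` verts H)"
  proof (rule set_eqI)
    fix w :: "bool + 'a" show "w \<in> {w. {Inl True, w} \<in> edges ?G} \<longleftrightarrow> w \<in> insert (Inl False) (Inr ` verts H)"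
      by (cases w) (auto simp: join_edge_iff)
  qed
  have "card (verts H) = m" using bij_betw_same_card[OF u] by simp
  moreover have "card (insert (Inl False) (Inr ` verts H) :: (bool + 'a) set) = Suc (card (Inr ` verts H :: (bool + 'a) set))"
    by (rule card_insert_disjoint) (use finite_verts in auto)
  ultimately have card: "card {w. {Inl True, w} \<in> edges ?G} \<ge> 3" unfolding N using m by (simp add: card_image)
  have vT: "Inl True \<in> verts ?G" unfolding verts_join by (rule InlI) simp
  obtain L where L: "distinct L" "set L = {w. {Inl True, w} \<in> edges ?G}" "length L \<ge> 3"
    and rot: "\<forall>x y. cyc_adj L x y \<longrightarrow> embeddable (add_vertex ?G {Inl True, x, y}) S \<and> {x, y} \<in> edges ?G"
    using rotation[OF vT card] by (elim exE conjE) (rule that; assumption)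
  have ends: "z = Inr (u 1) \<and> attachable H S (u 1) \<or> z = Inr (u m) \<and> attachable H S (u m)"
    if z: "z \<noteq> Inl False" "cyc_adj L (Inl False) z" for z
  proof -
    have "z \<in> insert (Inl False) (Inr ` verts H)" using cyc_adj_in(2)[OF z(2)] L(2) N by simp
    then obtain v where v: "v \<in> verts H" "z = Inr v" using z(1) by blast
    have att: "attachable H S v" using conjunct1[OF rot[rule_format, OF z(2)]] unfolding attachable_def v(2) .
    obtain i where i: "i \<in> {1..m}" "v = u i" using v(1) by (rule vert_u)
    have "card (nb (u i)) < 2" using attachable_card[OF att v(1)] unfolding i(2) .
    then have "\<not> (1 < i \<and> i < m)" using card_nb_inner[of i] by auto
    then have "i = 1 \<or> i = m" using i(1) by auto
    then show ?thesis using att v(2) i(2) by auto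
  qed
  have "Inl False \<in> set L" unfolding L(2) N by simp
  then obtain a b where "a \<noteq> b" "a \<noteq> Inl False" "b \<noteq> Inl False" "cyc_adj L (Inl False) a" "cyc_adj L (Inl False) b"
    by (rule cyc_adj_neighbours[OF L(1,3)])
  then show att: "attachable H S (u 1)" "attachable H S (u m)" using ends[of a] ends[of b] by auto
  \<comment> \<open>A touched end would have degree at least 2, too much for an attachable
    vertex.\<close>
  show "\<not> touched 1" "\<not> touched m"
    using attachable_card[OF att(1) u_vert] attachable_card[OF att(2) u_vert] m
      card_nb_touched_end[of 1] card_nb_touched_end[of m] by auto
qed

lemma touched_inner: assumes "touched i" "i \<in> {1..m}" shows "1 < i" "i < m"
  using assms ends(3,4) by (metis atLeastAtMost_iff le_neq_implies_less)+

lemma card_nb_untouched_le: assumes "\<not> touched i" "i \<in> {1..m}" shows "card (nb (u i)) \<le> 2"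
proof -
  have "card (nb (u i)) \<le> card {u (i - 1), u (i + 1)}" using nb_untouched_subset[OF assms] by (intro card_mono) auto
  also have "\<dots> \<le> 2" by (simp add: card_insert_if)
  finally show ?thesis .
qed

lemma touched_iff_card: "i \<in> {1..m} \<Longrightarrow> touched i \<longleftrightarrow> card (nb (u i)) \<ge> 3"
  using card_nb_untouched_le[of i] card_nb_touched[of i] touched_inner[of i] by fastforce

lemma fork_iff: "i \<in> {1..m} \<Longrightarrow> fork H (u i) \<longleftrightarrow> touched i"
  unfolding fork_def degree_nb using u_vert touched_iff_card by auto

text \<open>Suppose both path neighbours of \<open>u i\<close> are untouched. In the rotation around
  \<open>u i\<close> each of them is next to the apexes only: another vertex of \<open>H\<close>
  next to it would form a corner that makes it attachable by \<open>attachable_corner\<close>,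
  although it then has two neighbours. So the apexes are next to these two vertices only, and the
  rotation closes up after four vertices, whereas a fork has at least five neighbours in the
  join.\<close>

lemma no_separate:
  assumes i: "touched i" "i \<in> {1..m}" "\<not> touched (i - 1)" "\<not> touched (i + 1)"
  shows False
proof -
  let ?G = "K2 \<nabla> H" and ?x = "Inl True :: bool + 'a" and ?y = "Inl False :: bool + 'a"
  have im: "1 < i" "i < m" using touched_inner[OF i(1,2)] by auto
  have N: "{w. {Inr (u i), w} \<in> edges ?G} = {?x, ?y} \<union> Inr ` nb (u i)"
  proof (rule set_eqI)
    fix w :: "bool + 'a"
    have "w = ?x \<or> w = ?y \<or> (\<exists>z. w = Inr z)" by (metis sum.exhaust)
    then show "w \<in> {w. {Inr (u i), w} \<in> edges ?G} \<longleftrightarrow> w \<in> {?x, ?y} \<union> Inr ` nb (u i)"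
      using u_vert[OF i(2)] by (auto simp: join_edge_iff nb_def)
  qed
  have "card ({?x, ?y} \<union> Inr ` nb (u i)) = card {?x, ?y} + card (Inr ` nb (u i) :: (bool + 'a) set)"
    by (rule card_Un_disjoint) (use finite_nb in auto)
  also have "\<dots> = 2 + card (nb (u i))" by (simp add: card_image)
  finally have cardN: "card {w. {Inr (u i), w} \<in> edges ?G} \<ge> 5"
    unfolding N using card_nb_touched[OF i(1) im] by simp
  then have card3: "card {w. {Inr (u i), w} \<in> edges ?G} \<ge> 3" by simp
  have vG: "Inr (u i) \<in> verts ?G" using u_vert[OF i(2)] unfolding verts_join by (rule InrI)
  obtain L where L: "distinct L" "set L = {w. {Inr (u i), w} \<in> edges ?G}" "length L \<ge> 3"
    and rot: "\<forall>x y. cyc_adj L x y \<longrightarrow> embeddable (add_vertex ?G {Inr (u i), x, y}) S \<and> {x, y} \<in> edges ?G"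
    using rotation[OF vG card3] by (elim exE conjE) (rule that; assumption)
  have p: "cyc_adj L (Inr (u j)) ?x \<and> cyc_adj L (Inr (u j)) ?y \<and> (\<forall>z. cyc_adj L (Inr (u j)) z \<longrightarrow> z = ?x \<or> z = ?y)"
    if j: "j \<in> {1..m}" "\<not> touched j" "u j \<in> nb (u i)" for j
  proof -
    have only: "z = ?x \<or> z = ?y" if z: "cyc_adj L (Inr (u j)) z" for z
    proof (rule ccontr)
      assume n: "\<not> (z = ?x \<or> z = ?y)"
      note rz = rot[rule_format, OF z]
      from n obtain z' where z': "z = Inr z'" by (metis sum.exhaust)
      have "z \<in> {?x, ?y} \<union> Inr ` nb (u i)" using cyc_adj_in(2)[OF z] L(2) N by simp
      then have zi: "z' \<in> nb (u i)" using z' by auto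
      then have "z' \<noteq> u i" using simple_graph_edgeD(1)[OF H, of "u i" z'] unfolding nb_def by auto
      moreover have zj: "z' \<in> nb (u j)" using conjunct2[OF rz] unfolding z' join_edge_iff nb_def by simp
      moreover have "u i \<in> nb (u j)" using j(3) nb_sym by blast
      ultimately have sub: "{u i, z'} \<subseteq> nb (u j)" and c2: "card {u i, z'} = 2" by auto
      have "{u i, z'} = nb (u j)"
        by (rule card_seteq[OF finite_nb sub]) (use c2 card_nb_untouched_le[OF j(2,1)] in simp)
      then have nbj: "{w. {u j, w} \<in> edges H} = {u i, z'}" unfolding nb_def by simp
      have "attachable H S (u j)"
        by (rule attachable_corner[OF S H _ nbj]) (use conjunct1[OF rz] in \<open>simp add: z'\<close>)
      then have "card (nb (u j)) < 2" using attachable_card u_vert[OF j(1)] by blast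
      then show False using c2 card_mono[OF finite_nb sub] by simp
    qed
    have "Inr (u j) \<in> set L" unfolding L(2) N using j(3) by blast
    then obtain a b where "a \<noteq> b" "cyc_adj L (Inr (u j)) a" "cyc_adj L (Inr (u j)) b"
      by (rule cyc_adj_neighbours[OF L(1,3)])
    then show ?thesis using only[of a] only[of b] only by metis
  qed
  let ?p = "Inr (u (i - 1)) :: bool + 'a" and ?q = "Inr (u (i + 1)) :: bool + 'a"
  have ij: "i - 1 \<in> {1..m}" "i + 1 \<in> {1..m}" using im by auto
  note P = p[OF ij(1) i(3) nb_path(1)] and Q = p[OF ij(2) i(4) nb_path(2)]
  have pq: "?p \<noteq> ?q" using u_skip_neq im by simp
  have PP: "cyc_adj L ?p ?x" "cyc_adj L ?p ?y" "\<And>z. cyc_adj L ?p z \<Longrightarrow> z = ?x \<or> z = ?y" using P im by auto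
  have QQ: "cyc_adj L ?q ?x" "cyc_adj L ?q ?y" "\<And>z. cyc_adj L ?q z \<Longrightarrow> z = ?x \<or> z = ?y" using Q im by auto
  have XY: "z = ?p \<or> z = ?q" if w: "w = ?x \<or> w = ?y" "cyc_adj L w z" for w z
  proof -
    have "w \<in> set L" using cyc_adj_in(1)[OF w(2)] .
    then obtain a b where ab: "\<And>z. cyc_adj L w z \<Longrightarrow> z = a \<or> z = b"
      by (rule cyc_adj_neighbours[OF L(1,3)]) blast
    have "cyc_adj L w ?p" "cyc_adj L w ?q" using w(1) PP(1,2) QQ(1,2) cyc_adj_commute by metis+
    then show ?thesis using ab[of ?p] ab[of ?q] ab[OF w(2)] pq by metis
  qed
  have "set L \<subseteq> {?x, ?y, ?p, ?q}"
  proof (rule cyc_adj_closed)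
    show "?x \<in> set L" using cyc_adj_in(2)[OF PP(1)] .
    fix a b assume "a \<in> {?x, ?y, ?p, ?q}" "cyc_adj L a b"
    then show "b \<in> {?x, ?y, ?p, ?q}" using XY[of a b] PP(3)[of b] QQ(3)[of b] by auto
  qed simp
  then have "card (set L) \<le> card {?x, ?y, ?p, ?q}" by (intro card_mono) auto
  also have "\<dots> \<le> 4" by (simp add: card_insert_if)
  finally show False using cardN unfolding L(2)[symmetric] by simp
qed

end

section \<open>Inserting vertices into a pendant path\<close>

context spex_path
begin

text \<open>A vertex can be added at the end \<open>u 1\<close>. Shifting names along the untouched
  start of the path turns this into an insertion between \<open>u j\<close> and
  \<open>u (j + 1)\<close>, and contracting the edge from \<open>u (l - 1)\<close> to
  \<open>u l\<close> frees a name for the inserted vertex. Extra edges keep their ends, since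
  neither \<open>l\<close> nor any index up to \<open>j\<close> is touched.\<close>

lemma insertion_embeddable:
  assumes j: "1 \<le> j" "\<And>i. 1 \<le> i \<Longrightarrow> i \<le> j \<Longrightarrow> \<not> touched i" and l: "suppressible l" "j + 1 < l"
    and H': "simple_graph H'" "verts H' = verts H"
      "edges H' \<subseteq> {{u j, u l}, {u l, u (j + 1)}, {u (l - 1), u (l + 1)}} \<union>
        (edges H - {{u (l - 1), u l}, {u (l + 1), u l}, {u j, u (j + 1)}})"
  shows "embeddable (K2 \<nabla> H') S"
proof -
  let ?G = "K2 \<nabla> H"
  let ?A = "add_vertex ?G {Inl True, Inl False, Inr (u 1)}"
  \<comment> \<open>Position 0 is the new vertex. A position below \<open>j\<close> takes the next
    name, position \<open>j\<close> receives the name \<open>u l\<close>, and position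
    \<open>l\<close> is merged with position \<open>l - 1\<close>.\<close>
  define \<sigma> where "\<sigma> i = (if i < j then i + 1 else if i = j then l else if i = l then l - 1 else i)" for i
  define ix where "ix = inv_into {1..m} u"
  define \<phi> where "\<phi> t = (case t of None \<Rightarrow> Inr (u (\<sigma> 0)) | Some (Inl b) \<Rightarrow> Inl b | Some (Inr w) \<Rightarrow> Inr (u (\<sigma> (ix w))))"
    for t :: "(bool + 'a) option"
  define \<theta> :: "nat \<Rightarrow> (bool + 'a) option" where "\<theta> i = (if i = 0 then None else Some (Inr (u i)))" for i
  have lm: "1 < l" "l < m" "\<not> touched l" using l(1) unfolding suppressible_def by auto
  have ix: "ix (u i) = i" if "i \<in> {1..m}" for i
    unfolding ix_def using that u by (intro inv_into_f_f) (auto simp: bij_betw_def)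
  have \<phi>\<theta>: "\<phi> (\<theta> i) = Inr (u (\<sigma> i))" if "i \<le> m" for i
    using that ix[of i] by (simp add: \<phi>_def \<theta>_def)
  have \<phi>l: "\<phi> (Some (Inl b)) = Inl b" for b by (simp add: \<phi>_def)
  have \<sigma>m: "\<sigma> i \<in> {1..m}" if "i \<le> m" for i using that lm j(1) l(2) unfolding \<sigma>_def by auto
  have \<sigma>inj: "i = i' \<or> {i, i'} = {l - 1, l}" if "\<sigma> i = \<sigma> i'" for i i'
  proof (rule ccontr)
    assume "\<not> ?thesis"
    then have "i \<noteq> i'" "\<not> (i = l - 1 \<and> i' = l)" "\<not> (i = l \<and> i' = l - 1)" by (auto simp: insert_commute)
    then show False using that lm j(1) l(2) unfolding \<sigma>_def by (auto split: if_splits)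
  qed
  have \<sigma>surj: "\<exists>i\<le>m. \<sigma> i = i'" if i': "i' \<in> {1..m}" for i'
  proof -
    consider "i' \<le> j" | "i' = l" | "i' > j" "i' \<noteq> l" by linarith
    then show ?thesis
    proof cases
      case 1 then show ?thesis using i' by (intro exI[of _ "i' - 1"]) (auto simp: \<sigma>_def)
    next
      case 2 then show ?thesis using lm l(2) by (intro exI[of _ j]) (auto simp: \<sigma>_def)
    next
      case 3 then show ?thesis using i' by (intro exI[of _ i']) (auto simp: \<sigma>_def)
    qed
  qed
  have \<theta>V: "\<theta> i \<in> verts ?A" if "i \<le> m" for i
    using that u_vert[of i] unfolding \<theta>_def verts_add_vertex verts_join by (cases "i = 0") (auto intro!: imageI InrI)
  have A_cases: "(\<exists>b. t = Some (Inl b)) \<or> (\<exists>i\<le>m. t = \<theta> i)" if t: "t \<in> verts ?A" for t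
  proof -
    consider "t = None" | b where "t = Some (Inl b)" | w where "t = Some (Inr w)" by (metis option.exhaust sum.exhaust)
    then show ?thesis
    proof cases
      case 1 then show ?thesis by (intro disjI2 exI[of _ 0]) (simp add: \<theta>_def)
    next
      case (3 w)
      then have "w \<in> verts H" using t by (auto simp: verts_add_vertex verts_join)
      then obtain i where "i \<in> {1..m}" "w = u i" by (rule vert_u)
      then show ?thesis using 3 by (intro disjI2 exI[of _ i]) (simp add: \<theta>_def)
    qed blast
  qed
  have \<theta>path: "{\<theta> i, \<theta> (i + 1)} \<in> edges ?A" if "i < m" for i
  proof (cases "i = 0")
    case True
    have "{None, Some (Inr (u 1))} \<in> edges ?A" by (rule add_vertex_edgeI) simp
    then show ?thesis using True by (simp add: \<theta>_def)
  next
    case False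
    have "{Some (Inr (u i)), Some (Inr (u (i + 1)))} \<in> edges ?A"
      by (rule add_vertex_edgeI) (use path_edge[of i] False that in \<open>simp add: join_edge_iff\<close>)
    then show ?thesis using False by (simp add: \<theta>_def)
  qed
  have \<theta>apex: "{Some (Inl b), \<theta> i} \<in> edges ?A" if i: "i \<le> m" for i b
  proof (cases "i = 0")
    case True
    have "{None, Some (Inl b)} \<in> edges ?A" by (rule add_vertex_edgeI) (cases b; simp)
    then show ?thesis using True by (simp add: \<theta>_def insert_commute)
  next
    case False
    have "{Some (Inl b), Some (Inr (u i))} \<in> edges ?A"
      by (rule add_vertex_edgeI) (use u_vert[of i] False i in \<open>simp add: join_edge_iff\<close>)
    then show ?thesis using False by (simp add: \<theta>_def)
  qed
  have pathT: "\<exists>e'\<in>edges ?A. \<phi> ` e' = {Inr (u (\<sigma> i)), Inr (u (\<sigma> (i + 1)))}" if i: "i < m" for i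
    by (rule bexI[OF _ \<theta>path[OF i]]) (use \<phi>\<theta>[of i] \<phi>\<theta>[of "i + 1"] i in simp)
  have A: "simple_graph ?A"
    by (rule simple_graph_add_vertex[OF simple_graph_join[OF H]]) (use u_vert[of 1] m in \<open>auto simp: verts_join\<close>)
  show ?thesis
  proof (rule embeddable_contract[OF S A ends(1)[unfolded attachable_def] simple_graph_join[OF H'(1)], of "\<theta> (l - 1)" "\<theta> l" \<phi>])
    show "{\<theta> (l - 1), \<theta> l} \<in> edges ?A" using \<theta>path[of "l - 1"] lm by simp
    have "\<sigma> (l - 1) = \<sigma> l" using lm l(2) unfolding \<sigma>_def by auto
    then show "\<phi> (\<theta> (l - 1)) = \<phi> (\<theta> l)" using \<phi>\<theta>[of "l - 1"] \<phi>\<theta>[of l] lm by simp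
  next
    fix t t' assume t: "t \<in> verts ?A" "t' \<in> verts ?A" and eq: "\<phi> t = \<phi> t'"
    show "t = t' \<or> {t, t'} = {\<theta> (l - 1), \<theta> l}"
      using A_cases[OF t(1)] A_cases[OF t(2)]
    proof (elim disjE exE conjE)
      fix i i' assume i: "i \<le> m" "i' \<le> m" "t = \<theta> i" "t' = \<theta> i'"
      then have "u (\<sigma> i) = u (\<sigma> i')" using eq \<phi>\<theta> by simp
      then have "\<sigma> i = \<sigma> i'" using u_eq_iff[OF \<sigma>m \<sigma>m] i by blast
      then have "i = i' \<or> {i, i'} = {l - 1, l}" by (rule \<sigma>inj)
      then show ?thesis unfolding i(3,4) by (auto simp: doubleton_eq_iff)
    qed (use eq \<phi>\<theta> \<phi>l in auto)
  next
    show "verts (K2 \<nabla> H') \<subseteq> \<phi> ` verts ?A"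
    proof
      fix t :: "bool + 'a" assume t: "t \<in> verts (K2 \<nabla> H')"
      show "t \<in> \<phi> ` verts ?A"
      proof (cases t)
        case (Inl b)
        then show ?thesis by (intro image_eqI[of _ _ "Some (Inl b)"]) (auto simp: \<phi>l verts_add_vertex verts_join)
      next
        case (Inr w)
        then have "w \<in> verts H" using t H'(2) by (auto simp: verts_join)
        then obtain i' where i': "i' \<in> {1..m}" "w = u i'" by (rule vert_u)
        then obtain i where "i \<le> m" "\<sigma> i = i'" using \<sigma>surj by blast
        then show ?thesis using \<theta>V[of i] \<phi>\<theta>[of i] Inr i' by (intro image_eqI[of _ _ "\<theta> i"]) simp_all
      qed
    qed
  next
    fix e assume "e \<in> edges (K2 \<nabla> H')"
    then show "\<exists>e'\<in>edges ?A. \<phi> ` e' = e"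
    proof (cases rule: join_edge_cases)
      case 1
      have "{Some (Inl True), Some (Inl False)} \<in> edges ?A"
        by (rule add_vertex_edgeI) (simp add: join_edge_iff)
      moreover have "\<phi> ` {Some (Inl True), Some (Inl False)} = e" using 1 \<phi>l by simp
      ultimately show ?thesis by blast
    next
      case (2 b w)
      then have "w \<in> verts H" using H'(2) by simp
      then obtain i' where i': "i' \<in> {1..m}" "w = u i'" by (rule vert_u)
      then obtain i where i: "i \<le> m" "\<sigma> i = i'" using \<sigma>surj by blast
      have "\<phi> ` {Some (Inl b), \<theta> i} = e" using 2 \<phi>l \<phi>\<theta>[OF i(1)] i(2) i'(2) by simp
      then show ?thesis using \<theta>apex[OF i(1)] by blast
    next
      case (3 d)
      have pathE: "\<exists>e'\<in>edges ?A. \<phi> ` e' = e" if i: "i < m" and d: "d = {u (\<sigma> i), u (\<sigma> (i + 1))}" for i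
        using pathT[OF i] unfolding 3(2) d by simp
      consider "d = {u j, u l}" | "d = {u l, u (j + 1)}" | "d = {u (l - 1), u (l + 1)}"
        | "d \<in> edges H" "d \<noteq> {u (l - 1), u l}" "d \<noteq> {u (l + 1), u l}" "d \<noteq> {u j, u (j + 1)}"
        using subsetD[OF H'(3) 3(1)] by blast
      then show ?thesis
      proof cases
        case 1
        then show ?thesis using j(1) l(2) lm by (intro pathE[of "j - 1"]) (auto simp: \<sigma>_def)
      next
        case 2
        then show ?thesis using j(1) l(2) lm by (intro pathE[of j]) (auto simp: \<sigma>_def)
      next
        case 3
        then show ?thesis using j(1) l(2) lm by (intro pathE[of l]) (auto simp: \<sigma>_def)
      next
        case d: 4
        consider i where "i \<in> {1..<m}" "d = {u i, u (i + 1)}" | "d \<in> F" using d(1) unfolding E by blast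
        then show ?thesis
        proof cases
          case (1 i)
          have ne: "i \<noteq> j" "i \<noteq> l" "i \<noteq> l - 1" using d(2-4) 1(2) lm by (auto simp: insert_commute)
          show ?thesis
          proof (cases "i < j")
            case True then show ?thesis using 1 l(2) lm by (intro pathE[of "i - 1"]) (auto simp: \<sigma>_def)
          next
            case False
            have "i + 1 \<noteq> l" using ne lm by auto
            then show ?thesis using 1 False ne by (intro pathE[of i]) (auto simp: \<sigma>_def)
          qed
        next
          case 2
          have "\<phi> ` Some ` Inr ` d = (\<lambda>w. Inr w) ` d"
            unfolding image_image
          proof (rule image_cong)
            fix w assume w: "w \<in> d"
            then have "w \<in> verts H" using d(1) H unfolding simple_graph_def by auto
            then obtain i where i: "i \<in> {1..m}" "w = u i" by (rule vert_u)
            then have "touched i" using w 2 unfolding touched_def by blast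
            then have "\<not> i \<le> j" "i \<noteq> l" using j(2)[of i] i(1) lm(3) by auto
            then have "\<sigma> i = i" by (simp add: \<sigma>_def)
            then show "\<phi> (Some (Inr w)) = Inr w" using ix[OF i(1)] i(2) by (simp add: \<phi>_def)
          qed simp
          moreover have "Some ` Inr ` d \<in> edges ?A" by (intro add_vertex_edgeI join_edgeI d(1))
          ultimately show ?thesis using 3(2) by blast
        qed
      qed
    qed
  qed
qed

lemma insertion_bound:
  assumes j: "1 \<le> j" "\<And>i. 1 \<le> i \<Longrightarrow> i \<le> j \<Longrightarrow> \<not> touched i" and l: "suppressible l" "j + 1 < l"
  shows "excess \<rho> (g (u j)) (g (u (j + 1))) \<le> excess \<rho> (g (u (l - 1))) (g (u (l + 1)))"
proof -
  let ?a = "u (l - 1)" and ?b = "u (l + 1)" and ?r = "u l" and ?p = "u j" and ?q = "u (j + 1)"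
  note r = suppressibleD[OF l(1)]
  have lm: "1 < l" "l < m" using l(1) unfolding suppressible_def by auto
  have I: "l - 1 \<in> {1..m}" "l \<in> {1..m}" "l + 1 \<in> {1..m}" "j \<in> {1..m}" "j + 1 \<in> {1..m}" using lm l(2) j(1) by auto
  note V = I[THEN u_vert]
  have ne: "?p \<noteq> ?r" "?q \<noteq> ?r" "?p \<noteq> ?q" "?p \<noteq> ?b" "?q \<noteq> ?b"
    using u_eq_iff[OF I(4,2)] u_eq_iff[OF I(5,2)] u_eq_iff[OF I(4,5)] u_eq_iff[OF I(4,3)] u_eq_iff[OF I(5,3)] l(2) by auto
  define E' where "E' = insert {?a, ?b} (edges H - {{?a, ?r}, {?b, ?r}} - {{?p, ?q}}) \<union> {{?p, ?r}, {?r, ?q}}"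
  let ?H = "\<lparr>verts = verts H, edges = E'\<rparr>"
  have H': "simple_graph ?H" by (rule simple_graph_change[OF H]) (use V ne r(3) in \<open>auto simp: E'_def\<close>)
  have "embeddable (K2 \<nabla> ?H) S"
    by (rule insertion_embeddable[OF j l H']) (auto simp: E'_def)
  then have "energy ?H \<rho> (f(?r := (1 + (f ?p + f ?q)) / \<rho>)) \<le> energy H \<rho> f" by (rule opt[OF H', rotated]) simp
  moreover have "energy ?H \<rho> (f(?r := (1 + (f ?p + f ?q)) / \<rho>)) = energy H \<rho> f
     + ((1 + (f ?p + f ?q))\<^sup>2 / \<rho> - 2 * (\<Sum>e\<in>{{?p, ?q}}. prod f e)) - insertion_gain \<rho> (f ?a) (f ?b)"
  proof (rule energy_move[OF H H' _ r(1-5), of "{{?p, ?q}}" "{{?p, ?r}, {?r, ?q}}"])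
    show "{{?p, ?q}} \<subseteq> edges H - {{?a, ?r}, {?b, ?r}}"
      using path_edge[OF j(1)] I(5) ne by (auto simp: doubleton_eq_iff)
    have "{?p, ?r} \<noteq> {?r, ?q}" using ne by (auto simp: doubleton_eq_iff)
    then show "(\<Sum>e\<in>{{?p, ?r}, {?r, ?q}}. prod (f(?r := (1 + (f ?p + f ?q)) / \<rho>)) e) = (1 + (f ?p + f ?q)) / \<rho> * (f ?p + f ?q)"
      using ne by (simp add: algebra_simps add_divide_distrib)
  qed (use rho_bounds(2) in \<open>auto simp: E'_def\<close>)
  moreover have "(\<Sum>e\<in>{{?p, ?q}}. prod f e) = f ?p * f ?q" using ne by simp
  ultimately show ?thesis unfolding excess_insertion_gain by (simp add: insertion_gain_def add.assoc)
qed

section \<open>The first and the last fork, and what lies between them\<close>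

definition touched_set :: "nat set" where "touched_set = {i \<in> {1..m}. touched i}"
definition lo :: nat where "lo = Min touched_set"
definition hi :: nat where "hi = Max touched_set"

lemma lo_hi:
  shows "touched lo" "touched hi" "1 < lo" "lo < hi" "hi < m"
    and "\<And>i. i \<in> {1..m} \<Longrightarrow> touched i \<Longrightarrow> lo \<le> i \<and> i \<le> hi"
proof -
  have fin: "finite touched_set" unfolding touched_set_def by simp
  obtain e where e: "e \<in> F" using F(2) k by fastforce
  then have "card e = 2" using F_edge[OF e] H unfolding simple_graph_def by (auto dest: subsetD)
  then obtain v w where vw: "e = {v, w}" by (meson card_2_iff)
  then have "v \<in> verts H" using F_edge[OF e] simple_graph_edgeD(2)[OF H] by blast
  then obtain i where i: "i \<in> {1..m}" "v = u i" by (rule vert_u)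
  then have ti: "touched i" using e vw unfolding touched_def by blast
  obtain j where j: "j \<in> {1..m}" "{u i, u j} \<in> F" "i \<noteq> j" by (rule touchedE[OF ti i(1)])
  have ij: "i \<in> touched_set" "j \<in> touched_set" using i j ti touchedI[OF j(2)] unfolding touched_set_def by auto
  then have ne: "touched_set \<noteq> {}" by blast
  have "lo \<in> touched_set" "hi \<in> touched_set" unfolding lo_def hi_def using Min_in[OF fin ne] Max_in[OF fin ne] by auto
  then show t: "touched lo" "touched hi" and "1 < lo" "hi < m"
    using touched_inner unfolding touched_set_def by auto
  show all: "lo \<le> i \<and> i \<le> hi" if "i \<in> {1..m}" "touched i" for i
    unfolding lo_def hi_def using Min_le[OF fin] Max_ge[OF fin] that unfolding touched_set_def by auto
  have "lo \<le> i \<and> i \<le> hi" "lo \<le> j \<and> j \<le> hi" using all ij unfolding touched_set_def by blast+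
  then show "lo < hi" using j(3) by linarith
qed

lemma nb_first: "nb (u 1) = {u 2}"
proof
  show "nb (u 1) \<subseteq> {u 2}"
  proof
    fix w assume w: "w \<in> nb (u 1)"
    then obtain j where j: "j \<in> {1..m}" "w = u j" using nb_verts by (blast elim: vert_u)
    have 1: "1 \<in> {1..m}" using m by simp
    have "1 + 1 = j \<or> j + 1 = 1" using w edge_iff[OF 1 j(1)] ends(3) touchedI unfolding nb_def j(2) by blast
    then show "w \<in> {u 2}" using j by (auto simp: numeral_2_eq_2)
  qed
  show "{u 2} \<subseteq> nb (u 1)" using nb_path(2)[of 1] m by (simp add: numeral_2_eq_2)
qed

text \<open>Index \<open>0\<close> stands for an absent neighbour of the end of the path, which contributes \<open>0 = c + (- c)\<close>.\<close>

definition dev :: "nat \<Rightarrow> real" where "dev i = (if i = 0 then - c else g (u i))"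

lemma pendant: "pendant_sequence \<rho> c (g (u lo)) dev (lo - 1)"
proof
  show "\<rho> > 2" "c > 0" using rho_bounds by auto
  have "g (u lo) \<ge> c / (2 * \<rho>)" using g_fork[OF u_vert card_nb_touched] lo_hi by simp
  moreover have "c / (2 * \<rho>) > 0" using rho_bounds by simp
  ultimately show "g (u lo) > 0" by linarith
  show "dev 0 = - c" "dev (Suc (lo - 1)) = g (u lo)" using lo_hi(3) by (auto simp: dev_def)
  fix i assume i: "1 \<le> i" "i \<le> lo - 1"
  then have im: "i \<in> {1..m}" "i < lo" using lo_hi by auto
  then have nt: "\<not> touched i" using lo_hi(6)[of i] by auto
  note eq = g_eq[OF u_vert[OF im(1)]]
  \<comment> \<open>The end \<open>u 1\<close> has degree 1, hence the source \<open>- c\<close>,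
    which takes the place of the deviation of the absent neighbour.\<close>
  show "\<rho> * dev i = dev (i - 1) + dev (i + 1)"
  proof (cases "i = 1")
    case True
    then show ?thesis using eq nb_first by (simp add: dev_def numeral_2_eq_2)
  next
    case False
    then have "1 < i" "i < m" using i im lo_hi by auto
    then show ?thesis using eq nb_untouched[OF nt] u_skip_neq[of i] by (simp add: dev_def)
  qed
qed

text \<open>By extremality the gain of an insertion at the sign change cannot exceed the cost of
  suppressing \<open>u l\<close>. A sign change at position 0 means a new leaf at \<open>u 1\<close>
  instead of an insertion into an edge.\<close>

lemma pendant_cost:
  assumes l: "suppressible l" "lo < l"
  shows "pendant_sequence.invariant \<rho> dev / \<rho> \<le> excess \<rho> (g (u (l - 1))) (g (u (l + 1)))"
proof -
  interpret P: pendant_sequence \<rho> c "g (u lo)" dev "lo - 1" by (rule pendant)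
  obtain j where j: "j \<le> lo - 1" "dev j \<le> 0" "0 \<le> dev (Suc j)" using P.sign_change by blast
  have "P.invariant / \<rho> \<le> excess \<rho> (dev j) (dev (Suc j))"
    using P.gain_at_sign_change[OF j] unfolding excess_def .
  also have "\<dots> \<le> excess \<rho> (g (u (l - 1))) (g (u (l + 1)))"
  proof (cases "j = 0")
    case True
    have l1: "l \<in> {1..m}" "1 \<in> {1..m}" "l \<noteq> 1" using l lo_hi m unfolding suppressible_def by auto
    then show ?thesis using leaf_bound[OF ends(1) u_vert[OF l1(2)] _ l(1)] u_eq_iff[OF l1(1,2)] True by (simp add: dev_def)
  next
    case False
    have "\<not> touched i" if "1 \<le> i" "i \<le> j" for i using that j(1) lo_hi(6)[of i] lo_hi(3,4,5) by force
    then have "excess \<rho> (g (u j)) (g (u (j + 1))) \<le> excess \<rho> (g (u (l - 1))) (g (u (l + 1)))"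
      using False j(1) l lo_hi(3) by (intro insertion_bound) auto
    then show ?thesis using False by (simp add: dev_def)
  qed
  finally show ?thesis .
qed

text \<open>Let \<open>r\<close> have the least deviation among the suppressible vertices between
  the extreme forks. Its neighbours deviate at least as much, so its suppression has excess at most
  0, while the insertion into the pendant path has positive excess.\<close>

lemma no_contractible:
  assumes l: "lo < l" "l < hi" "\<not> touched l"
  shows "{u (l - 1), u (l + 1)} \<in> edges H"
proof (rule ccontr)
  assume n: "{u (l - 1), u (l + 1)} \<notin> edges H"
  define C where "C = {l. lo < l \<and> l < hi \<and> suppressible l}"
  have inC: "i \<in> C \<longleftrightarrow> lo < i \<and> i < hi \<and> \<not> touched i \<and> {u (i - 1), u (i + 1)} \<notin> edges H" for i
    using lo_hi(3,5) unfolding C_def suppressible_def by auto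
  have "l \<in> C" using l n inC by blast
  then have C: "finite C" "C \<noteq> {}" by (auto intro: finite_subset[of _ "{..hi}"] simp: C_def)
  define r where "r = arg_min_on (\<lambda>i. g (u i)) C"
  have r1: "r \<in> C" unfolding r_def by (rule arg_min_if_finite(1)[OF C])
  have r2: "g (u r) \<le> g (u i)" if "i \<in> C" for i
    unfolding r_def using arg_min_least[OF C that, of "\<lambda>i. g (u i)"] .
  have rr: "lo < r" "r < hi" "\<not> touched r" "suppressible r" using r1 inC unfolding C_def by auto
  then have rm: "1 < r" "r < m" "r \<in> {1..m}" using lo_hi by auto
  have two: "g (u r) \<le> c / (2 * \<rho>)" using g_two_le[OF u_vert[OF rm(3)] card_nb_untouched[OF rr(3) rm(1,2)]] .
  \<comment> \<open>A touched neighbour is a fork and deviates by at least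
    \<open>c / (2 * \<rho>)\<close>, an upper bound for the deviation at \<open>r\<close>. An
    untouched neighbour is not bridged by an extra edge, because that edge would end in the
    untouched \<open>u r\<close>; so it belongs to \<open>C\<close>.\<close>
  have ge: "g (u i) \<ge> g (u r)" if i: "i = r - 1 \<or> i = r + 1" for i
  proof (cases "touched i")
    case True
    have "i \<in> {1..m}" using i rm by auto
    then show ?thesis using g_fork[OF u_vert card_nb_touched[OF True touched_inner[OF True]]] two by fastforce
  next
    case False
    have "i \<noteq> lo" "i \<noteq> hi" using False lo_hi(1,2) by auto
    then have i2: "lo < i" "i < hi" using i rr rm by auto
    then have im: "i - 1 \<in> {1..m}" "i + 1 \<in> {1..m}" using lo_hi by auto
    have "{u (i - 1), u (i + 1)} \<notin> F"
    proof
      assume "{u (i - 1), u (i + 1)} \<in> F"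
      then have "touched (i - 1)" "touched (i + 1)" using touchedI by auto
      moreover have "i - 1 = r \<or> i + 1 = r" using i rm by auto
      ultimately show False using rr(3) by auto
    qed
    then have "{u (i - 1), u (i + 1)} \<notin> edges H" unfolding edge_iff[OF im] using i2 by auto
    then show ?thesis using r2[of i] inC i2 False by blast
  qed
  define a b t where "a = g (u (r - 1))" and "b = g (u (r + 1))" and "t = g (u r)"
  have ab: "t \<le> a" "t \<le> b" using ge unfolding a_def b_def t_def by auto
  have sum: "\<rho> * t = a + b"
    using g_eq[OF u_vert[OF rm(3)]] nb_untouched[OF rr(3) rm(1,2)] u_skip_neq[OF rm(1,2)] unfolding a_def b_def t_def by simp
  \<comment> \<open>For the fixed sum \<open>\<rho> * t\<close> the product is smallest when one
    factor equals \<open>t\<close>, where it is \<open>(\<rho> - 1) * t\<^sup>2\<close>.\<close>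
  have "0 \<le> (a - t) * (b - t)" using ab by simp
  then have "a * b \<ge> t * (a + b) - t\<^sup>2" by (simp add: power2_eq_square algebra_simps)
  then have ab2: "a * b \<ge> (\<rho> - 1) * t\<^sup>2" unfolding sum[symmetric] by (simp add: power2_eq_square algebra_simps)
  have "excess \<rho> a b = \<rho> * t\<^sup>2 - 2 * (a * b)"
    unfolding excess_def sum[symmetric] using rho_bounds(2) by (simp add: power2_eq_square)
  also have "\<dots> \<le> - ((\<rho> - 2) * t\<^sup>2)" using ab2 by (simp add: algebra_simps)
  also have "\<dots> \<le> 0" using rho_bounds(2) by simp
  finally have "excess \<rho> a b \<le> 0" .
  moreover have "pendant_sequence.invariant \<rho> dev / \<rho> > 0"
    using pendant_sequence.invariant_positive[OF pendant] rho_bounds(2) by simp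
  ultimately show False using pendant_cost[OF rr(4,1)] unfolding a_def b_def by linarith
qed

section \<open>Comparing the two pendant paths\<close>

lemma reversed: "spex_path H (\<lambda>i. u (m + 1 - i)) m k F S \<rho> f"
proof -
  have "bij_betw (\<lambda>i. m + 1 - i) {1..m} {1..m}"
    by (rule bij_betw_byWitness[of _ "\<lambda>i. m + 1 - i"]) auto
  from bij_betw_trans[OF this u] have b: "bij_betw (\<lambda>i. u (m + 1 - i)) {1..m} (verts H)" by (simp add: comp_def)
  have "{{u (m + 1 - i), u (m + 1 - (i + 1))} | i. i \<in> {1..<m}} = {{u i, u (i + 1)} | i. i \<in> {1..<m}}"
  proof (intro equalityI subsetI)
    fix e assume "e \<in> {{u (m + 1 - i), u (m + 1 - (i + 1))} | i. i \<in> {1..<m}}"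
    then obtain i where i: "i \<in> {1..<m}" "e = {u (m + 1 - i), u (m + 1 - (i + 1))}" by blast
    then have "e = {u (m - i), u (m - i + 1)}" "m - i \<in> {1..<m}" by (auto simp: insert_commute Suc_diff_le)
    then show "e \<in> {{u i, u (i + 1)} | i. i \<in> {1..<m}}" by blast
  next
    fix e assume "e \<in> {{u i, u (i + 1)} | i. i \<in> {1..<m}}"
    then obtain i where i: "i \<in> {1..<m}" "e = {u i, u (i + 1)}" by blast
    then have "e = {u (m + 1 - (m - i)), u (m + 1 - (m - i + 1))}" "m - i \<in> {1..<m}" by (auto simp: insert_commute)
    then show "e \<in> {{u (m + 1 - i), u (m + 1 - (i + 1))} | i. i \<in> {1..<m}}" by blast
  qed
  note P = this
  show ?thesis
    by (rule spex_path.intro[OF H b F(1,2)]) (use F(3) E S emb f_pos f_eq opt k m \<rho> in \<open>simp_all only: P\<close>)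
qed

text \<open>A vertex of the right pendant path is suppressed and inserted into the left one. The
  right path is read from its end through the reversed locale, while the insertion takes place in
  the original one.\<close>

lemma balance: "\<not> lo - 1 + 2 \<le> m - hi"
proof
  assume ab: "lo - 1 + 2 \<le> m - hi"
  interpret R: spex_path H "\<lambda>i. u (m + 1 - i)" m k F S \<rho> f by (rule reversed)
  have Rt: "R.touched i \<longleftrightarrow> touched (m + 1 - i)" for i unfolding R.touched_def touched_def ..
  have Rlo: "R.lo = m + 1 - hi"
  proof (rule antisym)
    have "m + 1 - hi \<in> {1..m}" "R.touched (m + 1 - hi)" using lo_hi Rt by auto
    then show "R.lo \<le> m + 1 - hi" using R.lo_hi(6) by blast
    have "m + 1 - R.lo \<in> {1..m}" "touched (m + 1 - R.lo)" using R.lo_hi Rt by auto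
    then have "m + 1 - R.lo \<le> hi" using lo_hi(6) by blast
    then show "m + 1 - hi \<le> R.lo" by simp
  qed
  have lo1: "R.lo - 1 = m - hi" using Rlo lo_hi by auto
  have up: "u (m + 1 - R.lo) = u hi" using Rlo lo_hi by auto
  have him: "hi \<in> {1..m}" "lo \<in> {1..m}" using lo_hi by auto
  have X: "pendant_sequence \<rho> c (g (u lo)) dev (lo - 1)" by (rule pendant)
  have Y: "pendant_sequence \<rho> c (g (u hi)) R.dev (m - hi)" using R.pendant unfolding lo1 up .
  have "\<exists>i. 2 \<le> i \<and> i \<le> m - hi \<and> (R.dev (i - 1) + R.dev (i + 1))\<^sup>2 / \<rho> - 2 * R.dev (i - 1) * R.dev (i + 1)
      < pendant_sequence.invariant \<rho> dev / \<rho>"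
  proof (rule pendant_balance[OF X Y _ \<rho> _ _ _ ab])
    show "c / (2 * \<rho>) \<le> g (u lo)" "c / (2 * \<rho>) \<le> g (u hi)"
      using g_fork[OF u_vert card_nb_touched] lo_hi by simp_all
    show "g (u hi) \<le> 2 * (real k + 2) * c / \<rho>" using g_bound[OF u_vert[OF him(1)]] by linarith
  qed (use k lo_hi in auto)
  then obtain i where i: "2 \<le> i" "i \<le> m - hi"
    "excess \<rho> (R.dev (i - 1)) (R.dev (i + 1)) < pendant_sequence.invariant \<rho> dev / \<rho>" unfolding excess_def by blast
  \<comment> \<open>\<open>i\<close> counts from the right end: \<open>2 \<le> i\<close> keeps
    \<open>l\<close> away from the end of the path, and \<open>i \<le> m - hi\<close> puts it behind
    the last fork.\<close>
  define l where "l = m + 1 - i"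
  have l: "hi < l" "l < m" "1 < l" "lo < l" "l \<in> {1..m}" "l - 1 \<in> {1..m}" "l + 1 \<in> {1..m}"
    using i lo_hi unfolding l_def by auto
  have nt: "\<not> touched l" "\<not> touched (l + 1)" using lo_hi(6)[OF l(5)] lo_hi(6)[OF l(7)] l(1) by auto
  have "{u (l - 1), u (l + 1)} \<notin> F" using nt(2) touchedI by blast
  then have "{u (l - 1), u (l + 1)} \<notin> edges H" unfolding edge_iff[OF l(6,7)] using l(3) by auto
  then have "suppressible l" unfolding suppressible_def using l nt by blast
  then have "pendant_sequence.invariant \<rho> dev / \<rho> \<le> excess \<rho> (g (u (l - 1))) (g (u (l + 1)))"
    using pendant_cost l(4) by blast
  moreover have "R.dev (i - 1) = g (u (l + 1))" "R.dev (i + 1) = g (u (l - 1))"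
    using i unfolding R.dev_def l_def by (auto simp: Suc_diff_le numeral_2_eq_2 intro!: arg_cong[of _ _ g] arg_cong[of _ _ u])
  ultimately show False using i(3) by (simp add: excess_def add.commute mult.commute mult.left_commute)
qed

end

section \<open>The shape of extremal graphs\<close>

text \<open>\<open>balance\<close> and \<open>balance_reversed\<close> leave open which path is the
  longer one, whereas the claim puts the shorter first.\<close>

lemma pendant_paths_commute: assumes "G \<in> pendant_paths H0 a b" shows "G \<in> pendant_paths H0 b a"
proof -
  obtain p q :: "nat \<Rightarrow> 'a" where pq: "p 0 \<in> verts H0" "q 0 \<in> verts H0" "p 0 \<noteq> q 0"
    "inj_on p {1..a}" "inj_on q {1..b}" "p ` {1..a} \<inter> q ` {1..b} = {}" "(p ` {1..a} \<union> q ` {1..b}) \<inter> verts H0 = {}"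
    and G: "G = \<lparr>verts = verts H0 \<union> p ` {1..a} \<union> q ` {1..b},
      edges = edges H0 \<union> {{p i, p (i + 1)} | i. i < a} \<union> {{q i, q (i + 1)} | i. i < b}\<rparr>"
    using assms unfolding pendant_paths_def mem_Collect_eq by (elim exE conjE) (rule that; assumption)
  show ?thesis
    unfolding pendant_paths_def mem_Collect_eq
  proof (rule exI[of _ q], rule exI[of _ p], intro conjI)
    show "q 0 \<noteq> p 0" using pq(3) by simp
    show "q ` {1..b} \<inter> p ` {1..a} = {}" using pq(6) by (simp add: Int_commute)
    show "(q ` {1..b} \<union> p ` {1..a}) \<inter> verts H0 = {}" using pq(7) by (simp add: Un_commute)
    show "G = \<lparr>verts = verts H0 \<union> q ` {1..b} \<union> p ` {1..a},
      edges = edges H0 \<union> {{q i, q (i + 1)} | i. i < b} \<union> {{p i, p (i + 1)} | i. i < a}\<rparr>"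
      unfolding G by (simp only: Un_ac)
  qed (fact pq)+
qed

context spex_path
begin

text \<open>An untouched \<open>i\<close> between the extreme forks is bridged by an extra edge, so
  \<open>i + 1\<close> is a fork; not being separate, it is followed by the fork
  \<open>i + 2\<close>. The forks found in this way are distinct for different \<open>i\<close>, so
  there are at most \<open>k\<close> such \<open>i\<close> besides at most \<open>2 * k\<close>
  forks.\<close>

lemma core_size: "hi + 1 - lo \<le> 3 * k"
proof -
  define N where "N = {i. lo < i \<and> i < hi \<and> \<not> touched i}"
  have finN: "finite N" by (rule finite_subset[of _ "{..hi}"]) (auto simp: N_def)
  have fin: "finite touched_set" unfolding touched_set_def by simp
  have next_two: "i + 1 \<in> touched_set" "i + 2 \<in> touched_set" if i: "i \<in> N" for i
  proof -
    have n: "lo < i" "i < hi" "\<not> touched i" using i unfolding N_def by auto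
    have I: "i - 1 \<in> {1..m}" "i + 1 \<in> {1..m}" using n lo_hi by auto
    have "{u (i - 1), u (i + 1)} \<in> F" using no_contractible[OF n] unfolding edge_iff[OF I] using n(1) by auto
    then have t: "touched (i + 1)" using touchedI by blast
    then show "i + 1 \<in> touched_set" using I(2) unfolding touched_set_def by blast
    have "touched (i + 1 + 1)" using no_separate[OF t I(2)] n(3) by auto
    moreover have "i + 1 < m" using touched_inner[OF t I(2)] by simp
    ultimately show "i + 2 \<in> touched_set" unfolding touched_set_def by simp
  qed
  have "(\<lambda>i. i + 1) ` N \<inter> (\<lambda>i. i + 2) ` N = {}"
  proof (rule equals0I)
    fix x assume "x \<in> (\<lambda>i. i + 1) ` N \<inter> (\<lambda>i. i + 2) ` N"
    then obtain i j where ij: "i \<in> N" "j \<in> N" "x = i + 1" "x = j + 2" by auto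
    then have "i = j + 1" by simp
    then show False using next_two(1)[OF ij(2)] ij(1) unfolding N_def touched_set_def by auto
  qed
  then have "card ((\<lambda>i. i + 1) ` N \<union> (\<lambda>i. i + 2) ` N) = card ((\<lambda>i. i + 1) ` N) + card ((\<lambda>i. i + 2) ` N)"
    using finN by (intro card_Un_disjoint) auto
  also have "\<dots> = 2 * card N" by (simp add: card_image inj_on_def)
  finally have "2 * card N \<le> card touched_set"
    using card_mono[OF fin, of "(\<lambda>i. i + 1) ` N \<union> (\<lambda>i. i + 2) ` N"] next_two by auto
  moreover have "card touched_set \<le> 2 * k" using card_touched unfolding touched_set_def .
  moreover have "{lo..hi} \<subseteq> N \<union> touched_set"
  proof
    fix i assume i: "i \<in> {lo..hi}"
    then have "i \<in> {1..m}" using lo_hi by auto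
    then show "i \<in> N \<union> touched_set"
      using i lo_hi(1,2) unfolding N_def touched_set_def by (cases "i = lo"; cases "i = hi") auto
  qed
  then have "card {lo..hi} \<le> card N + card touched_set"
    using card_mono[of "N \<union> touched_set" "{lo..hi}"] card_Un_le[of N touched_set] finN fin by (meson finite_UnI order_trans)
  ultimately show ?thesis by simp
qed

definition core :: "'a sgraph" where
  "core = \<lparr>verts = u ` {lo..hi}, edges = {e \<in> edges H. e \<subseteq> u ` {lo..hi}}\<rparr>"

lemma core_simple: "simple_graph core"
  using H unfolding simple_graph_def core_def by auto

lemma card_core: "card (verts core) = hi + 1 - lo"
proof -
  have "{lo..hi} \<subseteq> {1..m}" using lo_hi by auto
  then have "inj_on u {lo..hi}" using u unfolding bij_betw_def by (blast intro: inj_on_subset)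
  then show ?thesis unfolding core_def by (simp add: card_image)
qed

text \<open>The pendant paths are read outwards from the extreme forks: \<open>p 0\<close> and
  \<open>q 0\<close> are the forks themselves, so \<open>lo - 1\<close> and \<open>m - hi\<close>
  vertices are new.\<close>

lemma core_pendant: "H \<in> pendant_paths core (lo - 1) (m - hi)"
proof -
  define p where "p i = u (lo - i)" for i
  define q where "q i = u (hi + i)" for i
  have bnd: "1 < lo" "lo < hi" "hi < m" using lo_hi by auto
  have im: "u ` A \<inter> u ` B = {}" if "A \<subseteq> {1..m}" "B \<subseteq> {1..m}" "A \<inter> B = {}" for A B
    using that u inj_on_image_Int[of u "{1..m}" A B] unfolding bij_betw_def by simp
  have P: "p ` {1..lo - 1} = u ` {1..<lo}"
  proof (intro equalityI subsetI)
    fix x assume "x \<in> u ` {1..<lo}"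
    then obtain i where "i \<in> {1..<lo}" "x = u i" by blast
    then have "x = p (lo - i)" "lo - i \<in> {1..lo - 1}" by (auto simp: p_def)
    then show "x \<in> p ` {1..lo - 1}" by blast
  qed (auto simp: p_def)
  have Q: "q ` {1..m - hi} = u ` {hi<..m}"
  proof (intro equalityI subsetI)
    fix x assume "x \<in> u ` {hi<..m}"
    then obtain i where "i \<in> {hi<..m}" "x = u i" by blast
    then have "x = q (i - hi)" "i - hi \<in> {1..m - hi}" by (auto simp: q_def)
    then show "x \<in> q ` {1..m - hi}" by blast
  qed (auto simp: q_def)
  have "{1..m} = {lo..hi} \<union> {1..<lo} \<union> {hi<..m}" using bnd by auto
  then have V: "verts H = u ` {lo..hi} \<union> u ` {1..<lo} \<union> u ` {hi<..m}"
    using u unfolding bij_betw_def by (metis image_Un)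
  have Ed: "edges H = {e \<in> edges H. e \<subseteq> u ` {lo..hi}} \<union> {{p i, p (i + 1)} | i. i < lo - 1} \<union> {{q i, q (i + 1)} | i. i < m - hi}"
  proof (intro equalityI subsetI)
    fix e assume e: "e \<in> edges H"
    then consider i where "i \<in> {1..<m}" "e = {u i, u (i + 1)}" | "e \<in> F" unfolding E by blast
    then show "e \<in> {e \<in> edges H. e \<subseteq> u ` {lo..hi}} \<union> {{p i, p (i + 1)} | i. i < lo - 1} \<union> {{q i, q (i + 1)} | i. i < m - hi}"
    proof cases
      case (1 i)
      consider "i < lo" | "lo \<le> i" "i < hi" | "hi \<le> i" by linarith
      then show ?thesis
      proof cases
        case a: 1
        then have "e = {p (lo - 1 - i), p (lo - 1 - i + 1)}" "lo - 1 - i < lo - 1"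
          using 1 unfolding p_def by (auto simp: insert_commute Suc_diff_le)
        then show ?thesis by blast
      next
        case 2
        then have "e \<subseteq> u ` {lo..hi}" using 1(2) by auto
        then show ?thesis using e by blast
      next
        case 3
        then have "e = {q (i - hi), q (i - hi + 1)}" "i - hi < m - hi" using 1 unfolding q_def by auto
        then show ?thesis by blast
      qed
    next
      case 2
      have "e \<subseteq> u ` {lo..hi}"
      proof
        fix w assume w: "w \<in> e"
        then have "w \<in> verts H" using e H unfolding simple_graph_def by auto
        then obtain i where i: "i \<in> {1..m}" "w = u i" by (rule vert_u)
        then have "touched i" using w 2 unfolding touched_def by blast
        then show "w \<in> u ` {lo..hi}" using lo_hi(6)[OF i(1)] i(2) by auto
      qed
      then show ?thesis using e by blast
    qed
  next
    fix e assume "e \<in> {e \<in> edges H. e \<subseteq> u ` {lo..hi}} \<union> {{p i, p (i + 1)} | i. i < lo - 1} \<union> {{q i, q (i + 1)} | i. i < m - hi}"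
    then consider "e \<in> edges H" | i where "i < lo - 1" "e = {p i, p (i + 1)}" | i where "i < m - hi" "e = {q i, q (i + 1)}" by blast
    then show "e \<in> edges H"
    proof cases
      case (2 i)
      then have "e = {u (lo - (i + 1)), u (lo - (i + 1) + 1)}" unfolding p_def by (auto simp: insert_commute Suc_diff_Suc)
      then show ?thesis using path_edge[of "lo - (i + 1)"] 2(1) bnd by auto
    next
      case (3 i)
      then show ?thesis using path_edge[of "hi + i"] bnd unfolding q_def by (simp add: add.assoc)
    qed
  qed
  show ?thesis
    unfolding pendant_paths_def mem_Collect_eq
  proof (rule exI[of _ p], rule exI[of _ q], intro conjI)
    have I: "lo \<in> {1..m}" "hi \<in> {1..m}" using bnd by auto
    show "p 0 \<in> verts core" "q 0 \<in> verts core" using bnd by (auto simp: p_def q_def core_def)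
    show "p 0 \<noteq> q 0" using u_eq_iff[OF I] bnd by (simp add: p_def q_def)
    show "inj_on p {1..lo - 1}"
    proof (rule inj_onI)
      fix i j assume ij: "i \<in> {1..lo - 1}" "j \<in> {1..lo - 1}" "p i = p j"
      then have "lo - i \<in> {1..m}" "lo - j \<in> {1..m}" using bnd by auto
      then have "lo - i = lo - j" using ij(3) u_eq_iff unfolding p_def by blast
      then show "i = j" using ij by auto
    qed
    show "inj_on q {1..m - hi}"
    proof (rule inj_onI)
      fix i j assume ij: "i \<in> {1..m - hi}" "j \<in> {1..m - hi}" "q i = q j"
      then have "hi + i \<in> {1..m}" "hi + j \<in> {1..m}" using bnd by auto
      then have "hi + i = hi + j" using ij(3) u_eq_iff unfolding q_def by blast
      then show "i = j" by simp
    qed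
    show "p ` {1..lo - 1} \<inter> q ` {1..m - hi} = {}" unfolding P Q using bnd by (intro im) auto
    have "u ` {1..<lo} \<inter> u ` {lo..hi} = {}" "u ` {hi<..m} \<inter> u ` {lo..hi} = {}" using bnd by (intro im; auto)+
    then show "(p ` {1..lo - 1} \<union> q ` {1..m - hi}) \<inter> verts core = {}" unfolding P Q by (simp add: core_def Int_Un_distrib2)
    show "H = \<lparr>verts = verts core \<union> p ` {1..lo - 1} \<union> q ` {1..m - hi},
      edges = edges core \<union> {{p i, p (i + 1)} | i. i < lo - 1} \<union> {{q i, q (i + 1)} | i. i < m - hi}\<rparr>"
    proof (rule sgraph.equality)
      show "verts H = verts \<lparr>verts = verts core \<union> p ` {1..lo - 1} \<union> q ` {1..m - hi},
        edges = edges core \<union> {{p i, p (i + 1)} | i. i < lo - 1} \<union> {{q i, q (i + 1)} | i. i < m - hi}\<rparr>"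
        unfolding P Q V by (simp add: core_def)
      show "edges H = edges \<lparr>verts = verts core \<union> p ` {1..lo - 1} \<union> q ` {1..m - hi},
        edges = edges core \<union> {{p i, p (i + 1)} | i. i < lo - 1} \<union> {{q i, q (i + 1)} | i. i < m - hi}\<rparr>"
        using Ed unfolding core_def sgraph.simps .
    qed simp
  qed
qed

lemma balance_reversed: "\<not> m - hi + 2 \<le> lo - 1"
proof -
  interpret R: spex_path H "\<lambda>i. u (m + 1 - i)" m k F S \<rho> f by (rule reversed)
  have Rt: "R.touched i \<longleftrightarrow> touched (m + 1 - i)" for i unfolding R.touched_def touched_def ..
  have "hi \<in> {1..m}" "m + 1 - hi \<in> {1..m}" "R.touched (m + 1 - hi)" using lo_hi Rt by auto
  then have 1: "R.lo \<le> m + 1 - hi" using R.lo_hi(6) by blast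
  have "m + 1 - lo \<in> {1..m}" "R.touched (m + 1 - lo)" using lo_hi Rt by auto
  then have 2: "m + 1 - lo \<le> R.hi" using R.lo_hi(6) by blast
  have "m + 1 - R.hi \<in> {1..m}" "touched (m + 1 - R.hi)" using R.lo_hi Rt by auto
  then have 3: "lo \<le> m + 1 - R.hi" using lo_hi(6) by blast
  then show ?thesis using R.balance 1 2 lo_hi(3,4,5) R.lo_hi(3,4,5) by linarith
qed

lemma shape:
  "\<not> contractible_at H u m i" "\<not> separate_at H u m i"
  "\<exists>H0 n0. simple_graph H0 \<and> card (verts H0) = n0 \<and> n0 \<le> 3 * k \<and>
     H \<in> pendant_paths H0 (nat \<lfloor>(real m - real n0) / 2\<rfloor>) (nat \<lceil>(real m - real n0) / 2\<rceil>)"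
proof -
  show "\<not> contractible_at H u m i"
  proof
    assume "contractible_at H u m i"
    then obtain i1 i2 where i: "i \<in> {1..m}" "degree H (u i) = 2" "{u (i - 1), u (i + 1)} \<notin> edges H"
      "i1 \<in> {1..m}" "i2 \<in> {1..m}" "i1 < i" "i < i2" "fork H (u i1)" "fork H (u i2)"
      unfolding contractible_at_def by blast
    then have "lo \<le> i1" "i2 \<le> hi" using lo_hi(6) fork_iff by blast+
    moreover have "\<not> touched i" using touched_iff_card[OF i(1)] i(2) unfolding degree_nb by simp
    ultimately show False using no_contractible[of i] i(3,6,7) by simp
  qed
  show "\<not> separate_at H u m i"
  proof
    assume "separate_at H u m i"
    then have i: "i \<in> {1..m}" "touched i" "\<And>j. j \<in> {1..m} \<Longrightarrow> j + 1 = i \<or> j = i + 1 \<Longrightarrow> \<not> touched j"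
      unfolding separate_at_def using fork_iff by blast+
    have "1 < i" "i < m" using touched_inner[OF i(2,1)] by auto
    then have "i - 1 \<in> {1..m}" "i - 1 + 1 = i" "i + 1 \<in> {1..m}" by auto
    then have "\<not> touched (i - 1)" "\<not> touched (i + 1)" using i(3) by blast+
    then show False by (rule no_separate[OF i(2,1)])
  qed
  let ?a = "lo - 1" and ?b = "m - hi" and ?x = "(real m - real (hi + 1 - lo)) / 2"
  have bnd: "1 < lo" "lo < hi" "hi < m" using lo_hi by auto
  have x: "?x = (real ?a + real ?b) / 2" using bnd by (simp add: of_nat_diff)
  have "?a = ?b \<or> ?a = ?b + 1 \<or> ?b = ?a + 1" using balance balance_reversed by linarith
  then have "H \<in> pendant_paths core (nat \<lfloor>?x\<rfloor>) (nat \<lceil>?x\<rceil>)"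
  proof (elim disjE)
    assume "?a = ?b"
    then show ?thesis using core_pendant unfolding x by simp
  next
    assume ab: "?a = ?b + 1"
    have "\<lfloor>?x\<rfloor> = int ?b" "\<lceil>?x\<rceil> = int ?a" unfolding x ab
      by (rule floor_unique; simp add: field_simps) (rule ceiling_unique; simp add: field_simps)
    then show ?thesis using pendant_paths_commute[OF core_pendant] by simp
  next
    assume ab: "?b = ?a + 1"
    have "\<lfloor>?x\<rfloor> = int ?a" "\<lceil>?x\<rceil> = int ?b" unfolding x ab
      by (rule floor_unique; simp add: field_simps) (rule ceiling_unique; simp add: field_simps)
    then show ?thesis using core_pendant by simp
  qed
  then show "\<exists>H0 n0. simple_graph H0 \<and> card (verts H0) = n0 \<and> n0 \<le> 3 * k \<and>
     H \<in> pendant_paths H0 (nat \<lfloor>(real m - real n0) / 2\<rfloor>) (nat \<lceil>(real m - real n0) / 2\<rceil>)"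
    using core_simple card_core core_size by (intro exI[of _ core] exI[of _ "hi + 1 - lo"]) simp
qed

end

text \<open>Extremality enters through \<open>opt\<close>: the competitors
  \<open>K2 \<nabla> H'\<close> live on the same surface \<open>closed_surface h c\<close> on which
  \<open>K2 \<nabla> H\<close> is drawn. The locale is used with
  \<open>k = 3 * \<gamma>\<close>.\<close>

theorem theorem1p2:
  fixes \<gamma> :: nat
  assumes "\<gamma> \<ge> 1"
  shows "\<exists>N. \<forall>n \<ge> N. \<forall>(H :: 'a sgraph) (u :: nat \<Rightarrow> 'a).
    path_plus H u (n - 2) (3 * \<gamma>) \<longrightarrow> K2 \<nabla> H \<in> SPEX n \<gamma> \<longrightarrow>
      (\<nexists>i. contractible_at H u (n - 2) i) \<and> (\<nexists>i. separate_at H u (n - 2) i) \<and>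
      (\<exists>(H0 :: 'a sgraph) n0. simple_graph H0 \<and> card (verts H0) = n0 \<and> n0 \<le> 9 * \<gamma> \<and>
         H \<in> pendant_paths H0 (nat \<lfloor>(real n - 2 - real n0) / 2\<rfloor>)
                              (nat \<lceil>(real n - 2 - real n0) / 2\<rceil>))"
proof (intro exI[of _ "(200 * (3 * \<gamma> + 2)\<^sup>2)\<^sup>2 + 9 * \<gamma> + 10"] allI impI)
  fix n :: nat and H :: "'a sgraph" and u :: "nat \<Rightarrow> 'a"
  let ?k = "3 * \<gamma>" and ?m = "n - 2"
  assume n: "(200 * (3 * \<gamma> + 2)\<^sup>2)\<^sup>2 + 9 * \<gamma> + 10 \<le> n"
    and path: "path_plus H u ?m ?k" and spex: "K2 \<nabla> H \<in> SPEX n \<gamma>"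
  have n2: "real ?m = real n - 2" using n by (simp add: of_nat_diff)
  have H: "simple_graph H" and u: "bij_betw u {1..?m} (verts H)" using path unfolding path_plus_def by auto
  obtain F where F: "card F = ?k" "finite F" "F \<inter> {{u i, u (i + 1)} | i. i \<in> {1..<?m}} = {}"
    "edges H = {{u i, u (i + 1)} | i. i \<in> {1..<?m}} \<union> F"
    using path unfolding path_plus_def by (elim conjE exE) (rule that; assumption)
  obtain h c where hc: "2 * h + c = \<gamma>" "embeddable (K2 \<nabla> H) (closed_surface h c)" and cardG: "card (verts (K2 \<nabla> H)) = n"
    using spex unfolding SPEX_def genus_graphs_def by blast
  have cardH: "card (verts H) = ?m" using bij_betw_same_card[OF u] by simp
  then have ne: "verts H \<noteq> {}" using n by auto
  let ?\<rho> = "spectral_radius (K2 \<nabla> H)"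
  have "\<exists>f. (\<forall>v\<in>verts H. f v > 0) \<and> (\<forall>v\<in>verts H. ?\<rho> * f v = 1 + (\<Sum>w | {v, w} \<in> edges H. f w))
    \<and> energy H ?\<rho> f = (?\<rho> - 1) / 2 \<and> ?\<rho> > 0 \<and> ?\<rho>\<^sup>2 \<ge> 2 * real (card (verts H))"
  proof (rule spectral_radius_join[OF H ne])
    fix f :: "'a \<Rightarrow> real"
    assume f: "\<And>v. v \<in> verts H \<Longrightarrow> f v > 0"
      "\<And>v. v \<in> verts H \<Longrightarrow> ?\<rho> * f v = 1 + (\<Sum>w | {v, w} \<in> edges H. f w)"
      "energy H ?\<rho> f = (?\<rho> - 1) / 2" "?\<rho> > 0" "?\<rho>\<^sup>2 \<ge> 2 * real (card (verts H))"
    show "\<exists>f. (\<forall>v\<in>verts H. f v > 0) \<and> (\<forall>v\<in>verts H. ?\<rho> * f v = 1 + (\<Sum>w | {v, w} \<in> edges H. f w))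
    \<and> energy H ?\<rho> f = (?\<rho> - 1) / 2 \<and> ?\<rho> > 0 \<and> ?\<rho>\<^sup>2 \<ge> 2 * real (card (verts H))"
      by (intro exI[of _ f] conjI ballI f)
  qed
  then obtain f where f: "\<forall>v\<in>verts H. f v > 0"
    "\<forall>v\<in>verts H. ?\<rho> * f v = 1 + (\<Sum>w | {v, w} \<in> edges H. f w)"
    "energy H ?\<rho> f = (?\<rho> - 1) / 2" "?\<rho> > 0" "?\<rho>\<^sup>2 \<ge> 2 * real (card (verts H))"
    by (elim exE conjE) (rule that; assumption)
  \<comment> \<open>Since \<open>\<rho>\<^sup>2 \<ge> 2 * (n - 2)\<close>, the squared summand of
    the threshold turns into the lower bound for \<open>\<rho>\<close> required by the
    locale.\<close>
  have "(200 * (3 * \<gamma> + 2)\<^sup>2)\<^sup>2 \<le> 2 * ?m" using n by linarith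
  then have "real ((200 * (3 * \<gamma> + 2)\<^sup>2)\<^sup>2) \<le> real (2 * ?m)" by (simp only: of_nat_le_iff)
  then have "(200 * (real ?k + 2)\<^sup>2)\<^sup>2 \<le> ?\<rho>\<^sup>2" using f(5) unfolding cardH by (simp add: add.commute)
  then have \<rho>: "?\<rho> \<ge> 200 * (real ?k + 2)\<^sup>2" by (rule power2_le_imp_le) (rule less_imp_le[OF f(4)])
  have opt: "energy H' ?\<rho> f' \<le> energy H ?\<rho> f"
    if H': "simple_graph H'" "verts H' = verts H" "embeddable (K2 \<nabla> H') (closed_surface h c)" for H' f'
  proof (rule ccontr)
    assume "\<not> ?thesis"
    then have less: "?\<rho> < spectral_radius (K2 \<nabla> H')"
      by (intro spectral_radius_less_by_energy[OF H'(1), of _ f']) (use f(3) in simp)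
    have "verts (K2 \<nabla> H') = verts (K2 \<nabla> H)" unfolding verts_join H'(2) ..
    then have "K2 \<nabla> H' \<in> genus_graphs n \<gamma>"
      unfolding genus_graphs_def using simple_graph_join[OF H'(1)] cardG hc(1) H'(3) by auto
    then have "spectral_radius (K2 \<nabla> H') \<le> ?\<rho>" using spex unfolding SPEX_def by blast
    then show False using less by simp
  qed
  \<comment> \<open>The summand \<open>9 * \<gamma> + 10\<close> of the threshold provides
    \<open>m > 3 * k + 4\<close>.\<close>
  have k: "?k \<ge> 1" and m: "?m > 3 * ?k + 4" using assms n by linarith+
  interpret spex_path H u ?m ?k F "closed_surface h c" ?\<rho> f
    by (rule spex_path.intro[OF H u F(2,1,3,4) surface_closed_surface hc(2) f(1,2)[rule_format] opt k m \<rho>])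
  have k9: "3 * ?k = 9 * \<gamma>" by simp
  show "(\<nexists>i. contractible_at H u ?m i) \<and> (\<nexists>i. separate_at H u ?m i) \<and>
      (\<exists>(H0 :: 'a sgraph) n0. simple_graph H0 \<and> card (verts H0) = n0 \<and> n0 \<le> 9 * \<gamma> \<and>
         H \<in> pendant_paths H0 (nat \<lfloor>(real n - 2 - real n0) / 2\<rfloor>) (nat \<lceil>(real n - 2 - real n0) / 2\<rceil>))"
  proof (intro conjI)
    show "\<nexists>i. contractible_at H u ?m i" "\<nexists>i. separate_at H u ?m i" using shape(1,2) by blast+
    show "\<exists>(H0 :: 'a sgraph) n0. simple_graph H0 \<and> card (verts H0) = n0 \<and> n0 \<le> 9 * \<gamma> \<and>
         H \<in> pendant_paths H0 (nat \<lfloor>(real n - 2 - real n0) / 2\<rfloor>) (nat \<lceil>(real n - 2 - real n0) / 2\<rceil>)"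
      using shape(3) unfolding n2 k9 .
  qed
qed

end
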